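(* Let $R$ be a standard graded domain which is a finitely generated $\mathbb Z$-algebra of characteristic $0$, and let $I\subset R$ be a homogeneous ideal of finite colength, such that for all but finitely many primes $p$ the fiber $R_p:=R\otimes_{\mathbb Z}\mathbb Z/p\mathbb Z$ is a standard graded ring of dimension $d$ which is geometrically integral, and $I_p\subset R_p$ is a homogeneous ideal of finite colength. Then: (1) There exists a constant $C_1$, given in terms of invariants of $R$ and $I$ (in particular independent of $p$ and $n$), such that for all but finitely many primes $p$ and all $n\ge1$, $$\left|\frac{1}{p^{nd}}\ell\left(\frac{R_p}{I_p^{[p^n]}}\right)-\frac{1}{p^{(n+1)d}}\ell\left(\frac{R_p}{I_p^{[p^{n+1}]}}\right)\right|\le\frac{C_1}{p^{\,n-d+2}}.$$ (2) For any fixed $m\ge d-1$, $$\lim_{p\to\infty}\left[e_{HK}(R_p,I_p)-\frac{1}{p^{md}}\ell\left(\frac{R_p}{I_p^{[p^m]}}\right)\right]=0.$$ In particular, for any fixed $m\ge d-1$, $$e_{HK}^{\infty}(R,I):=\lim_{p\to\infty}e_{HK}(R_p,I_p)\ \text{ exists}\iff\lim_{p\to\infty}\frac{1}{p^{md}}\ell\left(\frac{R_p}{I_p^{[p^m]}}\right)\ \text{ exists}.$$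
   Context: Standard graded: $\mathbb N$-graded and generated over the degree-$0$ part by finitely many elements of degree $1$. For $R$ a finitely generated $\mathbb Z$-algebra, "finite colength" of $I$ means that $R/I$ is an abelian group of finite rank; for the fiber ring $R_p$ it means $\ell(R_p/I_p)<\infty$. $I_p$ is the ideal of $R_p$ induced by $I$ (the image of $I\otimes_{\mathbb Z}\mathbb Z/p\mathbb Z$ in $R_p$). Geometrically integral: remains an integral domain after base change to an algebraic closure of $\mathbb Z/p\mathbb Z$. $J^{[p^n]}$ denotes the $n$-th Frobenius power of an ideal $J$, generated by the $p^n$-th powers of elements of $J$. $e_{HK}(R_p,I_p)=\lim_{n\to\infty}\ell(R_p/I_p^{[p^n]})/p^{nd}$ is the Hilbert-Kunz multiplicity (the limit is known to exist).
   Formalization: For d = 1 it is also assumed that R has a nonzero element of degree 1; otherwise R may lie entirely in degree 0 and the claim fails, e.g. for Z[x,y]/(y²−x²(x+1)) in degree 0 with I = (x,y). *)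

theory Defs
  imports
    Complex_Main
    "HOL-Library.Extended_Nat"
    "HOL-Library.Poly_Mapping"
    "HOL-Algebra.Algebra"
begin

section \<open>Tensor products of commutative algebras\<close>

text \<open>
  The monoid ring over the integers of the multiplicative monoid \<open>A \<times> B\<close>: additively it is the
  free abelian group on \<open>carrier A \<times> carrier B\<close>, and basis elements are multiplied componentwise.
\<close>

definition pair_ring ::
  "('a, 'm) ring_scheme \<Rightarrow> ('b, 'n) ring_scheme \<Rightarrow> ('a \<times> 'b \<Rightarrow>\<^sub>0 int) ring" where
  "pair_ring A B =
    \<lparr>carrier = {x. Poly_Mapping.keys x \<subseteq> carrier A \<times> carrier B},
     monoid.mult = (\<lambda>x y. frag_extend (\<lambda>u. frag_extend
               (\<lambda>v. frag_of (fst u \<otimes>\<^bsub>A\<^esub> fst v, snd u \<otimes>\<^bsub>B\<^esub> snd v)) y) x),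
     one = frag_of (\<one>\<^bsub>A\<^esub>, \<one>\<^bsub>B\<^esub>),
     ring.zero = 0,
     ring.add = (+)\<rparr>"

text \<open>
  For commutative \<open>k\<close>-algebras \<open>A\<close> and \<open>B\<close> with structure maps \<open>\<phi>\<close> and \<open>\<psi>\<close>, the tensor product is
  the free abelian group on pairs modulo the usual relations (additivity in each argument and
  \<open>k\<close>-balancedness). The set of these relations is stable under multiplication by basis elements,
  so that the ideal it generates is just the additive subgroup it generates.
\<close>

definition tensor_rels ::
  "('c, 'l) ring_scheme \<Rightarrow> ('c \<Rightarrow> 'a) \<Rightarrow> ('a, 'm) ring_scheme \<Rightarrow> ('c \<Rightarrow> 'b) \<Rightarrow> ('b, 'n) ring_scheme
    \<Rightarrow> ('a \<times> 'b \<Rightarrow>\<^sub>0 int) set" where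
  "tensor_rels k \<phi> A \<psi> B =
     {frag_of (a \<oplus>\<^bsub>A\<^esub> a', b) - frag_of (a, b) - frag_of (a', b) | a a' b.
        a \<in> carrier A \<and> a' \<in> carrier A \<and> b \<in> carrier B} \<union>
     {frag_of (a, b \<oplus>\<^bsub>B\<^esub> b') - frag_of (a, b) - frag_of (a, b') | a b b'.
        a \<in> carrier A \<and> b \<in> carrier B \<and> b' \<in> carrier B} \<union>
     {frag_of (\<phi> c \<otimes>\<^bsub>A\<^esub> a, b) - frag_of (a, \<psi> c \<otimes>\<^bsub>B\<^esub> b) | a b c.
        a \<in> carrier A \<and> b \<in> carrier B \<and> c \<in> carrier k}"

definition tensor_ideal ::
  "('c, 'l) ring_scheme \<Rightarrow> ('c \<Rightarrow> 'a) \<Rightarrow> ('a, 'm) ring_scheme \<Rightarrow> ('c \<Rightarrow> 'b) \<Rightarrow> ('b, 'n) ring_scheme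
    \<Rightarrow> ('a \<times> 'b \<Rightarrow>\<^sub>0 int) set" where
  "tensor_ideal k \<phi> A \<psi> B = genideal (pair_ring A B) (tensor_rels k \<phi> A \<psi> B)"

definition tensor_ring ::
  "('c, 'l) ring_scheme \<Rightarrow> ('c \<Rightarrow> 'a) \<Rightarrow> ('a, 'm) ring_scheme \<Rightarrow> ('c \<Rightarrow> 'b) \<Rightarrow> ('b, 'n) ring_scheme
    \<Rightarrow> ('a \<times> 'b \<Rightarrow>\<^sub>0 int) set ring" where
  "tensor_ring k \<phi> A \<psi> B = pair_ring A B Quot tensor_ideal k \<phi> A \<psi> B"

definition pure_tensor ::
  "('c, 'l) ring_scheme \<Rightarrow> ('c \<Rightarrow> 'a) \<Rightarrow> ('a, 'm) ring_scheme \<Rightarrow> ('c \<Rightarrow> 'b) \<Rightarrow> ('b, 'n) ring_scheme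
    \<Rightarrow> 'a \<Rightarrow> 'b \<Rightarrow> ('a \<times> 'b \<Rightarrow>\<^sub>0 int) set" where
  "pure_tensor k \<phi> A \<psi> B a b = tensor_ideal k \<phi> A \<psi> B +>\<^bsub>pair_ring A B\<^esub> frag_of (a, b)"


section \<open>Geometric integrality\<close>

text \<open>
  Here \<open>A\<close> is an algebra over the field \<open>k\<close> via \<open>\<phi>\<close>. The library's algebraic closure of \<open>k\<close> comes
  with the embedding \<open>ring.indexed_const k\<close>.
\<close>

definition geometrically_integral ::
  "('c, 'l) ring_scheme \<Rightarrow> ('c \<Rightarrow> 'a) \<Rightarrow> ('a, 'm) ring_scheme \<Rightarrow> bool" where
  "geometrically_integral k \<phi> A \<longleftrightarrow>
     domain (tensor_ring k \<phi> A (ring.indexed_const k) (field.alg_closure k))"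


section \<open>Graded rings\<close>

definition graded_ring :: "('a, 'm) ring_scheme \<Rightarrow> (nat \<Rightarrow> 'a set) \<Rightarrow> bool" where
  "graded_ring R G \<longleftrightarrow>
     cring R \<and>
     (\<forall>i. subgroup (G i) (add_monoid R)) \<and>
     (\<forall>i j. \<forall>x\<in>G i. \<forall>y\<in>G j. x \<otimes>\<^bsub>R\<^esub> y \<in> G (i + j)) \<and>
     (\<forall>x\<in>carrier R. \<exists>!f. (\<forall>i. f i \<in> G i) \<and> finite {i. f i \<noteq> \<zero>\<^bsub>R\<^esub>} \<and>
        x = finsum R f {i. f i \<noteq> \<zero>\<^bsub>R\<^esub>})"

text \<open>
  A ring concentrated in degree \<open>0\<close> is standard graded in this sense (take \<open>S = {}\<close>).
\<close>

definition standard_graded :: "('a, 'm) ring_scheme \<Rightarrow> (nat \<Rightarrow> 'a set) \<Rightarrow> bool" where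
  "standard_graded R G \<longleftrightarrow>
     graded_ring R G \<and>
     (\<exists>S. finite S \<and> S \<subseteq> G 1 \<and> generate_ring R (G 0 \<union> S) = carrier R)"

definition homogeneous_ideal ::
  "('a, 'm) ring_scheme \<Rightarrow> (nat \<Rightarrow> 'a set) \<Rightarrow> 'a set \<Rightarrow> bool" where
  "homogeneous_ideal R G I \<longleftrightarrow> ideal I R \<and> (\<exists>H. H \<subseteq> (\<Union>i. G i) \<and> I = genideal R H)"


section \<open>Dimension, length and rank\<close>

definition krull_dim :: "('a, 'm) ring_scheme \<Rightarrow> enat" where
  "krull_dim R = Sup {enat n | n. \<exists>P :: nat \<Rightarrow> 'a set.
     (\<forall>i\<le>n. primeideal (P i) R) \<and> (\<forall>i<n. P i \<subset> P (Suc i))}"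

definition module_length :: "('a, 'm) ring_scheme \<Rightarrow> ('a, 'b, 'n) module_scheme \<Rightarrow> enat" where
  "module_length R M = Sup {enat n | n. \<exists>N :: nat \<Rightarrow> 'b set.
     (\<forall>i\<le>n. submodule (N i) R M) \<and> (\<forall>i<n. N i \<subset> N (Suc i))}"

definition quotient_module :: "('a, 'm) ring_scheme \<Rightarrow> 'a set \<Rightarrow> ('a, 'a set) module" where
  "quotient_module R J =
    \<lparr>carrier = carrier (R Quot J),
     monoid.mult = monoid.mult (R Quot J),
     one = one (R Quot J),
     ring.zero = ring.zero (R Quot J),
     ring.add = ring.add (R Quot J),
     smult = (\<lambda>r x. (J +>\<^bsub>R\<^esub> r) \<otimes>\<^bsub>R Quot J\<^esub> x)\<rparr>"

definition colength :: "('a, 'm) ring_scheme \<Rightarrow> 'a set \<Rightarrow> enat" where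
  "colength R J = module_length R (quotient_module R J)"

text \<open>
  The rank of the additive group of \<open>M\<close>: the maximal number of elements that are linearly
  independent over the integers.
\<close>

definition additive_rank :: "('a, 'm) ring_scheme \<Rightarrow> enat" where
  "additive_rank M = Sup {enat (card S) | S. finite S \<and> S \<subseteq> carrier M \<and>
     (\<forall>c :: 'a \<Rightarrow> int. finsum M (\<lambda>s. [c s] \<cdot>\<^bsub>M\<^esub> s) S = \<zero>\<^bsub>M\<^esub> \<longrightarrow> (\<forall>s\<in>S. c s = 0))}"


section \<open>Frobenius powers and Hilbert-Kunz multiplicity\<close>

definition frobenius_power :: "('a, 'm) ring_scheme \<Rightarrow> 'a set \<Rightarrow> nat \<Rightarrow> 'a set" where
  "frobenius_power R J q = genideal R {x [^]\<^bsub>R\<^esub> q | x. x \<in> J}"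

text \<open>
  Both definitions below are meant for ideals of finite colength in a ring of prime characteristic
  \<open>p\<close> and dimension \<open>d\<close>: an infinite colength makes the value of \<^const>\<open>the_enat\<close> meaningless, and
  \<^const>\<open>lim\<close> is meaningless for a divergent sequence.
\<close>

definition hk_quotient ::
  "nat \<Rightarrow> nat \<Rightarrow> ('a, 'm) ring_scheme \<Rightarrow> 'a set \<Rightarrow> nat \<Rightarrow> real" where
  "hk_quotient p d R J n =
     real (the_enat (colength R (frobenius_power R J (p ^ n)))) / real p ^ (n * d)"

definition hk_multiplicity :: "nat \<Rightarrow> nat \<Rightarrow> ('a, 'm) ring_scheme \<Rightarrow> 'a set \<Rightarrow> real" where
  "hk_multiplicity p d R J = lim (hk_quotient p d R J)"


section \<open>Fibers over the primes\<close>

text \<open>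
  Every ring is an algebra over the integers via \<open>int_map\<close>, and \<open>fiber R p\<close> is an algebra over
  \<open>ZFact p\<close> via \<open>b \<mapsto> 1 \<otimes> b\<close>.
\<close>

definition int_map :: "('a, 'm) ring_scheme \<Rightarrow> int \<Rightarrow> 'a" where
  "int_map R c = [c] \<cdot>\<^bsub>R\<^esub> \<one>\<^bsub>R\<^esub>"

definition fiber :: "('a, 'm) ring_scheme \<Rightarrow> nat \<Rightarrow> ('a \<times> int set \<Rightarrow>\<^sub>0 int) set ring" where
  "fiber R p = tensor_ring \<Z> (int_map R) R (int_map (ZFact (int p))) (ZFact (int p))"

definition fiber_tensor ::
  "('a, 'm) ring_scheme \<Rightarrow> nat \<Rightarrow> 'a \<Rightarrow> int set \<Rightarrow> ('a \<times> int set \<Rightarrow>\<^sub>0 int) set" where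
  "fiber_tensor R p = pure_tensor \<Z> (int_map R) R (int_map (ZFact (int p))) (ZFact (int p))"

text \<open>
  The image in \<open>fiber R p\<close> of \<open>M\<close> tensored with the integers modulo \<open>p\<close>, for an additive subgroup
  \<open>M\<close> of \<open>R\<close>. Applied to an ideal it gives the induced ideal, and applied to the graded pieces of
  \<open>R\<close> it gives the induced grading of the fiber.
\<close>

definition fiber_image ::
  "('a, 'm) ring_scheme \<Rightarrow> nat \<Rightarrow> 'a set \<Rightarrow> ('a \<times> int set \<Rightarrow>\<^sub>0 int) set set" where
  "fiber_image R p M = generate (add_monoid (fiber R p))
     {fiber_tensor R p a b | a b. a \<in> M \<and> b \<in> carrier (ZFact (int p))}"

definition geometrically_integral_fiber :: "('a, 'm) ring_scheme \<Rightarrow> nat \<Rightarrow> bool" where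
  "geometrically_integral_fiber R p \<longleftrightarrow>
     geometrically_integral (ZFact (int p)) (fiber_tensor R p \<one>\<^bsub>R\<^esub>) (fiber R p)"

definition primes_at_top :: "nat filter" where
  "primes_at_top = inf at_top (principal {p. Factorial_Ring.prime p})"

end

theory Submission
 imports Defs
begin

text \<open>
Let W be the polynomial ring over the integers in countably many variables. A finite generating set of
R gives a surjection from W to R with prime kernel P; only the first M variables matter. The fiber
over p is then W/(P + pW) (lemma krn_PP), and every notion in the statement (colength, Frobenius
power, Krull dimension, grading) is pulled back to ideals of W that contain P + pW. Geometric
integrality makes P + pW prime (prm_PQ).

Uniformity in p comes from data chosen once in characteristic zero: a transcendence basis V among
the variables, a finite set B that spans W over the polynomials A in V up to the denominator c, and a
maximal A-independent subset Y of B with denominator g. For all primes outside a finite set the same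
data have the same properties modulo P + pW (red_almost_all). They replace Noether normalization:
all arguments count polynomials of bounded degree.

Fix such a p, put d = card V and q = p^n, and let l_n be the length of W modulo the q-th Frobenius power
L of the preimage J of I. The p^d monomials in V with exponents below p are independent over the
subring of p-th powers of W (free_W), and a single element \<gamma> of A, of degree at most a constant times
p, carries W into the subring SS that they span over the p-th powers (gamma). Inside SS the length of
the quotient by the semilinear sum of L is exactly p^d l_n (len_TT), so that p^d l_n and l_{n+1}
differ at most by the length of a module killed by \<gamma> (len_compare). Such a module is bounded by the
growth of W between degrees s and s + deg \<gamma>; averaging over s of size about p q makes this growth at
most C p^d q^{d-1} (averaging, index_bound). Hence
  |p^d l_n - l_{n+1}| \<le> C p^d q^{d-1}
with C independent of p and n (HK_step). That d is the dimension of the fiber follows from counting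
(krull_upper) and from an explicit construction of chains of primes (krull_lower).

Dividing by p^{(n+1)d} bounds the difference of consecutive normalized lengths by C/p^n, which is at
most C/p^{n-d+2} if d \<ge> 2. For d = 1 more is needed: there geometric integrality forces all elements of
one degree to be integer multiples of a power of one element x, so that I is a power of x and the
lengths scale exactly (geo_ratio, ell_dim1). For d = 0 the fiber is a finite field (ell_dim0). The second
part sums the geometric series of the differences (geometric_steps).
\<close>

section \<open>Subgroups, ideals and indices\<close>

definition subgrp :: "'w::comm_ring_1 set => bool" where
 "subgrp N \<longleftrightarrow> 0 : N & (ALL x:N. ALL y:N. x - y : N)"

text \<open>For \<Omega> = UNIV these are the ideals, and for \<Omega> the set of p-th powers the modules over
the subring of p-th powers; lengths over both are compared below.\<close>
definition stab :: "'w::comm_ring_1 set => 'w set => bool" where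
 "stab \<Omega> N \<longleftrightarrow> subgrp N & (ALL r:\<Omega>. ALL x:N. r * x : N)"

abbreviation idl :: "'w::comm_ring_1 set => bool" where
 "idl \<equiv> stab UNIV"

definition prm :: "'w::comm_ring_1 set => bool" where
 "prm Q \<longleftrightarrow> idl Q & 1 ~: Q & (ALL a b. a * b : Q --> a : Q | b : Q)"

definition ssum :: "'w::comm_ring_1 set => 'w set => 'w set" where
 "ssum N M = {x + y | x y. x : N & y : M}"

definition coset :: "'w::comm_ring_1 set => 'w => 'w set" where
 "coset N x = {y. y - x : N}"

definition quo :: "'w::comm_ring_1 set => 'w set => 'w set set" where
 "quo N M = coset N ` M"

lemma subgrp_zero: "subgrp N ==> 0 : N"
 and subgrp_diff: "subgrp N ==> x : N ==> y : N ==> x - y : N"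
 by (auto simp: subgrp_def)

lemma subgrp_minus: "subgrp N ==> x : N ==> - x : N"
 using subgrp_diff[of N 0 x] subgrp_zero[of N] by simp

lemma subgrp_add: "subgrp N ==> x : N ==> y : N ==> x + y : N"
 using subgrp_diff[of N x "- y"] subgrp_minus[of N y] by simp

lemma subgrp_sum: "subgrp N ==> (!!i. i : I ==> f i : N) ==> sum f I : N"
 by (induction I rule: infinite_finite_induct) (auto simp: subgrp_zero subgrp_add)

lemma subgrp_of_nat: "subgrp N ==> x : N ==> of_nat k * x : N"
 by (induction k) (auto simp: subgrp_zero subgrp_add distrib_right)

lemma subgrp_of_int: "subgrp N ==> x : N ==> of_int k * x : N"
 by (cases k) (auto simp: subgrp_of_nat subgrp_minus simp del: of_nat_Suc)

lemma subgrp_add_iff: "subgrp N ==> x : N ==> x + y : N \<longleftrightarrow> y : N"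
 using subgrp_add subgrp_diff by fastforce

lemma subgrp_diff_swap: "subgrp N ==> x - y : N \<longleftrightarrow> y - x : N"
 using subgrp_minus[of N "x - y"] subgrp_minus[of N "y - x"] by auto

lemma subgrp_cong: "subgrp N ==> x - y : N ==> x : N \<longleftrightarrow> y : N"
 using subgrp_add[of N "x - y" y] subgrp_diff[of N x "x - y"] by auto

lemma subgrp_trans: "subgrp N ==> x - y : N ==> y - z : N ==> x - z : N"
 using subgrp_add[of N "x - y" "y - z"] by simp

lemma subgrp_UNIV [simp]: "subgrp UNIV"
 by (simp add: subgrp_def)

lemma stab_UNIV [simp]: "stab \<Omega> UNIV"
 by (simp add: stab_def)

lemma stab_subgrp: "stab \<Omega> N ==> subgrp N"
 and stab_mult: "stab \<Omega> N ==> r : \<Omega> ==> x : N ==> r * x : N"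
 by (auto simp: stab_def)

lemma idl_stab: "idl N ==> stab \<Omega> N"
 by (auto simp: stab_def)

lemma idl_mult: "idl N ==> x : N ==> r * x : N"
 and idl_mult2: "idl N ==> x : N ==> x * r : N"
 by (auto simp: stab_def mult.commute)

lemma idl_cong_mult:
 assumes "idl N" "a - b : N" "c - d : N"
 shows "a * c - b * d : N"
proof -
 have "a * c - b * d = (a - b) * c + b * (c - d)" by (simp add: algebra_simps)
 thus ?thesis using assms by (metis idl_mult idl_mult2 stab_subgrp subgrp_add)
qed

lemma idl_cong_add:
 assumes "subgrp N" "a - b : N" "c - d : N"
 shows "(a + c) - (b + d) : N"
 using subgrp_add[OF assms] by (simp add: algebra_simps)

lemma idl_cong_pow:
 assumes "idl N" "a - b : N"
 shows "a ^ k - b ^ k : N"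
proof (induction k)
 case 0 then show ?case using assms(1) by (simp add: stab_subgrp subgrp_zero)
next
 case (Suc k) then show ?case using idl_cong_mult[OF assms(1) assms(2) Suc] by simp
qed

lemma idl_cong_sum:
 assumes "subgrp N" "!!i. i : I ==> f i - g i : N"
 shows "sum f I - sum g I : N"
 unfolding sum_subtractf[symmetric] using assms by (rule subgrp_sum)

text \<open>Covers P + pW, the ideals generated by a power of one element modulo Q, and their products with
other ideals.\<close>
lemma idl_shift:
 assumes Q: "idl Q" and N: "idl N" shows "idl {x. EX w:N. x - g * w : Q}" (is "idl ?F")
 unfolding stab_def subgrp_def
proof (intro conjI ballI)
 note sQ = stab_subgrp[OF Q] and sN = stab_subgrp[OF N]
 have "0 - g * 0 : Q" using subgrp_zero[OF sQ] by simp
 thus "0 : ?F" using subgrp_zero[OF sN] by blast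
 fix y z assume "y : ?F" "z : ?F"
 then obtain v v' where v: "v : N" "v' : N" "y - g * v : Q" "z - g * v' : Q" by blast
 from subgrp_diff[OF sQ v(3,4)] have "(y - z) - g * (v - v') : Q" by (simp add: algebra_simps)
 thus "y - z : ?F" using subgrp_diff[OF sN v(1,2)] by blast
next
 fix r y assume "y : ?F"
 then obtain v where v: "v : N" "y - g * v : Q" by blast
 from idl_mult[OF Q v(2), of r] have "r * y - g * (r * v) : Q" by (simp add: algebra_simps)
 thus "r * y : ?F" using idl_mult[OF N v(1)] by blast
qed

lemma idl_shift_UNIV: "idl Q ==> idl {x. EX w. x - g * w : Q}"
 using idl_shift[of Q UNIV g] by simp

lemma prm_idl: "prm Q ==> idl Q"
 and prm_subgrp: "prm Q ==> subgrp Q"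
 and prm_one: "prm Q ==> 1 ~: Q"
 and prm_mult: "prm Q ==> a * b : Q \<longleftrightarrow> a : Q | b : Q"
 by (auto simp: prm_def stab_subgrp idl_mult idl_mult2)

lemma prm_pow: "prm Q ==> a ^ k : Q \<longleftrightarrow> a : Q & k > 0"
 by (induction k) (auto simp: prm_mult prm_one)

lemma prm_prod: "finite I ==> prm Q ==> prod f I : Q \<longleftrightarrow> (EX i:I. f i : Q)"
 by (induction I rule: finite_induct) (auto simp: prm_mult prm_one)

lemma subgrp_ssum: "subgrp N ==> subgrp M ==> subgrp (ssum N M)"
 unfolding subgrp_def ssum_def
proof (safe, goal_cases)
 case 1 then show ?case by force
next
 case (2 a b x x' y y')
 have e: "x + y - (x' + y') = (x - x') + (y - y')" for x y x' y' :: 'a by simp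
 show ?case unfolding e using 2 by blast
qed

lemma stab_ssum: "stab \<Omega> N ==> stab \<Omega> M ==> stab \<Omega> (ssum N M)"
 unfolding stab_def by (auto simp: subgrp_ssum) (auto simp: ssum_def distrib_left, blast)

lemma stab_Int: "stab \<Omega> N ==> stab \<Omega> M ==> stab \<Omega> (N \<inter> M)"
 by (auto simp: stab_def subgrp_def)

lemma ssum_left: "subgrp M ==> N \<subseteq> ssum N M"
 unfolding ssum_def using subgrp_zero by force

lemma ssum_right: "subgrp N ==> M \<subseteq> ssum N M"
 unfolding ssum_def using subgrp_zero by force

lemma ssum_least: "subgrp K ==> N \<subseteq> K ==> M \<subseteq> K ==> ssum N M \<subseteq> K"
 unfolding ssum_def using subgrp_add by blast

lemma coset_eq: "subgrp N ==> coset N x = coset N y \<longleftrightarrow> x - y : N"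
proof
 assume N: "subgrp N" and "coset N x = coset N y"
 moreover have "x : coset N x" using N by (simp add: coset_def subgrp_zero)
 ultimately show "x - y : N" by (auto simp: coset_def)
next
 assume N: "subgrp N" and *: "x - y : N"
 show "coset N x = coset N y"
  unfolding coset_def using subgrp_trans[OF N] * subgrp_diff_swap[OF N] by blast
qed

lemma quo_mono: "M \<subseteq> M' ==> quo N M \<subseteq> quo N M'"
 by (auto simp: quo_def)

lemma quo_coarsen:
 assumes "subgrp N" "subgrp N'" "N \<subseteq> N'"
 shows "quo N' M = (%c. coset N' (SOME x. x : c)) ` quo N M"
proof -
 have "coset N' (SOME x. x : coset N m) = coset N' m" for m
 proof -
  have "m : coset N m" using assms by (simp add: coset_def subgrp_zero)
  hence "(SOME x. x : coset N m) : coset N m" by (rule someI)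
  hence "(SOME x. x : coset N m) - m : N'" using assms by (auto simp: coset_def)
  thus ?thesis using assms by (simp add: coset_eq)
 qed
 thus ?thesis by (simp add: quo_def image_image)
qed

lemma finite_quo_mono:
 assumes "finite (quo N M)" "subgrp N" "subgrp N'" "N \<subseteq> N'" "M' \<subseteq> M"
 shows "finite (quo N' M')"
 using assms quo_coarsen[of N N' M'] quo_mono[of M' M N] by (metis finite_imageI finite_subset)

lemma card_quo_coarsen:
 assumes "finite (quo N M)" "subgrp N" "subgrp N'" "N \<subseteq> N'" "M' \<subseteq> M"
 shows "card (quo N' M') <= card (quo N M)"
proof -
 have f: "finite (quo N M')" using assms(1) quo_mono[OF assms(5)] finite_subset by blast
 have "card (quo N' M') <= card (quo N M')"
  using quo_coarsen[OF assms(2-4), of M'] f by (metis card_image_le)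
 also have "... <= card (quo N M)" using assms(1) quo_mono[OF assms(5)] by (simp add: card_mono)
 finally show ?thesis .
qed

text \<open>The cosets j v + A with j < k are distinct, so that representatives of A/N shifted by the j v give k
card (A/N) different classes.\<close>
lemma card_quo_step:
 assumes N: "subgrp N" and A: "subgrp A" and B: "subgrp B" and sub: "N \<subseteq> A" "A \<subseteq> B"
  and v: "v : B" "!!j. 0 < j ==> j < k ==> of_nat j * v ~: A"
  and fin: "finite (quo N B)"
 shows "k * card (quo N A) <= card (quo N B)"
proof -
 define rep where "rep c = (SOME x. x : A & coset N x = c)" for c
 have rep: "rep c : A" "coset N (rep c) = c" if "c : quo N A" for c
 proof -
  from that obtain x where "x : A & coset N x = c" by (auto simp: quo_def)
  hence "rep c : A & coset N (rep c) = c" unfolding rep_def by (rule someI)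
  thus "rep c : A" "coset N (rep c) = c" by auto
 qed
 define f where "f = (%(j, c). coset N (of_nat j * v + rep c))"
 have key: "j = j' & c = c'" if "j < k" "j' < k" "c : quo N A" "c' : quo N A"
  "f (j, c) = f (j', c')" "j' <= j" for j j' c c'
 proof -
  have *: "(of_nat j * v + rep c) - (of_nat j' * v + rep c') : N"
   using that(5) N by (simp add: f_def coset_eq)
  hence "(of_nat j * v + rep c) - (of_nat j' * v + rep c') : A" using sub by auto
  hence "((of_nat j * v + rep c) - (of_nat j' * v + rep c')) - (rep c - rep c') : A"
   using rep that A by (meson subgrp_diff)
  hence "of_nat (j - j') * v : A" using that(6) by (simp add: algebra_simps of_nat_diff)
  hence "~ j' < j" using v(2)[of "j - j'"] that(1) by auto
  hence "j = j'" using that(6) by simp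
  moreover from this * have "rep c - rep c' : N" by simp
  hence "c = c'" using rep that N by (metis coset_eq)
  ultimately show ?thesis by simp
 qed
 have "inj_on f ({..<k} \<times> quo N A)"
 proof (rule inj_onI)
  fix x y assume "x : {..<k} \<times> quo N A" "y : {..<k} \<times> quo N A" "f x = f y"
  moreover obtain j c j' c' where xy: "x = (j, c)" "y = (j', c')" by (metis surj_pair)
  ultimately have *: "j < k" "j' < k" "c : quo N A" "c' : quo N A" "f (j, c) = f (j', c')" by auto
  show "x = y"
  proof (cases "j' <= j")
   case True
   show ?thesis unfolding xy using key[OF *(1,2,3,4,5) True] by simp
  next
   case False
   show ?thesis unfolding xy using key[OF *(2,1,4,3) *(5)[symmetric]] False by simp
  qed
 qed
 moreover have "f ` ({..<k} \<times> quo N A) \<subseteq> quo N B"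
 proof (rule image_subsetI)
  fix x assume "x : {..<k} \<times> quo N A"
  then obtain j c where x: "x = (j, c)" "c : quo N A" by auto
  have "of_nat j * v + rep c : B"
   using rep(1)[OF x(2)] sub v(1) B by (intro subgrp_add subgrp_of_nat) auto
  thus "f x : quo N B" by (simp add: x f_def quo_def)
 qed
 ultimately have "card ({..<k} \<times> quo N A) <= card (quo N B)"
  using fin by (rule card_inj_on_le)
 thus ?thesis by (simp add: card_cartesian_product)
qed

section \<open>Lengths of modules\<close>

definition chn :: "'w::comm_ring_1 set => 'w set => 'w set => (nat => 'w set) => nat => bool" where
 "chn \<Omega> N M Z n \<longleftrightarrow> (ALL i<=n. stab \<Omega> (Z i) & N \<subseteq> Z i & Z i \<subseteq> M) & (ALL i<n. Z i \<subset> Z (Suc i))"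

text \<open>The length of M/N. For an unbounded set of chains the supremum of naturals is meaningless;
finiteness of the index is assumed wherever the value matters.\<close>
definition len :: "'w::comm_ring_1 set => 'w set => 'w set => nat" where
 "len \<Omega> N M = Sup {n. EX Z. chn \<Omega> N M Z n}"

lemma chnD:
 assumes "chn \<Omega> N M Z n"
 shows "i <= n ==> stab \<Omega> (Z i)" "i <= n ==> subgrp (Z i)" "i <= n ==> N \<subseteq> Z i" "i <= n ==> Z i \<subseteq> M"
  "i < n ==> Z i \<subset> Z (Suc i)"
 using assms by (auto simp: chn_def stab_subgrp)

text \<open>Every step of the chain multiplies the index by k at least.\<close>
lemma chn_card:
 assumes "chn \<Omega> N M Z n" "subgrp N" "finite (quo N M)"
  and k: "!!i. i < n ==> EX v:Z (Suc i). ALL j. 0 < j --> j < k --> of_nat j * v ~: Z i"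
 shows "k ^ n <= card (quo N M)"
proof -
 note sub = chnD(2,3,4)[OF assms(1)]
 have fin: "finite (quo N (Z i))" if "i <= n" for i
  by (rule finite_subset[OF quo_mono[OF sub(3)[OF that]] assms(3)])
 have "i <= n ==> k ^ i <= card (quo N (Z i))" for i
 proof (induction i)
  case 0
  have "0 : Z 0" using subgrp_zero[OF sub(1)[of 0]] by simp
  hence "quo N (Z 0) ~= {}" unfolding quo_def by blast
  thus ?case using fin[of 0] by (simp add: Suc_leI card_gt_0_iff)
 next
  case (Suc i)
  have i: "i < n" using Suc.prems by simp
  from k[OF i] obtain v where v: "v : Z (Suc i)" "!!j. 0 < j ==> j < k ==> of_nat j * v ~: Z i"
   by blast
  have Zi: "Z i \<subseteq> Z (Suc i)" using chnD(5)[OF assms(1) i] by blast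
  have "k * card (quo N (Z i)) <= card (quo N (Z (Suc i)))"
   using i by (intro card_quo_step[OF assms(2) sub(1) sub(1) sub(2) Zi v fin]) simp_all
  moreover have "k * k ^ i <= k * card (quo N (Z i))" using Suc.IH i by (intro mult_left_mono) simp_all
  ultimately show ?case unfolding power_Suc by linarith
 qed
 hence "k ^ n <= card (quo N (Z n))" by simp
 also have "... <= card (quo N M)" using assms(3) sub(3)[of n] by (simp add: card_mono quo_mono)
 finally show ?thesis .
qed

lemma chn_bound:
 assumes "chn \<Omega> N M Z n" "subgrp N" "finite (quo N M)"
 shows "n <= card (quo N M)"
proof -
 have "2 ^ n <= card (quo N M)"
 proof (rule chn_card[OF assms])
  fix i assume "i < n"
  from chnD(5)[OF assms(1) this] obtain v where "v : Z (Suc i)" "v ~: Z i" by blast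
  moreover have "j = 1" if "0 < j" "j < 2" for j :: nat using that by simp
  ultimately show "EX v:Z (Suc i). ALL j. 0 < j --> j < 2 --> of_nat j * v ~: Z i"
   by (intro bexI[of _ v]) (auto simp: less_Suc_eq numeral_2_eq_2)
 qed
 thus ?thesis using less_exp[of n] by linarith
qed

lemma len_le: "(!!n Z. chn \<Omega> N M Z n ==> n <= b) ==> len \<Omega> N M <= b"
 unfolding len_def by (cases "{n. EX Z. chn \<Omega> N M Z n} = {}") (auto intro!: cSup_least)

lemma len_ge:
 assumes "chn \<Omega> N M Z n" "subgrp N" "finite (quo N M)"
 shows "n <= len \<Omega> N M"
 unfolding len_def
proof (rule cSup_upper)
 show "bdd_above {n. EX Z. chn \<Omega> N M Z n}"
  by (rule bdd_aboveI[of _ "card (quo N M)"]) (use chn_bound assms in auto)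
qed (use assms in auto)

lemma len_chain:
 assumes "stab \<Omega> N" "stab \<Omega> M" "N \<subseteq> M" "finite (quo N M)"
 shows "EX Z. chn \<Omega> N M Z (len \<Omega> N M)"
proof -
 have "chn \<Omega> N M (%_. N) 0" using assms by (simp add: chn_def)
 hence "{n. EX Z. chn \<Omega> N M Z n} ~= {}" by auto
 moreover have "bdd_above {n. EX Z. chn \<Omega> N M Z n}"
  by (rule bdd_aboveI[of _ "card (quo N M)"])
    (use chn_bound[OF _ stab_subgrp[OF assms(1)] assms(4)] in auto)
 ultimately have "Sup {n. EX Z. chn \<Omega> N M Z n} : {n. EX Z. chn \<Omega> N M Z n}"
  using Max_in[of "{n. EX Z. chn \<Omega> N M Z n}"] by (simp add: bdd_above_nat cSup_eq_Max)
 thus ?thesis by (simp add: len_def)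
qed

text \<open>M/N is killed by the prime p, so that every step of a chain multiplies the index by at least p.\<close>
lemma len_le_log:
 assumes "subgrp N" "finite (quo N M)" "Factorial_Ring.prime p" "!!x. x : M ==> of_nat p * x : N"
  "card (quo N M) <= p ^ k"
 shows "len \<Omega> N M <= k"
proof (rule len_le)
 fix n Z assume ch: "chn \<Omega> N M Z n"
 have "p ^ n <= card (quo N M)"
 proof (rule chn_card[OF ch assms(1,2)])
  fix i assume i: "i < n"
  from chnD(5)[OF ch i] obtain v where v: "v : Z (Suc i)" "v ~: Z i" by blast
  have sg: "subgrp (Z i)" using chnD(2)[OF ch] i by simp
  have "v : M" using chnD(4)[OF ch, of "Suc i"] i v(1) by auto
  hence pv: "of_nat p * v : Z i" using chnD(3)[OF ch, of i] i assms(4)[of v] by auto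
  have "of_nat j * v ~: Z i" if j: "0 < j" "j < p" for j
  proof
   assume jv: "of_nat j * v : Z i"
   have "~ p dvd j" using j by (auto dest: dvd_imp_le)
   hence "coprime j p" using prime_imp_coprime[OF assms(3)] by (simp add: coprime_commute)
   hence "coprime (int j) (int p)" by simp
   then obtain a b where ab: "a * int j + b * int p = 1"
    using bezout_int[of "int j" "int p"] by (auto simp: coprime_iff_gcd_eq_1)
   have "of_int a * (of_nat j * v) + of_int b * (of_nat p * v) : Z i"
    using sg jv pv by (intro subgrp_add subgrp_of_int) auto
   also have "of_int a * (of_nat j * v) + of_int b * (of_nat p * v)
     = of_int (a * int j + b * int p) * v" by (simp add: algebra_simps)
   finally show False using v by (simp add: ab)
  qed
  thus "EX v:Z (Suc i). ALL j. 0 < j --> j < p --> of_nat j * v ~: Z i" using v by blast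
 qed
 hence "p ^ n <= p ^ k" using assms(5) by simp
 with prime_gt_1_nat[OF assms(3)] show "n <= k" by (rule power_le_imp_le_exp)
qed

lemma weak_chain:
 assumes st: "!!i. i <= n ==> stab \<Omega> (Z i) & N \<subseteq> Z i & Z i \<subseteq> M"
  and up: "!!i. i < n ==> Z i \<subseteq> Z (Suc i)" and "subgrp N" "finite (quo N M)"
 shows "card {i. i < n & Z i ~= Z (Suc i)} <= len \<Omega> N M"
proof -
 have "m <= n ==> EX Z'. chn \<Omega> N M Z' (card {i. i < m & Z i ~= Z (Suc i)})
   & Z' (card {i. i < m & Z i ~= Z (Suc i)}) = Z m" for m
 proof (induction m)
  case 0
  thus ?case using st[of 0] by (intro exI[of _ "%_. Z 0"]) (auto simp: chn_def)
 next
  case (Suc m)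
  define k where "k = card {i. i < m & Z i ~= Z (Suc i)}"
  have "m <= n" using Suc.prems by simp
  from Suc.IH[OF this] obtain Z' where Z': "chn \<Omega> N M Z' k" "Z' k = Z m"
   unfolding k_def by (elim exE conjE)
  show ?case
  proof (cases "Z m = Z (Suc m)")
   case True
   hence "{i. i < Suc m & Z i ~= Z (Suc i)} = {i. i < m & Z i ~= Z (Suc i)}"
    by (auto simp: less_Suc_eq)
   thus ?thesis using Z' True by (auto simp: k_def)
  next
   case False
   hence "{i. i < Suc m & Z i ~= Z (Suc i)} = insert m {i. i < m & Z i ~= Z (Suc i)}"
    by (auto simp: less_Suc_eq)
   hence c: "card {i. i < Suc m & Z i ~= Z (Suc i)} = Suc k" by (simp add: k_def)
   have "Z m \<subset> Z (Suc m)" using up[of m] Suc.prems False by auto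
   hence "chn \<Omega> N M (Z'(Suc k := Z (Suc m))) (Suc k)"
    unfolding chn_def
   proof (intro conjI allI impI)
    fix i assume i: "i <= Suc k"
    show "stab \<Omega> ((Z'(Suc k := Z (Suc m))) i)" "N \<subseteq> (Z'(Suc k := Z (Suc m))) i"
     "(Z'(Suc k := Z (Suc m))) i \<subseteq> M"
     using chnD(1,3,4)[OF Z'(1), of i] st[of "Suc m"] Suc.prems i by (cases "i = Suc k"; simp)+
   next
    fix i assume i: "i < Suc k"
    show "(Z'(Suc k := Z (Suc m))) i \<subset> (Z'(Suc k := Z (Suc m))) (Suc i)"
    proof (cases "i = k")
     case True then show ?thesis using \<open>Z m \<subset> Z (Suc m)\<close> Z'(2) by simp
    next
     case False then show ?thesis using chnD(5)[OF Z'(1), of i] i by simp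
    qed
   qed
   moreover have "(Z'(Suc k := Z (Suc m))) (Suc k) = Z (Suc m)" by simp
   ultimately show ?thesis unfolding c by blast
  qed
 qed
 from this[OF order_refl] obtain Z' where "chn \<Omega> N M Z' (card {i. i < n & Z i ~= Z (Suc i)})" by (elim exE conjE)
 thus ?thesis using assms(3,4) by (rule len_ge)
qed

text \<open>Comparison of lengths over two different rings of operators: any assignment of stable subgroups that
respects strict inclusions sends chains to chains.\<close>
lemma len_map:
 assumes "!!Z. stab \<Omega> Z ==> N \<subseteq> Z ==> Z \<subseteq> M ==> stab \<Omega>' (f Z) & N' \<subseteq> f Z & f Z \<subseteq> M'"
  and "!!Z Z'. stab \<Omega> Z ==> stab \<Omega> Z' ==> N \<subseteq> Z ==> Z \<subset> Z' ==> Z' \<subseteq> M ==> f Z \<subset> f Z'"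
  and "subgrp N'" "finite (quo N' M')"
 shows "len \<Omega> N M <= len \<Omega>' N' M'"
proof (rule len_le)
 fix n Z assume "chn \<Omega> N M Z n"
 hence ch: "chn \<Omega> N M Z n" .
 have "chn \<Omega>' N' M' (%i. f (Z i)) n"
  unfolding chn_def
 proof (intro conjI allI impI)
  fix i assume i: "i <= n"
  show "stab \<Omega>' (f (Z i))" "N' \<subseteq> f (Z i)" "f (Z i) \<subseteq> M'"
   using assms(1)[OF chnD(1,3,4)[OF ch i]] by auto
 next
  fix i assume i: "i < n"
  thus "f (Z i) \<subset> f (Z (Suc i))"
   using assms(2)[of "Z i" "Z (Suc i)"] chnD[OF ch, of i] chnD[OF ch, of "Suc i"] by simp
 qed
 thus "n <= len \<Omega>' N' M'" using assms(3,4) by (rule len_ge)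
qed

lemma len_mono:
 assumes "subgrp N" "finite (quo N M)" "N \<subseteq> N'" "M' \<subseteq> M" "\<Omega> \<subseteq> \<Omega>'"
 shows "len \<Omega>' N' M' <= len \<Omega> N M"
proof (rule len_map[where f = "%Z. Z"])
 fix Z assume Z: "stab \<Omega>' Z" "N' \<subseteq> Z" "Z \<subseteq> M'"
 have "stab \<Omega> Z" using Z(1) assms(5) unfolding stab_def by blast
 thus "stab \<Omega> Z & N \<subseteq> Z & Z \<subseteq> M" using Z assms by blast
qed (use assms(1,2) in simp_all)

lemma modular_eq:
 assumes "subgrp Z" "subgrp Z'" "Z \<subseteq> Z'" "Z \<inter> L = Z' \<inter> L" "ssum Z L = ssum Z' L" "subgrp L"
 shows "Z = Z'"
proof
 show "Z' \<subseteq> Z"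
 proof
  fix z assume z: "z : Z'"
  hence "z : ssum Z L" using assms ssum_left by blast
  then obtain x y where xy: "z = x + y" "x : Z" "y : L" by (auto simp: ssum_def)
  hence "y = z - x" by simp
  moreover have "z - x : Z'" using xy z assms by (intro subgrp_diff) auto
  ultimately have "y : Z' \<inter> L" using xy by simp
  thus "z : Z" using assms xy by (auto intro: subgrp_add)
 qed
qed (fact assms)

text \<open>Intersecting a chain with L and adding L to it loses no step: by the modular law a strict step stays
strict in one of the two.\<close>
lemma len_additive:
 assumes "stab \<Omega> N" "stab \<Omega> L" "stab \<Omega> M" "N \<subseteq> L" "L \<subseteq> M" "finite (quo N M)"
 shows "len \<Omega> N M = len \<Omega> N L + len \<Omega> L M"
proof (rule antisym)
 have fin: "finite (quo N L)" "finite (quo L M)"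
  using finite_quo_mono[OF assms(6) stab_subgrp[OF assms(1)] stab_subgrp[OF assms(1)] order_refl assms(5)]
   finite_quo_mono[OF assms(6) stab_subgrp[OF assms(1)] stab_subgrp[OF assms(2)] assms(4) order_refl]
  by simp_all
 show "len \<Omega> N M <= len \<Omega> N L + len \<Omega> L M"
 proof (rule len_le)
  fix n Z assume ch: "chn \<Omega> N M Z n"
  define A where "A = {i. i < n & Z i \<inter> L ~= Z (Suc i) \<inter> L}"
  define B where "B = {i. i < n & ssum (Z i) L ~= ssum (Z (Suc i)) L}"
  have "card A <= len \<Omega> N L" unfolding A_def
  proof (rule weak_chain)
   fix i assume i: "i <= n"
   show "stab \<Omega> (Z i \<inter> L) & N \<subseteq> Z i \<inter> L & Z i \<inter> L \<subseteq> L"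
    using chnD[OF ch] i assms by (simp add: stab_Int)
  next
   fix i assume "i < n"
   thus "Z i \<inter> L \<subseteq> Z (Suc i) \<inter> L" using chnD(5)[OF ch] by blast
  qed (use stab_subgrp[OF assms(1)] fin in simp_all)
  moreover have "card B <= len \<Omega> L M" unfolding B_def
  proof (rule weak_chain)
   fix i assume i: "i <= n"
   show "stab \<Omega> (ssum (Z i) L) & L \<subseteq> ssum (Z i) L & ssum (Z i) L \<subseteq> M"
    using chnD[OF ch] i assms by (simp add: stab_ssum ssum_right ssum_least stab_subgrp)
  next
   fix i assume "i < n"
   thus "ssum (Z i) L \<subseteq> ssum (Z (Suc i)) L" using chnD(5)[OF ch] by (fastforce simp: ssum_def)
  qed (use stab_subgrp[OF assms(2)] fin in simp_all)
  moreover have "{..<n} \<subseteq> A \<union> B"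
  proof
   fix i assume "i : {..<n}"
   hence i: "i < n" by simp
   hence "subgrp (Z i)" "subgrp (Z (Suc i))" "Z i \<subset> Z (Suc i)"
    using chnD[OF ch] by auto
   thus "i : A \<union> B" using modular_eq[of "Z i" "Z (Suc i)" L] i assms
    by (auto simp: A_def B_def stab_subgrp)
  qed
  hence "n <= card (A \<union> B)" using card_mono[of "A \<union> B" "{..<n}"] by (auto simp: A_def B_def)
  ultimately show "n <= len \<Omega> N L + len \<Omega> L M" using card_Un_le[of A B] by linarith
 qed
 obtain Z1 where Z1: "chn \<Omega> N L Z1 (len \<Omega> N L)" using len_chain assms fin by blast
 obtain Z2 where Z2: "chn \<Omega> L M Z2 (len \<Omega> L M)" using len_chain assms fin by blast
 define a where "a = len \<Omega> N L"
 define b where "b = len \<Omega> L M"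
 have "chn \<Omega> N M (%i. if i <= a then Z1 i else Z2 (i - a)) (a + b)"
  unfolding chn_def
 proof (intro conjI allI impI)
  fix i assume i: "i < a + b"
  consider "i < a" | "i = a" | "i > a" by linarith
  thus "(if i <= a then Z1 i else Z2 (i - a)) \<subset> (if Suc i <= a then Z1 (Suc i) else Z2 (Suc i - a))"
  proof cases
   case 1 thus ?thesis using chnD(5)[OF Z1] by (simp add: a_def)
  next
   case 2
   have "Z1 a \<subseteq> L" "L \<subseteq> Z2 0" "Z2 0 \<subset> Z2 (Suc 0)"
    using chnD[OF Z1, of a] chnD[OF Z2, of 0] i 2 by (auto simp: a_def b_def)
   thus ?thesis using 2 by auto
  next
   case 3 
   hence "Z2 (i - a) \<subset> Z2 (Suc (i - a))" using chnD(5)[OF Z2, of "i - a"] i by (simp add: b_def)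
   thus ?thesis using 3 by (auto simp: Suc_diff_le)
  qed
 next
  fix i assume i: "i <= a + b"
  let ?Z = "if i <= a then Z1 i else Z2 (i - a)"
  have *: "stab \<Omega> ?Z & N \<subseteq> ?Z & ?Z \<subseteq> M"
  proof (cases "i <= a")
   case True
   then show ?thesis using chnD[OF Z1, of i] assms unfolding a_def by auto
  next
   case False
   have "i - a <= b" using i by linarith
   then show ?thesis using chnD[OF Z2, of "i - a"] assms False unfolding b_def by auto
  qed
  show "stab \<Omega> ?Z" "N \<subseteq> ?Z" "?Z \<subseteq> M" using * by blast+
 qed
 thus "len \<Omega> N L + len \<Omega> L M <= len \<Omega> N M"
  using len_ge[OF _ stab_subgrp[OF assms(1)] assms(6)] unfolding a_def b_def by blast
qed

lemma len_second_iso: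
 assumes "stab \<Omega> N" "stab \<Omega> L" "finite (quo (N \<inter> L) L)"
 shows "len \<Omega> N (ssum N L) <= len \<Omega> (N \<inter> L) L"
proof (rule len_map[where f = "%Z. Z \<inter> L"])
 fix Z Z' assume Z: "stab \<Omega> Z" "stab \<Omega> Z'" "N \<subseteq> Z" "Z \<subset> Z'" "Z' \<subseteq> ssum N L"
 have "Z = Z'" if "Z \<inter> L = Z' \<inter> L"
 proof
  show "Z' \<subseteq> Z"
  proof
   fix z assume z: "z : Z'"
   hence "z : ssum N L" using Z by blast
   then obtain x y where xy: "z = x + y" "x : N" "y : L" by (auto simp: ssum_def)
   have "x : Z'" using xy Z by auto
   hence "z - x : Z'" using z Z by (intro subgrp_diff) (auto simp: stab_subgrp)
   moreover have "z - x = y" using xy by simp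
   ultimately have "y : Z \<inter> L" using that xy by auto
   thus "z : Z" using xy Z by (auto intro!: subgrp_add simp: stab_subgrp)
  qed
 qed (use Z in auto)
 thus "Z \<inter> L \<subset> Z' \<inter> L" using Z by auto
next
 fix Z assume "stab \<Omega> Z" "N \<subseteq> Z" "Z \<subseteq> ssum N L"
 thus "stab \<Omega> (Z \<inter> L) & N \<inter> L \<subseteq> Z \<inter> L & Z \<inter> L \<subseteq> L" using assms by (auto intro: stab_Int)
next
 show "subgrp (N \<inter> L)" using stab_Int[OF assms(1,2)] by (rule stab_subgrp)
qed (fact assms(3))

section \<open>Congruences and Frobenius\<close>

locale modulus =
 fixes Q :: "'w::comm_ring_1 set"
 assumes idl: "idl Q"
begin

definition cg :: "'w => 'w => bool" (infix \<open>\<asymp>\<close> 50) where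
 "a \<asymp> b \<longleftrightarrow> a - b : Q"

lemma sg: "subgrp Q" by (rule stab_subgrp[OF idl])

lemma cg_refl [simp, intro!]: "a \<asymp> a" by (simp add: cg_def subgrp_zero sg)

lemma cg_sym: "a \<asymp> b ==> b \<asymp> a" by (simp add: cg_def subgrp_diff_swap[OF sg])

lemma cg_trans [trans]: "a \<asymp> b ==> b \<asymp> c ==> a \<asymp> c"
 unfolding cg_def by (rule subgrp_trans[OF sg])

lemma cg_mult: "a \<asymp> b ==> c \<asymp> d ==> a * c \<asymp> b * d"
 unfolding cg_def by (rule idl_cong_mult[OF idl])

lemma cg_add: "a \<asymp> b ==> c \<asymp> d ==> a + c \<asymp> b + d"
 unfolding cg_def by (rule idl_cong_add[OF sg])

lemma cg_minus: "a \<asymp> b ==> - a \<asymp> - b"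
 unfolding cg_def using subgrp_diff_swap[OF sg, of a b] by simp

lemma cg_diff: "a \<asymp> b ==> c \<asymp> d ==> a - c \<asymp> b - d"
 using cg_add[OF _ cg_minus, of a b c d] by simp

lemma cg_pow: "a \<asymp> b ==> a ^ k \<asymp> b ^ k"
 unfolding cg_def by (rule idl_cong_pow[OF idl])

lemma cg_sum: "(!!i. i : I ==> f i \<asymp> g i) ==> sum f I \<asymp> sum g I"
 unfolding cg_def by (rule idl_cong_sum[OF sg])

lemma cg_mem: "a \<asymp> b ==> a : Q \<longleftrightarrow> b : Q"
 unfolding cg_def by (rule subgrp_cong[OF sg])

lemma cg_zero: "a \<asymp> 0 \<longleftrightarrow> a : Q" by (simp add: cg_def)

lemma cg_zero2: "0 \<asymp> a \<longleftrightarrow> a : Q" using cg_zero cg_sym by blast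

lemma cg_coset: "coset Q a = coset Q b \<longleftrightarrow> a \<asymp> b"
 by (simp add: cg_def coset_eq sg)

end

locale char_modulus = modulus Q for Q :: "'w::comm_ring_1 set" +
 fixes p :: nat
 assumes pp: "Factorial_Ring.prime p" and pQ: "of_nat p : Q"
begin

lemma p_gt: "p > 1" "p > 0" using prime_gt_1_nat[OF pp] by simp_all

lemma p_mult: "of_nat p * x : Q" by (rule idl_mult2[OF idl pQ])

lemma dvd_in: "p dvd k ==> of_nat k : Q" by (auto simp: p_mult elim!: dvdE)

lemma frob_add: "(a + b) ^ p \<asymp> a ^ p + b ^ p"
proof -
 let ?t = "%k. of_nat (p choose k) * a ^ k * b ^ (p - k)"
 have "(a + b) ^ p = (\<Sum>k\<le>p. ?t k)" by (rule binomial_ring)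
 also have "{..p} = insert 0 (insert p {0<..<p})" by auto
 also have "(\<Sum>k\<in>.... ?t k) = b ^ p + (a ^ p + (\<Sum>k\<in>{0<..<p}. ?t k))"
  using p_gt by simp
 finally have eq: "(a + b) ^ p = b ^ p + (a ^ p + (\<Sum>k\<in>{0<..<p}. ?t k))" .
 have "(\<Sum>k\<in>{0<..<p}. ?t k) : Q"
 proof (rule subgrp_sum[OF sg])
  fix k assume "k : {0<..<p}"
  hence "p dvd (p choose k)" by (intro dvd_choose_prime pp) auto
  thus "?t k : Q" using dvd_in idl_mult2[OF idl] by (metis (no_types))
 qed
 thus ?thesis unfolding cg_def eq by (simp add: algebra_simps)
qed

lemma frob_zero: "0 ^ p \<asymp> (0::'w)" using p_gt by (simp add: zero_power)

lemma frob_mem: "a : Q ==> a ^ p : Q"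
 using p_gt(2) by (cases p) (auto intro: idl_mult2[OF idl])

lemma frob_sum: "(\<Sum>i\<in>I. f i) ^ p \<asymp> (\<Sum>i\<in>I. f i ^ p)"
proof (induction I rule: infinite_finite_induct)
 case (insert x F)
 have "(\<Sum>i\<in>insert x F. f i) ^ p \<asymp> f x ^ p + (\<Sum>i\<in>F. f i) ^ p"
  using insert frob_add by simp
 also have "... \<asymp> f x ^ p + (\<Sum>i\<in>F. f i ^ p)" by (intro cg_add insert cg_refl)
 finally show ?case using insert by simp
qed (use frob_zero in auto)

lemma frob_minus: "(- a) ^ p \<asymp> - (a ^ p)"
proof -
 have "0 \<asymp> (- a + a) ^ p" using cg_sym[OF frob_zero] by simp
 also have "... \<asymp> (- a) ^ p + a ^ p" by (rule frob_add)
 finally have "(- a) ^ p + a ^ p : Q" by (simp add: cg_zero2)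
 thus ?thesis by (simp add: cg_def)
qed

lemma frob_diff: "(a - b) ^ p \<asymp> a ^ p - b ^ p"
proof -
 have "(a + - b) ^ p \<asymp> a ^ p + (- b) ^ p" by (rule frob_add)
 also have "... \<asymp> a ^ p + - (b ^ p)" by (intro cg_add frob_minus cg_refl)
 finally show ?thesis by simp
qed

lemma frob_int: "of_int k ^ p \<asymp> of_int k"
proof -
 have nat: "of_nat n ^ p \<asymp> of_nat n" for n
 proof (induction n)
  case 0 thus ?case using frob_zero by simp
 next
  case (Suc n)
  have "of_nat (Suc n) ^ p \<asymp> 1 ^ p + of_nat n ^ p" using frob_add[of 1 "of_nat n"] by simp
  also have "... \<asymp> 1 ^ p + of_nat n" by (intro cg_add Suc cg_refl)
  finally show ?case by simp
 qed
 show ?thesis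
 proof (cases "k >= 0")
  case True thus ?thesis using nat[of "nat k"] by simp
 next
  case False
  have "of_int k ^ p = (- of_nat (nat (- k))) ^ p" using False by simp
  also have "... \<asymp> - (of_nat (nat (- k)) ^ p)" by (rule frob_minus)
  also have "... \<asymp> - of_nat (nat (- k))" by (rule cg_minus[OF nat])
  finally show ?thesis using False by simp
 qed
qed

end

section \<open>Integer polynomials\<close>

type_synonym zpol = "(nat \<Rightarrow>\<^sub>0 nat) \<Rightarrow>\<^sub>0 int"

abbreviation lk :: "('k \<Rightarrow>\<^sub>0 'c::zero) => 'k => 'c" where "lk \<equiv> Poly_Mapping.lookup"
abbreviation sgl :: "'k => 'c::zero => 'k \<Rightarrow>\<^sub>0 'c" where "sgl \<equiv> Poly_Mapping.single"
abbreviation ks :: "('k \<Rightarrow>\<^sub>0 'c::zero) => 'k set" where "ks \<equiv> Poly_Mapping.keys"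

definition Mon :: "nat set => nat => (nat \<Rightarrow>\<^sub>0 nat) set" where
 "Mon V s = {m. ks m \<subseteq> V & (ALL i. lk m i <= s)}"

text \<open>The exponent of every single variable is at most s; this bounds degrees as well as the total degree
would, and makes counting simpler.\<close>
definition Pol :: "nat set => nat => zpol set" where
 "Pol V s = {f. ks f \<subseteq> Mon V s}"

definition mon :: "(nat \<Rightarrow>\<^sub>0 nat) => zpol" where "mon m = Poly_Mapping.single m 1"

definition vr :: "nat => zpol" where "vr l = mon (Poly_Mapping.single l 1)"

definition pm :: "(nat => nat) => nat set => nat \<Rightarrow>\<^sub>0 nat" where
 "pm f V = Abs_poly_mapping (%i. if i : V then f i else 0)"

lemma lk_pm: "finite V ==> lk (pm f V) i = (if i : V then f i else 0)"
 unfolding pm_def by (subst Abs_poly_mapping_inverse) (auto elim: finite_subset[rotated])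

lemma ks_pm: "finite V ==> ks (pm f V) = {i : V. f i ~= 0}"
 unfolding set_eq_iff mem_Collect_eq in_keys_iff by (simp add: lk_pm)

lemma lk_notin: "i ~: ks m ==> lk m i = 0"
 by (simp add: in_keys_iff)

lemma Mon_lk: "m : Mon V s ==> i ~: V ==> lk m i = 0"
 by (rule lk_notin) (auto simp: Mon_def)

lemma Mon_bij:
 assumes "finite V"
 shows "bij_betw (%f. pm f V) (PiE V (%_. {..s})) (Mon V s)"
proof (rule bij_betw_byWitness[where f' = "%m. restrict (lk m) V"])
 show "ALL f:V \<rightarrow>\<^sub>E {..s}. restrict (lk (pm f V)) V = f"
  using assms by (auto simp: lk_pm fun_eq_iff PiE_def extensional_def)
 show "ALL m:Mon V s. pm (restrict (lk m) V) V = m"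
  using assms by (auto intro!: poly_mapping_eqI simp: lk_pm Mon_lk)
 show "(%f. pm f V) ` (V \<rightarrow>\<^sub>E {..s}) \<subseteq> Mon V s"
 proof (rule image_subsetI)
  fix f assume "f : V \<rightarrow>\<^sub>E {..s}"
  hence f: "f i <= s" if "i : V" for i using that by (auto dest: PiE_mem)
  have "ks (pm f V) \<subseteq> V" using assms by (auto simp: ks_pm)
  moreover have "lk (pm f V) i <= s" for i using f[of i] assms by (simp add: lk_pm)
  ultimately show "pm f V : Mon V s" by (simp add: Mon_def)
 qed
 show "(%m. restrict (lk m) V) ` Mon V s \<subseteq> V \<rightarrow>\<^sub>E {..s}"
  by (auto simp: Mon_def)
qed

lemma finite_Mon: "finite V ==> finite (Mon V s)"
 using bij_betw_finite[OF Mon_bij] by (simp add: finite_PiE)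

lemma card_Mon: "finite V ==> card (Mon V s) = (s + 1) ^ card V"
 using bij_betw_same_card[OF Mon_bij, of V s] by (simp add: card_PiE)

lemma Mon_mono: "V \<subseteq> Y ==> s <= t ==> Mon V s \<subseteq> Mon Y t"
 unfolding Mon_def by (auto intro: order_trans)

lemma Pol_mono: "V \<subseteq> Y ==> s <= t ==> Pol V s \<subseteq> Pol Y t"
 unfolding Pol_def using Mon_mono by blast

lemma zero_Mon: "0 : Mon V s" by (simp add: Mon_def)

lemma Mon_add: "m : Mon V s ==> n : Mon V t ==> m + n : Mon V (s + t)"
 unfolding Mon_def by (auto simp: lookup_add add_mono dest!: keys_add[THEN subsetD])

lemma Pol_iff: "f : Pol V s \<longleftrightarrow> (ALL m. lk f m ~= 0 --> m : Mon V s)"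
 unfolding Pol_def by (auto simp: in_keys_iff)

lemma subgrp_Pol: "subgrp (Pol V s)"
 unfolding subgrp_def
proof (intro conjI ballI)
 fix f g assume "f : Pol V s" "g : Pol V s"
 thus "f - g : Pol V s"
  using keys_diff[of f g] unfolding Pol_def by blast
qed (simp add: Pol_def)

lemma sgl_Pol: "m : Mon V s ==> sgl m k : Pol V s"
 unfolding Pol_iff by (auto simp: lookup_single when_def)

lemma mon_Pol: "m : Mon V s ==> mon m : Pol V s"
 unfolding mon_def by (rule sgl_Pol)

lemma vr_Pol: "l : V ==> s >= 1 ==> vr l : Pol V s"
 unfolding vr_def by (rule mon_Pol) (auto simp: Mon_def lookup_single when_def)

lemma int_Pol: "of_int k : Pol V s"
 unfolding single_of_int[symmetric] by (rule sgl_Pol[OF zero_Mon])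

lemma nat_Pol: "of_nat k : Pol V s"
 using int_Pol[of "int k"] by simp

lemma one_Pol: "1 : Pol V s" using int_Pol[of 1] by simp

lemma zero_Pol: "0 : Pol V s" using int_Pol[of 0] by simp

lemma Pol_add: "f : Pol V s ==> g : Pol V s ==> f + g : Pol V s"
 by (rule subgrp_add[OF subgrp_Pol])

lemma Pol_diff: "f : Pol V s ==> g : Pol V s ==> f - g : Pol V s"
 by (rule subgrp_diff[OF subgrp_Pol])

lemma Pol_minus: "f : Pol V s ==> - f : Pol V s"
 by (rule subgrp_minus[OF subgrp_Pol])

lemma Pol_sum: "(!!i. i : I ==> f i : Pol V s) ==> sum f I : Pol V s"
 by (rule subgrp_sum[OF subgrp_Pol])

lemma Pol_expand:
 assumes "f : Pol V s" "finite V"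
 shows "f = (\<Sum>m\<in>Mon V s. sgl m (lk f m))"
proof (rule poly_mapping_eqI)
 fix k
 have "lk (\<Sum>m\<in>Mon V s. sgl m (lk f m)) k = (\<Sum>m\<in>Mon V s. if m = k then lk f m else 0)"
  by (simp add: lookup_sum lookup_single when_def)
 also have "... = (if k : Mon V s then lk f k else 0)"
  using finite_Mon[OF assms(2)] by (simp add: sum.delta)
 also have "... = lk f k" using assms(1) by (auto simp: Pol_iff)
 finally show "lk f k = lk (\<Sum>m\<in>Mon V s. sgl m (lk f m)) k" by simp
qed

lemma poly_expand: "f = (\<Sum>m\<in>ks f. sgl m (lk f m))" for f :: "'a \<Rightarrow>\<^sub>0 'b::comm_monoid_add"
proof (rule poly_mapping_eqI)
 fix k
 have "lk (\<Sum>m\<in>ks f. sgl m (lk f m)) k = (\<Sum>m\<in>ks f. if m = k then lk f m else 0)"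
  by (simp add: lookup_sum lookup_single when_def)
 also have "... = (if k : ks f then lk f k else 0)" by (simp add: sum.delta)
 also have "... = lk f k" by (auto simp: in_keys_iff)
 finally show "lk f k = lk (\<Sum>m\<in>ks f. sgl m (lk f m)) k" by simp
qed

lemma Pol_ex: "(!!m. m : ks f ==> ks m \<subseteq> V) ==> EX s. f : Pol V s"
proof -
 assume *: "!!m. m : ks f ==> ks m \<subseteq> V"
 let ?S = "\<Union>m\<in>ks f. lk m ` ks m"
 have "finite ?S" by simp
 have "lk m i <= Max (insert 0 ?S)" if "m : ks f" for m i
  using that \<open>finite ?S\<close> by (cases "i : ks m") (auto simp: lk_notin intro!: Max_ge)
 hence "f : Pol V (Max (insert 0 ?S))" using * unfolding Pol_def Mon_def by auto
 thus ?thesis by blast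
qed

lemma sgl_mon: "sgl m k = of_int k * mon m"
 unfolding mon_def single_of_int[symmetric] by (simp add: mult_single)

lemma mon_add: "mon (m + n) = mon m * mon n"
 by (simp add: mon_def mult_single)

lemma mon_0: "mon 0 = 1" by (simp add: mon_def)

lemma Pol_mult:
 assumes "f : Pol V s" "g : Pol V t" shows "f * g : Pol V (s + t)"
proof -
 have "ks (f * g) \<subseteq> {a + b |a b. a : ks f & b : ks g}" by (rule keys_mult)
 also have "... \<subseteq> Mon V (s + t)" using assms Mon_add unfolding Pol_def by blast
 finally show ?thesis by (simp add: Pol_def)
qed

lemma Pol_pow: "f : Pol V s ==> f ^ k : Pol V (k * s)"
 by (induction k) (auto simp: one_Pol dest: Pol_mult)

lemma Pol_mono': "f : Pol V s ==> s <= t ==> f : Pol V t"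
 using Pol_mono[OF order_refl] by blast

lemma Pol_mult': "f : Pol V s ==> g : Pol V t ==> s + t <= u ==> f * g : Pol V u"
 using Pol_mult Pol_mono' by blast

lemma Pol_prod: "finite I ==> (!!i. i : I ==> f i : Pol V (s i)) ==> prod f I : Pol V (sum s I)"
 by (induction I rule: finite_induct) (auto simp: one_Pol intro: Pol_mult)

lemma mon_pow: "mon m ^ k = mon (pm (%i. k * lk m i) (ks m))"
proof (induction k)
 case 0
 have "pm (%i. 0 * lk m i) (ks m) = 0" by (rule poly_mapping_eqI) (simp add: lk_pm)
 thus ?case by (simp add: mon_0)
next
 case (Suc k)
 have "pm (%i. Suc k * lk m i) (ks m) = m + pm (%i. k * lk m i) (ks m)"
  by (rule poly_mapping_eqI) (auto simp: lk_pm lookup_add lk_notin)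
 thus ?case using Suc by (simp add: mon_add)
qed

lemma mon_as_prod: "mon m = (\<Prod>i\<in>ks m. vr i ^ lk m i)"
proof -
 have *: "finite V ==> mon (pm f V) = (\<Prod>i\<in>V. vr i ^ f i)" for V f
 proof (induction V rule: finite_induct)
  case empty
  have "pm f {} = 0" by (rule poly_mapping_eqI) (simp add: lk_pm)
  thus ?case by (simp add: mon_0)
 next
  case (insert x F)
  have "pm f (insert x F) = pm (%i. f x * lk (sgl x 1) i) (ks (sgl x (1::nat))) + pm f F"
   using insert by (intro poly_mapping_eqI) (auto simp: lk_pm lookup_add lookup_single when_def)
  thus ?case using insert by (simp add: mon_add vr_def mon_pow)
 qed
 have "m = pm (lk m) (ks m)" by (rule poly_mapping_eqI) (simp add: lk_pm lk_notin)
 thus ?thesis using *[of "ks m" "lk m"] by simp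
qed

lemma mon_divmod:
 assumes "finite V" "m : Mon V s"
 shows "mon m = mon (pm (%i. lk m i mod p) V) * mon (pm (%i. lk m i div p) V) ^ p"
proof -
 have "m = pm (%i. lk m i mod p) V
  + pm (%i. p * lk (pm (%i. lk m i div p) V) i) (ks (pm (%i. lk m i div p) V))"
 proof (rule poly_mapping_eqI)
  fix k
  have "lk m k = lk m k mod p + p * (lk m k div p)" by simp
  moreover have "lk m k = lk m k mod p" if "lk m k div p = 0"
   using that calculation by simp
  moreover have "lk m k = 0" if "k ~: V" using Mon_lk[OF assms(2) that] .
  ultimately show "lk m k = lk (pm (%i. lk m i mod p) V
   + pm (%i. p * lk (pm (%i. lk m i div p) V) i) (ks (pm (%i. lk m i div p) V))) k"
   using assms(1) by (auto simp add: lk_pm lookup_add ks_pm)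
 qed
 thus ?thesis unfolding mon_pow mon_add[symmetric] by simp
qed

text \<open>Divide the exponents by p with remainder; the integer coefficients are their own p-th powers modulo
p by Fermat.\<close>
lemma decompose:
 assumes "char_modulus Q p" "finite V" "f : Pol V s"
 shows "EX h. (ALL a. h a : Pol V s) & f - (\<Sum>a\<in>Mon V (p - 1). mon a * h a ^ p) : Q"
proof -
 interpret char_modulus Q p by fact
 define md where "md m = pm (%i. lk m i mod p) V" for m
 define dv where "dv m = pm (%i. lk m i div p) V" for m
 define h where "h a = (\<Sum>m\<in>{m\<in>Mon V s. md m = a}. sgl (dv m) (lk f m))" for a
 have fin: "finite (Mon V s)" by (rule finite_Mon[OF assms(2)])
 have md: "md m : Mon V (p - 1)" for m
 proof -
  have "lk m i mod p <= p - 1" for i using p_gt mod_less_divisor[of p "lk m i"] by linarith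
  thus ?thesis using assms(2) by (auto simp: md_def Mon_def lk_pm ks_pm)
 qed
 have dv: "dv m : Mon V s" if "m : Mon V s" for m
 proof -
  have "lk m i div p <= s" for i
   using that order_trans[OF div_le_dividend, of "lk m i" s p] by (simp add: Mon_def)
  thus ?thesis using assms(2) by (auto simp: dv_def Mon_def lk_pm ks_pm)
 qed
 have "h a : Pol V s" for a unfolding h_def by (intro Pol_sum sgl_Pol dv) auto
 moreover have "f \<asymp> (\<Sum>a\<in>Mon V (p - 1). mon a * h a ^ p)"
 proof -
  have "f = (\<Sum>m\<in>Mon V s. sgl m (lk f m))" by (rule Pol_expand[OF assms(3,2)])
  also have "... = (\<Sum>a\<in>Mon V (p - 1). \<Sum>m\<in>{m\<in>Mon V s. md m = a}. sgl m (lk f m))"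
   by (rule sum.group[symmetric]) (use fin md finite_Mon[OF assms(2)] in auto)
  also have "... \<asymp> (\<Sum>a\<in>Mon V (p - 1). mon a * h a ^ p)"
  proof (rule cg_sum)
   fix a assume "a : Mon V (p - 1)"
   have "(\<Sum>m\<in>{m\<in>Mon V s. md m = a}. sgl m (lk f m))
    \<asymp> (\<Sum>m\<in>{m\<in>Mon V s. md m = a}. mon a * sgl (dv m) (lk f m) ^ p)"
   proof (rule cg_sum)
    fix m assume m: "m : {m\<in>Mon V s. md m = a}"
    have "sgl m (lk f m) = of_int (lk f m) * (mon a * mon (dv m) ^ p)"
     unfolding sgl_mon using mon_divmod[OF assms(2), of m s p] m by (simp add: md_def dv_def)
    also have "... \<asymp> of_int (lk f m) ^ p * (mon a * mon (dv m) ^ p)"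
     by (intro cg_mult cg_sym[OF frob_int] cg_refl)
    also have "... = mon a * sgl (dv m) (lk f m) ^ p"
     unfolding sgl_mon by (simp add: power_mult_distrib algebra_simps)
    finally show "sgl m (lk f m) \<asymp> mon a * sgl (dv m) (lk f m) ^ p" .
   qed
   also have "... = mon a * (\<Sum>m\<in>{m\<in>Mon V s. md m = a}. sgl (dv m) (lk f m) ^ p)"
    by (rule sum_distrib_left[symmetric])
   also have "... \<asymp> mon a * h a ^ p"
    unfolding h_def by (intro cg_mult cg_refl cg_sym[OF frob_sum])
   finally show "(\<Sum>m\<in>{m\<in>Mon V s. md m = a}. sgl m (lk f m)) \<asymp> mon a * h a ^ p" .
  qed
  finally show ?thesis .
 qed
 ultimately show ?thesis unfolding cg_def by blast
qed

section \<open>Leading monomials modulo k\<close>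

text \<open>The cases k = p and k = 0 give vanishing modulo p and vanishing. Working with k treats the fibers
and the generic situation at once.\<close>
definition kdv :: "int => zpol => bool" where "kdv k f \<longleftrightarrow> (ALL m. k dvd lk f m)"

definition kprime :: "int => bool" where
 "kprime k \<longleftrightarrow> ~ k dvd 1 & (ALL a b. k dvd a * b --> k dvd a | k dvd b)"

text \<open>With respect to the linear order of exponent vectors.\<close>
definition lmk :: "int => zpol => nat \<Rightarrow>\<^sub>0 nat" where
 "lmk k f = Max {m : ks f. ~ k dvd lk f m}"

lemma lmk:
 assumes "~ kdv k f"
 shows "~ k dvd lk f (lmk k f)" "~ k dvd lk f m ==> m <= lmk k f"
proof -
 obtain m0 where "~ k dvd lk f m0" using assms by (auto simp: kdv_def)
 moreover from this have "lk f m0 ~= 0" by auto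
 ultimately have "{m : ks f. ~ k dvd lk f m} ~= {}" by (auto simp: in_keys_iff)
 hence "lmk k f : {m : ks f. ~ k dvd lk f m}" unfolding lmk_def by (intro Max_in) auto
 thus "~ k dvd lk f (lmk k f)" by simp
 show "m <= lmk k f" if "~ k dvd lk f m"
  unfolding lmk_def by (rule Max_ge) (use that in \<open>auto simp: in_keys_iff\<close>)
qed

lemma lookup_mult_sum:
 fixes f g :: zpol
 shows "lk (f * g) M = (\<Sum>m\<in>ks f. \<Sum>n\<in>ks g. if m + n = M then lk f m * lk g n else 0)"
proof -
 have "f * g = (\<Sum>m\<in>ks f. sgl m (lk f m)) * (\<Sum>n\<in>ks g. sgl n (lk g n))"
  using poly_expand[of f] poly_expand[of g] by simp
 also have "... = (\<Sum>m\<in>ks f. \<Sum>n\<in>ks g. sgl (m + n) (lk f m * lk g n))"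
  by (simp add: sum_product mult_single)
 finally show ?thesis by (simp add: lookup_sum lookup_single when_def)
qed

text \<open>The sum of the two leading exponents arises in one way only, because the order is compatible with
addition; so the leading coefficient of the product is a product of two integers outside the prime
ideal of multiples of k.\<close>
lemma lmk_mult:
 assumes k: "kprime k" and f: "~ kdv k f" and g: "~ kdv k g"
 shows "~ kdv k (f * g)" "lmk k (f * g) = lmk k f + lmk k g"
proof -
 let ?F = "lmk k f" and ?G = "lmk k g"
 have key: "m = ?F & n = ?G" if "?F + ?G <= m + n" "~ k dvd lk f m * lk g n" for m n
 proof -
  have "~ k dvd lk f m" "~ k dvd lk g n" using that(2) by auto
  hence le: "m <= ?F" "n <= ?G" using lmk f g by blast+
  have "m = ?F"
  proof (rule ccontr)
   assume "m ~= ?F"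
   hence "m < ?F" using le by simp
   hence "m + n < ?F + ?G" using le(2) by (rule add_less_le_mono)
   thus False using that(1) by simp
  qed
  moreover have "n = ?G"
  proof (rule ccontr)
   assume "n ~= ?G"
   hence "n < ?G" using le by simp
   hence "m + n < ?F + ?G" using le(1) by (metis add_le_less_mono)
   thus False using that(1) by simp
  qed
  ultimately show ?thesis by simp
 qed
 have hi: "k dvd lk (f * g) M" if "?F + ?G < M" for M
  unfolding lookup_mult_sum
 proof (intro dvd_sum)
  fix m n
  show "k dvd (if m + n = M then lk f m * lk g n else 0)"
  proof (cases "m + n = M")
   case True
   hence "~ (m = ?F & n = ?G)" "?F + ?G <= m + n" using that by auto
   hence "k dvd lk f m * lk g n" using key[of m n] by blast
   thus ?thesis using True by simp
  qed simp
 qed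
 have "k dvd lk (f * g) (?F + ?G) - lk f ?F * lk g ?G"
 proof -
  have "lk f ?F * lk g ?G = (\<Sum>m\<in>ks f. \<Sum>n\<in>ks g. if m = ?F & n = ?G then lk f m * lk g n else 0)"
  proof -
   have "(\<Sum>m\<in>ks f. \<Sum>n\<in>ks g. if m = ?F & n = ?G then lk f m * lk g n else 0)
    = (\<Sum>m\<in>ks f. if m = ?F then (\<Sum>n\<in>ks g. if n = ?G then lk f m * lk g n else 0) else 0)"
    by (intro sum.cong refl) simp
   also have "... = (if ?F : ks f then if ?G : ks g then lk f ?F * lk g ?G else 0 else 0)"
    by (simp add: sum.delta)
   also have "... = lk f ?F * lk g ?G"
    using lk_notin[of ?F f] lk_notin[of ?G g] by (cases "?F : ks f"; cases "?G : ks g") simp_all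
   finally show ?thesis by simp
  qed
  hence "lk (f * g) (?F + ?G) - lk f ?F * lk g ?G =
   (\<Sum>m\<in>ks f. \<Sum>n\<in>ks g. (if m + n = ?F + ?G then lk f m * lk g n else 0)
    - (if m = ?F & n = ?G then lk f m * lk g n else 0))"
   unfolding lookup_mult_sum by (simp add: sum_subtractf)
  also have "k dvd ..."
  proof (intro dvd_sum)
   fix m n
   show "k dvd (if m + n = ?F + ?G then lk f m * lk g n else 0)
    - (if m = ?F & n = ?G then lk f m * lk g n else 0)"
   proof (cases "m = ?F & n = ?G")
    case False
    hence "k dvd lk f m * lk g n" if "m + n = ?F + ?G" using key[of m n] that by fastforce
    thus ?thesis using False by auto
   qed auto
  qed
  finally show ?thesis .
 qed
 moreover have "~ k dvd lk f ?F * lk g ?G" using k lmk(1)[OF f] lmk(1)[OF g] by (auto simp: kprime_def)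
 ultimately have nd: "~ k dvd lk (f * g) (?F + ?G)" using dvd_diff_commute
  by (metis diff_add_cancel dvd_add_right_iff)
 thus ndv: "~ kdv k (f * g)" by (auto simp: kdv_def)
 have "lmk k (f * g) <= ?F + ?G" using hi[of "lmk k (f * g)"] lmk(1)[OF ndv] by (meson not_le)
 moreover have "?F + ?G <= lmk k (f * g)" using lmk(2)[OF ndv nd] .
 ultimately show "lmk k (f * g) = ?F + ?G" by simp
qed

lemma kdv_mult: "kprime k ==> kdv k (f * g) \<longleftrightarrow> kdv k f | kdv k g"
proof -
 have *: "kdv k f ==> kdv k (f * g)" for f g
  unfolding kdv_def lookup_mult_sum by (auto intro!: dvd_sum)
 show "kprime k ==> ?thesis" using lmk_mult(1)[of k f g] *[of f g] *[of g f] by (auto simp: mult.commute)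
qed

lemma kdv_factor: "kdv k f ==> EX g. f = of_int k * g"
proof -
 assume "kdv k f"
 hence "ALL m. EX c. lk f m = k * c" by (auto simp: kdv_def dvd_def)
 then obtain c where c: "!!m. lk f m = k * c m" by metis
 have "f = (\<Sum>m\<in>ks f. sgl m (lk f m))" by (rule poly_expand)
 also have "... = of_int k * (\<Sum>m\<in>ks f. sgl m (c m))"
  unfolding sum_distrib_left by (intro sum.cong refl) (simp add: c sgl_mon mult.assoc)
 finally show ?thesis by blast
qed

lemma kdv_of_int_mult: "kdv k (of_int k * g)"
 unfolding kdv_def single_of_int[symmetric] mult_map_scale_conv_mult[symmetric]
 by (simp add: Poly_Mapping.map.rep_eq when_def)

lemma kdv_0: "kdv 0 f \<longleftrightarrow> f = 0"
 by (auto simp: kdv_def poly_mapping_eq_iff fun_eq_iff)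

lemma kprime_0: "kprime 0" by (auto simp: kprime_def)

lemma kprime_prime: "Factorial_Ring.prime p ==> kprime (int p)"
proof -
 assume "Factorial_Ring.prime p"
 hence "Factorial_Ring.prime (int p)" by simp
 thus ?thesis unfolding kprime_def using prime_dvd_mult_iff not_prime_unit by blast
qed

section \<open>Counting polynomials modulo p\<close>

text \<open>The reduced representatives of the polynomials over the field with p elements.\<close>
definition Rep :: "nat => nat set => nat => zpol set" where
 "Rep p V s = {f : Pol V s. ALL m. 0 <= lk f m & lk f m < int p}"

lemma Rep_bij:
 assumes "finite V" "p > 0"
 shows "bij_betw (%\<phi>. \<Sum>m\<in>Mon V s. sgl m (\<phi> m)) (PiE (Mon V s) (%_. {0..<int p})) (Rep p V s)"
proof (rule bij_betw_byWitness[where f' = "%f. restrict (lk f) (Mon V s)"])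
 have fin: "finite (Mon V s)" by (rule finite_Mon[OF assms(1)])
 have lks: "lk (\<Sum>m\<in>Mon V s. sgl m (\<phi> m)) k = (if k : Mon V s then \<phi> k else 0)" for \<phi> :: "_ => int" and k
 proof -
  have "lk (\<Sum>m\<in>Mon V s. sgl m (\<phi> m)) k = (\<Sum>m\<in>Mon V s. if m = k then \<phi> m else 0)"
   by (simp add: lookup_sum lookup_single when_def)
  thus ?thesis using fin by (simp add: sum.delta)
 qed
 show "ALL \<phi>:Mon V s \<rightarrow>\<^sub>E {0..<int p}. restrict (lk (\<Sum>m\<in>Mon V s. sgl m (\<phi> m))) (Mon V s) = \<phi>"
  by (auto simp: lks fun_eq_iff PiE_def extensional_def)
 show "ALL f:Rep p V s. (\<Sum>m\<in>Mon V s. sgl m (restrict (lk f) (Mon V s) m)) = f"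
 proof
  fix f assume "f : Rep p V s"
  hence "f : Pol V s" by (simp add: Rep_def)
  from Pol_expand[OF this assms(1)] show "(\<Sum>m\<in>Mon V s. sgl m (restrict (lk f) (Mon V s) m)) = f" by simp
 qed
 show "(%\<phi>. \<Sum>m\<in>Mon V s. sgl m (\<phi> m)) ` (Mon V s \<rightarrow>\<^sub>E {0..<int p}) \<subseteq> Rep p V s"
 proof (rule image_subsetI)
  fix \<phi> assume phi: "\<phi> : Mon V s \<rightarrow>\<^sub>E {0..<int p}"
  have "(\<Sum>m\<in>Mon V s. sgl m (\<phi> m)) : Pol V s" by (intro Pol_sum sgl_Pol)
  moreover have "0 <= lk (\<Sum>m\<in>Mon V s. sgl m (\<phi> m)) k & lk (\<Sum>m\<in>Mon V s. sgl m (\<phi> m)) k < int p" for k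
   unfolding lks using PiE_mem[OF phi, of k] assms(2) by simp
  ultimately show "(\<Sum>m\<in>Mon V s. sgl m (\<phi> m)) : Rep p V s" by (simp add: Rep_def)
 qed
 show "(%f. restrict (lk f) (Mon V s)) ` Rep p V s \<subseteq> Mon V s \<rightarrow>\<^sub>E {0..<int p}"
  by (auto simp: Rep_def)
qed

lemma finite_Rep: "finite V ==> p > 0 ==> finite (Rep p V s)"
 using bij_betw_finite[OF Rep_bij[of V p s]] by (simp add: finite_PiE finite_Mon)

lemma card_Rep: "finite V ==> p > 0 ==> card (Rep p V s) = p ^ ((s + 1) ^ card V)"
 using bij_betw_same_card[OF Rep_bij, of V p s] by (simp add: card_PiE finite_Mon card_Mon)

lemma Rep_inj: "f : Rep p V s ==> g : Rep p V s ==> kdv (int p) (f - g) ==> f = g"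
proof (rule poly_mapping_eqI)
 fix m assume *: "f : Rep p V s" "g : Rep p V s" "kdv (int p) (f - g)"
 hence "int p dvd lk f m - lk g m" by (simp add: kdv_def lookup_minus)
 hence "lk f m mod int p = lk g m mod int p" by (simp add: mod_eq_dvd_iff)
 thus "lk f m = lk g m" using * by (simp add: Rep_def)
qed

lemma Rep_ex:
 assumes "finite V" "p > 0" "f : Pol V s"
 shows "EX r:Rep p V s. EX g. f - r = of_nat p * g"
proof -
 define r where "r = (\<Sum>m\<in>Mon V s. sgl m (restrict (%m. lk f m mod int p) (Mon V s) m))"
 have "restrict (%m. lk f m mod int p) (Mon V s) : Mon V s \<rightarrow>\<^sub>E {0..<int p}" using assms(2) by simp
 hence "r : Rep p V s" unfolding r_def using bij_betw_imp_surj_on[OF Rep_bij[OF assms(1,2), of s]] by blast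
 moreover have "f - r = of_nat p * (\<Sum>m\<in>Mon V s. sgl m (lk f m div int p))"
 proof -
  have "f - r = (\<Sum>m\<in>Mon V s. sgl m (lk f m)) - (\<Sum>m\<in>Mon V s. sgl m (lk f m mod int p))"
   unfolding r_def using Pol_expand[OF assms(3,1)] by simp
  also have "... = (\<Sum>m\<in>Mon V s. of_nat p * sgl m (lk f m div int p))"
   unfolding sum_subtractf[symmetric]
  proof (intro sum.cong refl)
   fix m
   have "lk f m - lk f m mod int p = int p * (lk f m div int p)"
    by (simp add: minus_mod_eq_mult_div)
   hence "sgl m (lk f m) - sgl m (lk f m mod int p) = sgl m (int p * (lk f m div int p))"
    by (metis single_diff)
   thus "sgl m (lk f m) - sgl m (lk f m mod int p) = of_nat p * sgl m (lk f m div int p)"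
    by (simp add: sgl_mon mult.assoc)
  qed
  finally show ?thesis by (simp add: sum_distrib_left)
 qed
 ultimately show ?thesis by blast
qed

lemma vr_pow: "vr l ^ i = mon (sgl l i)"
proof -
 have "pm (%j. i * lk (sgl l 1) j) (ks (sgl l (1::nat))) = sgl l i"
  by (rule poly_mapping_eqI) (simp add: lk_pm lookup_single when_def)
 thus ?thesis unfolding vr_def mon_pow by simp
qed

lemma kdv_sum: "(!!i. i : I ==> kdv k (f i)) ==> kdv k (sum f I)"
 unfolding kdv_def lookup_sum by (auto intro: dvd_sum)

text \<open>The elements that are combinations of B modulo Q, with coefficients in Pol V s.\<close>
definition spn :: "zpol set => nat set => nat => zpol set => zpol set" where
 "spn Q V s B = {w. EX \<alpha>. (ALL b:B. \<alpha> b : Pol V s) & w - (\<Sum>b\<in>B. \<alpha> b * b) : Q}"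

text \<open>Coefficients enter through F: the identity gives independence over A, the Frobenius map independence
over the p-th powers of A.\<close>
definition ind :: "zpol set => nat set => (zpol => zpol) => 'i set => ('i => zpol) => bool" where
 "ind Q V F I u \<longleftrightarrow> (ALL s \<beta>. (ALL i:I. \<beta> i : Pol V s) --> (\<Sum>i\<in>I. F (\<beta> i) * u i) : Q --> (ALL i:I. \<beta> i : Q))"

text \<open>Algebraic independence of the variables V modulo Q, over the rationals for k = 0 and over the field
with p elements for k = p.\<close>
definition AI :: "int => zpol set => nat set => bool" where
 "AI k Q V \<longleftrightarrow> (ALL s. ALL f:Pol V s. f : Q --> kdv k f)"

lemma spnI: "(!!b. b : B ==> \<alpha> b : Pol V s) ==> w - (\<Sum>b\<in>B. \<alpha> b * b) : Q ==> w : spn Q V s B"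
 unfolding spn_def by blast

lemma spnE:
 assumes "w : spn Q V s B"
 obtains \<alpha> where "!!b. b : B ==> \<alpha> b : Pol V s" "w - (\<Sum>b\<in>B. \<alpha> b * b) : Q"
 using assms unfolding spn_def by blast

lemma indD:
 assumes "ind Q V F I u" "!!i. i : I ==> \<beta> i : Pol V s" "(\<Sum>i\<in>I. F (\<beta> i) * u i) : Q" "i : I"
 shows "\<beta> i : Q"
 using assms unfolding ind_def by blast

lemma spn_mono: "s <= t ==> spn Q V s B \<subseteq> spn Q V t B"
 unfolding spn_def using Pol_mono'[of _ V s t] by blast

lemma spn_mono': "w : spn Q V s B ==> s <= t ==> w : spn Q V t B"
 using spn_mono by blast

locale zmodulus = modulus Q for Q :: "zpol set"
begin

lemma spn_subgrp: "w : spn Q V s B ==> w' : spn Q V s B ==> w - w' : spn Q V s B" for V s B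
proof (elim spnE)
 fix \<alpha> \<beta> assume *: "!!b. b : B ==> \<alpha> b : Pol V s" "w - (\<Sum>b\<in>B. \<alpha> b * b) : Q"
  "!!b. b : B ==> \<beta> b : Pol V s" "w' - (\<Sum>b\<in>B. \<beta> b * b) : Q"
 show ?thesis
 proof (rule spnI[where \<alpha> = "%b. \<alpha> b - \<beta> b"])
  have "(w - (\<Sum>b\<in>B. \<alpha> b * b)) - (w' - (\<Sum>b\<in>B. \<beta> b * b)) : Q" by (rule subgrp_diff[OF sg *(2,4)])
  thus "w - w' - (\<Sum>b\<in>B. (\<alpha> b - \<beta> b) * b) : Q"
   by (simp add: left_diff_distrib sum_subtractf algebra_simps)
 qed (use * Pol_diff in blast)
qed

lemma subgrp_spn: "subgrp (spn Q V s B)"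
 unfolding subgrp_def
proof (intro conjI ballI)
 show "0 : spn Q V s B"
  by (rule spnI[where \<alpha> = "%_. 0"]) (simp_all add: zero_Pol subgrp_zero sg)
qed (rule spn_subgrp)

lemma Q_spn: "w : Q ==> w : spn Q V s B"
 by (rule spnI[where \<alpha> = "%_. 0"]) (simp_all add: zero_Pol)

lemma spn_cg: "w \<asymp> w' ==> w' : spn Q V s B ==> w : spn Q V s B"
 using subgrp_add[OF subgrp_spn, of "w - w'" V s B w'] Q_spn[of "w - w'"] unfolding cg_def by simp

lemma spn_mult:
 assumes "f : Pol V t" "w : spn Q V s B" shows "f * w : spn Q V (s + t) B"
proof -
 from assms(2) obtain \<alpha> where a: "!!b. b : B ==> \<alpha> b : Pol V s" "w - (\<Sum>b\<in>B. \<alpha> b * b) : Q"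
  unfolding spn_def by blast
 show ?thesis
 proof (rule spnI[where \<alpha> = "%b. f * \<alpha> b"])
  fix b assume "b : B"
  show "f * \<alpha> b : Pol V (s + t)" by (rule Pol_mult'[OF assms(1) a(1)[OF \<open>b : B\<close>]]) simp
 next
  have "f * (w - (\<Sum>b\<in>B. \<alpha> b * b)) : Q" by (rule idl_mult[OF idl a(2)])
  thus "f * w - (\<Sum>b\<in>B. f * \<alpha> b * b) : Q"
   by (simp add: right_diff_distrib sum_distrib_left mult.assoc)
 qed
qed

lemma spn_single:
 assumes "finite B" "b : B" "f : Pol V s" shows "f * b : spn Q V s B"
proof (rule spnI[where \<alpha> = "%b'. if b' = b then f else 0"])
 have "(\<Sum>b'\<in>B. (if b' = b then f else 0) * b') = (\<Sum>b'\<in>B. if b' = b then f * b' else 0)"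
  by (rule sum.cong) simp_all
 also have "... = f * b" using assms by (simp add: sum.delta)
 finally show "f * b - (\<Sum>b'\<in>B. (if b' = b then f else 0) * b') : Q" by (simp add: subgrp_zero sg)
qed (use assms(3) zero_Pol in auto)

lemma spn_sum: "(!!i. i : I ==> f i : spn Q V s B) ==> sum f I : spn Q V s B"
 by (rule subgrp_sum[OF subgrp_spn])

lemma spn_comp:
 assumes "w : spn Q V s B" "!!b. b : B ==> g * b : spn Q V t B'"
 shows "g * w : spn Q V (s + t) B'"
proof -
 from assms(1) obtain \<alpha> where a: "!!b. b : B ==> \<alpha> b : Pol V s" "w - (\<Sum>b\<in>B. \<alpha> b * b) : Q"
  unfolding spn_def by blast
 have "g * w \<asymp> g * (\<Sum>b\<in>B. \<alpha> b * b)" using a(2) by (intro cg_mult cg_refl) (simp add: cg_def)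
 also have "... = (\<Sum>b\<in>B. \<alpha> b * (g * b))"
  unfolding sum_distrib_left by (intro sum.cong refl) (simp add: algebra_simps)
 finally have "g * w \<asymp> (\<Sum>b\<in>B. \<alpha> b * (g * b))" .
 moreover have "(\<Sum>b\<in>B. \<alpha> b * (g * b)) : spn Q V (s + t) B'"
 proof (rule spn_sum)
  fix b assume "b : B"
  from spn_mult[OF a(1)[OF this] assms(2)[OF this]]
  show "\<alpha> b * (g * b) : spn Q V (s + t) B'" by (simp add: add.commute)
 qed
 ultimately show ?thesis by (rule spn_cg)
qed

end


text \<open>Multiplication by one variable costs one factor c, so the product of c^(Ms) with a polynomial of
exponents at most s lies in the A-span of B, with coefficients whose degree is linear in s.\<close>
locale spanned = zmodulus Q for Q +
 fixes M :: nat and V :: "nat set" and c :: zpol and B :: "zpol set" and \<kappa> :: nat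
 assumes finB: "finite B" and oneB: "1 : B" and cPol: "c : Pol V \<kappa>"
  and step: "!!l b. l < M ==> b : B ==> c * vr l * b : spn Q V \<kappa> B"
begin

lemma c_pow: "w : spn Q V s B ==> c ^ n * w : spn Q V (s + n * \<kappa>) B"
 by (rule spn_mult[OF Pol_pow[OF cPol]])

lemma step_pow: "w : spn Q V s B ==> l < M ==> (c * vr l) ^ n * w : spn Q V (s + n * \<kappa>) B"
proof (induction n)
 case (Suc n)
 have "c * vr l * ((c * vr l) ^ n * w) : spn Q V (s + n * \<kappa> + \<kappa>) B"
  by (rule spn_comp[OF Suc.IH[OF Suc.prems]]) (rule step[OF Suc.prems(2)])
 thus ?case by (simp add: algebra_simps)
qed simp

lemma step_prod: "finite I ==> I \<subseteq> {..<M} ==> w : spn Q V s B ==>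
  (\<Prod>i\<in>I. (c * vr i) ^ e i) * w : spn Q V (s + (\<Sum>i\<in>I. e i) * \<kappa>) B"
proof (induction I rule: finite_induct)
 case (insert x F)
 have "(c * vr x) ^ e x * ((\<Prod>i\<in>F. (c * vr i) ^ e i) * w) : spn Q V (s + (\<Sum>i\<in>F. e i) * \<kappa> + e x * \<kappa>) B"
  by (rule step_pow) (use insert in auto)
 thus ?case using insert by (simp add: algebra_simps)
qed simp

lemma clear_mon:
 assumes "m : Mon {..<M} s" shows "c ^ (M * s) * mon m : spn Q V (M * s * \<kappa>) B"
proof -
 let ?n = "\<Sum>i\<in>ks m. lk m i"
 have sub: "ks m \<subseteq> {..<M}" using assms by (simp add: Mon_def)
 have "?n <= (\<Sum>i\<in>ks m. s)" by (rule sum_mono) (use assms in \<open>simp add: Mon_def\<close>)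
 also have "... <= (\<Sum>i\<in>{..<M}. s)" by (rule sum_mono2) (use sub in auto)
 finally have n: "?n <= M * s" by simp
 have "1 : spn Q V 0 B" using spn_single[OF finB oneB, of 1 V 0] by (simp add: one_Pol)
 from step_prod[OF finite_keys sub this, of "lk m"]
 have "(\<Prod>i\<in>ks m. (c * vr i) ^ lk m i) : spn Q V (?n * \<kappa>) B" by simp
 also have "(\<Prod>i\<in>ks m. (c * vr i) ^ lk m i) = c ^ ?n * mon m"
  unfolding mon_as_prod[of m] by (simp add: power_mult_distrib prod.distrib power_sum)
 finally have "c ^ (M * s - ?n) * (c ^ ?n * mon m) : spn Q V (?n * \<kappa> + (M * s - ?n) * \<kappa>) B"
  by (rule c_pow)
 thus ?thesis using n by (simp add: mult.assoc[symmetric] power_add[symmetric] distrib_right[symmetric])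
qed

lemma clear:
 assumes "f : Pol {..<M} s" shows "c ^ (M * s) * f : spn Q V (M * s * \<kappa>) B"
proof -
 have "c ^ (M * s) * f = (\<Sum>m\<in>Mon {..<M} s. of_int (lk f m) * (c ^ (M * s) * mon m))"
  by (subst Pol_expand[OF assms]) (simp_all add: sum_distrib_left sgl_mon algebra_simps)
 also have "... : spn Q V (M * s * \<kappa>) B"
 proof (rule spn_sum)
  fix m assume "m : Mon {..<M} s"
  from spn_mult[OF int_Pol[of "lk f m" V 0] clear_mon[OF this]]
  show "of_int (lk f m) * (c ^ (M * s) * mon m) : spn Q V (M * s * \<kappa>) B" by simp
 qed
 finally show ?thesis .
qed

end

section \<open>Existence of a transcendence basis with denominators\<close>

lemma split_var:
 assumes "f : Pol (insert l V) s" "finite V" "l ~: V"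
 shows "EX h. (ALL i. h i : Pol V s) & f = (\<Sum>i\<le>s. h i * vr l ^ i)"
proof -
 define h where "h i = (\<Sum>m\<in>{m\<in>Mon (insert l V) s. lk m l = i}. sgl (pm (lk m) V) (lk f m))" for i
 have fin: "finite (Mon (insert l V) s)" by (rule finite_Mon) (use assms in simp)
 have "h i : Pol V s" for i
  unfolding h_def
 proof (intro Pol_sum sgl_Pol)
  fix m assume "m : {m\<in>Mon (insert l V) s. lk m l = i}"
  thus "pm (lk m) V : Mon V s" using assms(2) by (simp add: Mon_def ks_pm lk_pm)
 qed
 moreover have "f = (\<Sum>i\<le>s. h i * vr l ^ i)"
 proof -
  have "f = (\<Sum>m\<in>Mon (insert l V) s. sgl m (lk f m))" by (rule Pol_expand[OF assms(1)]) (use assms in simp)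
  also have "... = (\<Sum>i\<le>s. \<Sum>m\<in>{m\<in>Mon (insert l V) s. lk m l = i}. sgl m (lk f m))"
   by (rule sum.group[symmetric]) (use fin in \<open>auto simp: Mon_def\<close>)
  also have "... = (\<Sum>i\<le>s. h i * vr l ^ i)"
  proof (intro sum.cong refl)
   fix i
   show "(\<Sum>m\<in>{m\<in>Mon (insert l V) s. lk m l = i}. sgl m (lk f m)) = h i * vr l ^ i"
    unfolding h_def sum_distrib_right
   proof (intro sum.cong refl)
    fix m assume m: "m : {m\<in>Mon (insert l V) s. lk m l = i}"
    have "m = pm (lk m) V + sgl l i"
    proof (rule poly_mapping_eqI)
     fix k
     have "lk m k = 0" if "k ~: insert l V" using Mon_lk[of m "insert l V" s k] m that by simp
     thus "lk m k = lk (pm (lk m) V + sgl l i) k"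
      using m assms(2,3) by (auto simp: lookup_add lk_pm lookup_single when_def)
    qed
    hence "mon m = mon (pm (lk m) V) * vr l ^ i" by (metis mon_add vr_pow)
    thus "sgl m (lk f m) = sgl (pm (lk m) V) (lk f m) * vr l ^ i" by (simp add: sgl_mon mult.assoc)
   qed
  qed
  finally show ?thesis .
 qed
 ultimately show ?thesis by blast
qed

lemma max_subset:
 assumes "finite B" "Y0 \<subseteq> B" "P Y0"
 shows "EX Y. Y0 \<subseteq> Y & Y \<subseteq> B & P Y & (ALL b:B - Y. ~ P (insert b Y))"
proof -
 let ?S = "{Y. Y0 \<subseteq> Y & Y \<subseteq> B & P Y}"
 have "finite ?S" by (rule finite_subset[of _ "Pow B"]) (use assms in auto)
 moreover have "?S ~= {}" using assms by blast
 ultimately obtain Y where Y: "Y : ?S" "!!Y'. Y' : ?S ==> Y \<subseteq> Y' ==> Y = Y'"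
  using finite_has_maximal[of ?S] by (metis (no_types, lifting))
 have "~ P (insert b Y)" if "b : B - Y" for b
 proof
  assume "P (insert b Y)"
  hence "insert b Y : ?S" using Y(1) that by blast
  hence "Y = insert b Y" using Y(2) by blast
  thus False using that by blast
 qed
 thus ?thesis using Y(1) by blast
qed

locale prime_modulus = zmodulus Q for Q +
 assumes prQ: "prm Q"
begin

text \<open>By maximality of V a variable outside V satisfies a nontrivial relation over A; its coefficients are
made nonzero modulo Q by truncating at the last coefficient outside Q.\<close>
lemma integral_eq:
 assumes kp: "kprime k" and kQ: "of_int k : Q" and ai: "AI k Q V" and fin: "finite V"
  and max: "l ~: V ==> ~ AI k Q (insert l V)"
 shows "EX n a s. n >= 1 & (ALL i<=n. a i : Pol V s) & a n ~: Q & a n * vr l ^ n - (\<Sum>i<n. a i * vr l ^ i) : Q"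
proof (cases "l : V")
 case True
 have "vr l : Pol V 1" by (rule vr_Pol) (use True in auto)
 thus ?thesis using prm_one[OF prQ]
  by (intro exI[of _ 1] exI[of _ "%i. if i = 0 then vr l else 1"])
    (auto simp: one_Pol subgrp_zero sg intro!: exI[of _ 1])
next
 case False
 from max[OF this] obtain s f where f: "f : Pol (insert l V) s" "f : Q" "~ kdv k f"
  unfolding AI_def by blast
 from split_var[OF f(1) fin False] obtain h where
  h: "!!i. h i : Pol V s" "f = (\<Sum>i\<le>s. h i * vr l ^ i)" by blast
 have ex: "EX i<=s. h i ~: Q"
 proof (rule ccontr)
  assume "~ (EX i<=s. h i ~: Q)"
  hence "kdv k (h i)" if "i <= s" for i using ai h(1) that unfolding AI_def by blast
  hence "kdv k (h i * vr l ^ i)" if "i <= s" for i using that kdv_mult[OF kp] by simp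
  hence "kdv k f" unfolding h(2) by (intro kdv_sum) simp
  thus False using f(3) by simp
 qed
 define n where "n = Max {i. i <= s & h i ~: Q}"
 have "n : {i. i <= s & h i ~: Q}" unfolding n_def by (rule Max_in) (use ex in auto)
 hence n: "n <= s" "h n ~: Q" by auto
 have hi: "h i : Q" if "n < i" "i <= s" for i
 proof (rule ccontr)
  assume "h i ~: Q"
  hence "i <= n" unfolding n_def using that(2) by (intro Max_ge) auto
  thus False using that(1) by simp
 qed
 have "{..s} = {..n} \<union> {n<..s}" using n(1) by auto
 hence "f = (\<Sum>i\<le>n. h i * vr l ^ i) + (\<Sum>i\<in>{n<..s}. h i * vr l ^ i)"
  unfolding h(2) using sum.union_disjoint[of "{..n}" "{n<..s}" "%i. h i * vr l ^ i"]
  by (simp add: disjoint_iff)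
 moreover have "(\<Sum>i\<in>{n<..s}. h i * vr l ^ i) : Q"
  by (intro subgrp_sum[OF sg] idl_mult2[OF idl] hi) auto
 ultimately have "(\<Sum>i\<le>n. h i * vr l ^ i) : Q"
  using f(2) subgrp_diff[OF sg, of f "(\<Sum>i\<in>{n<..s}. h i * vr l ^ i)"] by simp
 hence low: "(\<Sum>i<n. h i * vr l ^ i) + h n * vr l ^ n : Q"
  by (simp add: lessThan_Suc_atMost[symmetric])
 have "n >= 1"
 proof (rule ccontr)
  assume "~ n >= 1"
  hence "n = 0" by simp
  thus False using low n(2) by simp
 qed
 moreover define a where "a i = (if i = n then h n else - h i)" for i
 have "(\<Sum>i<n. a i * vr l ^ i) = - (\<Sum>i<n. h i * vr l ^ i)"
  unfolding sum_negf[symmetric] a_def by (intro sum.cong refl) auto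
 hence "a n * vr l ^ n - (\<Sum>i<n. a i * vr l ^ i) : Q" using low by (simp add: a_def add.commute)
 moreover have "a i : Pol V s" for i using h(1) Pol_minus by (simp add: a_def)
 moreover have "a n ~: Q" using n(2) by (simp add: a_def)
 ultimately show ?thesis by blast
qed

text \<open>B consists of monomials with exponents bounded by the degrees of the relations from integral_eq, and
c is the product of their leading coefficients.\<close>
lemma data_B:
 assumes kp: "kprime k" and kQ: "of_int k : Q" and ai: "AI k Q V" and V: "V \<subseteq> {..<M}"
  and max: "!!l. l < M ==> l ~: V ==> ~ AI k Q (insert l V)"
 shows "EX c B \<kappa>. spanned Q M V c B \<kappa> & c ~: Q & B \<subseteq> Pol {..<M} \<kappa>"
proof -
 have fin: "finite V" using V finite_subset by blast
 let ?P = "%l n a s. n >= 1 & (ALL i<=n. a i : Pol V s) & a n ~: Q & a n * vr l ^ n - (\<Sum>i<n. a i * vr l ^ i) : Q"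
 have "ALL l:{..<M}. EX n a s. ?P l n a s"
  using integral_eq[OF kp kQ ai fin] max by blast
 from bchoice[OF this] obtain n where "ALL l:{..<M}. EX a s. ?P l (n l) a s" ..
 from bchoice[OF this] obtain a where "ALL l:{..<M}. EX s. ?P l (n l) (a l) s" ..
 from bchoice[OF this] obtain s where P: "ALL l:{..<M}. ?P l (n l) (a l) (s l)" ..
 have n: "!!l. l < M ==> n l >= (1::nat)"
  and a: "!!l i. l < M ==> i <= n l ==> a l i : Pol V (s l)"
  and an: "!!l. l < M ==> a l (n l) ~: Q"
  and rel: "!!l. l < M ==> a l (n l) * vr l ^ n l - (\<Sum>i<n l. a l i * vr l ^ i) : Q"
  using P by blast+
 define c where "c = (\<Prod>l<M. a l (n l))"
 define E where "E = {m. ks m \<subseteq> {..<M} & (ALL l<M. lk m l < n l)}"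
 define N where "N = (\<Sum>l<M. n l)"
 define S where "S = (\<Sum>l<M. s l)"
 have E: "E \<subseteq> Mon {..<M} N"
 proof
  fix m assume m: "m : E"
  have "lk m i <= N" for i
  proof (cases "i < M")
   case True
   have "n i <= N" unfolding N_def by (rule member_le_sum) (use True in auto)
   thus ?thesis using m True unfolding E_def by (auto intro: order_trans less_imp_le)
  next
   case False
   hence "i ~: ks m" using m unfolding E_def by auto
   thus ?thesis by (simp add: lk_notin)
  qed
  thus "m : Mon {..<M} N" using m unfolding E_def Mon_def by blast
 qed
 have finE: "finite E" using finite_subset[OF E] finite_Mon by blast
 have cPol: "c : Pol V S" unfolding c_def S_def by (rule Pol_prod) (auto intro: a)
 have c': "EX c':Pol V S. c = c' * a l (n l)" if "l < M" for l
 proof -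
  have "c = (\<Prod>i\<in>{..<M}-{l}. a i (n i)) * a l (n l)"
   unfolding c_def using that by (simp add: prod.remove[of "{..<M}" l] mult.commute)
  moreover have "(\<Prod>i\<in>{..<M}-{l}. a i (n i)) : Pol V (\<Sum>i\<in>{..<M}-{l}. s i)"
   by (rule Pol_prod) (auto intro: a)
  moreover have "(\<Sum>i\<in>{..<M}-{l}. s i) <= S" unfolding S_def by (rule sum_mono2) auto
  ultimately show ?thesis using Pol_mono' by blast
 qed
 have cQ: "c ~: Q" unfolding c_def by (subst prm_prod) (use prQ an in auto)
 define \<kappa> where "\<kappa> = N + 2 * S"
 have "spanned Q M V c (mon ` E) \<kappa>"
 proof
  show "finite (mon ` E)" using finE by simp
  have "0 : E" using n unfolding E_def by (auto simp: Suc_le_eq)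
  thus "1 : mon ` E" using mon_0 by force
  show "c : Pol V \<kappa>" by (rule Pol_mono'[OF cPol]) (simp add: \<kappa>_def)
  fix l b assume l: "l < M" and "b : mon ` E"
  then obtain m where m: "m : E" "b = mon m" by blast
  show "c * vr l * b : spn Q V \<kappa> (mon ` E)"
  proof (cases "lk m l + 1 < n l")
   case True
   have "m + sgl l 1 : E"
    using m(1) True l keys_add[of m "sgl l (1::nat)"] unfolding E_def
    by (auto simp: lookup_add lookup_single when_def)
   hence "mon (m + sgl l 1) : mon ` E" by blast
   hence "c * mon (m + sgl l 1) : spn Q V S (mon ` E)" using finE cPol by (intro spn_single) auto
   hence "c * mon (m + sgl l 1) : spn Q V \<kappa> (mon ` E)" by (rule spn_mono') (simp add: \<kappa>_def)
   thus ?thesis by (simp add: m(2) mon_add vr_def ac_simps)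
  next
   case False
   hence nl: "lk m l + 1 = n l" using m(1) l unfolding E_def by (auto simp: not_less Suc_le_eq le_Suc_eq)
   define m0 where "m0 = pm (lk m) ({..<M} - {l})"
   have ml: "m = m0 + sgl l (lk m l)"
   proof (rule poly_mapping_eqI)
    fix k
    have "lk m k = 0" if "k ~: {..<M}" using m(1) that unfolding E_def by (intro lk_notin) auto
    thus "lk m k = lk (m0 + sgl l (lk m l)) k"
     by (auto simp: m0_def lookup_add lk_pm lookup_single when_def)
   qed
   obtain c' where c': "c' : Pol V S" "c = c' * a l (n l)" using c'[OF l] by blast
   have "c * vr l * b = c' * mon m0 * (a l (n l) * (vr l ^ lk m l * vr l))"
    unfolding m(2) c'(2) by (subst ml) (simp add: mon_add vr_pow algebra_simps)
   also have "vr l ^ lk m l * vr l = vr l ^ n l" unfolding nl[symmetric] by simp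
   also have "c' * mon m0 * (a l (n l) * vr l ^ n l) \<asymp> c' * mon m0 * (\<Sum>i<n l. a l i * vr l ^ i)"
    by (intro cg_mult cg_refl) (simp add: cg_def rel[OF l])
   also have "... = (\<Sum>i<n l. c' * a l i * mon (m0 + sgl l i))"
    unfolding sum_distrib_left by (intro sum.cong refl) (simp add: mon_add vr_pow algebra_simps)
   finally have eq: "c * vr l * b \<asymp> (\<Sum>i<n l. c' * a l i * mon (m0 + sgl l i))" .
   have "(\<Sum>i<n l. c' * a l i * mon (m0 + sgl l i)) : spn Q V \<kappa> (mon ` E)"
   proof (rule spn_sum)
    fix i assume i: "i : {..<n l}"
    have "m0 + sgl l i : E"
     using m(1) i l keys_add[of m0 "sgl l i"] unfolding E_def
     by (auto simp: lookup_add lookup_single when_def m0_def lk_pm ks_pm split: if_splits)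
    hence mem: "mon (m0 + sgl l i) : mon ` E" by blast
    have "s l <= S" unfolding S_def by (rule member_le_sum) (use l in auto)
    hence "c' * a l i : Pol V \<kappa>" using i
     by (intro Pol_mult'[OF c'(1) a[OF l, of i]]) (auto simp: \<kappa>_def)
    thus "c' * a l i * mon (m0 + sgl l i) : spn Q V \<kappa> (mon ` E)"
     using finE mem by (intro spn_single) auto
   qed
   thus ?thesis by (rule spn_cg[OF eq])
  qed
 qed
 moreover have "mon ` E \<subseteq> Pol {..<M} \<kappa>"
 proof
  fix b assume "b : mon ` E"
  hence "b : Pol {..<M} N" using E mon_Pol by blast
  thus "b : Pol {..<M} \<kappa>" by (rule Pol_mono') (simp add: \<kappa>_def)
 qed
 ultimately show ?thesis using cQ by blast
qed

text \<open>Adjoining b to the maximal family Y gives a relation in which b has a coefficient outside Q; g is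
the product of these coefficients.\<close>
lemma ind_max_span:
 assumes fin: "finite B" and Y: "Y \<subseteq> B" "ind Q V (%x. x) Y u" and max: "!!b. b : B - Y ==> ~ ind Q V (%x. x) (insert b Y) u"
 shows "EX g s. g : Pol V s & g ~: Q & (ALL b:B. EX \<alpha>. (ALL y:Y. \<alpha> y : Pol V s) & g * u b - (\<Sum>y\<in>Y. \<alpha> y * u y) : Q)"
proof -
 have finY: "finite Y" using Y(1) fin finite_subset by blast
 let ?P = "%b g s \<alpha>. g : Pol V s & g ~: Q & (ALL y:Y. \<alpha> y : Pol V s) & g * u b - (\<Sum>y\<in>Y. \<alpha> y * u y) : Q"
 have one: "EX g s \<alpha>. ?P b g s \<alpha>"
  if b: "b : B" for b
 proof (cases "b : Y")
  case True
  have "(\<Sum>y\<in>Y. (if y = b then 1 else 0) * u y) = (\<Sum>y\<in>Y. if y = b then u y else 0)"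
   by (rule sum.cong) simp_all
  also have "... = u b" using True finY by (simp add: sum.delta)
  finally have "1 * u b - (\<Sum>y\<in>Y. (if y = b then 1 else 0) * u y) : Q" by (simp add: subgrp_zero sg)
  moreover have "ALL y:Y. (if y = b then 1 else 0) : Pol V 0" by (simp add: one_Pol zero_Pol)
  ultimately have "?P b 1 0 (%y. if y = b then 1 else 0)"
   using prm_one[OF prQ] one_Pol[of V 0] by (intro conjI)
  thus ?thesis by (intro exI)
 next
  case False
  with b max have "~ ind Q V (%x. x) (insert b Y) u" by blast
  then obtain s \<beta> where \<beta>: "ALL i:insert b Y. \<beta> i : Pol V s" "(\<Sum>i\<in>insert b Y. \<beta> i * u i) : Q"
   "~ (ALL i:insert b Y. \<beta> i : Q)" unfolding ind_def by blast
  have sum: "\<beta> b * u b + (\<Sum>i\<in>Y. \<beta> i * u i) : Q" using \<beta>(2) False finY by simp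
  have "\<beta> b ~: Q"
  proof
   assume bq: "\<beta> b : Q"
   hence "\<beta> b * u b : Q" by (rule idl_mult2[OF idl])
   hence "(\<Sum>i\<in>Y. \<beta> i * u i) : Q" using sum subgrp_add_iff[OF sg] by blast
   hence "\<beta> i : Q" if "i : Y" for i using indD[OF Y(2), of \<beta> s i] \<beta>(1) that by blast
   thus False using \<beta>(3) bq by blast
  qed
  moreover have "\<beta> b * u b - (\<Sum>i\<in>Y. - \<beta> i * u i) : Q" using sum by (simp add: sum_negf)
  moreover have "ALL y:Y. - \<beta> y : Pol V s" using \<beta>(1) Pol_minus by blast
  ultimately have "?P b (\<beta> b) s (%y. - \<beta> y)" using \<beta>(1) by (intro conjI) simp_all
  thus ?thesis by (intro exI)
 qed
 hence "ALL b:B. EX g s \<alpha>. ?P b g s \<alpha>" by blast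
 from bchoice[OF this] obtain g where "ALL b:B. EX s \<alpha>. ?P b (g b) s \<alpha>" ..
 from bchoice[OF this] obtain s where "ALL b:B. EX \<alpha>. ?P b (g b) (s b) \<alpha>" ..
 from bchoice[OF this] obtain \<alpha> where P: "ALL b:B. ?P b (g b) (s b) (\<alpha> b)" ..
 have g: "!!b. b : B ==> g b : Pol V (s b)" "!!b. b : B ==> g b ~: Q"
  and \<alpha>: "!!b y. b : B ==> y : Y ==> \<alpha> b y : Pol V (s b)"
  "!!b. b : B ==> g b * u b - (\<Sum>y\<in>Y. \<alpha> b y * u y) : Q" using P by blast+
 define G where "G = (\<Prod>b\<in>B. g b)"
 define S where "S = (\<Sum>b\<in>B. s b)"
 have "G : Pol V S" unfolding G_def S_def by (rule Pol_prod[OF fin g(1)])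
 hence "G : Pol V (2 * S)" by (rule Pol_mono') simp
 moreover have "G ~: Q" unfolding G_def by (subst prm_prod[OF fin prQ]) (use g(2) in blast)
 moreover have "EX \<alpha>. (ALL y:Y. \<alpha> y : Pol V (2 * S)) & G * u b - (\<Sum>y\<in>Y. \<alpha> y * u y) : Q" if b: "b : B" for b
 proof -
  define G' where "G' = (\<Prod>b'\<in>B-{b}. g b')"
  have GG: "G = G' * g b" unfolding G_def G'_def using prod.remove[OF fin b, of g] by (simp add: mult.commute)
  have "G' : Pol V (\<Sum>b'\<in>B-{b}. s b')" unfolding G'_def by (rule Pol_prod) (use fin g(1) in auto)
  moreover have "(\<Sum>b'\<in>B-{b}. s b') <= S" unfolding S_def by (rule sum_mono2) (use fin in auto)
  ultimately have G': "G' : Pol V S" by (rule Pol_mono')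
  have sS: "s b <= S" unfolding S_def by (rule member_le_sum) (use fin b in auto)
  have "G' * (g b * u b - (\<Sum>y\<in>Y. \<alpha> b y * u y)) : Q" by (rule idl_mult[OF idl \<alpha>(2)[OF b]])
  hence "G * u b - (\<Sum>y\<in>Y. (G' * \<alpha> b y) * u y) : Q"
   by (simp add: GG right_diff_distrib sum_distrib_left mult.assoc)
  moreover have "ALL y:Y. G' * \<alpha> b y : Pol V (2 * S)"
   using Pol_mult'[OF G' \<alpha>(1)[OF b]] sS by simp
  ultimately show ?thesis by (intro exI[of _ "%y. G' * \<alpha> b y"] conjI)
 qed
 ultimately show ?thesis by blast
qed

lemma data_Y:
 assumes "finite B" "1 : B"
 shows "EX Y g s. Y \<subseteq> B & 1 : Y & ind Q V (%x. x) Y (%x. x) & g : Pol V s & g ~: Q & (ALL b:B. g * b : spn Q V s Y)"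
proof -
 have "ind Q V (%x. x) {1} (%x. x)" unfolding ind_def by auto
 from max_subset[OF assms(1), of "{1}" "%Y. ind Q V (%x. x) Y (%x. x)"] this assms(2)
 obtain Y where Y: "{1} \<subseteq> Y" "Y \<subseteq> B" "ind Q V (%x. x) Y (%x. x)"
  "!!b. b : B - Y ==> ~ ind Q V (%x. x) (insert b Y) (%x. x)" by auto
 from ind_max_span[OF assms(1) Y(2-4)] obtain g s where "g : Pol V s" "g ~: Q"
  "ALL b:B. EX \<alpha>. (ALL y:Y. \<alpha> y : Pol V s) & g * b - (\<Sum>y\<in>Y. \<alpha> y * y) : Q" by auto
 thus ?thesis using Y unfolding spn_def by blast
qed

end

context modulus
begin

text \<open>Maps compatible with the ring operations modulo Q. The identity and the Frobenius map are the two
instances, and the counting lemmas are proved for both at once.\<close>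
definition homQ :: "('w => 'w) => bool" where
 "homQ F \<longleftrightarrow> (ALL a b. F (a - b) \<asymp> F a - F b) & (ALL a b. F (a * b) \<asymp> F a * F b) & (ALL a:Q. F a : Q)"

lemma homQ_id: "homQ (%x. x)" by (simp add: homQ_def)

lemma homQ_zero: "homQ F ==> F 0 \<asymp> 0"
 unfolding homQ_def cg_zero using subgrp_zero[OF sg] by blast

lemma homQ_add: assumes "homQ F" shows "F (a + b) \<asymp> F a + F b"
proof -
 have "F (a + b) = F (a - (0 - b))" by simp
 also have "... \<asymp> F a - F (0 - b)" using assms unfolding homQ_def by blast
 also have "... \<asymp> F a - (F 0 - F b)" using assms unfolding homQ_def by (intro cg_diff cg_refl) blast
 also have "... \<asymp> F a - (0 - F b)" by (intro cg_diff cg_refl homQ_zero[OF assms])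
 finally show ?thesis by simp
qed

lemma homQ_sum: assumes "homQ F" shows "F (\<Sum>i\<in>I. f i) \<asymp> (\<Sum>i\<in>I. F (f i))"
proof (induction I rule: infinite_finite_induct)
 case (insert x A)
 have "F (\<Sum>i\<in>insert x A. f i) \<asymp> F (f x) + F (\<Sum>i\<in>A. f i)" using insert homQ_add[OF assms] by simp
 also have "... \<asymp> F (f x) + (\<Sum>i\<in>A. F (f i))" by (intro cg_add cg_refl insert)
 finally show ?case using insert by simp
qed (simp_all add: homQ_zero[OF assms])

end

lemma (in char_modulus) homQ_frob: "homQ (%x. x ^ p)"
 unfolding homQ_def using frob_diff frob_mem by (simp add: power_mult_distrib)

text \<open>(1 + t/K)^d tends to 1.\<close>
lemma dvd_pow_growth:
 fixes n1 n2 d t :: nat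
 assumes "n2 < n1"
 shows "EX K>0. n2 * (K + t) ^ d < n1 * K ^ d"
proof -
 have "((%K. (1 + real t / real K) ^ d) \<longlonglongrightarrow> (1 + 0) ^ d)"
  by (intro tendsto_intros lim_const_over_n)
 moreover have "real n1 / (real n2 + 1/2) > (1 + 0 :: real) ^ d" using assms by simp
 ultimately have "eventually (%K. (1 + real t / real K) ^ d < real n1 / (real n2 + 1/2)) sequentially"
  by (rule order_tendstoD(2))
 hence "eventually (%K. K > 0 & (1 + real t / real K) ^ d < real n1 / (real n2 + 1/2)) sequentially"
  by (rule eventually_conj[OF eventually_gt_at_top])
 then obtain K :: nat where K: "K > 0" "(1 + real t / real K) ^ d < real n1 / (real n2 + 1/2)"
  unfolding eventually_sequentially by blast
 have "(real K + real t) ^ d = (1 + real t / real K) ^ d * real K ^ d"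
  using K(1) by (simp add: power_mult_distrib[symmetric] field_simps)
 hence "real n2 * (real K + real t) ^ d <= (real n2 + 1/2) * ((1 + real t / real K) ^ d * real K ^ d)"
  by (simp add: mult_right_mono)
 also have "... = ((real n2 + 1/2) * (1 + real t / real K) ^ d) * real K ^ d" by simp
 also have "... < real n1 * real K ^ d"
  by (rule mult_strict_right_mono) (use K in \<open>simp_all add: field_simps\<close>)
 finally have "real (n2 * (K + t) ^ d) < real (n1 * K ^ d)" by simp
 hence "n2 * (K + t) ^ d < n1 * K ^ d" by (simp only: of_nat_less_iff)
 thus ?thesis using K(1) by blast
qed

lemma siegel_scale:
 fixes n1 n2 d t K p :: nat
 assumes "n2 * (K + t) ^ d < n1 * K ^ d" "K > 0"
 shows "n2 * (K * p + t * p + 1) ^ d < n1 * (K * p + 1) ^ d"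
proof -
 have "(K * p + t * p + 1) * K <= (K * p + 1) * (K + t)" by (simp add: algebra_simps)
 hence "((K * p + t * p + 1) * K) ^ d <= ((K * p + 1) * (K + t)) ^ d" by (rule power_mono) simp
 hence "(K * p + t * p + 1) ^ d * K ^ d <= (K * p + 1) ^ d * (K + t) ^ d"
  by (simp only: power_mult_distrib)
 hence "n2 * ((K * p + t * p + 1) ^ d * K ^ d) <= n2 * ((K * p + 1) ^ d * (K + t) ^ d)"
  by (rule mult_left_mono) simp
 hence "n2 * (K * p + t * p + 1) ^ d * K ^ d <= n2 * (K + t) ^ d * (K * p + 1) ^ d"
  by (simp only: ac_simps)
 also have "... < n1 * K ^ d * (K * p + 1) ^ d" using assms(1) by (intro mult_strict_right_mono) simp_all
 finally have "(n2 * (K * p + t * p + 1) ^ d) * K ^ d < (n1 * (K * p + 1) ^ d) * K ^ d"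
  by (simp only: ac_simps)
 thus ?thesis by (rule mult_right_less_imp_less) simp
qed

text \<open>V is a transcendence basis, c and B come from data_B, and Y is a maximal independent subset of B
with denominator g. The conditions on V over the integers or modulo p are added in the two
extensions of this locale.\<close>
locale frame = prime_modulus Q + spanned Q M V c B \<kappa> for Q M V c B \<kappa> +
 fixes g :: zpol and Y :: "zpol set"
 assumes VM: "V \<subseteq> {..<M}"
  and gen: "!!w. EX s. EX f:Pol {..<M} s. w - f : Q"
  and cQ: "c ~: Q" and gQ: "g ~: Q" and gPol: "g : Pol V \<kappa>"
  and Bpol: "B \<subseteq> Pol {..<M} \<kappa>"
  and YB: "Y \<subseteq> B" and oneY: "1 : Y" and indY: "ind Q V (%x. x) Y (%x. x)"
  and gspan: "!!b. b : B ==> g * b : spn Q V \<kappa> Y"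
begin

lemma finV: "finite V" using VM finite_subset by blast
lemma finY: "finite Y" using YB finB finite_subset by blast

end

text \<open>A frame in characteristic p. The rank card Y of W over A is required to be less than p; free_W uses
this.\<close>
locale red = frame Q M V c B \<kappa> g Y + char_modulus Q p for Q p M V c B \<kappa> g Y +
 assumes ai: "AI (int p) Q V" and rp: "card Y < p"
begin

lemma kdv_Q: "kdv (int p) f ==> f : Q"
 using kdv_factor[of "int p" f] p_mult by auto

lemma Pol_Q: "f : Pol V s ==> f : Q \<longleftrightarrow> kdv (int p) f"
 using ai kdv_Q unfolding AI_def by blast

lemma coset_Pol_image:
 assumes "w : Pol U s" "finite U"
 shows "EX r:Rep p U s. w \<asymp> r"
proof -
 from Rep_ex[OF assms(2) p_gt(2) assms(1)] obtain r x where "r : Rep p U s" "w - r = of_nat p * x" by blast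
 moreover from this have "w - r : Q" using p_mult[of x] by simp
 ultimately show ?thesis unfolding cg_def by blast
qed

text \<open>A combination is determined modulo Q by the reductions of its coefficients modulo p.\<close>
lemma card_comb:
 assumes "finite J" "homQ F"
  and "!!w. w : T ==> EX \<theta>. (ALL j:J. \<theta> j : Pol V s) & h w \<asymp> (\<Sum>j\<in>J. F (\<theta> j) * v j)"
 shows "finite ((%w. coset Q (h w)) ` T)" 
  "card ((%w. coset Q (h w)) ` T) <= p ^ (card J * (s + 1) ^ card V)"
proof -
 let ?E = "PiE J (%_. Rep p V s)"
 let ?H = "%\<theta>. coset Q (\<Sum>j\<in>J. F (\<theta> j) * v j)"
 have finE: "finite ?E" by (intro finite_PiE assms finite_Rep finV p_gt)
 have sub: "(%w. coset Q (h w)) ` T \<subseteq> ?H ` ?E"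
 proof (rule image_subsetI)
  fix w assume "w : T"
  from assms(3)[OF this] obtain \<theta> where th: "ALL j:J. \<theta> j : Pol V s" "h w \<asymp> (\<Sum>j\<in>J. F (\<theta> j) * v j)" by blast
  have "ALL j:J. EX r. r : Rep p V s & \<theta> j \<asymp> r" using coset_Pol_image[OF _ finV] th(1) by blast
  from bchoice[OF this] obtain r where r: "ALL j:J. r j : Rep p V s & \<theta> j \<asymp> r j" ..
  have "F (\<theta> j) \<asymp> F (r j)" if "j : J" for j
  proof -
   have "F (\<theta> j - r j) : Q" using assms(2) r that unfolding homQ_def cg_def by blast
   moreover have "F (\<theta> j - r j) \<asymp> F (\<theta> j) - F (r j)" using assms(2) unfolding homQ_def by blast
   ultimately have "F (\<theta> j) - F (r j) : Q" using cg_mem by blast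
   thus ?thesis by (simp add: cg_def)
  qed
  hence "(\<Sum>j\<in>J. F (\<theta> j) * v j) \<asymp> (\<Sum>j\<in>J. F (restrict r J j) * v j)"
   by (intro cg_sum cg_mult cg_refl) simp
  from cg_trans[OF th(2) this] have "coset Q (h w) = ?H (restrict r J)" by (simp add: cg_coset)
  moreover have "restrict r J : ?E" using r by simp
  ultimately show "coset Q (h w) : ?H ` ?E" by blast
 qed
 show "finite ((%w. coset Q (h w)) ` T)" using finite_subset[OF sub] finE by blast
 have "card ((%w. coset Q (h w)) ` T) <= card (?H ` ?E)" by (rule card_mono[OF _ sub]) (use finE in simp)
 also have "... <= card ?E" by (rule card_image_le[OF finE])
 also have "... = p ^ (card J * (s + 1) ^ card V)"
  using assms(1) by (simp add: card_PiE card_Rep[OF finV p_gt(2)] power_mult[symmetric] mult.commute)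
 finally show "card ((%w. coset Q (h w)) ` T) <= p ^ (card J * (s + 1) ^ card V)" .
qed

text \<open>Pigeonhole: by assumption there are more families of coefficients of exponent at most s than values
that the combinations of the u i can take after multiplication by w.\<close>
lemma siegel:
 assumes fin: "finite I" "finite J" and F: "homQ F" and w: "w ~: Q"
  and rel: "!!i. i : I ==> EX \<eta>. (ALL j:J. \<eta> j : Pol V t) & w * u i \<asymp> (\<Sum>j\<in>J. F (\<eta> j) * v j)"
  and num: "card J * (s + t + 1) ^ card V < card I * (s + 1) ^ card V"
 shows "EX \<beta>. (ALL i:I. \<beta> i : Pol V s) & (EX i:I. \<beta> i ~: Q) & (\<Sum>i\<in>I. F (\<beta> i) * u i) : Q"
proof -
 let ?D = "PiE I (%_. Rep p V s)"
 let ?h = "%\<beta>. w * (\<Sum>i\<in>I. F (\<beta> i) * u i)"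
 have "ALL i:I. EX \<eta>. (ALL j:J. \<eta> j : Pol V t) & w * u i \<asymp> (\<Sum>j\<in>J. F (\<eta> j) * v j)" using rel by blast
 from bchoice[OF this] obtain \<eta> where eta:
  "ALL i:I. (ALL j:J. \<eta> i j : Pol V t) & w * u i \<asymp> (\<Sum>j\<in>J. F (\<eta> i j) * v j)" ..
 have h: "EX \<theta>. (ALL j:J. \<theta> j : Pol V (s + t)) & ?h \<beta> \<asymp> (\<Sum>j\<in>J. F (\<theta> j) * v j)" if "\<beta> : ?D" for \<beta>
 proof (intro exI conjI ballI)
  have \<beta>: "\<beta> i : Pol V s" if "i : I" for i
   using PiE_mem[OF \<open>\<beta> : ?D\<close> that] by (simp add: Rep_def)
  fix j assume "j : J"
  thus "(\<Sum>i\<in>I. \<beta> i * \<eta> i j) : Pol V (s + t)" using \<beta> eta by (intro Pol_sum Pol_mult) auto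
 next
  have "?h \<beta> = (\<Sum>i\<in>I. F (\<beta> i) * (w * u i))"
   unfolding sum_distrib_left by (intro sum.cong refl) (simp add: ac_simps)
  also have "... \<asymp> (\<Sum>i\<in>I. F (\<beta> i) * (\<Sum>j\<in>J. F (\<eta> i j) * v j))"
   using eta by (intro cg_sum cg_mult cg_refl) blast
  also have "... = (\<Sum>i\<in>I. \<Sum>j\<in>J. (F (\<beta> i) * F (\<eta> i j)) * v j)"
   unfolding sum_distrib_left by (intro sum.cong refl) (simp add: ac_simps)
  also have "... = (\<Sum>j\<in>J. \<Sum>i\<in>I. (F (\<beta> i) * F (\<eta> i j)) * v j)" by (rule sum.swap)
  also have "... = (\<Sum>j\<in>J. (\<Sum>i\<in>I. F (\<beta> i) * F (\<eta> i j)) * v j)"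
   by (simp add: sum_distrib_right)
  also have "... \<asymp> (\<Sum>j\<in>J. F (\<Sum>i\<in>I. \<beta> i * \<eta> i j) * v j)"
  proof (intro cg_sum cg_mult cg_refl)
   fix j
   have "(\<Sum>i\<in>I. F (\<beta> i) * F (\<eta> i j)) \<asymp> (\<Sum>i\<in>I. F (\<beta> i * \<eta> i j))"
   proof (rule cg_sum)
    fix i
    have "F (\<beta> i * \<eta> i j) \<asymp> F (\<beta> i) * F (\<eta> i j)" using F unfolding homQ_def by blast
    thus "F (\<beta> i) * F (\<eta> i j) \<asymp> F (\<beta> i * \<eta> i j)" by (rule cg_sym)
   qed
   also have "... \<asymp> F (\<Sum>i\<in>I. \<beta> i * \<eta> i j)" by (rule cg_sym[OF homQ_sum[OF F]])
   finally show "(\<Sum>i\<in>I. F (\<beta> i) * F (\<eta> i j)) \<asymp> F (\<Sum>i\<in>I. \<beta> i * \<eta> i j)" .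
  qed
  finally show "?h \<beta> \<asymp> (\<Sum>j\<in>J. F (\<Sum>i\<in>I. \<beta> i * \<eta> i j) * v j)" .
 qed
 have "card ((%\<beta>. coset Q (?h \<beta>)) ` ?D) <= p ^ (card J * (s + t + 1) ^ card V)"
  by (rule card_comb(2)[OF fin(2) F h])
 also have "... < p ^ (card I * (s + 1) ^ card V)" by (rule power_strict_increasing[OF num p_gt(1)])
 also have "... = card ?D"
  using fin(1) by (simp add: card_PiE card_Rep[OF finV p_gt(2)] power_mult[symmetric] mult.commute)
 finally have "~ inj_on (%\<beta>. coset Q (?h \<beta>)) ?D" using card_image by fastforce
 then obtain \<beta> \<beta>' where bb: "\<beta> : ?D" "\<beta>' : ?D" "coset Q (?h \<beta>) = coset Q (?h \<beta>')" "\<beta> ~= \<beta>'"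
  unfolding inj_on_def by blast
 have mem: "\<beta> i : Rep p V s" "\<beta>' i : Rep p V s" if "i : I" for i
  using bb(1,2) that by (auto dest: PiE_mem)
 have "?h \<beta> \<asymp> ?h \<beta>'" using bb(3) by (simp add: cg_coset)
 hence "w * ((\<Sum>i\<in>I. F (\<beta> i) * u i) - (\<Sum>i\<in>I. F (\<beta>' i) * u i)) : Q"
  by (simp add: cg_def right_diff_distrib)
 hence d: "(\<Sum>i\<in>I. F (\<beta> i) * u i) - (\<Sum>i\<in>I. F (\<beta>' i) * u i) : Q" using prm_mult[OF prQ] w by blast
 have "(\<Sum>i\<in>I. F (\<beta> i - \<beta>' i) * u i) \<asymp> (\<Sum>i\<in>I. (F (\<beta> i) - F (\<beta>' i)) * u i)"
  using F unfolding homQ_def by (intro cg_sum cg_mult cg_refl) blast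
 also have "... = (\<Sum>i\<in>I. F (\<beta> i) * u i) - (\<Sum>i\<in>I. F (\<beta>' i) * u i)"
  by (simp add: left_diff_distrib sum_subtractf)
 finally have "(\<Sum>i\<in>I. F (\<beta> i - \<beta>' i) * u i) : Q" using d cg_mem by blast
 moreover have "ALL i:I. \<beta> i - \<beta>' i : Pol V s" using mem Pol_diff unfolding Rep_def by blast
 moreover have "EX i:I. \<beta> i - \<beta>' i ~: Q"
 proof (rule ccontr)
  assume "~ (EX i:I. \<beta> i - \<beta>' i ~: Q)"
  hence "\<beta> i = \<beta>' i" if "i : I" for i
   using that mem[OF that] Rep_inj[of "\<beta> i" p V s "\<beta>' i"] Pol_Q[of "\<beta> i - \<beta>' i" s] 
    Pol_diff[of "\<beta> i" V s "\<beta>' i"] unfolding Rep_def by blast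
  hence "\<beta> = \<beta>'" using bb(1,2) by (intro PiE_ext) auto
  thus False using bb(4) by simp
 qed
 ultimately show ?thesis by (intro exI[of _ "%i. \<beta> i - \<beta>' i"] conjI)
qed

text \<open>For s large the hypothesis of siegel holds as soon as card J < card I.\<close>
lemma exchange:
 assumes fin: "finite I" "finite J" and F: "homQ F" and w: "w ~: Q"
  and rel: "!!i. i : I ==> EX \<eta>. (ALL j:J. \<eta> j : Pol V t) & w * u i \<asymp> (\<Sum>j\<in>J. F (\<eta> j) * v j)"
  and ind: "ind Q V F I u"
 shows "card I <= card J"
proof (rule ccontr)
 assume "~ card I <= card J"
 hence "card J < card I" by simp
 from dvd_pow_growth[OF this, of t "card V"] obtain K where
  K: "K > 0" "card J * (K + t) ^ card V < card I * K ^ card V" by blast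
 have "K - 1 + t + 1 = K + t" "K - 1 + 1 = K" using K(1) by auto
 hence "card J * (K - 1 + t + 1) ^ card V < card I * (K - 1 + 1) ^ card V" using K(2) by (simp only:)
 note num = this
 have "EX \<beta>. (ALL i:I. \<beta> i : Pol V (K - 1)) & (EX i:I. \<beta> i ~: Q) & (\<Sum>i\<in>I. F (\<beta> i) * u i) : Q"
  by (rule siegel[OF fin F w rel num])
 thus False using ind unfolding ind_def by blast
qed

abbreviation (input) E where "E \<equiv> Mon V (p - 1)"

abbreviation "frc h \<equiv> (\<Sum>a\<in>E. mon a * h a ^ p)"
lemma finE: "finite E" by (rule finite_Mon[OF finV])
lemma cardE: "card E = p ^ card V" using card_Mon[OF finV, of "p - 1"] p_gt by simp

lemma E_small: "a : E ==> lk a i < p"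
 using p_gt unfolding Mon_def by (auto simp: le_Suc_eq less_Suc_eq_le Suc_le_eq intro: le_less_trans)

lemma kp: "kprime (int p)" by (rule kprime_prime[OF pp])

lemma lmk_pow: "~ kdv (int p) f ==> ~ kdv (int p) (f ^ n) & (ALL i. lk (lmk (int p) (f ^ n)) i = n * lk (lmk (int p) f) i)"
proof (induction n)
 case 0
 have n1: "~ kdv (int p) 1" using pp unfolding kdv_def by (auto intro!: exI[of _ 0] simp: lookup_one)
 have "lmk (int p) 1 = 0"
 proof (rule ccontr)
  assume "lmk (int p) 1 ~= 0"
  hence "lk (1::zpol) (lmk (int p) 1) = 0" by (simp add: lookup_one)
  thus False using lmk(1)[OF n1] by simp
 qed
 thus ?case using n1 by simp
next
 case (Suc n)
 thus ?case using lmk_mult[OF kp, of f "f ^ n"] by (simp add: lookup_add)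
qed

text \<open>The summands have different leading monomials, because exponents in E are the remainders modulo p.\<close>
lemma A_free:
 assumes "!!a. a : E ==> \<beta> a : Pol V s" "(frc \<beta>) : Q" "a : E"
 shows "\<beta> a : Q"
proof (rule ccontr)
 assume "\<beta> a ~: Q"
 let ?k = "int p"
 let ?S = "{a : E. ~ kdv ?k (\<beta> a)}"
 have ne: "?S ~= {}" using assms(3) \<open>\<beta> a ~: Q\<close> kdv_Q by blast
 let ?f = "%a. mon a * \<beta> a ^ p"
 have nm: "~ kdv ?k (mon a)" for a using pp unfolding kdv_def mon_def by (auto intro!: exI[of _ a])
 have lmon: "lmk ?k (mon a) = a" for a
 proof (rule ccontr)
  assume "lmk ?k (mon a) ~= a"
  hence "lk (mon a) (lmk ?k (mon a)) = 0" by (simp add: mon_def lookup_single)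
  thus False using lmk(1)[OF nm[of a]] by simp
 qed
 have f: "~ kdv ?k (?f a)" "lk (lmk ?k (?f a)) i = lk a i + p * lk (lmk ?k (\<beta> a)) i" if "a : ?S" for a i
  using lmk_mult[OF kp nm, of "\<beta> a ^ p" a] lmk_pow[of "\<beta> a" p] that lmon by (auto simp: lookup_add)
 have inj: "a = a'" if "a : ?S" "a' : ?S" "lmk ?k (?f a) = lmk ?k (?f a')" for a a'
 proof (rule poly_mapping_eqI)
  fix i
  have "lk a i + p * lk (lmk ?k (\<beta> a)) i = lk a' i + p * lk (lmk ?k (\<beta> a')) i"
   using f(2)[OF that(1), of i] f(2)[OF that(2), of i] that(3) by simp
  hence "(lk a i + p * lk (lmk ?k (\<beta> a)) i) mod p = (lk a' i + p * lk (lmk ?k (\<beta> a')) i) mod p" by simp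
  thus "lk a i = lk a' i" using E_small[of a i] E_small[of a' i] that(1,2) by simp
 qed
 have finS: "finite ?S" using finE by simp
 let ?L = "(%a. lmk ?k (?f a)) ` ?S"
 have "Max ?L : ?L" by (rule Max_in) (use finS ne in auto)
 then obtain a0 where a0: "a0 : ?S" "Max ?L = lmk ?k (?f a0)" by blast
 define M0 where "M0 = lmk ?k (?f a0)"
 have oth: "?k dvd lk (?f a) M0" if "a : E - {a0}" for a
 proof (cases "a : ?S")
  case True
  have "lmk ?k (?f a) <= M0" unfolding M0_def a0(2)[symmetric] by (rule Max_ge) (use finS True in auto)
  moreover have "lmk ?k (?f a) ~= M0" using inj[OF True a0(1)] that unfolding M0_def by blast
  ultimately have "~ M0 <= lmk ?k (?f a)" by simp
  thus ?thesis using lmk(2)[OF f(1)[OF True], of M0] by blast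
 next
  case False
  hence "kdv ?k (\<beta> a)" using that by blast
  hence "kdv ?k (?f a)" using p_gt(2) kdv_mult[OF kp] by (cases p) auto
  thus ?thesis by (simp add: kdv_def)
 qed
 have "(\<Sum>a\<in>E. ?f a) : Pol V (p - 1 + p * s)"
  using assms(1) by (intro Pol_sum Pol_mult mon_Pol Pol_pow)
 hence "kdv ?k (\<Sum>a\<in>E. ?f a)" using assms(2) Pol_Q by blast
 hence "?k dvd lk (\<Sum>a\<in>E. ?f a) M0" by (simp add: kdv_def)
 also have "(\<Sum>a\<in>E. ?f a) = ?f a0 + (\<Sum>a\<in>E-{a0}. ?f a)" using a0(1) finE by (intro sum.remove) auto
 finally have "?k dvd lk (?f a0) M0 + (\<Sum>a\<in>E-{a0}. lk (?f a) M0)" by (simp add: lookup_add lookup_sum)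
 moreover have "?k dvd (\<Sum>a\<in>E-{a0}. lk (?f a) M0)" by (intro dvd_sum oth)
 ultimately have "?k dvd lk (?f a0) M0" using dvd_add_left_iff by blast
 thus False using lmk(1)[OF f(1)[OF a0(1)]] unfolding M0_def by blast
qed

end

context red
begin

text \<open>Independence of monomials over the subring of p-th powers of W.\<close>
definition indW :: "(nat \<Rightarrow>\<^sub>0 nat) set => bool" where
 "indW Z \<longleftrightarrow> (ALL b. (\<Sum>a\<in>Z. mon a * b a ^ p) : Q --> (ALL a:Z. b a : Q))"

lemma indWD: "indW Z ==> (\<Sum>a\<in>Z. mon a * b a ^ p) : Q ==> a : Z ==> b a : Q"
 unfolding indW_def by (elim allE[of _ b]) blast

lemma clearY: "finite T ==> EX G s. G : Pol V s & G ~: Q & (ALL w:T. G * w : spn Q V s Y)"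
proof (induction T rule: finite_induct)
 case empty
 show ?case using one_Pol prm_one[OF prQ] by blast
next
 case (insert w T)
 then obtain G s where G: "G : Pol V s" "G ~: Q" "ALL w:T. G * w : spn Q V s Y" by blast
 from gen[of w] obtain t f where f: "f : Pol {..<M} t" "w - f : Q" by blast
 let ?k = "M * t"
 have cP: "c ^ ?k : Pol V (?k * \<kappa>)" by (rule Pol_pow[OF cPol])
 have "c ^ ?k * w \<asymp> c ^ ?k * f" by (intro cg_mult cg_refl) (simp add: cg_def f)
 hence "c ^ ?k * w : spn Q V (?k * \<kappa>) B" by (rule spn_cg) (rule clear[OF f(1)])
 hence 1: "g * (c ^ ?k * w) : spn Q V (?k * \<kappa> + \<kappa>) Y" by (rule spn_comp) (rule gspan)
 let ?s = "s + ?k * \<kappa> + \<kappa>"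
 have gc: "g * c ^ ?k : Pol V (\<kappa> + ?k * \<kappa>)" by (rule Pol_mult[OF gPol cP])
 have "G * (g * c ^ ?k) : Pol V ?s" by (rule Pol_mult'[OF G(1) gc]) simp
 moreover have "G * (g * c ^ ?k) ~: Q" using G(2) gQ cQ by (simp add: prm_mult[OF prQ] prm_pow[OF prQ])
 moreover have "G * (g * c ^ ?k) * w' : spn Q V ?s Y" if "w' : insert w T" for w'
 proof (cases "w' = w")
  case True
  have "G * (g * (c ^ ?k * w)) : spn Q V (?k * \<kappa> + \<kappa> + s) Y" by (rule spn_mult[OF G(1) 1])
  thus ?thesis using True by (simp add: ac_simps)
 next
  case False
  hence "G * w' : spn Q V s Y" using that G(3) by blast
  from spn_mult[OF gc this] show ?thesis by (simp add: ac_simps)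
 qed
 ultimately show ?case by blast
qed

lemma spnY_E:
 assumes "w : spn Q V s B'" shows "EX \<eta>. (ALL y:B'. \<eta> y : Pol V s) & w \<asymp> (\<Sum>y\<in>B'. \<eta> y * y)"
 using assms unfolding spn_def cg_def by blast

lemma frob_comb: "(\<Sum>y\<in>S. \<eta> y * y) ^ p \<asymp> (\<Sum>y\<in>S. \<eta> y ^ p * y ^ p)"
proof -
 have "(\<Sum>y\<in>S. \<eta> y * y) ^ p \<asymp> (\<Sum>y\<in>S. (\<eta> y * y) ^ p)" by (rule frob_sum)
 thus ?thesis by (simp only: power_mult_distrib)
qed

lemma frob_inj: "a ^ p : Q ==> a : Q"
 using prm_pow[OF prQ] by blast

lemma free_W_multiplier:
 assumes Z: "indW Z" "Z \<subseteq> E" and max: "!!a. a : E - Z ==> ~ indW (insert a Z)"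
  and T: "finite T" "T \<subseteq> E"
 shows "EX w. w ~: Q & (ALL a:T. EX v. w ^ p * mon a \<asymp> (\<Sum>a'\<in>Z. mon a' * v a' ^ p))"
 using T
proof (induction T rule: finite_induct)
 case empty
 show ?case using prm_one[OF prQ] by blast
next
 case (insert a T)
 then obtain w where w: "w ~: Q" "ALL a:T. EX v. w ^ p * mon a \<asymp> (\<Sum>a'\<in>Z. mon a' * v a' ^ p)" by blast
 have finZ: "finite Z" using Z(2) finE finite_subset by blast
 have "EX x v. x ~: Q & x ^ p * mon a \<asymp> (\<Sum>a'\<in>Z. mon a' * v a' ^ p)"
 proof (cases "a : Z")
  case True
  have "(\<Sum>a'\<in>Z. mon a' * (if a' = a then 1 else 0) ^ p) = (\<Sum>a'\<in>Z. if a' = a then mon a' else 0)"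
   using p_gt by (intro sum.cong refl) (simp add: zero_power)
  also have "... = 1 ^ p * mon a" using True finZ by (simp add: sum.delta)
  finally have "1 ^ p * mon a \<asymp> (\<Sum>a'\<in>Z. mon a' * (if a' = a then 1 else 0) ^ p)" by simp
  thus ?thesis using prm_one[OF prQ] by (intro exI[of _ 1] exI[of _ "%a'. if a' = a then 1 else 0"] conjI)
 next
  case False
  hence "~ indW (insert a Z)" using max insert by blast
  then obtain b where b: "(\<Sum>a'\<in>insert a Z. mon a' * b a' ^ p) : Q" "~ (ALL a':insert a Z. b a' : Q)"
   unfolding indW_def by blast
  have s: "mon a * b a ^ p + (\<Sum>a'\<in>Z. mon a' * b a' ^ p) : Q" using b(1) finZ False by simp
  have "b a ~: Q"
  proof
   assume ba: "b a : Q"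
   have "mon a * b a ^ p : Q" by (intro idl_mult[OF idl] frob_mem ba)
   hence "(\<Sum>a'\<in>Z. mon a' * b a' ^ p) : Q" using s subgrp_add_iff[OF sg] by blast
   hence "ALL a':Z. b a' : Q" using Z(1) unfolding indW_def by blast
   thus False using b(2) ba by blast
  qed
  moreover have "b a ^ p * mon a \<asymp> (\<Sum>a'\<in>Z. mon a' * (- b a') ^ p)"
  proof -
   have "b a ^ p * mon a \<asymp> - (\<Sum>a'\<in>Z. mon a' * b a' ^ p)" using s by (simp add: cg_def mult.commute)
   also have "... = (\<Sum>a'\<in>Z. mon a' * - (b a' ^ p))" by (simp add: sum_negf)
   also have "... \<asymp> (\<Sum>a'\<in>Z. mon a' * (- b a') ^ p)"
    by (intro cg_sum cg_mult cg_refl cg_sym[OF frob_minus])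
   finally show ?thesis .
  qed
  ultimately show ?thesis by (intro exI[of _ "b a"] exI[of _ "%a'. - b a'"] conjI)
 qed
 then obtain x v where x: "x ~: Q" "x ^ p * mon a \<asymp> (\<Sum>a'\<in>Z. mon a' * v a' ^ p)" by blast
 have scale: "(y * z) ^ p * mon a' \<asymp> (\<Sum>i\<in>Z. mon i * (y * u i) ^ p)"
  if "z ^ p * mon a' \<asymp> (\<Sum>i\<in>Z. mon i * u i ^ p)" for y z a' u
 proof -
  have "(y * z) ^ p * mon a' = y ^ p * (z ^ p * mon a')" by (simp add: power_mult_distrib mult.assoc)
  also have "... \<asymp> y ^ p * (\<Sum>i\<in>Z. mon i * u i ^ p)" by (intro cg_mult cg_refl that)
  also have "... = (\<Sum>i\<in>Z. mon i * (y * u i) ^ p)"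
   unfolding sum_distrib_left by (intro sum.cong refl) (simp add: power_mult_distrib ac_simps)
  finally show ?thesis .
 qed
 have "w * x ~: Q" using w(1) x(1) prm_mult[OF prQ] by blast
 moreover have "EX v. (w * x) ^ p * mon a' \<asymp> (\<Sum>i\<in>Z. mon i * v i ^ p)" if "a' : insert a T" for a'
 proof (cases "a' = a")
  case True
  show ?thesis unfolding True by (rule exI[of _ "%i. w * v i"]) (rule scale[OF x(2)])
 next
  case False
  hence "a' : T" using that by simp
  from bspec[OF w(2) this] obtain u where "w ^ p * mon a' \<asymp> (\<Sum>i\<in>Z. mon i * u i ^ p)" ..
  from scale[OF this, of x] show ?thesis
   by (intro exI[of _ "%i. x * u i"]) (simp only: mult.commute[of w x])
 qed
 ultimately show ?case by (intro exI[of _ "w * x"] conjI ballI)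
qed

lemma ind_EY':
 assumes "ind Q V (%x. x) Y' (%b. b ^ p)" "finite Y'"
 shows "ind Q V (%x. x ^ p) (E \<times> Y') (%(a, b). mon a * b ^ p)"
 unfolding ind_def
proof (intro allI impI ballI)
 fix s \<beta> ab
 assume \<beta>: "ALL i:E \<times> Y'. \<beta> i : Pol V s"
  and s: "(\<Sum>i\<in>E \<times> Y'. \<beta> i ^ p * (case i of (a, b) => mon a * b ^ p)) : Q" and ab: "ab : E \<times> Y'"
 have "(\<Sum>i\<in>E \<times> Y'. \<beta> i ^ p * (case i of (a, b) => mon a * b ^ p))
  = (\<Sum>a\<in>E. \<Sum>b\<in>Y'. \<beta> (a, b) ^ p * (mon a * b ^ p))"
  unfolding sum.cartesian_product by (intro sum.cong refl) auto
 also have "... = (\<Sum>b\<in>Y'. \<Sum>a\<in>E. \<beta> (a, b) ^ p * (mon a * b ^ p))" by (rule sum.swap)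
 also have "... = (\<Sum>b\<in>Y'. (\<Sum>a\<in>E. mon a * \<beta> (a, b) ^ p) * b ^ p)"
  unfolding sum_distrib_right by (intro sum.cong refl) (simp add: ac_simps)
 finally have s': "(\<Sum>b\<in>Y'. (\<Sum>a\<in>E. mon a * \<beta> (a, b) ^ p) * b ^ p) : Q" using s by simp
 obtain a b where ab': "ab = (a, b)" "a : E" "b : Y'" using ab by blast
 have P: "(\<Sum>a\<in>E. mon a * \<beta> (a, b) ^ p) : Pol V (p - 1 + p * s)" if "b : Y'" for b
  using \<beta> that by (intro Pol_sum Pol_mult mon_Pol Pol_pow) auto
 have "(\<Sum>a\<in>E. mon a * \<beta> (a, b) ^ p) : Q" by (rule indD[OF assms(1) P s' ab'(3)])
 from A_free[OF _ this ab'(2)] \<beta> ab'(3) show "\<beta> ab : Q" unfolding ab'(1) by blast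
qed

lemma ind_ZY:
 assumes "indW Z" "finite Z"
 shows "ind Q V (%x. x ^ p) (Z \<times> Y) (%(a, b). mon a * b ^ p)"
 unfolding ind_def
proof (intro allI impI ballI)
 fix s \<beta> ab
 assume \<beta>: "ALL i:Z \<times> Y. \<beta> i : Pol V s"
  and s: "(\<Sum>i\<in>Z \<times> Y. \<beta> i ^ p * (case i of (a, b) => mon a * b ^ p)) : Q" and ab: "ab : Z \<times> Y"
 have "(\<Sum>i\<in>Z \<times> Y. \<beta> i ^ p * (case i of (a, b) => mon a * b ^ p))
  = (\<Sum>a\<in>Z. \<Sum>b\<in>Y. \<beta> (a, b) ^ p * (mon a * b ^ p))"
  unfolding sum.cartesian_product by (intro sum.cong refl) auto
 also have "... = (\<Sum>a\<in>Z. mon a * (\<Sum>b\<in>Y. \<beta> (a, b) ^ p * b ^ p))"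
  unfolding sum_distrib_left by (intro sum.cong refl) (simp add: ac_simps)
 also have "... \<asymp> (\<Sum>a\<in>Z. mon a * (\<Sum>b\<in>Y. \<beta> (a, b) * b) ^ p)"
  by (intro cg_sum cg_mult cg_refl cg_sym[OF frob_comb])
 finally have s': "(\<Sum>a\<in>Z. mon a * (\<Sum>b\<in>Y. \<beta> (a, b) * b) ^ p) : Q" using s cg_mem by blast
 obtain a b where ab': "ab = (a, b)" "a : Z" "b : Y" using ab by blast
 have 1: "(\<Sum>b\<in>Y. \<beta> (a, b) * b) : Q" by (rule indWD[OF assms(1) s' ab'(2)])
 have "\<beta> (a, b) : Q" by (rule indD[OF indY _ 1 ab'(3)]) (use \<beta> ab'(2) in blast)
 thus "\<beta> ab : Q" using ab'(1) by simp
qed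

text \<open>Let Z be a maximal W^p-independent subset of E and Y\' a maximal A-independent set among the p-th
powers of B. Computing the rank of W over the p-th powers of A in two ways gives card Z * card Y =
p^d * card Y\' with d = card V. As card Y < p is prime to p, p^d divides card Z, so Z = E.\<close>
lemma free_W: "indW E"
proof -
 have i0: "indW {0}" unfolding indW_def by (auto simp: mon_0 intro: frob_inj)
 have "0 : E" by (rule zero_Mon)
 with max_subset[OF finE, of "{0}" indW] i0 obtain Z where
  Z: "{0} \<subseteq> Z" "Z \<subseteq> E" "indW Z" and Zmax: "ALL a:E - Z. ~ indW (insert a Z)" by auto
 have finZ: "finite Z" using Z(2) finE finite_subset by blast
 have j0: "ind Q V (%x. x) {1} (%b. b ^ p)" unfolding ind_def by auto
 from max_subset[OF finB, of "{1}" "%Y. ind Q V (%x. x) Y (%b. b ^ p)"] j0 oneB obtain Y' where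
  Y': "{1} \<subseteq> Y'" "Y' \<subseteq> B" "ind Q V (%x. x) Y' (%b. b ^ p)"
  and Ymax: "ALL b:B - Y'. ~ ind Q V (%x. x) (insert b Y') (%b. b ^ p)" by auto
 have finY': "finite Y'" using Y'(2) finB finite_subset by blast
 have "card (E \<times> Y') <= card (Z \<times> Y)"
 proof -
  from free_W_multiplier[OF Z(3,2) _ finE order_refl] Zmax obtain w where
   w: "w ~: Q" "ALL a:E. EX v. w ^ p * mon a \<asymp> (\<Sum>a'\<in>Z. mon a' * v a' ^ p)" by blast
  from bchoice[OF w(2)] obtain v where v: "ALL a:E. w ^ p * mon a \<asymp> (\<Sum>a'\<in>Z. mon a' * v a a' ^ p)" ..
  have "finite ((%(a, a', b). v a a' * b) ` (E \<times> Z \<times> Y'))" using finE finZ finY' by simp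
  from clearY[OF this] obtain G t where G: "G ~: Q"
   "ALL x:(%(a, a', b). v a a' * b) ` (E \<times> Z \<times> Y'). G * x : spn Q V t Y" by blast
  have wG: "(w * G) ^ p ~: Q" using w(1) G(1) prm_mult[OF prQ] frob_inj by blast
  show ?thesis
  proof (rule exchange[OF _ _ homQ_frob wG _ ind_EY'[OF Y'(3) finY'], where v = "%(a, b). mon a * b ^ p" and t = t])
   fix i assume "i : E \<times> Y'"
   then obtain a b where i: "i = (a, b)" "a : E" "b : Y'" by blast
   have "ALL a':Z. EX \<eta>. (ALL y:Y. \<eta> y : Pol V t) & G * (v a a' * b) \<asymp> (\<Sum>y\<in>Y. \<eta> y * y)"
   proof
    fix a' assume "a' : Z"
    hence "(a, a', b) : E \<times> Z \<times> Y'" using i by blast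
    hence "G * (v a a' * b) : spn Q V t Y" using G(2) by force
    thus "EX \<eta>. (ALL y:Y. \<eta> y : Pol V t) & G * (v a a' * b) \<asymp> (\<Sum>y\<in>Y. \<eta> y * y)" by (rule spnY_E)
   qed
   from bchoice[OF this] obtain \<eta> where eta:
    "ALL a':Z. (ALL y:Y. \<eta> a' y : Pol V t) & G * (v a a' * b) \<asymp> (\<Sum>y\<in>Y. \<eta> a' y * y)" ..
   have "(w * G) ^ p * (mon a * b ^ p) = G ^ p * b ^ p * (w ^ p * mon a)"
    by (simp add: power_mult_distrib ac_simps)
   also have "... \<asymp> G ^ p * b ^ p * (\<Sum>a'\<in>Z. mon a' * v a a' ^ p)" using v i(2) by (intro cg_mult cg_refl) blast
   also have "... = (\<Sum>a'\<in>Z. mon a' * (G * (v a a' * b)) ^ p)"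
    unfolding sum_distrib_left by (intro sum.cong refl) (simp add: power_mult_distrib ac_simps)
   also have "... \<asymp> (\<Sum>a'\<in>Z. mon a' * (\<Sum>y\<in>Y. \<eta> a' y * y) ^ p)"
    using eta by (intro cg_sum cg_mult cg_refl cg_pow) blast
   also have "... \<asymp> (\<Sum>a'\<in>Z. mon a' * (\<Sum>y\<in>Y. \<eta> a' y ^ p * y ^ p))"
    by (intro cg_sum cg_mult cg_refl frob_comb)
   also have "... = (\<Sum>a'\<in>Z. \<Sum>y\<in>Y. \<eta> a' y ^ p * (mon a' * y ^ p))"
    unfolding sum_distrib_left by (intro sum.cong refl) (simp add: ac_simps)
   also have "... = (\<Sum>j\<in>Z \<times> Y. (case j of (a', y) => \<eta> a' y) ^ p * (case j of (a', y) => mon a' * y ^ p))"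
    unfolding sum.cartesian_product by (intro sum.cong refl) auto
   finally have "(w * G) ^ p * (case i of (a, b) => mon a * b ^ p) \<asymp>
    (\<Sum>j\<in>Z \<times> Y. (case j of (a', y) => \<eta> a' y) ^ p * (case j of (a', y) => mon a' * y ^ p))"
    by (simp add: i(1))
   moreover have "ALL j:Z \<times> Y. (case j of (a', y) => \<eta> a' y) : Pol V t" using eta by auto
   ultimately show "EX \<eta>. (ALL j:Z \<times> Y. \<eta> j : Pol V t) & (w * G) ^ p * (case i of (a, b) => mon a * b ^ p) \<asymp>
    (\<Sum>j\<in>Z \<times> Y. \<eta> j ^ p * (case j of (a', y) => mon a' * y ^ p))"
    by (intro exI[of _ "%j. case j of (a', y) => \<eta> a' y"] conjI)
  qed (use finE finZ finY finY' in simp_all)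
 qed
 moreover have "card (Z \<times> Y) <= card (E \<times> Y')"
 proof -
  from ind_max_span[OF finB Y'(2,3)] Ymax obtain h t where
   h: "h : Pol V t" "h ~: Q" "ALL b:B. EX \<alpha>. (ALL y:Y'. \<alpha> y : Pol V t) & h * b ^ p - (\<Sum>y\<in>Y'. \<alpha> y * y ^ p) : Q"
   by blast
  let ?t = "p - 1 + t"
  show ?thesis
  proof (rule exchange[OF _ _ homQ_frob h(2) _ ind_ZY[OF Z(3) finZ], where v = "%(a, b). mon a * b ^ p" and t = ?t])
   fix i assume "i : Z \<times> Y"
   then obtain a b where i: "i = (a, b)" "a : Z" "b : Y" by blast
   from h(3) i(3) YB obtain \<alpha> where al: "ALL y:Y'. \<alpha> y : Pol V t" "h * b ^ p - (\<Sum>y\<in>Y'. \<alpha> y * y ^ p) : Q" by blast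
   have "ALL y:Y'. EX \<eta>. (ALL a'. \<eta> a' : Pol V ?t) & mon a * \<alpha> y - (\<Sum>a'\<in>E. mon a' * \<eta> a' ^ p) : Q"
   proof
    fix y assume "y : Y'"
    hence "mon a * \<alpha> y : Pol V ?t" using al(1) i(2) Z(2) by (intro Pol_mult mon_Pol) auto
    from decompose[OF char_modulus_axioms finV this]
    show "EX \<eta>. (ALL a'. \<eta> a' : Pol V ?t) & mon a * \<alpha> y - (\<Sum>a'\<in>E. mon a' * \<eta> a' ^ p) : Q" .
   qed
   from bchoice[OF this] obtain \<eta> where eta:
    "ALL y:Y'. (ALL a'. \<eta> y a' : Pol V ?t) & mon a * \<alpha> y - (\<Sum>a'\<in>E. mon a' * \<eta> y a' ^ p) : Q" ..
   have "h * (mon a * b ^ p) = mon a * (h * b ^ p)" by (simp add: ac_simps)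
   also have "... \<asymp> mon a * (\<Sum>y\<in>Y'. \<alpha> y * y ^ p)" using al(2) by (intro cg_mult cg_refl) (simp add: cg_def)
   also have "... = (\<Sum>y\<in>Y'. mon a * \<alpha> y * y ^ p)" by (simp add: sum_distrib_left mult.assoc)
   also have "... \<asymp> (\<Sum>y\<in>Y'. (\<Sum>a'\<in>E. mon a' * \<eta> y a' ^ p) * y ^ p)"
    using eta by (intro cg_sum cg_mult cg_refl) (simp add: cg_def)
   also have "... = (\<Sum>y\<in>Y'. \<Sum>a'\<in>E. \<eta> y a' ^ p * (mon a' * y ^ p))"
    unfolding sum_distrib_right by (intro sum.cong refl) (simp add: ac_simps)
   also have "... = (\<Sum>a'\<in>E. \<Sum>y\<in>Y'. \<eta> y a' ^ p * (mon a' * y ^ p))" by (rule sum.swap)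
   also have "... = (\<Sum>j\<in>E \<times> Y'. (case j of (a', y) => \<eta> y a') ^ p * (case j of (a', y) => mon a' * y ^ p))"
    unfolding sum.cartesian_product by (intro sum.cong refl) auto
   finally have "h * (case i of (a, b) => mon a * b ^ p) \<asymp>
    (\<Sum>j\<in>E \<times> Y'. (case j of (a', y) => \<eta> y a') ^ p * (case j of (a', y) => mon a' * y ^ p))"
    by (simp add: i(1))
   moreover have "ALL j:E \<times> Y'. (case j of (a', y) => \<eta> y a') : Pol V ?t" using eta by auto
   ultimately show "EX \<eta>. (ALL j:E \<times> Y'. \<eta> j : Pol V ?t) & h * (case i of (a, b) => mon a * b ^ p) \<asymp>
    (\<Sum>j\<in>E \<times> Y'. \<eta> j ^ p * (case j of (a', y) => mon a' * y ^ p))"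
    by (intro exI[of _ "%j. case j of (a', y) => \<eta> y a'"] conjI)
  qed (use finE finZ finY finY' in simp_all)
 qed
 ultimately have "card (E \<times> Y') = card (Z \<times> Y)" by (rule antisym)
 hence "p ^ card V * card Y' = card Z * card Y" unfolding card_cartesian_product cardE .
 hence "p ^ card V dvd card Z * card Y" by (metis dvd_triv_left)
 moreover have "coprime (p ^ card V) (card Y)"
 proof -
  have "card Y > 0" using oneY finY card_gt_0_iff by blast
  hence "~ p dvd card Y" using rp by (auto dest: dvd_imp_le)
  hence "coprime p (card Y)" by (rule prime_imp_coprime[OF pp])
  thus ?thesis by simp
 qed
 ultimately have "p ^ card V dvd card Z" by (simp add: coprime_dvd_mult_left_iff)
 moreover have "card Z > 0" using Z(1) finZ card_gt_0_iff by blast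
 ultimately have "card E <= card Z" unfolding cardE by (rule dvd_imp_le)
 hence "Z = E" using card_seteq[OF finE Z(2)] by simp
 thus ?thesis using Z(3) by simp
qed

section \<open>The subring generated by A and the p-th powers\<close>

text \<open>The products of polynomials in V with p-th powers span this subring, cf. decompose.\<close>
definition SS :: "zpol set" where
 "SS = {w. EX h. w \<asymp> (frc h)}"

lemma SSI: "w \<asymp> (frc h) ==> w : SS"
 unfolding SS_def mem_Collect_eq by (rule exI[of _ h])

lemma SS_cg: "w \<asymp> w' ==> w' : SS ==> w : SS"
 unfolding SS_def using cg_trans by blast

lemma SS_diff: "w : SS ==> w' : SS ==> w - w' : SS"
proof -
 assume "w : SS" "w' : SS"
 then obtain h h' where h: "w \<asymp> (frc h)" "w' \<asymp> (frc h')"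
  unfolding SS_def by blast
 have "w - w' \<asymp> (frc h) - (frc h')" by (intro cg_diff h)
 also have "... = (\<Sum>a\<in>E. mon a * (h a ^ p - h' a ^ p))" by (simp add: right_diff_distrib sum_subtractf)
 also have "... \<asymp> (\<Sum>a\<in>E. mon a * (h a - h' a) ^ p)" by (intro cg_sum cg_mult cg_refl cg_sym[OF frob_diff])
 finally show ?thesis by (rule SSI)
qed

lemma Pol_SS: "f : Pol V s ==> f : SS"
 using decompose[OF char_modulus_axioms finV, of f s] unfolding SS_def cg_def by blast

lemma subgrp_SS: "subgrp SS"
 unfolding subgrp_def using SS_diff Pol_SS[OF zero_Pol] by blast

lemma SS_frob_mult: "w : SS ==> x ^ p * w : SS"
proof -
 assume "w : SS"
 then obtain h where h: "w \<asymp> (frc h)" unfolding SS_def by blast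
 have "x ^ p * w \<asymp> x ^ p * (frc h)" by (intro cg_mult cg_refl h)
 also have "... = (\<Sum>a\<in>E. mon a * (x * h a) ^ p)"
  unfolding sum_distrib_left by (intro sum.cong refl) (simp add: power_mult_distrib ac_simps)
 finally show ?thesis by (rule SSI)
qed

lemma SS_mult: "w : SS ==> w' : SS ==> w * w' : SS"
proof -
 assume "w : SS" "w' : SS"
 then obtain h h' where h: "w \<asymp> (frc h)" "w' \<asymp> (frc h')"
  unfolding SS_def by blast
 have "w * w' \<asymp> (frc h) * (frc h')" by (intro cg_mult h)
 also have "... = (\<Sum>a\<in>E. \<Sum>a'\<in>E. h a ^ p * (h' a' ^ p * mon (a + a')))"
  unfolding sum_product by (intro sum.cong refl) (simp add: mon_add ac_simps)
 finally have eq: "w * w' \<asymp> (\<Sum>a\<in>E. \<Sum>a'\<in>E. h a ^ p * (h' a' ^ p * mon (a + a')))" .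
 have "(\<Sum>a\<in>E. \<Sum>a'\<in>E. h a ^ p * (h' a' ^ p * mon (a + a'))) : SS"
 proof (intro subgrp_sum[OF subgrp_SS] SS_frob_mult)
  fix a a' assume "a : E" "a' : E"
  from Pol_SS[OF mon_Pol[OF Mon_add[OF this]]] show "mon (a + a') : SS" .
 qed
 thus ?thesis by (rule SS_cg[OF eq])
qed

lemma one_SS: "1 : SS" by (rule Pol_SS[OF one_Pol])

lemma frob_SS: "x ^ p : SS" using SS_frob_mult[OF one_SS, of x] by simp

lemma indYp: "ind Q V (%x. x) Y (%b. b ^ p)"
 unfolding ind_def
proof (intro allI impI ballI)
 fix s \<beta> y
 assume \<beta>: "ALL i:Y. \<beta> i : Pol V s" and s: "(\<Sum>i\<in>Y. \<beta> i * i ^ p) : Q" and y: "y : Y"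
 have "ALL i:Y. EX h. (ALL a. h a : Pol V s) & \<beta> i - (frc h) : Q"
  using decompose[OF char_modulus_axioms finV] \<beta> by blast
 from bchoice[OF this] obtain h where
  h: "ALL i:Y. (ALL a. h i a : Pol V s) & \<beta> i - (\<Sum>a\<in>E. mon a * h i a ^ p) : Q" ..
 have "(\<Sum>i\<in>Y. \<beta> i * i ^ p) \<asymp> (\<Sum>i\<in>Y. (\<Sum>a\<in>E. mon a * h i a ^ p) * i ^ p)"
  using h by (intro cg_sum cg_mult cg_refl) (simp add: cg_def)
 also have "... = (\<Sum>i\<in>Y. \<Sum>a\<in>E. mon a * (h i a ^ p * i ^ p))"
  unfolding sum_distrib_right by (intro sum.cong refl) (simp add: ac_simps)
 also have "... = (\<Sum>a\<in>E. \<Sum>i\<in>Y. mon a * (h i a ^ p * i ^ p))" by (rule sum.swap)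
 also have "... = (\<Sum>a\<in>E. mon a * (\<Sum>i\<in>Y. h i a ^ p * i ^ p))" by (simp add: sum_distrib_left)
 also have "... \<asymp> (\<Sum>a\<in>E. mon a * (\<Sum>i\<in>Y. h i a * i) ^ p)"
  by (intro cg_sum cg_mult cg_refl cg_sym[OF frob_comb])
 finally have "(\<Sum>a\<in>E. mon a * (\<Sum>i\<in>Y. h i a * i) ^ p) : Q" using s cg_mem by blast
 from indWD[OF free_W this] have 1: "ALL a:E. (\<Sum>i\<in>Y. h i a * i) : Q" by blast
 have "h y a : Q" if "a : E" for a
  by (rule indD[OF indY, of "%i. h i a" s]) (use h 1 that y in auto)
 hence "(\<Sum>a\<in>E. mon a * h y a ^ p) : Q" by (intro subgrp_sum[OF sg] idl_mult[OF idl] frob_mem)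
 moreover have "\<beta> y \<asymp> (\<Sum>a\<in>E. mon a * h y a ^ p)" using h y by (simp add: cg_def)
 ultimately show "\<beta> y : Q" using cg_mem by blast
qed

text \<open>The element b and the p-th powers of Y are card Y + 1 elements of a module of rank card Y over A,
hence dependent with coefficients of exponent at most K p. The coefficient of b is nonzero because
the p-th powers of Y are independent.\<close>
lemma gamma_one:
 assumes K: "card Y * (K + (\<kappa> + \<kappa> * \<kappa> * M)) ^ card V < (card Y + 1) * K ^ card V" "K > 0" and b: "b : B"
 shows "EX \<gamma>:Pol V (K * p). \<gamma> ~: Q & \<gamma> * b : SS"
proof -
 let ?\<kappa>2 = "\<kappa> + \<kappa> * \<kappa> * M"
 let ?n = "M * (p * \<kappa>)"
 let ?I = "insert None (Some ` Y)"
 let ?u = "%i. case i of None => b | Some y => y ^ p"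
 have cI: "card ?I = card Y + 1" using finY by (simp add: card_image)
 have w: "g * c ^ ?n ~: Q" using gQ cQ by (simp add: prm_mult[OF prQ] prm_pow[OF prQ])
 have bnd: "?n * \<kappa> + \<kappa> <= ?\<kappa>2 * p"
 proof -
  have "\<kappa> <= \<kappa> * p" using p_gt by simp
  thus ?thesis by (simp add: algebra_simps)
 qed
 have "EX \<beta>. (ALL i:?I. \<beta> i : Pol V (K * p)) & (EX i:?I. \<beta> i ~: Q) & (\<Sum>i\<in>?I. \<beta> i * ?u i) : Q"
 proof (rule siegel[OF _ finY homQ_id w, where v = "%y. y" and t = "?\<kappa>2 * p"])
  fix i assume i: "i : ?I"
  have "c ^ ?n * ?u i : spn Q V (?n * \<kappa>) B"
  proof (cases i)
   case None
   have "1 * b : spn Q V 0 B" by (rule spn_single[OF finB b one_Pol])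
   from c_pow[OF this, of ?n] show ?thesis using None by simp
  next
   case (Some y)
   hence "y : Pol {..<M} \<kappa>" using i YB Bpol by blast
   from clear[OF Pol_pow[OF this, of p]] show ?thesis using Some by simp
  qed
  hence "g * (c ^ ?n * ?u i) : spn Q V (?n * \<kappa> + \<kappa>) Y" by (rule spn_comp) (rule gspan)
  hence "g * (c ^ ?n * ?u i) : spn Q V (?\<kappa>2 * p) Y" by (rule spn_mono'[OF _ bnd])
  from spnY_E[OF this] show "EX \<eta>. (ALL j:Y. \<eta> j : Pol V (?\<kappa>2 * p)) & g * c ^ ?n * ?u i \<asymp> (\<Sum>j\<in>Y. \<eta> j * j)"
   by (simp only: mult.assoc)
 next
  show "card Y * (K * p + ?\<kappa>2 * p + 1) ^ card V < card ?I * (K * p + 1) ^ card V"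
   unfolding cI by (rule siegel_scale[OF K])
 qed (use finY in simp)
 then obtain \<beta> where \<beta>: "ALL i:?I. \<beta> i : Pol V (K * p)" "EX i:?I. \<beta> i ~: Q" "(\<Sum>i\<in>?I. \<beta> i * ?u i) : Q" by blast
 have "(\<Sum>i\<in>?I. \<beta> i * ?u i) = \<beta> None * b + (\<Sum>i\<in>Some ` Y. \<beta> i * ?u i)" using finY by simp
 also have "(\<Sum>i\<in>Some ` Y. \<beta> i * ?u i) = (\<Sum>y\<in>Y. \<beta> (Some y) * y ^ p)"
  by (subst sum.reindex) simp_all
 finally have s: "\<beta> None * b + (\<Sum>y\<in>Y. \<beta> (Some y) * y ^ p) : Q" using \<beta>(3) by simp
 have "\<beta> None ~: Q"
 proof
  assume n: "\<beta> None : Q"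
  hence "\<beta> None * b : Q" by (rule idl_mult2[OF idl])
  hence "(\<Sum>y\<in>Y. \<beta> (Some y) * y ^ p) : Q" using s subgrp_add_iff[OF sg] by blast
  hence "\<beta> (Some y) : Q" if "y : Y" for y
   using indD[OF indYp, of "%y. \<beta> (Some y)" "K * p" y] \<beta>(1) that by blast
  thus False using n \<beta>(2) by blast
 qed
 moreover have "\<beta> None * b : SS"
 proof -
  have "(\<Sum>y\<in>Y. \<beta> (Some y) * y ^ p) : SS"
  proof (rule subgrp_sum[OF subgrp_SS])
   fix y assume "y : Y"
   hence "\<beta> (Some y) : SS" using \<beta>(1) Pol_SS by blast
   thus "\<beta> (Some y) * y ^ p : SS" using frob_SS by (rule SS_mult)
  qed
  hence "- (\<Sum>y\<in>Y. \<beta> (Some y) * y ^ p) : SS" by (rule subgrp_minus[OF subgrp_SS])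
  moreover have "\<beta> None * b \<asymp> - (\<Sum>y\<in>Y. \<beta> (Some y) * y ^ p)" using s by (simp add: cg_def)
  ultimately show ?thesis using SS_cg by blast
 qed
 moreover have "\<beta> None : Pol V (K * p)" using \<beta>(1) by blast
 ultimately show ?thesis by blast
qed

text \<open>W is generated over its p-th powers by monomials with exponents below p. A power of c moves them
into the A-span of B, and the product of the multipliers from gamma_one moves B into SS.\<close>
lemma gamma:
 assumes K: "card Y * (K + (\<kappa> + \<kappa> * \<kappa> * M)) ^ card V < (card Y + 1) * K ^ card V" "K > 0"
 shows "EX \<gamma>:Pol V ((card B * K + M * \<kappa>) * p). \<gamma> ~: Q & (ALL w. \<gamma> * w : SS)"
proof -
 have "ALL b:B. EX \<gamma>. \<gamma> : Pol V (K * p) & \<gamma> ~: Q & \<gamma> * b : SS" using gamma_one[OF K] by blast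
 from bchoice[OF this] obtain \<gamma> where \<gamma>: "ALL b:B. \<gamma> b : Pol V (K * p) & \<gamma> b ~: Q & \<gamma> b * b : SS" ..
 define G where "G = (\<Prod>b\<in>B. \<gamma> b)"
 have GP: "G : Pol V (card B * K * p)"
  unfolding G_def using Pol_prod[OF finB, of \<gamma> V "%_. K * p"] \<gamma> by (simp add: mult.assoc)
 have GQ: "G ~: Q" unfolding G_def by (subst prm_prod[OF finB prQ]) (use \<gamma> in blast)
 have GB: "G * b : SS" if b: "b : B" for b
 proof -
  have Gb: "G * b = (\<Prod>b'\<in>B - {b}. \<gamma> b') * (\<gamma> b * b)"
   unfolding G_def using prod.remove[OF finB b, of \<gamma>] by (simp add: ac_simps)
  have "(\<Prod>b'\<in>B - {b}. \<gamma> b') : Pol V (\<Sum>b'\<in>B - {b}. K * p)"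
   by (rule Pol_prod) (use finB \<gamma> in auto)
  from Pol_SS[OF this] have "(\<Prod>b'\<in>B - {b}. \<gamma> b') : SS" .
  moreover have "\<gamma> b * b : SS" using \<gamma> b by blast
  ultimately show ?thesis unfolding Gb by (rule SS_mult)
 qed
 let ?k = "M * (p - 1)"
 have all: "G * c ^ ?k * w : SS" for w
 proof -
  from gen[of w] obtain s f where f: "f : Pol {..<M} s" "w - f : Q" by blast
  from decompose[OF char_modulus_axioms _ f(1)] obtain h where
   h: "f - (\<Sum>a\<in>Mon {..<M} (p - 1). mon a * h a ^ p) : Q" by blast
  have "w \<asymp> f" using f(2) by (simp add: cg_def)
  also have "f \<asymp> (\<Sum>a\<in>Mon {..<M} (p - 1). mon a * h a ^ p)" using h by (simp add: cg_def)
  finally have "G * c ^ ?k * w \<asymp> G * c ^ ?k * (\<Sum>a\<in>Mon {..<M} (p - 1). mon a * h a ^ p)"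
   by (intro cg_mult cg_refl)
  also have "... = (\<Sum>a\<in>Mon {..<M} (p - 1). h a ^ p * (G * (c ^ ?k * mon a)))"
   unfolding sum_distrib_left by (intro sum.cong refl) (simp add: ac_simps)
  finally have eq: "G * c ^ ?k * w \<asymp> (\<Sum>a\<in>Mon {..<M} (p - 1). h a ^ p * (G * (c ^ ?k * mon a)))" .
  have "(\<Sum>a\<in>Mon {..<M} (p - 1). h a ^ p * (G * (c ^ ?k * mon a))) : SS"
  proof (intro subgrp_sum[OF subgrp_SS] SS_frob_mult)
   fix a assume "a : Mon {..<M} (p - 1)"
   from spnY_E[OF clear_mon[OF this]] obtain \<eta> where
    eta: "ALL b:B. \<eta> b : Pol V (?k * \<kappa>)" "c ^ ?k * mon a \<asymp> (\<Sum>b\<in>B. \<eta> b * b)" by blast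
   have "G * (c ^ ?k * mon a) \<asymp> G * (\<Sum>b\<in>B. \<eta> b * b)" by (intro cg_mult cg_refl eta)
   also have "... = (\<Sum>b\<in>B. \<eta> b * (G * b))"
    unfolding sum_distrib_left by (intro sum.cong refl) (simp add: ac_simps)
   finally have 1: "G * (c ^ ?k * mon a) \<asymp> (\<Sum>b\<in>B. \<eta> b * (G * b))" .
   have "(\<Sum>b\<in>B. \<eta> b * (G * b)) : SS"
    by (intro subgrp_sum[OF subgrp_SS] SS_mult GB Pol_SS) (use eta(1) in auto)
   thus "G * (c ^ ?k * mon a) : SS" by (rule SS_cg[OF 1])
  qed
  thus ?thesis by (rule SS_cg[OF eq])
 qed
 have "G * c ^ ?k ~: Q" using GQ cQ by (simp add: prm_mult[OF prQ] prm_pow[OF prQ])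
 moreover have "G * c ^ ?k : Pol V ((card B * K + M * \<kappa>) * p)"
 proof (rule Pol_mult'[OF GP Pol_pow[OF cPol]])
  have "?k * \<kappa> <= M * p * \<kappa>" by simp
  thus "card B * K * p + ?k * \<kappa> <= (card B * K + M * \<kappa>) * p" by (simp add: algebra_simps)
 qed
 ultimately show ?thesis using all by blast
qed

text \<open>After multiplication by c^(Ms), which is injective modulo Q, the count is that of coefficient
families on B.\<close>
lemma growth:
 "finite (quo Q (Pol {..<M} s))" "card (quo Q (Pol {..<M} s)) <= p ^ (card B * (M * s * \<kappa> + 1) ^ card V)"
proof -
 let ?C = "%w. coset Q (c ^ (M * s) * w)"
 have comb: "EX \<theta>. (ALL j:B. \<theta> j : Pol V (M * s * \<kappa>)) & c ^ (M * s) * w \<asymp> (\<Sum>j\<in>B. \<theta> j * j)"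
  if "w : Pol {..<M} s" for w
  by (rule spnY_E[OF clear[OF that]])
 note cc = card_comb[where T = "Pol {..<M} s" and h = "%w. c ^ (M * s) * w" and v = "%y. y", OF finB homQ_id comb]
 have eq: "quo Q (Pol {..<M} s) = (%C. coset Q (SOME w. ?C w = C)) ` (?C ` Pol {..<M} s)"
  unfolding quo_def image_image
 proof (rule image_cong[OF refl])
  fix w assume "w : Pol {..<M} s"
  have "?C (SOME w'. ?C w' = ?C w) = ?C w" by (rule someI[of "%w'. ?C w' = ?C w"]) simp
  hence "c ^ (M * s) * (SOME w'. ?C w' = ?C w) - c ^ (M * s) * w : Q" by (simp add: coset_eq[OF sg])
  hence "c ^ (M * s) * ((SOME w'. ?C w' = ?C w) - w) : Q" by (simp add: right_diff_distrib)
  hence "(SOME w'. ?C w' = ?C w) - w : Q" using cQ prm_mult[OF prQ] prm_pow[OF prQ] by blast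
  thus "coset Q w = coset Q (SOME w'. ?C w' = ?C w)" by (simp add: coset_eq[OF sg] subgrp_diff_swap[OF sg])
 qed
 show "finite (quo Q (Pol {..<M} s))" unfolding eq using cc(1) by simp
 show "card (quo Q (Pol {..<M} s)) <= p ^ (card B * (M * s * \<kappa> + 1) ^ card V)"
  unfolding eq using card_image_le[OF cc(1)] cc(2) order_trans by blast
qed

end

text \<open>The ideal generated by T.\<close>
definition gid :: "'w::comm_ring_1 set => 'w set" where
 "gid T = \<Inter>{N. idl N & T \<subseteq> N}"

lemma idl_gid: "idl (gid T)"
 unfolding gid_def stab_def subgrp_def by simp

lemma gid_incl: "T \<subseteq> gid T"
 unfolding gid_def by blast

lemma gid_least: "idl N ==> T \<subseteq> N ==> gid T \<subseteq> N"
 unfolding gid_def by blast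

text \<open>The preimage in W of the q-th Frobenius power of the image of J in W/Q.\<close>
definition FP :: "'w::comm_ring_1 set => 'w set => nat => 'w set" where
 "FP Q J q = gid ({w ^ q | w. w : J} \<union> Q)"

lemma index_mult:
 assumes Q: "subgrp Q" and K: "subgrp K" and P: "subgrp P" and sub: "Q \<subseteq> K" "K \<subseteq> P" and fin: "finite (quo Q P)"
 shows "card (quo K P) * card (quo Q K) <= card (quo Q P)"
proof -
 define r where "r C = (SOME x. x : P & coset K x = C)" for C
 define t where "t C = (SOME x. x : K & coset Q x = C)" for C
 have r: "r C : P & coset K (r C) = C" if "C : quo K P" for C
 proof -
  from that obtain x where "x : P & coset K x = C" by (auto simp: quo_def)
  thus ?thesis unfolding r_def by (rule someI)
 qed
 have t: "t C : K & coset Q (t C) = C" if "C : quo Q K" for C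
 proof -
  from that obtain x where "x : K & coset Q x = C" by (auto simp: quo_def)
  thus ?thesis unfolding t_def by (rule someI)
 qed
 let ?f = "%(C, D). coset Q (r C + t D)"
 have "inj_on ?f (quo K P \<times> quo Q K)"
 proof (rule inj_onI)
  fix x y assume xy: "x : quo K P \<times> quo Q K" "y : quo K P \<times> quo Q K" "?f x = ?f y"
  obtain C D C' D' where e: "x = (C, D)" "y = (C', D')" by (metis surj_pair)
  have m: "C : quo K P" "D : quo Q K" "C' : quo K P" "D' : quo Q K" using xy e by auto
  have d: "(r C + t D) - (r C' + t D') : Q" using xy(3) unfolding e by (simp add: coset_eq[OF Q])
  have "t D' - t D : K" using t m K by (intro subgrp_diff) auto
  hence "((r C + t D) - (r C' + t D')) + (t D' - t D) : K" using d sub by (intro subgrp_add[OF K]) auto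
  hence "r C - r C' : K" by simp
  hence "coset K (r C) = coset K (r C')" by (simp add: coset_eq[OF K])
  hence CC: "C = C'" using r m by simp
  hence "t D - t D' : Q" using d by simp
  hence "coset Q (t D) = coset Q (t D')" by (simp add: coset_eq[OF Q])
  hence "D = D'" using t m by simp
  thus "x = y" using CC e by simp
 qed
 moreover have "?f ` (quo K P \<times> quo Q K) \<subseteq> quo Q P"
 proof (rule image_subsetI)
  fix x assume x: "x : quo K P \<times> quo Q K"
  obtain C D where e: "x = (C, D)" by (metis surj_pair)
  have "r C + t D : P" using r[of C] t[of D] x sub unfolding e by (intro subgrp_add[OF P]) auto
  thus "?f x : quo Q P" unfolding e quo_def by simp
 qed
 ultimately have "card (quo K P \<times> quo Q K) <= card (quo Q P)" using fin by (rule card_inj_on_le)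
 thus ?thesis by (simp add: card_cartesian_product)
qed

context red
begin

text \<open>The growth function of W/Q.\<close>
definition NN :: "nat => nat" where "NN s = card (quo Q (Pol {..<M} s))"

lemma NN_pos: "NN s > 0"
proof -
 have "quo Q (Pol {..<M} s) ~= {}" using zero_Pol unfolding quo_def by blast
 thus ?thesis unfolding NN_def using growth(1) card_gt_0_iff by blast
qed

text \<open>Otherwise NN would grow by more than p^k in each of T steps.\<close>
lemma averaging:
 assumes "NN (s0 + T * \<delta>) <= p ^ (k * T)" "T > 0"
 shows "EX j<T. NN (s0 + Suc j * \<delta>) <= p ^ k * NN (s0 + j * \<delta>)"
proof (rule ccontr)
 assume "~ ?thesis"
 hence gt: "p ^ k * NN (s0 + j * \<delta>) < NN (s0 + Suc j * \<delta>)" if "j < T" for j using that not_le by blast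
 have "j <= T ==> p ^ (k * j) <= NN (s0 + j * \<delta>) & (j > 0 --> p ^ (k * j) < NN (s0 + j * \<delta>))" for j
 proof (induction j)
  case 0
  show ?case using NN_pos[of s0] by simp
 next
  case (Suc j)
  have "p ^ (k * Suc j) = p ^ k * p ^ (k * j)" by (simp add: power_add)
  also have "... <= p ^ k * NN (s0 + j * \<delta>)" using Suc by (intro mult_left_mono) simp_all
  also have "... < NN (s0 + Suc j * \<delta>)" using gt[of j] Suc.prems by simp
  finally show ?case by simp
 qed
 from this[of T] assms show False by simp
qed

text \<open>Multiplication by \<gamma> embeds the classes of degree at most s into those classes of degree at
most s + \<delta> that lie in K. So the index of K is bounded by the quotient of the two counts.\<close>
lemma index_bound:
 assumes K: "subgrp K" "Q \<subseteq> K" and \<gamma>: "\<gamma> : Pol {..<M} \<delta>" "\<gamma> ~: Q" "!!w. \<gamma> * w : K"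
  and S: "S \<subseteq> ssum (Pol {..<M} (s + \<delta>)) K" and num: "NN (s + \<delta>) <= p ^ k * NN s"
 shows "finite (quo K S)" "card (quo K S) <= p ^ k"
proof -
 let ?P = "ssum (Pol {..<M} (s + \<delta>)) Q"
 let ?K = "K \<inter> ?P"
 have sP: "subgrp ?P" by (rule subgrp_ssum[OF subgrp_Pol sg])
 have QP: "Q \<subseteq> ?P" by (rule ssum_right[OF subgrp_Pol])
 have sK: "subgrp ?K" using stab_Int[of "{}" K ?P] K sP by (simp add: stab_def)
 have qP: "quo Q ?P = quo Q (Pol {..<M} (s + \<delta>))"
 proof
  show "quo Q ?P \<subseteq> quo Q (Pol {..<M} (s + \<delta>))"
  proof
   fix C assume "C : quo Q ?P"
   then obtain x y where xy: "C = coset Q (x + y)" "x : Pol {..<M} (s + \<delta>)" "y : Q"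
    unfolding quo_def ssum_def by blast
   have "C = coset Q x" unfolding xy(1) using xy(3) by (simp add: coset_eq[OF sg])
   thus "C : quo Q (Pol {..<M} (s + \<delta>))" using xy(2) unfolding quo_def by blast
  qed
  show "quo Q (Pol {..<M} (s + \<delta>)) \<subseteq> quo Q ?P" by (rule quo_mono[OF ssum_left[OF sg]])
 qed
 have finP: "finite (quo Q ?P)" unfolding qP by (rule growth)
 have 1: "card (quo ?K ?P) * card (quo Q ?K) <= NN (s + \<delta>)"
  using index_mult[OF sg sK sP _ _ finP] K(2) QP unfolding NN_def qP by blast
 have finK: "finite (quo Q ?K)" using finite_subset[OF quo_mono finP] by blast
 have 2: "NN s <= card (quo Q ?K)"
  unfolding NN_def
 proof (rule card_inj_on_le[OF _ _ finK])
  let ?f = "%C. coset Q (\<gamma> * (SOME x. x : Pol {..<M} s & coset Q x = C))"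
  have some: "(SOME x. x : Pol {..<M} s & coset Q x = C) : Pol {..<M} s &
   coset Q (SOME x. x : Pol {..<M} s & coset Q x = C) = C" if "C : quo Q (Pol {..<M} s)" for C
  proof -
   from that obtain x where "x : Pol {..<M} s & coset Q x = C" by (auto simp: quo_def)
   thus ?thesis by (rule someI)
  qed
  show "inj_on ?f (quo Q (Pol {..<M} s))"
  proof (rule inj_onI)
   fix C C' assume C: "C : quo Q (Pol {..<M} s)" "C' : quo Q (Pol {..<M} s)" "?f C = ?f C'"
   define x where "x = (SOME x. x : Pol {..<M} s & coset Q x = C)"
   define y where "y = (SOME x. x : Pol {..<M} s & coset Q x = C')"
   have "\<gamma> * (x - y) : Q" using C(3) unfolding x_def y_def by (simp add: coset_eq[OF sg] right_diff_distrib)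
   hence "x - y : Q" using \<gamma>(2) prm_mult[OF prQ] by blast
   hence "coset Q x = coset Q y" by (simp add: coset_eq[OF sg])
   thus "C = C'" using some[OF C(1)] some[OF C(2)] unfolding x_def y_def by simp
  qed
  show "?f ` quo Q (Pol {..<M} s) \<subseteq> quo Q ?K"
  proof (rule image_subsetI)
   fix C assume "C : quo Q (Pol {..<M} s)"
   from some[OF this] have "\<gamma> * (SOME x. x : Pol {..<M} s & coset Q x = C) : Pol {..<M} (s + \<delta>)"
    by (intro Pol_mult'[OF \<gamma>(1), of _ s]) auto
   hence "\<gamma> * (SOME x. x : Pol {..<M} s & coset Q x = C) : ?K"
    using \<gamma>(3) ssum_left[OF sg] by blast
   thus "?f C : quo Q ?K" unfolding quo_def by (rule imageI)
  qed
 qed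
 have fK: "finite (quo ?K ?P)" by (rule finite_quo_mono[OF finP sg sK _ order_refl]) (use K(2) QP in blast)
 have sub: "quo K S \<subseteq> quo K ?P"
 proof
  fix C assume "C : quo K S"
  then obtain x y where xy: "C = coset K (x + y)" "x : Pol {..<M} (s + \<delta>)" "y : K"
   using S unfolding quo_def ssum_def by blast
  have "C = coset K x" unfolding xy(1) using xy(3) by (simp add: coset_eq[OF K(1)])
  moreover have "x : ?P" using xy(2) ssum_left[OF sg] by blast
  ultimately show "C : quo K ?P" unfolding quo_def by blast
 qed
 have fKP: "finite (quo K ?P)" by (rule finite_quo_mono[OF fK sK K(1) _ order_refl]) blast
 thus "finite (quo K S)" using sub finite_subset by blast
 have "card (quo K S) <= card (quo K ?P)" by (rule card_mono[OF fKP sub])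
 also have "... <= card (quo ?K ?P)" by (rule card_quo_coarsen[OF fK sK K(1) _ order_refl]) blast
 finally have "card (quo K S) * NN s <= card (quo ?K ?P) * card (quo Q ?K)" using 2 by (rule mult_le_mono)
 also have "... <= p ^ k * NN s" using 1 num by (rule order_trans)
 finally show "card (quo K S) <= p ^ k" using NN_pos[of s] by simp
qed

section \<open>Semilinear sums\<close>

definition PW :: "zpol set" where "PW = {w ^ p | w. True}"

text \<open>The sum of the x^a C(a)^(p), where C(a)^(p) is the set of p-th powers and x^a runs over the
monomials E; a W^p-module if the C a are ideals.\<close>
definition TT :: "((nat \<Rightarrow>\<^sub>0 nat) => zpol set) => zpol set" where
 "TT C = {w. EX h. (ALL a:E. h a : C a) & w \<asymp> (frc h)}"

abbreviation "TD L D \<equiv> TT (%b. if b : D then UNIV else L)"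

lemma TTI: "(!!a. a : E ==> h a : C a) ==> w \<asymp> (frc h) ==> w : TT C"
 unfolding TT_def mem_Collect_eq by (intro exI[of _ h] conjI ballI)

lemma TTE:
 assumes "w : TT C"
 obtains h where "ALL a:E. h a : C a" "w \<asymp> (frc h)"
 using assms unfolding TT_def mem_Collect_eq by (elim exE conjE)

lemma SS_TT: "SS = TT (%_. UNIV)"
 unfolding SS_def TT_def by simp

lemma TT_mono: "(!!a. a : E ==> C a \<subseteq> C' a) ==> TT C \<subseteq> TT C'"
proof
 fix w assume sub: "!!a. a : E ==> C a \<subseteq> C' a" and "w : TT C"
 then obtain h where "ALL a:E. h a : C a" "w \<asymp> (frc h)" by (elim TTE)
 thus "w : TT C'" using sub by (intro TTI[of h]) auto
qed

lemma TT_cong: "(!!a. a : E ==> C a = C' a) ==> TT C = TT C'"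
 using TT_mono[of C C'] TT_mono[of C' C] by blast

lemma mon_TT:
 assumes "a : E" "w : C a" "!!a. a : E ==> subgrp (C a)"
 shows "mon a * w ^ p : TT C"
proof (rule TTI[of "%b. if b = a then w else 0"])
 have "(\<Sum>b\<in>E. mon b * (if b = a then w else 0) ^ p) = (\<Sum>b\<in>E. if b = a then mon b * w ^ p else 0)"
  using p_gt by (intro sum.cong refl) (simp add: zero_power)
 also have "... = mon a * w ^ p" using assms(1) finE by (simp add: sum.delta)
 finally show "mon a * w ^ p \<asymp> (\<Sum>b\<in>E. mon b * (if b = a then w else 0) ^ p)" by simp
qed (use assms subgrp_zero in auto)

lemma Q_TT:
 assumes "!!a. a : E ==> subgrp (C a)" shows "Q \<subseteq> TT C"
proof
 fix w assume "w : Q"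
 hence "w \<asymp> (\<Sum>a\<in>E. mon a * 0 ^ p)" using p_gt by (simp add: zero_power cg_zero)
 thus "w : TT C" using assms subgrp_zero by (intro TTI[of "%_. 0"]) auto
qed

lemma stab_TT:
 assumes "!!a. a : E ==> idl (C a)" shows "stab PW (TT C)"
 unfolding stab_def subgrp_def
proof (intro conjI ballI)
 show "0 : TT C" using Q_TT[of C] assms subgrp_zero[OF sg] stab_subgrp by blast
next
 fix x y assume "x : TT C" "y : TT C"
 then obtain h h' where h: "ALL a:E. h a : C a" "x \<asymp> (frc h)"
  "ALL a:E. h' a : C a" "y \<asymp> (frc h')" by (elim TTE)
 have "x - y \<asymp> (frc h) - (frc h')" by (intro cg_diff h)
 also have "... = (\<Sum>a\<in>E. mon a * (h a ^ p - h' a ^ p))" by (simp add: right_diff_distrib sum_subtractf)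
 also have "... \<asymp> (\<Sum>a\<in>E. mon a * (h a - h' a) ^ p)" by (intro cg_sum cg_mult cg_refl cg_sym[OF frob_diff])
 finally show "x - y : TT C"
 proof (rule TTI[rotated])
  fix a assume a: "a : E"
  show "h a - h' a : C a" by (rule subgrp_diff[OF stab_subgrp[OF assms[OF a]]]) (use h a in auto)
 qed
next
 fix r x assume "r : PW" "x : TT C"
 then obtain h z where h: "ALL a:E. h a : C a" "x \<asymp> (frc h)" "r = z ^ p"
  unfolding PW_def by (elim TTE) blast
 have "r * x \<asymp> r * (frc h)" by (intro cg_mult cg_refl h)
 also have "... = (\<Sum>a\<in>E. mon a * (z * h a) ^ p)"
  unfolding sum_distrib_left h(3) by (intro sum.cong refl) (simp add: power_mult_distrib ac_simps)
 finally show "r * x : TT C" using h assms by (intro TTI[of "%a. z * h a"]) (auto intro: idl_mult)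
qed

lemma free_diff:
 assumes "(frc h) \<asymp> (frc h')" "a : E"
 shows "h a - h' a : Q"
proof -
 have "(\<Sum>a\<in>E. mon a * (h a - h' a) ^ p) \<asymp> (\<Sum>a\<in>E. mon a * (h a ^ p - h' a ^ p))"
  by (intro cg_sum cg_mult cg_refl frob_diff)
 also have "... = (frc h) - (frc h')"
  by (simp add: right_diff_distrib sum_subtractf)
 finally have "(\<Sum>a\<in>E. mon a * (h a - h' a) ^ p) : Q" using assms(1) cg_mem unfolding cg_def by blast
 from indWD[OF free_W this assms(2)] show ?thesis .
qed

lemma finite_quo_TT:
 assumes L: "idl L" "finite (quo L UNIV)"
 shows "finite (quo (TT (%_. L)) (TT (%_. UNIV)))"
proof -
 have sL: "subgrp L" using L(1) by (rule stab_subgrp)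
 have sT: "subgrp (TT (%_. L))" by (rule stab_subgrp[OF stab_TT]) (rule L(1))
 define r where "r C = (SOME x. coset L x = C)" for C
 have r: "x - r (coset L x) : L" for x
 proof -
  have "coset L (r (coset L x)) = coset L x" unfolding r_def by (rule someI[of "%y. coset L y = coset L x"]) simp
  thus ?thesis by (simp add: coset_eq[OF sL] subgrp_diff_swap[OF sL])
 qed
 have "quo (TT (%_. L)) (TT (%_. UNIV)) \<subseteq>
  (%\<theta>. coset (TT (%_. L)) (\<Sum>a\<in>E. mon a * r (\<theta> a) ^ p)) ` (PiE E (%_. quo L UNIV))"
 proof
  fix C assume "C : quo (TT (%_. L)) (TT (%_. UNIV))"
  then obtain w where w: "C = coset (TT (%_. L)) w" "w : TT (%_. UNIV)" by (auto simp: quo_def)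
  from w(2) obtain h where h: "w \<asymp> (frc h)" by (elim TTE)
  let ?t = "restrict (%a. coset L (h a)) E"
  have "w - (\<Sum>a\<in>E. mon a * r (?t a) ^ p) \<asymp> (frc h) - (\<Sum>a\<in>E. mon a * r (?t a) ^ p)"
   by (intro cg_diff h cg_refl)
  also have "... = (\<Sum>a\<in>E. mon a * (h a ^ p - r (coset L (h a)) ^ p))"
   by (simp add: right_diff_distrib sum_subtractf)
  also have "... \<asymp> (\<Sum>a\<in>E. mon a * (h a - r (coset L (h a))) ^ p)"
   by (intro cg_sum cg_mult cg_refl cg_sym[OF frob_diff])
  finally have "w - (\<Sum>a\<in>E. mon a * r (?t a) ^ p) : TT (%_. L)"
   by (rule TTI[rotated]) (rule r)
  hence "C = coset (TT (%_. L)) (\<Sum>a\<in>E. mon a * r (?t a) ^ p)" unfolding w(1) by (simp add: coset_eq[OF sT])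
  moreover have "?t : PiE E (%_. quo L UNIV)" by (simp add: quo_def)
  ultimately show "C : (%\<theta>. coset (TT (%_. L)) (\<Sum>a\<in>E. mon a * r (\<theta> a) ^ p)) ` (PiE E (%_. quo L UNIV))"
   by blast
 qed
 thus ?thesis by (rule finite_subset) (intro finite_imageI finite_PiE finE L(2))
qed

text \<open>By freeness the coefficient of the monomial a is well defined modulo Q, which identifies the
subquotient with W/L; the operators change from W^p to W along Frobenius.\<close>
lemma len_TT_step:
 assumes L: "idl L" "finite (quo L UNIV)" "Q \<subseteq> L" and D: "a : E" "a ~: D"
 shows "len PW (TD L D) (TD L (insert a D)) = len UNIV L UNIV"
proof (rule antisym)
 let ?C = "%b. if b : D then UNIV else L"
 let ?C' = "%b. if b : insert a D then UNIV else L"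
 have iC: "idl (?C b)" "idl (?C' b)" for b using L(1) by simp_all
 have sL: "subgrp L" using L(1) by (rule stab_subgrp)
 show "len PW (TT ?C) (TT ?C') <= len UNIV L UNIV"
 proof (rule len_map[where f = "%Z. {w. mon a * w ^ p : Z}", OF _ _ sL L(2)])
  fix Z assume Z: "stab PW Z" "TT ?C \<subseteq> Z" "Z \<subseteq> TT ?C'"
  have sZ: "subgrp Z" using Z(1) by (rule stab_subgrp)
  have QZ: "Q \<subseteq> Z" using Q_TT[of ?C] iC stab_subgrp Z(2) by blast
  have "idl {w. mon a * w ^ p : Z}"
   unfolding stab_def subgrp_def
  proof (intro conjI ballI)
   show "0 : {w. mon a * w ^ p : Z}" using p_gt subgrp_zero[OF sZ] by (simp add: zero_power)
  next
   fix x y assume xy: "x : {w. mon a * w ^ p : Z}" "y : {w. mon a * w ^ p : Z}"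
   have "mon a * (x - y) ^ p \<asymp> mon a * (x ^ p - y ^ p)" by (intro cg_mult cg_refl frob_diff)
   hence "mon a * (x - y) ^ p - (mon a * x ^ p - mon a * y ^ p) : Z"
    using QZ unfolding cg_def by (auto simp: right_diff_distrib)
   moreover have "mon a * x ^ p - mon a * y ^ p : Z" using xy by (intro subgrp_diff[OF sZ]) simp_all
   ultimately show "x - y : {w. mon a * w ^ p : Z}" using subgrp_cong[OF sZ] by blast
  next
   fix r x assume "x : {w. mon a * w ^ p : Z}"
   moreover have "r ^ p : PW" unfolding PW_def by blast
   ultimately have "r ^ p * (mon a * x ^ p) : Z" using stab_mult[OF Z(1)] by blast
   thus "r * x : {w. mon a * w ^ p : Z}" by (simp add: power_mult_distrib ac_simps)
  qed
  moreover have "L \<subseteq> {w. mon a * w ^ p : Z}"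
  proof
   fix w assume "w : L"
   hence "w : ?C a" using D(2) by simp
   hence "mon a * w ^ p : TT ?C" by (rule mon_TT[OF D(1) _ stab_subgrp[OF iC(1)]])
   thus "w : {w. mon a * w ^ p : Z}" using Z(2) by blast
  qed
  ultimately show "idl {w. mon a * w ^ p : Z} & L \<subseteq> {w. mon a * w ^ p : Z} & {w. mon a * w ^ p : Z} \<subseteq> UNIV"
   by simp
 next
  fix Z Z' assume Z: "stab PW Z" "stab PW Z'" "TT ?C \<subseteq> Z" "Z \<subset> Z'" "Z' \<subseteq> TT ?C'"
  have sZ: "subgrp Z" "subgrp Z'" using Z(1,2) by (auto intro: stab_subgrp)
  obtain z where z: "z : Z'" "z ~: Z" using Z(4) by blast
  hence "z : TT ?C'" using Z(5) by blast
  then obtain h where h: "ALL b:E. h b : ?C' b" "z \<asymp> (\<Sum>b\<in>E. mon b * h b ^ p)" by (elim TTE)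
  have "z - mon a * h a ^ p \<asymp> (\<Sum>b\<in>E. mon b * h b ^ p) - mon a * h a ^ p" by (intro cg_diff h cg_refl)
  also have "... = (\<Sum>b\<in>E - {a}. mon b * h b ^ p)" using D(1) finE by (simp add: sum_diff1)
  also have "... = mon a * 0 ^ p + (\<Sum>b\<in>E - {a}. mon b * (if b = a then 0 else h b) ^ p)"
  proof -
   have "(\<Sum>b\<in>E - {a}. mon b * h b ^ p) = (\<Sum>b\<in>E - {a}. mon b * (if b = a then 0 else h b) ^ p)"
    by (rule sum.cong) simp_all
   thus ?thesis using p_gt by (simp add: zero_power)
  qed
  also have "... = (\<Sum>b\<in>E. mon b * (if b = a then 0 else h b) ^ p)"
   using sum.remove[OF finE D(1), of "%b. mon b * (if b = a then 0 else h b) ^ p"] by simp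
  finally have "z - mon a * h a ^ p : TT ?C"
  proof (rule TTI[rotated])
   fix b assume "b : E"
   from bspec[OF h(1) this] show "(if b = a then 0 else h b) : ?C b"
    using D(2) subgrp_zero[OF sL] by (cases "b = a"; cases "b : D") simp_all
  qed
  hence zZ: "z - mon a * h a ^ p : Z" "z - mon a * h a ^ p : Z'" using Z by blast+
  hence "h a ~: {w. mon a * w ^ p : Z}" "h a : {w. mon a * w ^ p : Z'}"
   using z subgrp_cong[OF sZ(1)] subgrp_cong[OF sZ(2)] by blast+
  thus "{w. mon a * w ^ p : Z} \<subset> {w. mon a * w ^ p : Z'}" using Z(4) by blast
 qed
 let ?U = "%N. TT (?C(a := N))"
 have finTT: "finite (quo (TT ?C) (TT ?C'))"
 proof (rule finite_quo_mono[OF finite_quo_TT[OF L(1,2)]])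
  show "subgrp (TT (%_. L))" by (rule stab_subgrp[OF stab_TT]) (rule L(1))
  show "subgrp (TT ?C)" by (rule stab_subgrp[OF stab_TT]) (rule iC)
  show "TT (%_. L) \<subseteq> TT ?C" by (rule TT_mono) simp
  show "TT ?C' \<subseteq> TT (%_. UNIV)" by (rule TT_mono) simp
 qed
 show "len UNIV L UNIV <= len PW (TT ?C) (TT ?C')"
 proof (rule len_map[where f = ?U])
  fix N assume N: "idl N" "L \<subseteq> N"
  have "stab PW (?U N)" by (rule stab_TT) (use iC N in simp)
  moreover have "TT ?C \<subseteq> ?U N" by (rule TT_mono) (use D N in auto)
  moreover have "?U N \<subseteq> TT ?C'" by (rule TT_mono) auto
  ultimately show "stab PW (?U N) & TT ?C \<subseteq> ?U N & ?U N \<subseteq> TT ?C'" by blast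
 next
  fix N N' assume N: "idl N" "idl N'" "L \<subseteq> N" "N \<subset> N'"
  have "?U N \<subseteq> ?U N'" by (rule TT_mono) (use N in auto)
  moreover obtain n where n: "n : N'" "n ~: N" using N(4) by blast
  have "mon a * n ^ p : ?U N'"
  proof (rule mon_TT[OF D(1)])
   show "n : (?C(a := N')) a" using n(1) by simp
   show "subgrp ((?C(a := N')) b)" for b
    using sL stab_subgrp[OF N(2)] by simp
  qed
  moreover have "mon a * n ^ p ~: ?U N"
  proof
   assume "mon a * n ^ p : ?U N"
   then obtain h where h: "ALL b:E. h b : (?C(a := N)) b" "mon a * n ^ p \<asymp> (\<Sum>b\<in>E. mon b * h b ^ p)" by (elim TTE)
   have "(\<Sum>b\<in>E. mon b * (if b = a then n else 0) ^ p) = (\<Sum>b\<in>E. if b = a then mon b * n ^ p else 0)"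
    using p_gt by (intro sum.cong refl) (simp add: zero_power)
   also have "... = mon a * n ^ p" using D(1) finE by (simp add: sum.delta)
   finally have "(\<Sum>b\<in>E. mon b * (if b = a then n else 0) ^ p) \<asymp> (\<Sum>b\<in>E. mon b * h b ^ p)" using h(2) by simp
   from free_diff[OF this D(1)] have "n - h a : Q" by simp
   moreover have "h a : N" using bspec[OF h(1) D(1)] by simp
   ultimately have "n : N" using L(3) N subgrp_cong[OF stab_subgrp[OF N(1)], of n "h a"] by blast
   thus False using n by simp
  qed
  ultimately show "?U N \<subset> ?U N'" by blast
 next
  show "subgrp (TT ?C)" by (rule stab_subgrp[OF stab_TT]) (rule iC)
 qed (rule finTT)
qed

lemma len_TT:
 assumes L: "idl L" "finite (quo L UNIV)" "Q \<subseteq> L"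
 shows "len PW (TT (%_. L)) SS = p ^ card V * len UNIV L UNIV"
proof -
 have st: "stab PW (TD L D)" for D by (rule stab_TT) (use L(1) in simp)
 have le: "TD L D \<subseteq> TD L D'" if "D \<subseteq> D'" for D D'
  by (rule TT_mono) (use that in auto)
 have "finite D ==> D \<subseteq> E ==> len PW (TD L {}) (TD L D)
   = card D * len UNIV L UNIV" for D
 proof (induction D rule: finite_induct)
  case empty
  let ?T = "TD L {}"
  have "n = 0" if "chn PW ?T ?T Z n" for Z n
  proof (rule ccontr)
   assume "n ~= 0"
   thus False using chnD[OF that, of 0] chnD[OF that, of "Suc 0"] by auto
  qed
  hence "len PW ?T ?T <= 0" by (intro len_le) blast
  thus ?case by simp
 next
  case (insert a D)
  have fin: "finite (quo (TD L {}) (TD L (insert a D)))"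
  proof (rule finite_quo_mono[OF finite_quo_TT[OF L(1,2)]])
   show "subgrp (TT (%_. L))" by (rule stab_subgrp[OF stab_TT]) (rule L(1))
   show "subgrp (TD L {})" by (rule stab_subgrp[OF st])
   show "TT (%_. L) \<subseteq> TD L {}" by (rule TT_mono) simp
   show "TD L (insert a D) \<subseteq> TT (%_. UNIV)" by (rule TT_mono) simp
  qed
  have "len PW (TD L {}) (TD L (insert a D))
   = len PW (TD L {}) (TD L D)
   + len PW (TD L D) (TD L (insert a D))"
   by (rule len_additive[OF st st st le le fin]) auto
  also have "len PW (TD L D) (TD L (insert a D)) = len UNIV L UNIV"
   by (rule len_TT_step[OF L]) (use insert in auto)
  finally show ?case using insert by simp
 qed
 from this[OF finE order_refl]
 have "len PW (TT (%_. L)) (TD L E) = p ^ card V * len UNIV L UNIV"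
  unfolding cardE by simp
 also have "TD L E = SS" unfolding SS_TT by (rule TT_cong) simp
 finally show ?thesis .
qed

end

lemma subgrp_preimage_mult:
 fixes g :: "'w::comm_ring_1"
 assumes "subgrp N" shows "idl {x. ALL w. g * (w * x) : N}"
 unfolding stab_def subgrp_def
proof (intro conjI ballI)
 show "0 : {x. ALL w. g * (w * x) : N}" using subgrp_zero[OF assms] by simp
next
 fix x y assume "x : {x. ALL w. g * (w * x) : N}" "y : {x. ALL w. g * (w * x) : N}"
 thus "x - y : {x. ALL w. g * (w * x) : N}"
  using subgrp_diff[OF assms] by (auto simp: right_diff_distrib)
next
 fix r x assume "x : {x. ALL w. g * (w * x) : N}"
 hence "g * ((w * r) * x) : N" for w by blast
 thus "r * x : {x. ALL w. g * (w * x) : N}" by (simp add: ac_simps)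
qed

lemma len_self: "len \<Omega> N N = 0"
proof -
 have "n = 0" if "chn \<Omega> N N Z n" for Z n
 proof (rule ccontr)
  assume "n ~= 0"
  thus False using chnD[OF that, of 0] chnD[OF that, of "Suc 0"] by auto
 qed
 hence "len \<Omega> N N <= 0" by (intro len_le) blast
 thus ?thesis by simp
qed

context char_modulus
begin

lemma FP_idl: "idl (FP Q J q)" unfolding FP_def by (rule idl_gid)
lemma FP_Q: "Q \<subseteq> FP Q J q" unfolding FP_def using gid_incl[of "{w ^ q | w. w : J} \<union> Q"] by blast
lemma FP_pow: "w : J ==> w ^ q : FP Q J q"
 unfolding FP_def using gid_incl[of "{w ^ q | w. w : J} \<union> Q"] by blast
lemma FP_least: "idl N ==> Q \<subseteq> N ==> (!!w. w : J ==> w ^ q : N) ==> FP Q J q \<subseteq> N"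
 unfolding FP_def by (rule gid_least) auto

lemma frob_preimage_idl:
 assumes N: "idl N" "Q \<subseteq> N"
 shows "idl {x. x ^ p : N}"
 unfolding stab_def subgrp_def
proof (intro conjI ballI)
 have sN: "subgrp N" using N(1) by (rule stab_subgrp)
 show "0 : {x. x ^ p : N}" using p_gt subgrp_zero[OF sN] by (simp add: zero_power)
 fix x y assume "x : {x. x ^ p : N}" "y : {x. x ^ p : N}"
 hence "x ^ p - y ^ p : N" by (intro subgrp_diff[OF sN]) simp_all
 moreover have "(x - y) ^ p - (x ^ p - y ^ p) : N" using frob_diff[of x y] N(2) unfolding cg_def by blast
 ultimately show "x - y : {x. x ^ p : N}" using subgrp_cong[OF sN] by blast
next
 fix r x assume "x : {x. x ^ p : N}"
 thus "r * x : {x. x ^ p : N}" using idl_mult[OF N(1)] by (simp add: power_mult_distrib)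
qed

lemma FP_step:
 shows "l : FP Q J q ==> l ^ p : FP Q J (q * p)"
  and "idl N ==> Q \<subseteq> N ==> (!!l. l : FP Q J q ==> l ^ p : N) ==> FP Q J (q * p) \<subseteq> N"
proof -
 have "FP Q J q \<subseteq> {x. x ^ p : FP Q J (q * p)}"
 proof (rule FP_least[OF frob_preimage_idl[OF FP_idl FP_Q]])
  show "Q \<subseteq> {x. x ^ p : FP Q J (q * p)}" using frob_mem FP_Q by blast
  fix w assume "w : J"
  thus "w ^ q : {x. x ^ p : FP Q J (q * p)}" using FP_pow[of w J "q * p"] by (simp add: power_mult)
 qed
 thus "l : FP Q J q ==> l ^ p : FP Q J (q * p)" by blast
 assume N: "idl N" "Q \<subseteq> N" "!!l. l : FP Q J q ==> l ^ p : N"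
 show "FP Q J (q * p) \<subseteq> N"
 proof (rule FP_least[OF N(1,2)])
  fix w assume "w : J"
  hence "(w ^ q) ^ p : N" using N(3) FP_pow by blast
  thus "w ^ (q * p) : N" by (simp add: power_mult)
 qed
qed

lemma frob_sum_n: "(\<Sum>i\<in>I. f i) ^ (p ^ n) \<asymp> (\<Sum>i\<in>I. f i ^ (p ^ n))"
proof (induction n)
 case (Suc n)
 have "(\<Sum>i\<in>I. f i) ^ (p ^ Suc n) = ((\<Sum>i\<in>I. f i) ^ (p ^ n)) ^ p" by (simp add: power_mult[symmetric] mult.commute)
 also have "... \<asymp> (\<Sum>i\<in>I. f i ^ (p ^ n)) ^ p" by (rule cg_pow[OF Suc])
 also have "... \<asymp> (\<Sum>i\<in>I. (f i ^ (p ^ n)) ^ p)" by (rule frob_sum)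
 also have "... = (\<Sum>i\<in>I. f i ^ (p ^ Suc n))" by (simp add: power_mult[symmetric] mult.commute)
 finally show ?case .
qed simp

lemma frob_diff_n: "(a - b) ^ (p ^ n) \<asymp> a ^ (p ^ n) - b ^ (p ^ n)"
proof (induction n)
 case (Suc n)
 have e: "x ^ (p ^ Suc n) = (x ^ (p ^ n)) ^ p" for x :: 'w by (simp add: power_mult[symmetric] mult.commute)
 have "((a - b) ^ (p ^ n)) ^ p \<asymp> (a ^ (p ^ n) - b ^ (p ^ n)) ^ p" by (rule cg_pow[OF Suc])
 also have "... \<asymp> (a ^ (p ^ n)) ^ p - (b ^ (p ^ n)) ^ p" by (rule frob_diff)
 finally show ?case unfolding e .
qed simp

lemma frob_int_n: "of_int k ^ (p ^ n) \<asymp> of_int k"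
proof (induction n)
 case (Suc n)
 have "of_int k ^ (p ^ Suc n) = (of_int k ^ (p ^ n)) ^ p" by (simp add: power_mult[symmetric] mult.commute)
 also have "... \<asymp> of_int k ^ p" by (rule cg_pow[OF Suc])
 also have "... \<asymp> of_int k" by (rule frob_int)
 finally show ?case .
qed simp


text \<open>N\'/N is a one-dimensional space over a finite residue field, on which Frobenius is surjective; so
W^p-stable subgroups between N and N\' are ideals.\<close>
lemma frob_simple:
 assumes N: "idl N" "idl N'" "N \<subset> N'" "finite (quo K UNIV)" "idl K" "K \<subseteq> N"
  and simple: "!!Z. idl Z ==> N \<subset> Z ==> Z \<subseteq> N' ==> Z = N'" and QN: "Q \<subseteq> N"
  and Z: "stab {w ^ p | w. True} Z" "N \<subset> Z" "Z \<subseteq> N'"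
 shows "Z = N'"
proof
 show "N' \<subseteq> Z"
 proof
  fix z assume z: "z : N'"
  obtain v where v: "v : Z" "v ~: N" using Z(2) by blast
  have sN: "subgrp N" and sZ: "subgrp Z" using N(1) Z(1) by (auto intro: stab_subgrp)
  let ?m = "{w. w * v : N}"
  have gen: "EX r. x - r * u : N" if u: "u : N'" "u ~: N" and x: "x : N'" for u x
  proof -
   let ?I = "{y. EX r. y - r * u : N}"
   have "idl ?I" unfolding stab_def subgrp_def
   proof (intro conjI ballI)
    show "0 : ?I" using subgrp_zero[OF sN] by (auto intro: exI[of _ 0])
    fix y y' assume "y : ?I" "y' : ?I"
    then obtain r r' where r: "y - r * u : N" "y' - r' * u : N" by blast
    have "(y - r * u) - (y' - r' * u) : N" by (rule subgrp_diff[OF sN r])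
    hence "(y - y') - (r - r') * u : N" by (simp add: algebra_simps)
    thus "y - y' : ?I" by blast
   next
    fix s y assume "y : ?I"
    then obtain r where "y - r * u : N" by blast
    hence "s * (y - r * u) : N" by (rule idl_mult[OF N(1)])
    hence "s * y - (s * r) * u : N" by (simp add: algebra_simps)
    thus "s * y : ?I" by blast
   qed
   moreover have "N \<subset> ?I"
   proof -
    have "y - 0 * u : N" if "y : N" for y using that by simp
    hence "N \<subseteq> ?I" by blast
    moreover have "u - 1 * u : N" using subgrp_zero[OF sN] by simp
    hence "u : ?I" by blast
    ultimately show ?thesis using u(2) by blast
   qed
   moreover have "?I \<subseteq> N'"
   proof
    fix y assume "y : ?I"
    then obtain r where "y - r * u : N" by blast
    hence "y - r * u : N'" using N(3) by blast
    moreover have "r * u : N'" by (rule idl_mult[OF N(2) u(1)])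
    ultimately show "y : N'" using subgrp_cong[OF stab_subgrp[OF N(2)]] by blast
   qed
   ultimately have "?I = N'" by (rule simple)
   thus ?thesis using x by blast
  qed
  have vN': "v : N'" using v Z(3) by blast
  have idm: "idl ?m" unfolding stab_def subgrp_def
  proof (intro conjI ballI)
   show "0 : ?m" using subgrp_zero[OF sN] by simp
   fix x y assume "x : ?m" "y : ?m"
   thus "x - y : ?m" using subgrp_diff[OF sN] by (simp add: left_diff_distrib)
  next
   fix r x assume "x : ?m" thus "r * x : ?m" using idl_mult[OF N(1)] by (simp add: mult.assoc)
  qed
  have sm: "subgrp ?m" using idm by (rule stab_subgrp)
  have primem: "b : ?m" if "a * b : ?m" "a ~: ?m" for a b
  proof -
   have "a * v : N'" by (rule idl_mult[OF N(2) vN'])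
   moreover have "a * v ~: N" using that(2) by simp
   ultimately obtain r where "v - r * (a * v) : N" using gen vN' by blast
   hence "b * (v - r * (a * v)) : N" by (rule idl_mult[OF N(1)])
   hence 1: "b * v - r * (a * b * v) : N" by (simp add: algebra_simps)
   have "r * (a * b * v) : N" by (rule idl_mult[OF N(1)]) (use that(1) in simp)
   hence "b * v : N" using subgrp_cong[OF sN 1] by blast
   thus ?thesis by simp
  qed
  have powm: "x : ?m" if "x ^ k : ?m" "k > 0" for x k
   using that
  proof (induction k)
   case (Suc k)
   show ?case
   proof (cases "x : ?m")
    case False
    hence "x ^ k : ?m" using primem[of x "x ^ k"] Suc.prems by simp
    thus ?thesis using Suc.IH False v by (cases "k = 0") auto
   qed
  qed simp
  have Km: "K \<subseteq> ?m" using idl_mult2[OF N(5)] N(6) by blast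
  have Qm: "Q \<subseteq> ?m" using idl_mult2[OF idl] QN by blast
  have finm: "finite (quo ?m UNIV)"
   by (rule finite_quo_mono[OF N(4) stab_subgrp[OF N(5)] sm Km order_refl])
  let ?f = "%C. coset ?m ((SOME x. coset ?m x = C) ^ p)"
  have some: "coset ?m (SOME x. coset ?m x = C) = C" if "C : quo ?m UNIV" for C
  proof -
   from that obtain x where "coset ?m x = C" by (auto simp: quo_def)
   thus ?thesis by (rule someI)
  qed
  have inj: "inj_on ?f (quo ?m UNIV)"
  proof (rule inj_onI)
   fix C C' assume C: "C : quo ?m UNIV" "C' : quo ?m UNIV" "?f C = ?f C'"
   define x where "x = (SOME x. coset ?m x = C)"
   define y where "y = (SOME x. coset ?m x = C')"
   have 1: "x ^ p - y ^ p : ?m" using C(3) unfolding x_def y_def by (simp add: coset_eq[OF sm])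
   have "(x - y) ^ p - (x ^ p - y ^ p) : ?m" using frob_diff[of x y] Qm unfolding cg_def by blast
   hence "(x - y) ^ p : ?m" using subgrp_cong[OF sm] 1 by blast
   hence "x - y : ?m" using powm p_gt(2) by blast
   hence "coset ?m x = coset ?m y" by (simp add: coset_eq[OF sm])
   thus "C = C'" using some[OF C(1)] some[OF C(2)] unfolding x_def y_def by simp
  qed
  have "?f ` quo ?m UNIV \<subseteq> quo ?m UNIV" unfolding quo_def by blast
  hence surj: "?f ` quo ?m UNIV = quo ?m UNIV" by (rule endo_inj_surj[OF finm _ inj])
  obtain w where w: "z - w * v : N" using gen[OF vN' v(2) z] by blast
  have "coset ?m w : ?f ` quo ?m UNIV" unfolding surj by (simp add: quo_def)
  then obtain C where C: "coset ?m w = ?f C" by blast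
  define u where "u = (SOME x. coset ?m x = C)"
  have "w - u ^ p : ?m" using C unfolding u_def by (simp add: coset_eq[OF sm])
  hence "w * v - u ^ p * v : N" by (simp add: left_diff_distrib)
  hence "z - u ^ p * v : N" using subgrp_trans[OF sN w] by blast
  hence "z - u ^ p * v : Z" using Z(2) by blast
  moreover have "u ^ p * v : Z" using stab_mult[OF Z(1) _ v(1)] by blast
  ultimately show "z : Z" using subgrp_cong[OF sZ] by blast
 qed
qed (rule Z(3))

text \<open>Refine to a chain with simple subquotients and apply frob_simple to each of them.\<close>
lemma len_frob:
 assumes K: "idl K" "finite (quo K UNIV)" "Q \<subseteq> K"
 shows "len {w ^ p | w. True} K UNIV <= len UNIV K UNIV"
proof -
 let ?PW = "{w ^ p | w. True} :: 'w set"
 have sK: "subgrp K" using K(1) by (rule stab_subgrp)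
 let ?l = "len UNIV K UNIV"
 obtain Z where Z: "chn UNIV K UNIV Z ?l" using len_chain[OF K(1) stab_UNIV _ K(2)] by blast
 have st: "stab ?PW (Z i)" if "i <= ?l" for i using chnD(1)[OF Z that] by (rule idl_stab)
 have fin: "finite (quo K T)" for T using finite_subset[OF quo_mono K(2)] by blast
 have longer: "False" if "chn UNIV K UNIV Z' (Suc ?l)" for Z'
  using len_ge[OF that sK K(2)] by simp
 have top: "Z ?l = UNIV"
 proof (rule ccontr)
  assume ne: "Z ?l ~= UNIV"
  have "chn UNIV K UNIV (%i. if i <= ?l then Z i else UNIV) (Suc ?l)"
   unfolding chn_def using chnD[OF Z] ne by (auto simp: le_Suc_eq less_Suc_eq)
  thus False by (rule longer)
 qed
 have bot: "Z 0 = K"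
 proof (rule ccontr)
  assume ne: "Z 0 ~= K"
  have "chn UNIV K UNIV (%i. case i of 0 => K | Suc j => Z j) (Suc ?l)"
   unfolding chn_def
  proof (intro conjI allI impI)
   fix i assume i: "i <= Suc ?l"
   show "idl (case i of 0 => K | Suc j => Z j)" "K \<subseteq> (case i of 0 => K | Suc j => Z j)"
    "(case i of 0 => K | Suc j => Z j) \<subseteq> UNIV"
    using chnD(1,3)[OF Z, of "i - 1"] i K(1) by (cases i; simp)+
  next
   fix i assume i: "i < Suc ?l"
   have "K \<subset> Z 0" using chnD(3)[OF Z, of 0] ne by blast
   thus "(case i of 0 => K | Suc j => Z j) \<subset> (case Suc i of 0 => K | Suc j => Z j)"
    using chnD(5)[OF Z, of "i - 1"] i by (cases i) simp_all
  qed
  thus False by (rule longer)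
 qed
 have simple: "T = Z (Suc i)" if i: "i < ?l" and T: "idl T" "Z i \<subset> T" "T \<subseteq> Z (Suc i)" for i T
 proof (rule ccontr)
  assume "T ~= Z (Suc i)"
  hence lt: "T \<subset> Z (Suc i)" using T by blast
  have "chn UNIV K UNIV (%j. if j <= i then Z j else if j = Suc i then T else Z (j - 1)) (Suc ?l)"
   unfolding chn_def
  proof (intro conjI allI impI)
   fix j assume j: "j <= Suc ?l"
   let ?x = "if j <= i then Z j else if j = Suc i then T else Z (j - 1)"
   have KT: "K \<subseteq> T" using chnD(3)[OF Z, of i] i T(2) by auto
   show "idl ?x" using chnD(1)[OF Z, of j] chnD(1)[OF Z, of "j - 1"] i j T(1) by simp
   show "K \<subseteq> ?x" using chnD(3)[OF Z, of j] chnD(3)[OF Z, of "j - 1"] i j KT by simp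
   show "?x \<subseteq> UNIV" by simp
  next
   fix j assume j: "j < Suc ?l"
   consider "j < i" | "j = i" | "j = Suc i" | "j > Suc i" by linarith
   thus "(if j <= i then Z j else if j = Suc i then T else Z (j - 1)) \<subset>
    (if Suc j <= i then Z (Suc j) else if Suc j = Suc i then T else Z (Suc j - 1))"
   proof cases
    case 1 thus ?thesis using chnD(5)[OF Z, of j] i by simp
   next
    case 2 thus ?thesis using T(2) by simp
   next
    case 3 thus ?thesis using lt by simp
   next
    case 4
    thus ?thesis using chnD(5)[OF Z, of "j - 1"] j by simp
   qed
  qed
  thus False by (rule longer)
 qed
 have one: "len ?PW (Z i) (Z (Suc i)) <= 1" if i: "i < ?l" for i
 proof (rule len_le)
  fix n T assume T: "chn ?PW (Z i) (Z (Suc i)) T n"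
  have eq: "T j = Z (Suc i)" if j: "j <= n" "Z i \<subset> T j" for j
  proof (rule frob_simple[OF _ _ _ K(2,1)])
   show "idl (Z i)" "K \<subseteq> Z i" using chnD(1,3)[OF Z, of i] i by simp_all
   show "Q \<subseteq> Z i" using chnD(3)[OF Z, of i] i K(3) by auto
   show "idl (Z (Suc i))" using chnD(1)[OF Z, of "Suc i"] i by simp
   show "Z i \<subset> Z (Suc i)" using chnD(5)[OF Z i] .
   show "!!Za. idl Za ==> Z i \<subset> Za ==> Za \<subseteq> Z (Suc i) ==> Za = Z (Suc i)" by (rule simple[OF i])
   show "stab ?PW (T j)" "T j \<subseteq> Z (Suc i)" using chnD(1,4)[OF T] j by simp_all
   show "Z i \<subset> T j" by (rule j(2))
  qed
  show "n <= 1"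
  proof (rule ccontr)
   assume "~ n <= 1"
   hence n: "2 <= n" by simp
   have "Z i \<subseteq> T 0" "T 0 \<subset> T (Suc 0)" "T (Suc 0) \<subset> T (Suc (Suc 0))" "T (Suc (Suc 0)) \<subseteq> Z (Suc i)"
    using chnD(3)[OF T, of 0] chnD(5)[OF T, of 0] chnD(5)[OF T, of 1] chnD(4)[OF T, of 2] n
    by (simp_all add: numeral_2_eq_2)
   moreover have "T (Suc 0) = Z (Suc i)" using n calculation by (intro eq) auto
   ultimately show False by blast
  qed
 qed
 have "i <= ?l ==> len ?PW K (Z i) <= i" for i
 proof (induction i)
  case 0 thus ?case by (simp add: bot len_self)
 next
  case (Suc i)
  have i: "i <= ?l" "i < ?l" using Suc.prems by simp_all
  have "len ?PW K (Z (Suc i)) = len ?PW K (Z i) + len ?PW (Z i) (Z (Suc i))"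
   by (rule len_additive[OF idl_stab[OF K(1)] st st chnD(3)[OF Z] _ fin])
     (use i Suc.prems chnD(5)[OF Z i(2)] in auto)
  thus ?case using Suc.IH[OF i(1)] one[OF i(2)] by linarith
 qed
 from this[of ?l] show ?thesis by (simp add: top)
qed

end

lemma ssum_mono: "N \<subseteq> N' ==> M \<subseteq> M' ==> ssum N M \<subseteq> ssum N' M'"
 unfolding ssum_def by blast

context red
begin

lemma stab_PW: "idl N ==> stab PW N" by (rule idl_stab)

lemma stab_PW_SS: "stab PW SS" unfolding SS_TT by (rule stab_TT) simp

lemma frob_pow_TT:
 assumes "idl L" "w : SS" "l : L" shows "w * l ^ p : TT (%_. L)"
proof -
 from assms(2) obtain h where h: "w \<asymp> (frc h)" unfolding SS_TT by (elim TTE)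
 have "w * l ^ p \<asymp> (frc h) * l ^ p" by (intro cg_mult h cg_refl)
 also have "... = (\<Sum>a\<in>E. mon a * (h a * l) ^ p)"
  unfolding sum_distrib_right by (intro sum.cong refl) (simp add: power_mult_distrib ac_simps)
 finally show ?thesis by (rule TTI[rotated]) (rule idl_mult[OF assms(1,3)])
qed

text \<open>L2 is the p-th Frobenius power of L, and T the semilinear sum of L; by len_TT the length of SS/T
over W^p is p^d times the length of W/L. First inequality: (L2 + SS)/L2 is a quotient of SS/T, and
W/(L2 + SS) is killed by \<gamma>. Second inequality: (T + \<gamma>W)/T is a quotient of W/L2, and
SS/(T + \<gamma>W) is killed by \<gamma>; the length of W/L2 over W^p is at most the one over W by
len_frob. In both cases index_bound controls the part killed by \<gamma>.\<close>
lemma len_compare: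
 assumes L: "idl L" "Q \<subseteq> L" "finite (quo L UNIV)"
  and L2: "idl L2" "Q \<subseteq> L2" "finite (quo L2 UNIV)"
  and up: "!!l. l : L ==> l ^ p : L2"
  and least: "!!N. idl N ==> Q \<subseteq> N ==> (!!l. l : L ==> l ^ p : N) ==> L2 \<subseteq> N"
  and \<gamma>: "\<gamma> : Pol {..<M} \<delta>" "\<gamma> ~: Q" "!!w. \<gamma> * w : SS"
  and num: "NN (s + \<delta>) <= p ^ k * NN s"
  and cov: "UNIV \<subseteq> ssum (Pol {..<M} (s + \<delta>)) L2" "SS \<subseteq> ssum (Pol {..<M} (s + \<delta>)) (TT (%_. L))"
 shows "len UNIV L2 UNIV <= p ^ card V * len UNIV L UNIV + k"
  and "p ^ card V * len UNIV L UNIV <= len UNIV L2 UNIV + k"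
proof -
 let ?T = "TT (%_. L)"
 have stT: "stab PW ?T" by (rule stab_TT) (rule L(1))
 have sT: "subgrp ?T" using stT by (rule stab_subgrp)
 have stSS: "stab PW SS" by (rule stab_PW_SS)
 have sS: "subgrp SS" using stSS by (rule stab_subgrp)
 have sL2: "subgrp L2" using L2(1) by (rule stab_subgrp)
 have TS: "?T \<subseteq> SS" unfolding SS_TT by (rule TT_mono) simp
 have QT: "Q \<subseteq> ?T" by (rule Q_TT) (rule stab_subgrp[OF L(1)])
 have TL2: "?T \<subseteq> L2"
 proof
  fix w assume "w : ?T"
  then obtain h where h: "ALL a:E. h a : L" "w \<asymp> (frc h)" by (elim TTE)
  have "(frc h) : L2"
   by (intro subgrp_sum[OF sL2] idl_mult[OF L2(1)] up) (use h in blast)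
  moreover have "w - (frc h) : L2" using h(2) L2(2) unfolding cg_def by blast
  ultimately show "w : L2" using subgrp_cong[OF sL2] by blast
 qed
 have \<gamma>L2: "\<gamma> * x : ?T" if "x : L2" for x
 proof -
  have "L2 \<subseteq> {x. ALL w. \<gamma> * (w * x) : ?T}"
  proof (rule least)
   show "idl {x. ALL w. \<gamma> * (w * x) : ?T}" by (rule subgrp_preimage_mult[OF sT])
   show "Q \<subseteq> {x. ALL w. \<gamma> * (w * x) : ?T}" using QT idl_mult[OF idl] by blast
   fix l assume "l : L"
   from frob_pow_TT[OF L(1) \<gamma>(3) this] show "l ^ p : {x. ALL w. \<gamma> * (w * x) : ?T}"
    by (simp add: mult.assoc)
  qed
  hence "\<gamma> * (1 * x) : ?T" using that by blast
  thus ?thesis by simp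
 qed
 have finTS: "finite (quo ?T SS)" unfolding SS_TT by (rule finite_quo_TT[OF L(1,3)])
 have lenTS: "len PW ?T SS = p ^ card V * len UNIV L UNIV" by (rule len_TT[OF L(1,3,2)])
 have finL2: "finite (quo L2 T)" for T using finite_subset[OF quo_mono L2(3)] by blast
 have pQ': "of_nat p * x : N" if "Q \<subseteq> N" for x N using p_mult that by blast
 let ?K = "ssum L2 SS"
 have stK: "stab PW ?K" by (rule stab_ssum[OF stab_PW[OF L2(1)] stSS])
 have L2K: "L2 \<subseteq> ?K" by (rule ssum_left[OF sS])
 have SK: "SS \<subseteq> ?K" by (rule ssum_right[OF sL2])
 have KK: "finite (quo ?K UNIV)" "card (quo ?K UNIV) <= p ^ k"
 proof -
  have 1: "subgrp ?K" using stK by (rule stab_subgrp)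
  have 2: "Q \<subseteq> ?K" using L2(2) L2K by blast
  have 3: "\<gamma> * w : ?K" for w using \<gamma>(3) SK by blast
  have 4: "UNIV \<subseteq> ssum (Pol {..<M} (s + \<delta>)) ?K"
   by (rule order_trans[OF cov(1) ssum_mono[OF order_refl L2K]])
  show "finite (quo ?K UNIV)" by (rule index_bound(1)[OF 1 2 \<gamma>(1,2) 3 4 num])
  show "card (quo ?K UNIV) <= p ^ k" by (rule index_bound(2)[OF 1 2 \<gamma>(1,2) 3 4 num])
 qed
 have "len UNIV L2 UNIV <= len PW L2 UNIV" by (rule len_mono[OF sL2 L2(3)]) auto
 also have "... = len PW L2 ?K + len PW ?K UNIV"
  by (rule len_additive[OF stab_PW[OF L2(1)] stK stab_UNIV L2K _ L2(3)]) simp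
 also have "len PW L2 ?K <= len PW (L2 \<inter> SS) SS"
 proof (rule len_second_iso[OF stab_PW[OF L2(1)] stSS])
  show "finite (quo (L2 \<inter> SS) SS)"
   by (rule finite_quo_mono[OF finTS sT stab_subgrp[OF stab_Int[OF stab_PW[OF L2(1)] stSS]]])
     (use TL2 TS in blast)+
 qed
 also have "len PW (L2 \<inter> SS) SS <= len PW ?T SS"
  by (rule len_mono[OF sT finTS]) (use TL2 TS in blast)+
 also have "len PW ?K UNIV <= k"
  by (rule len_le_log[OF stab_subgrp[OF stK] KK(1) pp _ KK(2)]) (rule pQ', use L2(2) L2K in blast)
 finally show "len UNIV L2 UNIV <= p ^ card V * len UNIV L UNIV + k" by (simp add: lenTS)
 define G where "G N = {x. EX w:N. x \<asymp> \<gamma> * w}" for N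
 have stG: "stab PW (G N)" if "idl N" for N
  unfolding stab_def subgrp_def G_def
 proof (intro conjI ballI)
  have sN: "subgrp N" using that by (rule stab_subgrp)
  have "0 \<asymp> \<gamma> * 0" by simp
  thus "0 : {x. EX w:N. x \<asymp> \<gamma> * w}" using subgrp_zero[OF sN] by blast
  fix x y assume "x : {x. EX w:N. x \<asymp> \<gamma> * w}" "y : {x. EX w:N. x \<asymp> \<gamma> * w}"
  then obtain w w' where w: "w : N" "w' : N" "x \<asymp> \<gamma> * w" "y \<asymp> \<gamma> * w'" by blast
  have "x - y \<asymp> \<gamma> * (w - w')" using cg_diff[OF w(3,4)] by (simp add: right_diff_distrib)
  thus "x - y : {x. EX w:N. x \<asymp> \<gamma> * w}" using subgrp_diff[OF sN w(1,2)] by blast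
 next
  fix r x assume "x : {x. EX w:N. x \<asymp> \<gamma> * w}"
  then obtain w where w: "w : N" "x \<asymp> \<gamma> * w" by blast
  have "r * x \<asymp> \<gamma> * (r * w)" using cg_mult[OF cg_refl w(2), of r] by (simp add: ac_simps)
  thus "r * x : {x. EX w:N. x \<asymp> \<gamma> * w}" using idl_mult[OF that w(1)] by blast
 qed
 have stGU: "stab PW (G UNIV)" by (rule stG) simp
 have GS: "G UNIV \<subseteq> SS" unfolding G_def using SS_cg \<gamma>(3) by blast
 have GT: "G L2 \<subseteq> ?T"
 proof
  fix x assume "x : G L2"
  then obtain w where w: "w : L2" "x \<asymp> \<gamma> * w" unfolding G_def by blast
  have "x - \<gamma> * w : ?T" using w(2) QT unfolding cg_def by blast
  thus "x : ?T" using \<gamma>L2[OF w(1)] subgrp_cong[OF sT] by blast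
 qed
 have GG: "G L2 \<subseteq> G UNIV" unfolding G_def by blast
 have finGG: "finite (quo (G L2) (G UNIV))"
 proof -
  have sG: "subgrp (G L2)" by (rule stab_subgrp[OF stG[OF L2(1)]])
  have "quo (G L2) (G UNIV) \<subseteq> (%C. coset (G L2) (\<gamma> * (SOME x. x : C))) ` quo L2 UNIV"
  proof
   fix D assume "D : quo (G L2) (G UNIV)"
   then obtain x w where w: "D = coset (G L2) x" "x \<asymp> \<gamma> * w" unfolding quo_def G_def by blast
   have "w : coset L2 w" by (simp add: coset_def subgrp_zero[OF sL2])
   hence "(SOME y. y : coset L2 w) : coset L2 w" by (rule someI)
   hence 1: "(SOME y. y : coset L2 w) - w : L2" by (simp add: coset_def)
   hence "w - (SOME y. y : coset L2 w) : L2" by (simp add: subgrp_diff_swap[OF sL2])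
   moreover have "x - \<gamma> * (SOME y. y : coset L2 w) \<asymp> \<gamma> * (w - (SOME y. y : coset L2 w))"
    using cg_diff[OF w(2) cg_refl, of "\<gamma> * (SOME y. y : coset L2 w)"] by (simp add: right_diff_distrib)
   ultimately have "x - \<gamma> * (SOME y. y : coset L2 w) : G L2"
    unfolding G_def mem_Collect_eq by (rule bexI[rotated])
   hence "D = coset (G L2) (\<gamma> * (SOME y. y : coset L2 w))" unfolding w(1) by (simp add: coset_eq[OF sG])
   moreover have "coset L2 w : quo L2 UNIV" unfolding quo_def by (rule imageI) simp
   ultimately show "D : (%C. coset (G L2) (\<gamma> * (SOME x. x : C))) ` quo L2 UNIV" by (rule image_eqI)
  qed
  thus ?thesis by (rule finite_subset) (intro finite_imageI L2(3))
 qed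
 let ?H = "ssum ?T (G UNIV)"
 have stH: "stab PW ?H" by (rule stab_ssum[OF stT stGU])
 have TH: "?T \<subseteq> ?H" by (rule ssum_left[OF stab_subgrp[OF stGU]])
 have GH: "G UNIV \<subseteq> ?H" by (rule ssum_right[OF sT])
 have HS: "?H \<subseteq> SS" by (rule ssum_least[OF sS TS GS])
 have HH: "finite (quo ?H SS)" "card (quo ?H SS) <= p ^ k"
 proof -
  have 1: "subgrp ?H" using stH by (rule stab_subgrp)
  have 2: "Q \<subseteq> ?H" using QT TH by blast
  have 3: "\<gamma> * w : ?H" for w
  proof -
   have "\<gamma> * w : G UNIV" unfolding G_def using cg_refl by blast
   thus ?thesis using GH by blast
  qed
  have 4: "SS \<subseteq> ssum (Pol {..<M} (s + \<delta>)) ?H"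
   by (rule order_trans[OF cov(2) ssum_mono[OF order_refl TH]])
  show "finite (quo ?H SS)" by (rule index_bound(1)[OF 1 2 \<gamma>(1,2) 3 4 num])
  show "card (quo ?H SS) <= p ^ k" by (rule index_bound(2)[OF 1 2 \<gamma>(1,2) 3 4 num])
 qed
 have "p ^ card V * len UNIV L UNIV = len PW ?T SS" by (simp add: lenTS)
 also have "... = len PW ?T ?H + len PW ?H SS"
  by (rule len_additive[OF stT stH stSS TH HS finTS])
 also have "len PW ?T ?H <= len PW (?T \<inter> G UNIV) (G UNIV)"
 proof (rule len_second_iso[OF stT stGU])
  show "finite (quo (?T \<inter> G UNIV) (G UNIV))"
   by (rule finite_quo_mono[OF finGG stab_subgrp[OF stG[OF L2(1)]] stab_subgrp[OF stab_Int[OF stT stGU]]])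
     (use GT GG in blast)+
 qed
 also have "... <= len PW (G L2) (G UNIV)"
  by (rule len_mono[OF stab_subgrp[OF stG[OF L2(1)]] finGG]) (use GT GG in blast)+
 also have "... <= len PW L2 UNIV"
 proof (rule len_map[where f = "%Z. {w. \<gamma> * w : Z}", OF _ _ sL2 L2(3)])
  fix Z assume Z: "stab PW Z" "G L2 \<subseteq> Z" "Z \<subseteq> G UNIV"
  have sZ: "subgrp Z" using Z(1) by (rule stab_subgrp)
  have "stab PW {w. \<gamma> * w : Z}"
   unfolding stab_def subgrp_def
  proof (intro conjI ballI)
   show "0 : {w. \<gamma> * w : Z}" using subgrp_zero[OF sZ] by simp
   fix x y assume "x : {w. \<gamma> * w : Z}" "y : {w. \<gamma> * w : Z}"
   thus "x - y : {w. \<gamma> * w : Z}" using subgrp_diff[OF sZ] by (simp add: right_diff_distrib)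
  next
   fix r x assume "r : PW" "x : {w. \<gamma> * w : Z}"
   hence "r * (\<gamma> * x) : Z" using stab_mult[OF Z(1)] by simp
   thus "r * x : {w. \<gamma> * w : Z}" by (simp add: ac_simps)
  qed
  moreover have "L2 \<subseteq> {w. \<gamma> * w : Z}"
  proof
   fix w assume "w : L2"
   hence "\<gamma> * w : G L2" unfolding G_def using cg_refl by blast
   thus "w : {w. \<gamma> * w : Z}" using Z(2) by blast
  qed
  ultimately show "stab PW {w. \<gamma> * w : Z} & L2 \<subseteq> {w. \<gamma> * w : Z} & {w. \<gamma> * w : Z} \<subseteq> UNIV" by simp
 next
  fix Z Z' assume Z: "stab PW Z" "stab PW Z'" "G L2 \<subseteq> Z" "Z \<subset> Z'" "Z' \<subseteq> G UNIV"
  have sZ: "subgrp Z" "subgrp Z'" using Z(1,2) by (auto intro: stab_subgrp)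
  obtain z where z: "z : Z'" "z ~: Z" using Z(4) by blast
  then obtain w where w: "z \<asymp> \<gamma> * w" using Z(5) unfolding G_def by blast
  have "x : G L2" if "x : Q" for x
  proof -
   have "x \<asymp> \<gamma> * 0" using that by (simp add: cg_zero)
   thus ?thesis unfolding G_def using subgrp_zero[OF sL2] by blast
  qed
  hence "z - \<gamma> * w : Z" using w Z(3) unfolding cg_def by blast
  hence "\<gamma> * w ~: Z" "\<gamma> * w : Z'" using z Z(4) subgrp_cong[OF sZ(1)] subgrp_cong[OF sZ(2)] by blast+
  thus "{w. \<gamma> * w : Z} \<subset> {w. \<gamma> * w : Z'}" using Z(4) by blast
 qed
 also have "... <= len UNIV L2 UNIV" unfolding PW_def by (rule len_frob[OF L2(1,3,2)])
 also have "len PW ?H SS <= k"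
  by (rule len_le_log[OF stab_subgrp[OF stH] HH(1) pp _ HH(2)]) (rule pQ', use QT TH in blast)
 finally show "p ^ card V * len UNIV L UNIV <= len UNIV L2 UNIV + k" by simp
qed

section \<open>The step from n to n + 1\<close>

text \<open>The p^n-th power of the monic relation for the variable l is again monic, with integer coefficients,
and lies in the Frobenius power; it reduces exponents below D p^n.\<close>
lemma pow_reduce:
 assumes J: "Q \<subseteq> J" "idl J" and rel: "l < M ==> vr l ^ D - (\<Sum>i<D. of_int (a l i) * vr l ^ i) : J"
  and l: "l < M" and D: "D >= 1"
 shows "EX f:Pol {..<M} (D * p ^ n). vr l ^ e - f : FP Q J (p ^ n)"
proof (induction e rule: less_induct)
 case (less e)
 let ?q = "p ^ n" and ?L = "FP Q J (p ^ n)"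
 have sL: "subgrp ?L" using FP_idl by (rule stab_subgrp)
 have q: "?q >= 1" using p_gt by simp
 show ?case
 proof (cases "e < D * ?q")
  case True
  have "vr l ^ e : Pol {..<M} (e * 1)" by (rule Pol_pow) (rule vr_Pol, use l in auto)
  hence "vr l ^ e : Pol {..<M} (D * ?q)" by (rule Pol_mono') (use True in simp)
  thus ?thesis using subgrp_zero[OF sL] by force
 next
  case False
  have "(vr l ^ D - (\<Sum>i<D. of_int (a l i) * vr l ^ i)) ^ ?q : ?L" by (rule FP_pow[OF rel[OF l]])
  moreover have "(vr l ^ D - (\<Sum>i<D. of_int (a l i) * vr l ^ i)) ^ ?q
   \<asymp> vr l ^ (D * ?q) - (\<Sum>i<D. of_int (a l i) * vr l ^ (i * ?q))"
  proof -
   have "(vr l ^ D - (\<Sum>i<D. of_int (a l i) * vr l ^ i)) ^ ?q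
    \<asymp> (vr l ^ D) ^ ?q - (\<Sum>i<D. of_int (a l i) * vr l ^ i) ^ ?q" by (rule frob_diff_n)
   also have "... \<asymp> (vr l ^ D) ^ ?q - (\<Sum>i<D. (of_int (a l i) * vr l ^ i) ^ ?q)"
    by (intro cg_diff cg_refl frob_sum_n)
   also have "... = (vr l ^ D) ^ ?q - (\<Sum>i<D. of_int (a l i) ^ ?q * (vr l ^ i) ^ ?q)"
    by (simp only: power_mult_distrib)
   also have "... \<asymp> (vr l ^ D) ^ ?q - (\<Sum>i<D. of_int (a l i) * (vr l ^ i) ^ ?q)"
    by (intro cg_diff cg_refl cg_sum cg_mult frob_int_n)
   finally show ?thesis by (simp only: power_mult)
  qed
  ultimately have "vr l ^ (D * ?q) - (\<Sum>i<D. of_int (a l i) * vr l ^ (i * ?q)) : ?L"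
   using subgrp_cong[OF sL] FP_Q[of J ?q] unfolding cg_def by blast
  hence "vr l ^ (e - D * ?q) * (vr l ^ (D * ?q) - (\<Sum>i<D. of_int (a l i) * vr l ^ (i * ?q))) : ?L"
   by (rule idl_mult[OF FP_idl])
  moreover have "vr l ^ (e - D * ?q) * vr l ^ (D * ?q) = vr l ^ e"
   using False by (simp add: power_add[symmetric])
  moreover have "vr l ^ (e - D * ?q) * (\<Sum>i<D. of_int (a l i) * vr l ^ (i * ?q))
   = (\<Sum>i<D. of_int (a l i) * vr l ^ (e - D * ?q + i * ?q))"
   unfolding sum_distrib_left by (intro sum.cong refl) (simp add: power_add ac_simps)
  ultimately have 1: "vr l ^ e - (\<Sum>i<D. of_int (a l i) * vr l ^ (e - D * ?q + i * ?q)) : ?L"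
   by (simp add: right_diff_distrib)
  have "ALL i:{..<D}. EX f. f : Pol {..<M} (D * ?q) & vr l ^ (e - D * ?q + i * ?q) - f : ?L"
  proof
   fix i assume "i : {..<D}"
   hence "i * ?q < D * ?q" using p_gt by simp
   hence "e - D * ?q + i * ?q < e" using False by linarith
   from less[OF this] show "EX f. f : Pol {..<M} (D * ?q) & vr l ^ (e - D * ?q + i * ?q) - f : ?L" by blast
  qed
  from bchoice[OF this] obtain f where
   f: "ALL i:{..<D}. f i : Pol {..<M} (D * ?q) & vr l ^ (e - D * ?q + i * ?q) - f i : ?L" ..
  have "(\<Sum>i<D. of_int (a l i) * f i) : Pol {..<M} (D * ?q)"
   by (intro Pol_sum Pol_mult'[OF int_Pol[of _ _ 0]]) (use f in auto)
  moreover have "(\<Sum>i<D. of_int (a l i) * vr l ^ (e - D * ?q + i * ?q)) - (\<Sum>i<D. of_int (a l i) * f i) : ?L"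
  proof (rule idl_cong_sum[OF sL])
   fix i assume "i : {..<D}"
   hence "of_int (a l i) * (vr l ^ (e - D * ?q + i * ?q) - f i) : ?L" using f by (intro idl_mult[OF FP_idl]) blast
   thus "of_int (a l i) * vr l ^ (e - D * ?q + i * ?q) - of_int (a l i) * f i : ?L"
    by (simp only: right_diff_distrib)
  qed
  ultimately show ?thesis using subgrp_trans[OF sL 1] by blast
 qed
qed

lemma cover:
 assumes J: "Q \<subseteq> J" "idl J" and rel: "!!l. l < M ==> vr l ^ D - (\<Sum>i<D. of_int (a l i) * vr l ^ i) : J"
  and D: "D >= 1"
 shows "EX f:Pol {..<M} (M * (D * p ^ n)). w - f : FP Q J (p ^ n)"
proof -
 let ?q = "p ^ n" and ?L = "FP Q J (p ^ n)"
 have sL: "subgrp ?L" using FP_idl by (rule stab_subgrp)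
 from gen[of w] obtain s g where g: "g : Pol {..<M} s" "w - g : Q" by blast
 have "ALL m:Mon {..<M} s. EX f. f : Pol {..<M} (M * (D * ?q)) & mon m - f : ?L"
 proof
  fix m assume m: "m : Mon {..<M} s"
  hence sub: "ks m \<subseteq> {..<M}" by (simp add: Mon_def)
  have "ALL i:ks m. EX f. f : Pol {..<M} (D * ?q) & vr i ^ lk m i - f : ?L"
  proof
   fix i assume "i : ks m"
   hence "i < M" using sub by blast
   from pow_reduce[where l = i and a = a, OF J rel this D] show "EX f. f : Pol {..<M} (D * ?q) & vr i ^ lk m i - f : ?L" by blast
  qed
  from bchoice[OF this] obtain f where f: "ALL i:ks m. f i : Pol {..<M} (D * ?q) & vr i ^ lk m i - f i : ?L" ..
  have cong: "(\<Prod>i\<in>I. vr i ^ lk m i) - (\<Prod>i\<in>I. f i) : ?L" if "finite I" "I \<subseteq> ks m" for I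
   using that
  proof (induction I rule: finite_induct)
   case empty
   show ?case using subgrp_zero[OF sL] by simp
  next
   case (insert x F)
   have "vr x ^ lk m x * (\<Prod>i\<in>F. vr i ^ lk m i) - f x * (\<Prod>i\<in>F. f i) : ?L"
    by (rule idl_cong_mult[OF FP_idl]) (use f insert in auto)
   thus ?case using insert(1,2) by simp
  qed
  have "(\<Prod>i\<in>ks m. f i) : Pol {..<M} (\<Sum>i\<in>ks m. D * ?q)" by (rule Pol_prod) (use f in auto)
  moreover have "(\<Sum>i\<in>ks m. D * ?q) <= M * (D * ?q)"
  proof -
   have "card (ks m) <= M" using card_mono[OF _ sub] by simp
   thus ?thesis by simp
  qed
  ultimately have "(\<Prod>i\<in>ks m. f i) : Pol {..<M} (M * (D * ?q))" by (rule Pol_mono')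
  moreover have "mon m - (\<Prod>i\<in>ks m. f i) : ?L" using cong[OF finite_keys order_refl] by (simp only: mon_as_prod[of m])
  ultimately show "EX f. f : Pol {..<M} (M * (D * ?q)) & mon m - f : ?L" by blast
 qed
 from bchoice[OF this] obtain f where
  f: "ALL m:Mon {..<M} s. f m : Pol {..<M} (M * (D * ?q)) & mon m - f m : ?L" ..
 let ?f = "\<Sum>m\<in>Mon {..<M} s. of_int (lk g m) * f m"
 have "?f : Pol {..<M} (M * (D * ?q))"
  by (intro Pol_sum Pol_mult'[OF int_Pol[of _ _ 0]]) (use f in auto)
 moreover have "g - ?f : ?L"
 proof -
  have "g = (\<Sum>m\<in>Mon {..<M} s. of_int (lk g m) * mon m)"
   unfolding sgl_mon[symmetric] by (rule Pol_expand[OF g(1)]) simp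
  moreover have "(\<Sum>m\<in>Mon {..<M} s. of_int (lk g m) * mon m) - ?f : ?L"
  proof (rule idl_cong_sum[OF sL])
   fix m assume "m : Mon {..<M} s"
   hence "of_int (lk g m) * (mon m - f m) : ?L" using f by (intro idl_mult[OF FP_idl]) blast
   thus "of_int (lk g m) * mon m - of_int (lk g m) * f m : ?L" by (simp only: right_diff_distrib)
  qed
  ultimately show ?thesis by simp
 qed
 moreover have "w - g : ?L" using g(2) FP_Q by blast
 ultimately show ?thesis using subgrp_trans[OF sL] by blast
qed

lemma finite_FP:
 assumes J: "Q \<subseteq> J" "idl J" and rel: "!!l. l < M ==> vr l ^ D - (\<Sum>i<D. of_int (a l i) * vr l ^ i) : J"
  and D: "D >= 1"
 shows "finite (quo (FP Q J (p ^ n)) UNIV)"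
proof -
 let ?L = "FP Q J (p ^ n)" and ?P = "Pol {..<M} (M * (D * p ^ n))"
 have sL: "subgrp ?L" using FP_idl by (rule stab_subgrp)
 have "quo ?L UNIV \<subseteq> quo ?L ?P"
 proof
  fix C assume "C : quo ?L UNIV"
  then obtain w where w: "C = coset ?L w" unfolding quo_def by blast
  from cover[OF J rel D, of n w] obtain f where "f : ?P" "w - f : ?L" by blast
  thus "C : quo ?L ?P" unfolding w quo_def using coset_eq[OF sL] by blast
 qed
 moreover have "finite (quo ?L ?P)"
  by (rule finite_quo_mono[OF growth(1) sg sL FP_Q order_refl])
 ultimately show ?thesis by (rule finite_subset)
qed

definition ell :: "zpol set => nat => nat" where
 "ell J n = len UNIV (FP Q J (p ^ n)) UNIV"

text \<open>K4 p bounds the degree of the multiplier \<gamma>. The degrees to be averaged run from s0 = K4 p q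
(M D + 1) to 2 s0 in steps of K4 p, where q = p^n. By growth the logarithm to base p of the count at
2 s0 is at most a constant times (p q)^d, so one of these steps increases it by at most C p^d
q^(d-1).\<close>
lemma HK_step:
 assumes J: "Q \<subseteq> J" "idl J" and rel: "!!l. l < M ==> vr l ^ D - (\<Sum>i<D. of_int (a l i) * vr l ^ i) : J"
  and D: "D >= 1" and d: "card V >= 1"
  and K: "card Y * (K + (\<kappa> + \<kappa> * \<kappa> * M)) ^ card V < (card Y + 1) * K ^ card V" "K > 0"
  and K4: "K4 = card B * K + M * \<kappa> + 1"
  and C: "C = card B * (M * (2 * K4 * (M * D + 1)) * \<kappa> + 1) ^ card V"
 shows "ell J (Suc n) <= p ^ card V * ell J n + C * p ^ card V * (p ^ n) ^ (card V - 1)"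
  and "p ^ card V * ell J n <= ell J (Suc n) + C * p ^ card V * (p ^ n) ^ (card V - 1)"
proof -
 let ?q = "p ^ n"
 let ?L = "FP Q J ?q" and ?L2 = "FP Q J (p ^ Suc n)"
 have q: "?q >= 1" using p_gt by simp
 obtain \<gamma> where \<gamma>: "\<gamma> : Pol V ((card B * K + M * \<kappa>) * p)" "\<gamma> ~: Q" "!!w. \<gamma> * w : SS"
  using gamma[OF K] by blast
 define \<delta> where "\<delta> = K4 * p"
 have "\<gamma> : Pol {..<M} ((card B * K + M * \<kappa>) * p)" using \<gamma>(1) Pol_mono[OF VM order_refl] by blast
 hence \<gamma>\<delta>: "\<gamma> : Pol {..<M} \<delta>" by (rule Pol_mono') (simp add: \<delta>_def K4)
 define T where "T = (M * D + 1) * ?q"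
 define k where "k = C * p ^ card V * ?q ^ (card V - 1)"
 define s0 where "s0 = T * \<delta>"
 have T: "T > 0" using p_gt unfolding T_def by simp
 have "NN (s0 + T * \<delta>) <= p ^ (k * T)"
 proof -
  have "NN (s0 + T * \<delta>) <= p ^ (card B * (M * (s0 + T * \<delta>) * \<kappa> + 1) ^ card V)"
   unfolding NN_def by (rule growth(2))
  also have "... <= p ^ (k * T)"
  proof (rule power_increasing)
   have "M * (s0 + T * \<delta>) * \<kappa> + 1 <= (M * (2 * K4 * (M * D + 1)) * \<kappa> + 1) * (p * ?q)"
   proof -
    have "M * (s0 + T * \<delta>) * \<kappa> = M * (2 * K4 * (M * D + 1)) * \<kappa> * (p * ?q)"
     by (simp add: s0_def T_def \<delta>_def algebra_simps)
    moreover have "1 <= p * ?q" using q p_gt by simp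
    ultimately show ?thesis unfolding distrib_right by linarith
   qed
   hence "(M * (s0 + T * \<delta>) * \<kappa> + 1) ^ card V <= ((M * (2 * K4 * (M * D + 1)) * \<kappa> + 1) * (p * ?q)) ^ card V"
    by (rule power_mono) simp
   hence "card B * (M * (s0 + T * \<delta>) * \<kappa> + 1) ^ card V
    <= card B * ((M * (2 * K4 * (M * D + 1)) * \<kappa> + 1) * (p * ?q)) ^ card V" by (rule mult_left_mono) simp
   also have "... = C * (p ^ card V * ?q ^ card V)" by (simp only: C power_mult_distrib mult.assoc)
   also have "?q ^ card V = ?q ^ (card V - 1) * ?q" using d by (metis Suc_diff_le diff_Suc_1 power_Suc2 One_nat_def)
   also have "C * (p ^ card V * (?q ^ (card V - 1) * ?q)) = k * ?q" by (simp add: k_def)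
   also have "k * ?q <= k * T" unfolding T_def by simp
   finally show "card B * (M * (s0 + T * \<delta>) * \<kappa> + 1) ^ card V <= k * T" .
  qed (use p_gt in simp)
  finally show ?thesis .
 qed
 from averaging[OF this T] obtain j where j: "NN (s0 + Suc j * \<delta>) <= p ^ k * NN (s0 + j * \<delta>)" by blast
 define s where "s = s0 + j * \<delta>"
 have num: "NN (s + \<delta>) <= p ^ k * NN s" using j unfolding s_def by (simp add: algebra_simps)
 have s0: "p - 1 + p * (M * (D * ?q)) <= s + \<delta>"
 proof -
  have "p * (M * (D * ?q)) + p <= p * (M * D * ?q) + p * ?q" using q by simp
  also have "... = T * p" by (simp add: T_def algebra_simps)
  also have "... <= T * (K4 * p)" by (simp add: K4)
  also have "... <= s + \<delta>" by (simp add: s_def s0_def \<delta>_def)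
  finally show ?thesis by linarith
 qed
 have cov: "EX f:Pol {..<M} (M * (D * p ^ n)). w - f : FP Q J (p ^ n)" for w n
  by (rule cover[OF J rel D])
 have idls: "idl ?L" "Q \<subseteq> ?L" "finite (quo ?L UNIV)" "idl ?L2" "Q \<subseteq> ?L2" "finite (quo ?L2 UNIV)"
  using FP_idl FP_Q finite_FP[OF J rel D] by blast+
 have 1: "UNIV \<subseteq> ssum (Pol {..<M} (s + \<delta>)) ?L2"
 proof
  fix w :: zpol
  from cov[of "Suc n" w] obtain f where f: "f : Pol {..<M} (M * (D * p ^ Suc n))" "w - f : ?L2" by blast
  have "M * (D * p ^ Suc n) <= s + \<delta>" using s0 by (simp add: ac_simps)
  hence "f : Pol {..<M} (s + \<delta>)" by (rule Pol_mono'[OF f(1)])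
  moreover have "w = f + (w - f)" by simp
  ultimately show "w : ssum (Pol {..<M} (s + \<delta>)) ?L2" unfolding ssum_def using f(2) by blast
 qed
 have 2: "SS \<subseteq> ssum (Pol {..<M} (s + \<delta>)) (TT (%_. ?L))"
 proof
  fix w assume "w : SS"
  then obtain h where h: "w \<asymp> (frc h)" unfolding SS_TT by (elim TTE)
  have "ALL a. EX f. f : Pol {..<M} (M * (D * ?q)) & h a - f : ?L" using cov[of n] by blast
  from choice[OF this] obtain f where f: "ALL a. f a : Pol {..<M} (M * (D * ?q)) & h a - f a : ?L" ..
  let ?f = "\<Sum>a\<in>E. mon a * f a ^ p"
  have "?f : Pol {..<M} (s + \<delta>)"
  proof (intro Pol_sum)
   fix a assume a: "a : E"
   have "mon a : Pol {..<M} (p - 1)" using mon_Pol[OF a] Pol_mono[OF VM order_refl] by blast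
   from Pol_mult'[OF this Pol_pow s0] f show "mon a * f a ^ p : Pol {..<M} (s + \<delta>)" by blast
  qed
  moreover have "w - ?f : TT (%_. ?L)"
  proof (rule TTI[of "%a. h a - f a"])
   have "w - ?f \<asymp> (frc h) - ?f" by (intro cg_diff h cg_refl)
   also have "... = (\<Sum>a\<in>E. mon a * (h a ^ p - f a ^ p))" by (simp add: right_diff_distrib sum_subtractf)
   also have "... \<asymp> (\<Sum>a\<in>E. mon a * (h a - f a) ^ p)"
    by (intro cg_sum cg_mult cg_refl cg_sym[OF frob_diff])
   finally show "w - ?f \<asymp> (\<Sum>a\<in>E. mon a * (h a - f a) ^ p)" .
  qed (use f in blast)
  moreover have "w = ?f + (w - ?f)" by simp
  ultimately show "w : ssum (Pol {..<M} (s + \<delta>)) (TT (%_. ?L))" unfolding ssum_def by blast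
 qed
 have qq: "p ^ Suc n = p ^ n * p" by simp
 have up: "l ^ p : ?L2" if "l : ?L" for l unfolding qq by (rule FP_step(1)[OF that])
 have least: "?L2 \<subseteq> N" if "idl N" "Q \<subseteq> N" "!!l. l : ?L ==> l ^ p : N" for N
  unfolding qq by (rule FP_step(2)[OF that])
 note cmp = len_compare[OF idls up least \<gamma>\<delta> \<gamma>(2,3) num 1 2]
 show "ell J (Suc n) <= p ^ card V * ell J n + C * p ^ card V * ?q ^ (card V - 1)"
  unfolding ell_def k_def[symmetric] by (rule cmp(1))
 show "p ^ card V * ell J n <= ell J (Suc n) + C * p ^ card V * ?q ^ (card V - 1)"
  unfolding ell_def k_def[symmetric] by (rule cmp(2))
qed

end

section \<open>Reduction modulo almost all primes\<close>

text \<open>For an ideal P this is P + pW.\<close>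
definition PP :: "zpol set => nat => zpol set" where
 "PP P p = {x. EX w:P. EX z. x = w + of_nat p * z}"

lemma PP_idl: assumes "idl P" shows "idl (PP P p)"
proof -
 have "PP P p = {x. EX z. x - of_nat p * z : P}"
 proof (intro equalityI subsetI)
  fix x assume "x : {x. EX z. x - of_nat p * z : P}"
  then obtain z where "x - of_nat p * z : P" by blast
  moreover have "x = (x - of_nat p * z) + of_nat p * z" by simp
  ultimately show "x : PP P p" unfolding PP_def by blast
 next
  fix x assume "x : PP P p"
  then obtain w z where "w : P" "x = w + of_nat p * z" unfolding PP_def by blast
  hence "x - of_nat p * z : P" by simp
  thus "x : {x. EX z. x - of_nat p * z : P}" by blast
 qed
 thus ?thesis using idl_shift_UNIV[OF assms] by simp
qed

lemma P_PP: "P \<subseteq> PP P p"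
proof
 fix x assume "x : P"
 moreover have "x = x + of_nat p * 0" by simp
 ultimately show "x : PP P p" unfolding PP_def by blast
qed

lemma p_PP: "subgrp P ==> of_nat p * z : PP P p"
proof -
 assume "subgrp P"
 moreover have "of_nat p * z = 0 + of_nat p * z" by simp
 ultimately show ?thesis unfolding PP_def using subgrp_zero by blast
qed

lemma finite_kdv: "f ~= 0 ==> finite {p. kdv (int p) f}"
proof -
 assume "f ~= 0"
 then obtain m where m: "lk f m ~= 0" using poly_mapping_eqI[of f 0] by auto
 have "{p. kdv (int p) f} \<subseteq> {p. p dvd nat \<bar>lk f m\<bar>}"
  unfolding kdv_def by (auto simp: nat_dvd_iff)
 moreover have "finite {p. p dvd nat \<bar>lk f m\<bar>}" using m by (intro finite_divisors_nat) simp
 ultimately show ?thesis by (rule finite_subset)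
qed

lemma Pol_empty: "f : Pol {} s ==> EX k. f = of_int k"
proof -
 assume "f : Pol {} s"
 hence *: "m = 0" if "lk f m ~= 0" for m using that unfolding Pol_iff Mon_def by auto
 have "f = sgl 0 (lk f 0)"
  using * by (intro poly_mapping_eqI) (auto simp: lookup_single when_def)
 hence "f = of_int (lk f 0)" unfolding single_of_int[symmetric] by simp
 thus ?thesis by blast
qed

lemma AI_empty:
 assumes "!!k. of_int k : Q ==> d dvd k" shows "AI d Q {}"
 unfolding AI_def
proof (intro allI ballI impI)
 fix s f assume "f : Pol {} s" "f : Q"
 then obtain k where "f = of_int k" "d dvd k" using Pol_empty assms by blast
 thus "kdv d f" unfolding kdv_def single_of_int[symmetric] by (simp add: lookup_single when_def)
qed

lemma (in prime_modulus) full_data: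
 assumes kp: "kprime k" and kQ: "of_int k : Q" and ai: "AI k Q V0" and V0: "V0 \<subseteq> {..<M}"
  and gen: "!!w. EX s. EX f:Pol {..<M} s. w - f : Q"
 shows "EX V c B \<kappa> g Y. V0 \<subseteq> V & AI k Q V & frame Q M V c B \<kappa> g Y"
proof -
 obtain V where V: "V0 \<subseteq> V" "V \<subseteq> {..<M}" "AI k Q V" "ALL l:{..<M} - V. ~ AI k Q (insert l V)"
  using max_subset[of "{..<M}" V0 "AI k Q", OF _ V0 ai] by auto
 have "EX c B \<kappa>. spanned Q M V c B \<kappa> & c ~: Q & B \<subseteq> Pol {..<M} \<kappa>"
  by (rule data_B[OF kp kQ V(3,2)]) (use V(4) in auto)
 then obtain c B \<kappa> where B: "spanned Q M V c B \<kappa>" "c ~: Q" "B \<subseteq> Pol {..<M} \<kappa>" by blast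
 interpret S: spanned Q M V c B \<kappa> by (rule B(1))
 from data_Y[OF S.finB S.oneB, of V] obtain Y g s where
  Y: "Y \<subseteq> B" "1 : Y" "ind Q V (%x. x) Y (%x. x)" "g : Pol V s" "g ~: Q" "ALL b:B. g * b : spn Q V s Y" by blast
 let ?\<kappa> = "\<kappa> + s"
 have 1: "spanned Q M V c B ?\<kappa>"
 proof
  show "c : Pol V ?\<kappa>" by (rule Pol_mono'[OF S.cPol]) simp
  fix l b assume "l < M" "b : B"
  thus "c * vr l * b : spn Q V ?\<kappa> B" by (intro spn_mono'[OF S.step]) auto
 qed (fact S.finB S.oneB)+
 have 2: "B \<subseteq> Pol {..<M} ?\<kappa>"
 proof
  fix b assume "b : B" thus "b : Pol {..<M} ?\<kappa>" using B(3) Pol_mono'[of b "{..<M}" \<kappa> ?\<kappa>] by auto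
 qed
 have 3: "g : Pol V ?\<kappa>" by (rule Pol_mono'[OF Y(4)]) simp
 have 4: "ALL b:B. g * b : spn Q V ?\<kappa> Y"
 proof
  fix b assume "b : B"
  hence "g * b : spn Q V s Y" using Y(6) by blast
  thus "g * b : spn Q V ?\<kappa> Y" by (rule spn_mono') simp
 qed
 have "frame Q M V c B ?\<kappa> g Y"
  unfolding frame_def frame_axioms_def using V B(2) Y(1,2,3,5) 1 2 3 4 gen prime_modulus_axioms by simp
 thus ?thesis using V(1,3) by blast
qed

locale zdata = frame P M V c B \<kappa> g Y for P M V c B \<kappa> g Y +
 assumes ai0: "AI 0 P V"
begin

lemma gclear: "EX k s \<zeta>. (ALL y:Y. \<zeta> y : Pol V s) & g * c ^ k * z - (\<Sum>y\<in>Y. \<zeta> y * y) : P"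
proof -
 from gen[of z] obtain t f where f: "f : Pol {..<M} t" "z - f : P" by blast
 have "cg (c ^ (M * t) * z) (c ^ (M * t) * f)" by (intro cg_mult cg_refl) (simp add: cg_def f)
 hence "c ^ (M * t) * z : spn P V (M * t * \<kappa>) B" by (rule spn_cg) (rule clear[OF f(1)])
 hence "g * (c ^ (M * t) * z) : spn P V (M * t * \<kappa> + \<kappa>) Y" by (rule spn_comp) (rule gspan)
 hence "g * c ^ (M * t) * z : spn P V (M * t * \<kappa> + \<kappa>) Y" by (simp only: mult.assoc)
 thus ?thesis unfolding spn_def by blast
qed

text \<open>Multiply the element p z of the relation by g c^k, to write it as p times a combination of Y modulo
P. Independence in characteristic zero then shows that g c^k times the coefficient is divisible by
p, and p divides neither g nor c.\<close>
lemma indep_mod: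
 assumes p: "Factorial_Ring.prime p" "~ kdv (int p) c" "~ kdv (int p) g"
  and \<alpha>: "!!y. y : Y ==> \<alpha> y : Pol V s" "(\<Sum>y\<in>Y. \<alpha> y * y) : PP P p" "y : Y"
 shows "kdv (int p) (\<alpha> y)"
proof -
 note kp = kprime_prime[OF p(1)]
 from \<alpha>(2) obtain w z where wz: "w : P" "(\<Sum>y\<in>Y. \<alpha> y * y) = w + of_nat p * z" unfolding PP_def by blast
 from gclear[of z] obtain k t \<zeta> where \<zeta>: "ALL y:Y. \<zeta> y : Pol V t" "g * c ^ k * z - (\<Sum>y\<in>Y. \<zeta> y * y) : P" by blast
 let ?G = "g * c ^ k"
 let ?\<beta> = "%y. ?G * \<alpha> y - of_nat p * \<zeta> y"
 have "(\<Sum>y\<in>Y. ?\<beta> y * y) = ?G * (\<Sum>y\<in>Y. \<alpha> y * y) - of_nat p * (\<Sum>y\<in>Y. \<zeta> y * y)"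
  by (simp add: left_diff_distrib sum_subtractf sum_distrib_left mult.assoc)
 also have "... = ?G * w + of_nat p * (g * c ^ k * z - (\<Sum>y\<in>Y. \<zeta> y * y))"
  unfolding wz(2) by (simp add: algebra_simps)
 also have "... : P" by (intro subgrp_add[OF sg] idl_mult[OF idl] wz(1) \<zeta>(2))
 finally have s: "(\<Sum>y\<in>Y. ?\<beta> y * y) : P" .
 have GP: "?G : Pol V (\<kappa> + k * \<kappa>)" by (rule Pol_mult[OF gPol Pol_pow[OF cPol]])
 have \<beta>P: "?\<beta> y : Pol V (\<kappa> + k * \<kappa> + s + t)" if "y : Y" for y
 proof (rule Pol_diff)
  show "?G * \<alpha> y : Pol V (\<kappa> + k * \<kappa> + s + t)" by (rule Pol_mult'[OF GP \<alpha>(1)[OF that]]) simp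
  show "of_nat p * \<zeta> y : Pol V (\<kappa> + k * \<kappa> + s + t)"
   by (rule Pol_mult'[OF nat_Pol[of p V 0] bspec[OF \<zeta>(1) that]]) simp
 qed
 have "?\<beta> y : P" by (rule indD[OF indY \<beta>P s \<alpha>(3)])
 hence "?\<beta> y = 0" using ai0 \<beta>P[OF \<alpha>(3)] unfolding AI_def kdv_0 by blast
 hence "?G * \<alpha> y = of_int (int p) * \<zeta> y" by simp
 hence "kdv (int p) (?G * \<alpha> y)" by (simp only: kdv_of_int_mult)
 moreover have "~ kdv (int p) (c ^ k)"
 proof (induction k)
  case 0
  show ?case using kp unfolding kdv_def kprime_def by (auto intro!: exI[of _ 0])
 next
  case (Suc k) thus ?case using p(2) kdv_mult[OF kp] by simp
 qed
 ultimately show ?thesis using p(3) kdv_mult[OF kp] by blast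
qed

lemma red_good:
 assumes p: "Factorial_Ring.prime p" "~ kdv (int p) c" "~ kdv (int p) g" "card Y < p"
  and pr: "prm (PP P p)"
 shows "red (PP P p) p M V c B \<kappa> g Y"
proof -
 let ?Q = "PP P p"
 have sP: "subgrp P" by (rule sg)
 have spn: "spn P V s B' \<subseteq> spn ?Q V s B'" for s B' unfolding spn_def using P_PP by blast
 have pin: "of_nat p * z : ?Q" for z by (rule p_PP[OF sP])
 have kdvQ: "f : ?Q" if "kdv (int p) f" for f
  using kdv_factor[OF that] pin by auto
 have ai: "AI (int p) ?Q V"
  unfolding AI_def
 proof (intro allI ballI impI)
  fix s f assume f: "f : Pol V s" "f : ?Q"
  have "(\<Sum>y\<in>Y. (if y = 1 then f else 0) * y) = (\<Sum>y\<in>Y. if y = 1 then f else 0)"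
   by (rule sum.cong) auto
  also have "... = f" using oneY finY by (simp add: sum.delta)
  finally have "(\<Sum>y\<in>Y. (if y = 1 then f else 0) * y) : ?Q" using f(2) by simp
  from indep_mod[OF p(1-3) _ this oneY, of s] show "kdv (int p) f" using f(1) zero_Pol by simp
 qed
 have 1: "prime_modulus ?Q" by (unfold_locales) (use PP_idl[OF idl] pr in auto)
 have 2: "char_modulus ?Q p"
  by (unfold_locales) (use PP_idl[OF idl] p(1) pin[of 1] in auto)
 have 3: "spanned ?Q M V c B \<kappa>"
 proof
  fix l b assume "l < M" "b : B"
  from step[OF this] show "c * vr l * b : spn ?Q V \<kappa> B" using spn by blast
 qed (use PP_idl[OF idl] finB oneB cPol in auto)
 show ?thesis
  unfolding red_def red_axioms_def frame_def frame_axioms_def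
 proof (intro conjI allI impI 1 2 3)
  show "V \<subseteq> {..<M}" by (rule VM)
  show "EX s. EX f:Pol {..<M} s. w - f : ?Q" for w using gen[of w] P_PP by blast
  show "AI (int p) ?Q V" by (rule ai)
  show "c ~: ?Q" using ai cPol p(2) unfolding AI_def by blast
  show "g ~: ?Q" using ai gPol p(3) unfolding AI_def by blast
  show "g : Pol V \<kappa>" by (rule gPol)
  show "B \<subseteq> Pol {..<M} \<kappa>" by (rule Bpol)
  show "Y \<subseteq> B" "1 : Y" by (rule YB oneY)+
  show "ind ?Q V (%x. x) Y (%x. x)"
   unfolding ind_def
  proof (intro allI impI ballI)
   fix s \<beta> y assume "ALL i:Y. \<beta> i : Pol V s" "(\<Sum>i\<in>Y. \<beta> i * i) : ?Q" "y : Y"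
   hence "kdv (int p) (\<beta> y)" by (intro indep_mod[OF p(1-3)]) auto
   thus "\<beta> y : ?Q" by (rule kdvQ)
  qed
  show "g * b : spn ?Q V \<kappa> Y" if "b : B" for b using gspan[OF that] spn by blast
  show "card Y < p" by (rule p(4))
 qed
qed

definition badp :: "nat set" where
 "badp = {p. kdv (int p) c} \<union> {p. kdv (int p) g} \<union> {..card Y}"

lemma finite_badp: "finite badp"
proof -
 have "c ~= 0" "g ~= 0" using cQ gQ subgrp_zero[OF sg] by auto
 thus ?thesis unfolding badp_def using finite_kdv by simp
qed

lemma red_almost_all:
 "Factorial_Ring.prime p ==> p ~: badp ==> prm (PP P p) ==> red (PP P p) p M V c B \<kappa> g Y"
 by (rule red_good) (auto simp: badp_def)

text \<open>A multiple g c^k w is a nonzero combination of Y; only primes that divide its coefficients can be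
exceptional.\<close>
lemma nonzero_mod:
 assumes "w ~: P" shows "finite {p. Factorial_Ring.prime p & w : PP P p}"
proof -
 from gclear[of w] obtain k s \<zeta> where \<zeta>: "ALL y:Y. \<zeta> y : Pol V s" "g * c ^ k * w - (\<Sum>y\<in>Y. \<zeta> y * y) : P" by blast
 have "EX y:Y. \<zeta> y ~= 0"
 proof (rule ccontr)
  assume "~ (EX y:Y. \<zeta> y ~= 0)"
  hence "(\<Sum>y\<in>Y. \<zeta> y * y) = 0" by (intro sum.neutral) simp
  hence "g * c ^ k * w : P" using \<zeta>(2) by simp
  thus False using assms gQ cQ prm_mult[OF prQ] prm_pow[OF prQ] by blast
 qed
 then obtain y where y: "y : Y" "\<zeta> y ~= 0" by blast
 have "{p. Factorial_Ring.prime p & w : PP P p} \<subseteq> badp \<union> {p. kdv (int p) (\<zeta> y)}"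
 proof
  fix p assume "p : {p. Factorial_Ring.prime p & w : PP P p}"
  hence p: "Factorial_Ring.prime p" "w : PP P p" by auto
  show "p : badp \<union> {p. kdv (int p) (\<zeta> y)}"
  proof (cases "p : badp")
   case False
   hence np: "~ kdv (int p) c" "~ kdv (int p) g" by (auto simp: badp_def)
   have "g * c ^ k * w : PP P p" by (rule idl_mult[OF PP_idl[OF idl] p(2)])
   moreover have "g * c ^ k * w - (\<Sum>y\<in>Y. \<zeta> y * y) : PP P p" using \<zeta>(2) P_PP by blast
   ultimately have "(\<Sum>y\<in>Y. \<zeta> y * y) : PP P p"
    using subgrp_cong[OF stab_subgrp[OF PP_idl[OF idl]]] by blast
   from indep_mod[OF p(1) np _ this y(1)] \<zeta>(1) show ?thesis by blast
  qed simp
 qed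
 thus ?thesis using finite_badp finite_kdv[OF y(2)] finite_subset by blast
qed

end

lemma zdata_ex:
 assumes pr: "prm P" and gen: "!!w. EX s. EX f:Pol {..<M} s. w - f : P" and char0: "!!k. of_int k : P ==> k = 0"
 shows "EX V c B \<kappa> g Y. zdata P M V c B \<kappa> g Y"
proof -
 interpret prime_modulus P by unfold_locales (use pr prm_idl in auto)
 have "AI 0 P {}" by (rule AI_empty) (use char0 in auto)
 from full_data[OF kprime_0 _ this _ gen] obtain V c B \<kappa> g Y where
  d: "AI 0 P V" "frame P M V c B \<kappa> g Y" using subgrp_zero[OF sg] by auto
 have "zdata P M V c B \<kappa> g Y" unfolding zdata_def zdata_axioms_def using d by simp
 thus ?thesis by blast
qed

section \<open>Krull dimension\<close>

text \<open>If r runs over representatives modulo P1 and u over those modulo P0, the elements r + f u are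
distinct modulo P0.\<close>
lemma growth_step:
 fixes P0 P1 :: "zpol set"
 assumes P: "prm P0" "prm P1" "P0 \<subseteq> P1" and f: "f : P1" "f ~: P0" "f : Pol U t"
  and fin: "finite (quo P0 (Pol U n))" and n: "a <= n" "t + b <= n"
 shows "card (quo P1 (Pol U a)) * card (quo P0 (Pol U b)) <= card (quo P0 (Pol U n))"
proof -
 have s0: "subgrp P0" and s1: "subgrp P1" using P by (auto intro: prm_subgrp)
 define r where "r C = (SOME x. x : Pol U a & coset P1 x = C)" for C
 define u where "u C = (SOME x. x : Pol U b & coset P0 x = C)" for C
 have r: "r C : Pol U a & coset P1 (r C) = C" if "C : quo P1 (Pol U a)" for C
 proof -
  from that obtain x where "x : Pol U a & coset P1 x = C" by (auto simp: quo_def)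
  thus ?thesis unfolding r_def by (rule someI)
 qed
 have u: "u C : Pol U b & coset P0 (u C) = C" if "C : quo P0 (Pol U b)" for C
 proof -
  from that obtain x where "x : Pol U b & coset P0 x = C" by (auto simp: quo_def)
  thus ?thesis unfolding u_def by (rule someI)
 qed
 let ?f = "%(C, D). coset P0 (r C + f * u D)"
 have "inj_on ?f (quo P1 (Pol U a) \<times> quo P0 (Pol U b))"
 proof (rule inj_onI)
  fix x y assume xy: "x : quo P1 (Pol U a) \<times> quo P0 (Pol U b)" "y : quo P1 (Pol U a) \<times> quo P0 (Pol U b)" "?f x = ?f y"
  obtain C D C' D' where e: "x = (C, D)" "y = (C', D')" by (metis surj_pair)
  have m: "C : quo P1 (Pol U a)" "D : quo P0 (Pol U b)" "C' : quo P1 (Pol U a)" "D' : quo P0 (Pol U b)"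
   using xy e by auto
  have d: "(r C + f * u D) - (r C' + f * u D') : P0" using xy(3) unfolding e by (simp add: coset_eq[OF s0])
  have "f * (u D' - u D) : P1" by (rule idl_mult2[OF prm_idl[OF P(2)] f(1)])
  hence "((r C + f * u D) - (r C' + f * u D')) + f * (u D' - u D) : P1"
   using d P(3) by (intro subgrp_add[OF s1]) auto
  hence "r C - r C' : P1" by (simp add: algebra_simps)
  hence "coset P1 (r C) = coset P1 (r C')" by (simp add: coset_eq[OF s1])
  hence CC: "C = C'" using r m by simp
  hence "f * (u D - u D') : P0" using d by (simp add: algebra_simps)
  hence "u D - u D' : P0" using f(2) prm_mult[OF P(1)] by blast
  hence "coset P0 (u D) = coset P0 (u D')" by (simp add: coset_eq[OF s0])
  hence "D = D'" using u m by simp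
  thus "x = y" using CC e by simp
 qed
 moreover have "?f ` (quo P1 (Pol U a) \<times> quo P0 (Pol U b)) \<subseteq> quo P0 (Pol U n)"
 proof (rule image_subsetI)
  fix x assume x: "x : quo P1 (Pol U a) \<times> quo P0 (Pol U b)"
  obtain C D where e: "x = (C, D)" by (metis surj_pair)
  have m: "C : quo P1 (Pol U a)" "D : quo P0 (Pol U b)" using x e by auto
  have "r C : Pol U n" using r[OF m(1)] Pol_mono'[of "r C" U a n] n by simp
  moreover have "f * u D : Pol U n" using u[OF m(2)] n by (intro Pol_mult'[OF f(3), of _ b]) auto
  ultimately have "r C + f * u D : Pol U n" by (rule Pol_add)
  thus "?f x : quo P0 (Pol U n)" unfolding e quo_def by simp
 qed
 ultimately have "card (quo P1 (Pol U a) \<times> quo P0 (Pol U b)) <= card (quo P0 (Pol U n))"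
  using fin by (rule card_inj_on_le)
 thus ?thesis by (simp add: card_cartesian_product)
qed

text \<open>Each strict inclusion of primes raises the order of growth by one: apply growth_step s times.\<close>
lemma (in red) chain_growth:
 "(!!i. i <= L ==> prm (T i) & Q \<subseteq> T i) ==> (!!i. i < L ==> T i \<subset> T (Suc i)) ==>
  EX k. ALL s>=1. 2 ^ (s ^ L) <= card (quo (T 0) (Pol {..<M} (k * s)))"
proof (induction L arbitrary: T)
 case 0
 have pr: "prm (T 0)" "Q \<subseteq> T 0" using 0(1)[of 0] by auto
 have s0: "subgrp (T 0)" using pr(1) by (rule prm_subgrp)
 have fin: "finite (quo (T 0) (Pol {..<M} n))" for n
  by (rule finite_quo_mono[OF growth(1) sg s0 pr(2) order_refl])
 have "2 <= card (quo (T 0) (Pol {..<M} n))" for n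
 proof -
  have "coset (T 0) 1 ~= coset (T 0) 0" using prm_one[OF pr(1)] by (simp add: coset_eq[OF s0])
  moreover have "{coset (T 0) 1, coset (T 0) 0} \<subseteq> quo (T 0) (Pol {..<M} n)"
   unfolding quo_def using one_Pol zero_Pol by blast
  ultimately show ?thesis using card_mono[OF fin[of n], of "{coset (T 0) 1, coset (T 0) 0}"] by simp
 qed
 thus ?case by auto
next
 case (Suc L)
 have "EX k. ALL s>=1. 2 ^ (s ^ L) <= card (quo (T (Suc 0)) (Pol {..<M} (k * s)))"
  by (rule Suc.IH[of "%i. T (Suc i)"]) (use Suc.prems in auto)
 then obtain k where k: "!!s. s >= 1 ==> 2 ^ (s ^ L) <= card (quo (T (Suc 0)) (Pol {..<M} (k * s)))" by blast
 have pr: "prm (T 0)" "Q \<subseteq> T 0" "prm (T (Suc 0))" "T 0 \<subset> T (Suc 0)" using Suc.prems by auto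
 have s0: "subgrp (T 0)" and s1: "subgrp (T (Suc 0))" using pr by (auto intro: prm_subgrp)
 have fin: "finite (quo (T 0) (Pol {..<M} n))" for n
  by (rule finite_quo_mono[OF growth(1) sg s0 pr(2) order_refl])
 obtain f0 where f0: "f0 : T (Suc 0)" "f0 ~: T 0" using pr(4) by blast
 from gen[of f0] obtain t f where f: "f : Pol {..<M} t" "f0 - f : Q" by blast
 have "f0 - f : T 0" "f0 - f : T (Suc 0)" using f(2) pr by auto
 hence f': "f : T (Suc 0)" "f ~: T 0" using f0 subgrp_cong[OF s0] subgrp_cong[OF s1] by blast+
 have "2 ^ (s ^ Suc L) <= card (quo (T 0) (Pol {..<M} ((k + t) * s)))" if s: "s >= 1" for s
 proof -
  let ?N = "card (quo (T (Suc 0)) (Pol {..<M} (k * s)))"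
  have le: "T 0 \<subseteq> T (Suc 0)" using pr by auto
  have iter: "?N ^ n <= card (quo (T 0) (Pol {..<M} (k * s + n * t)))" for n
  proof (induction n)
   case 0
   have "quo (T 0) (Pol {..<M} (k * s)) ~= {}" unfolding quo_def using zero_Pol by blast
   thus ?case using fin[of "k * s"] by (simp add: Suc_leI card_gt_0_iff)
  next
   case (Suc n)
   have "?N ^ Suc n <= ?N * card (quo (T 0) (Pol {..<M} (k * s + n * t)))" using Suc by simp
   also have "... <= card (quo (T 0) (Pol {..<M} (k * s + Suc n * t)))"
    by (rule growth_step[OF pr(1,3) le f' f(1) fin]) simp_all
   finally show ?case .
  qed
  have "(2::nat) ^ (s ^ Suc L) = (2 ^ (s ^ L)) ^ s" by (simp only: power_Suc2 power_mult)
  also have "... <= ?N ^ s" by (rule power_mono[OF k[OF s]]) simp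
  also have "... <= card (quo (T 0) (Pol {..<M} (k * s + s * t)))" by (rule iter)
  also have "k * s + s * t = (k + t) * s" by (simp add: algebra_simps)
  finally show ?thesis .
 qed
 thus ?case by blast
qed

text \<open>The growth of W/Q has order card V at most by growth.\<close>
lemma (in red) krull_upper:
 assumes "!!i. i <= L ==> prm (T i) & Q \<subseteq> T i" "!!i. i < L ==> T i \<subset> T (Suc i)"
 shows "L <= card V"
proof (rule ccontr)
 assume "~ L <= card V"
 hence L: "card V + 1 <= L" by simp
 from chain_growth[of L T] assms obtain k where
  k: "!!s. s >= 1 ==> 2 ^ (s ^ L) <= card (quo (T 0) (Pol {..<M} (k * s)))" by blast
 define C where "C = p * (card B * (M * k * \<kappa> + 1) ^ card V)"
 define s where "s = C + 1"
 have T0: "subgrp (T 0)" "Q \<subseteq> T 0" using assms(1)[of 0] by (auto intro: prm_subgrp)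
 have s1: "s >= 1" by (simp add: s_def)
 have "2 ^ (s ^ L) <= card (quo (T 0) (Pol {..<M} (k * s)))" by (rule k[OF s1])
 also have "... <= card (quo Q (Pol {..<M} (k * s)))" by (rule card_quo_coarsen[OF growth(1) sg T0 order_refl])
 also have "... <= p ^ (card B * (M * (k * s) * \<kappa> + 1) ^ card V)" by (rule growth(2))
 also have "... <= (2 ^ p) ^ (card B * (M * (k * s) * \<kappa> + 1) ^ card V)"
  by (rule power_mono) (simp_all add: less_imp_le)
 also have "... = 2 ^ (p * (card B * (M * (k * s) * \<kappa> + 1) ^ card V))" by (simp add: power_mult)
 finally have "s ^ L <= p * (card B * (M * (k * s) * \<kappa> + 1) ^ card V)" by simp
 also have "... <= p * (card B * ((M * k * \<kappa> + 1) * s) ^ card V)"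
 proof -
  have "M * (k * s) * \<kappa> + 1 <= (M * k * \<kappa> + 1) * s" using s1 by (simp add: algebra_simps)
  thus ?thesis by (intro mult_left_mono power_mono) simp_all
 qed
 also have "... = C * s ^ card V" by (simp only: C_def power_mult_distrib mult.assoc)
 finally have "s ^ L <= C * s ^ card V" .
 moreover have "s * s ^ card V <= s ^ L" using power_increasing[OF L s1] by simp
 ultimately have "s * s ^ card V <= C * s ^ card V" by linarith
 hence "s <= C" using s1 by simp
 thus False by (simp add: s_def)
qed

text \<open>An ideal maximal among those that contain I and avoid the multiplicative set S is prime.\<close>
lemma prime_avoiding:
 fixes I :: "'w::comm_ring_1 set"
 assumes I: "idl I" and S: "1 : S" "!!a b. a : S ==> b : S ==> a * b : S" and d: "I \<inter> S = {}"
 shows "EX Q. prm Q & I \<subseteq> Q & Q \<inter> S = {}"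
proof -
 let ?A = "{N. idl N & I \<subseteq> N & N \<inter> S = {}}"
 have "EX N:?A. ALL N':?A. N \<subseteq> N' --> N' = N"
 proof (rule subset_Zorn_nonempty)
  show "?A ~= {}" using I d by blast
  fix C assume C: "C ~= {}" "subset.chain ?A C"
  have CA: "C \<subseteq> ?A" using C(2) unfolding subset.chain_def by (rule conjunct1)
  have mem: "N : ?A" if "N : C" for N by (rule subsetD[OF CA that])
  have tot: "N \<subseteq> N' | N' \<subseteq> N" if "N : C" "N' : C" for N N'
   using conjunct2[OF C(2)[unfolded subset_chain_def]] that by blast
  have "idl (\<Union>C)"
   unfolding stab_def subgrp_def
  proof (intro conjI ballI)
   obtain N where N: "N : C" using C(1) by blast
   have "0 : N" using mem[OF N] subgrp_zero stab_subgrp by blast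
   thus "0 : \<Union>C" using N by blast
   fix x y assume "x : \<Union>C" "y : \<Union>C"
   then obtain N1 N2 where N12: "N1 : C" "N2 : C" "x : N1" "y : N2" by blast
   then obtain N3 where N3: "N3 : C" "x : N3" "y : N3" using tot[of N1 N2] by blast
   have "subgrp N3" using mem[OF N3(1)] stab_subgrp by blast
   from subgrp_diff[OF this N3(2,3)] show "x - y : \<Union>C" using N3(1) by blast
  next
   fix r x assume "x : \<Union>C"
   then obtain N1 where N1: "N1 : C" "x : N1" by blast
   have "idl N1" using mem[OF N1(1)] by blast
   from idl_mult[OF this N1(2)] show "r * x : \<Union>C" using N1(1) by blast
  qed
  moreover have "I \<subseteq> \<Union>C" using C(1) mem by blast
  moreover have "\<Union>C \<inter> S = {}" using mem by blast
  ultimately show "\<Union>C : ?A" by simp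
 qed
 then obtain N where NA: "N : ?A" and NM: "ALL N':?A. N \<subseteq> N' --> N' = N" ..
 hence N: "idl N" "I \<subseteq> N" "N \<inter> S = {}" by simp_all
 have max: "N' = N" if "idl N'" "I \<subseteq> N'" "N' \<inter> S = {}" "N \<subseteq> N'" for N' using NM that by simp
 have sN: "subgrp N" using N(1) by (rule stab_subgrp)
 have ext: "EX s r. s : S & s - r * a : N" if a: "a ~: N" for a
 proof (rule ccontr)
  assume no: "~ (EX s r. s : S & s - r * a : N)"
  let ?N = "{y. EX r. y - r * a : N}"
  have "idl ?N" unfolding stab_def subgrp_def
  proof (intro conjI ballI)
   have "0 - 0 * a : N" using subgrp_zero[OF sN] by simp
   thus "0 : ?N" by blast
   fix y y' assume "y : ?N" "y' : ?N"
   then obtain r r' where r: "y - r * a : N" "y' - r' * a : N" by blast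
   have "(y - r * a) - (y' - r' * a) : N" by (rule subgrp_diff[OF sN r])
   hence "(y - y') - (r - r') * a : N" by (simp add: algebra_simps)
   thus "y - y' : ?N" by blast
  next
   fix s y assume "y : ?N"
   then obtain r where "y - r * a : N" by blast
   hence "s * (y - r * a) : N" by (rule idl_mult[OF N(1)])
   hence "s * y - (s * r) * a : N" by (simp add: algebra_simps)
   thus "s * y : ?N" by blast
  qed
  moreover have NN: "N \<subseteq> ?N"
  proof
   fix y assume "y : N" hence "y - 0 * a : N" by simp
   thus "y : ?N" by blast
  qed
  moreover have "?N \<inter> S = {}" using no by blast
  ultimately have "?N = N" using max[of ?N] N(2) by blast
  moreover have "a - 1 * a : N" using subgrp_zero[OF sN] by simp
  ultimately show False using a by blast
 qed
 have "prm N" unfolding prm_def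
 proof (intro conjI allI impI N(1))
  show "1 ~: N" using N(3) S(1) by blast
  fix a b assume ab: "a * b : N"
  show "a : N | b : N"
  proof (rule ccontr)
   assume "~ (a : N | b : N)"
   then obtain s r s' r' where s: "s : S" "s - r * a : N" "s' : S" "s' - r' * b : N" using ext by blast
   have "s * s' - (r * a) * (r' * b) : N" by (rule idl_cong_mult[OF N(1) s(2,4)])
   moreover have "(r * a) * (r' * b) : N" using idl_mult[OF N(1) ab, of "r * r'"] by (simp add: ac_simps)
   ultimately have "s * s' : N" using subgrp_cong[OF sN] by blast
   thus False using S(2)[OF s(1,3)] N(3) by blast
  qed
 qed
 thus ?thesis using N by blast
qed

text \<open>The order compares the smallest differing index first, so the variable with least index decides.\<close>
lemma monomial_order:
 assumes "m <= m'" "!!j. j < l ==> lk m j = 0" "!!j. j < l ==> lk m' j = 0"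
 shows "lk m l <= lk (m' :: nat \<Rightarrow>\<^sub>0 nat) l"
proof (cases "m = m'")
 case False
 hence "m < m'" using assms(1) by simp
 hence "less_fun (lk m) (lk m')" by (simp add: less_poly_mapping.rep_eq)
 then obtain k where k: "lk m k < lk m' k" "!!k'. k' < k ==> lk m k' = lk m' k'" unfolding less_fun_def by blast
 have "~ k < l" using k(1) assms(3)[of k] by auto
 thus ?thesis using k by (cases "k = l") auto
qed simp

lemma lmk_mem: "~ kdv k f ==> f : Pol V s ==> lmk k f : Mon V s"
proof -
 assume f: "~ kdv k f" "f : Pol V s"
 have "lk f (lmk k f) ~= 0" using lmk(1)[OF f(1)] by auto
 thus ?thesis using f(2) by (simp add: Pol_iff)
qed

lemma lmk_cong:
 assumes "kdv k (f - h)" shows "kdv k f \<longleftrightarrow> kdv k h" "lmk k f = lmk k h"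
proof -
 have *: "k dvd lk f m \<longleftrightarrow> k dvd lk h m" for m
  using assms unfolding kdv_def lookup_minus by (metis diff_add_cancel dvd_add_right_iff)
 show "kdv k f \<longleftrightarrow> kdv k h" unfolding kdv_def using * by simp
 have seteq: "{m : ks f. ~ k dvd lk f m} = {m. ~ k dvd lk f m}" for f :: zpol
 proof -
  have "m : ks f" if "~ k dvd lk f m" for m
  proof -
   have "lk f m ~= 0" using that by auto
   thus ?thesis by (rule iffD2[OF in_keys_iff])
  qed
  thus ?thesis by blast
 qed
 show "lmk k f = lmk k h" unfolding lmk_def seteq by (simp only: *)
qed

lemma lmk_mon: assumes "kprime k" shows "~ kdv k (mon a)" "lmk k (mon a) = a"
proof -
 show nm: "~ kdv k (mon a)" using assms unfolding kdv_def mon_def kprime_def by (auto intro!: exI[of _ a])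
 show "lmk k (mon a) = a"
 proof (rule ccontr)
  assume "lmk k (mon a) ~= a"
  hence "lk (mon a) (lmk k (mon a)) = 0" by (simp add: mon_def lookup_single)
  thus False using lmk(1)[OF nm] by simp
 qed
qed

lemma lmk_power: "kprime k ==> ~ kdv k f ==> ~ kdv k (f ^ n) & (ALL i. lk (lmk k (f ^ n)) i = n * lk (lmk k f) i)"
proof (induction n)
 case 0
 thus ?case using lmk_mon[of k 0] by (simp add: mon_0)
next
 case (Suc n)
 thus ?case using lmk_mult[of k f "f ^ n"] by (simp add: lookup_add)
qed

lemma shifted_one:
 assumes kp: "kprime k" and c: "c : Pol V s" "~ kdv k c" and l: "l : V" "!!j. j : V ==> l <= j"
 shows "~ kdv k (1 + vr l * c)" "lk (lmk k (1 + vr l * c)) l >= 1"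
proof -
 let ?m = "lmk k (vr l * c)"
 have m: "~ kdv k (vr l * c)" "?m = sgl l 1 + lmk k c"
  using lmk_mult[OF kp lmk_mon(1)[OF kp] c(2), of "sgl l 1"] lmk_mon(2)[OF kp, of "sgl l 1"] unfolding vr_def by auto
 have ml: "lk ?m l >= 1" unfolding m(2) by (simp add: lookup_add)
 hence "?m ~= 0" by auto
 hence "lk (1 + vr l * c) ?m = lk (vr l * c) ?m" by (simp add: lookup_add lookup_one)
 hence nd: "~ k dvd lk (1 + vr l * c) ?m" using lmk(1)[OF m(1)] by simp
 thus nk: "~ kdv k (1 + vr l * c)" unfolding kdv_def by blast
 have P: "vr l * c : Pol V (1 + s)" by (rule Pol_mult[OF vr_Pol[OF l(1)] c(1)]) simp
 have P1: "1 + vr l * c : Pol V (1 + s)" by (rule Pol_add[OF one_Pol P])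
 have z: "lk m j = 0" if "m : Mon V t" "j < l" for m t j
 proof (rule Mon_lk[OF that(1)])
  show "j ~: V" using l(2)[of j] that(2) by auto
 qed
 have "lk ?m l <= lk (lmk k (1 + vr l * c)) l"
  by (rule monomial_order[OF lmk(2)[OF nk nd]]) (use z lmk_mem[OF m(1) P] lmk_mem[OF nk P1] in blast)+
 thus "lk (lmk k (1 + vr l * c)) l >= 1" using ml by linarith
qed

text \<open>Put \<pi> = 1 + x c with x the first variable of V. Modulo \<pi> the element c is invertible with
inverse -x, so no denominators are needed: if a = \<pi> w modulo Q, then g a^i is divisible by
\<pi>^i inside A for every i. If a does not involve x, the exponent of x in the leading monomial of
g a^i is that of g, while the one of \<pi>^i is at least i. So a vanishes modulo Q.\<close>
lemma (in frame) avoid_ideal: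
 assumes kp: "kprime k" and ai: "AI k Q V" and kQ: "!!f. kdv k f ==> f : Q"
  and l: "l : V" "!!j. j : V ==> l <= j" and a: "a : Pol (V - {l}) s" and w: "a - (1 + vr l * c) * w : Q"
 shows "a : Q"
proof (rule ccontr)
 assume aQ: "a ~: Q"
 define \<pi> where "\<pi> = 1 + vr l * c"
 define i where "i = lk (lmk k g) l + 1"
 have nd: "~ kdv k f" if "f ~: Q" for f using kQ that by blast
 have PQ: "f : Q \<longleftrightarrow> kdv k f" if "f : Pol V t" for f t using ai kQ that unfolding AI_def by blast
 have aV: "a : Pol V s" using a Pol_mono[of "V - {l}" V s s] by blast
 have vP: "vr l : Pol V 1" by (rule vr_Pol) (use l in auto)
 have \<pi>P: "\<pi> : Pol V (1 + \<kappa>)" unfolding \<pi>_def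
  by (rule Pol_add[OF one_Pol]) (rule Pol_mult'[OF vP cPol], simp)
 from gen[of w] obtain t f where f: "f : Pol {..<M} t" "w - f : Q" by blast
 let ?n = "M * (i * t)"
 have "c ^ ?n * w ^ i \<asymp> c ^ ?n * f ^ i" using f(2) by (intro cg_mult cg_refl cg_pow) (simp add: cg_def)
 hence "c ^ ?n * w ^ i : spn Q V (?n * \<kappa>) B" by (rule spn_cg) (rule clear[OF Pol_pow[OF f(1)]])
 hence "g * (c ^ ?n * w ^ i) : spn Q V (?n * \<kappa> + \<kappa>) Y" by (rule spn_comp) (rule gspan)
 then obtain \<alpha> where \<alpha>: "ALL y:Y. \<alpha> y : Pol V (?n * \<kappa> + \<kappa>)" "g * (c ^ ?n * w ^ i) - (\<Sum>y\<in>Y. \<alpha> y * y) : Q"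
  unfolding spn_def by blast
 \<comment> \<open>Y is independent and contains 1, so the coefficients of 1 agree\<close>
 have "g * (c ^ ?n * a ^ i) \<asymp> g * (c ^ ?n * (\<pi> * w) ^ i)"
  using w by (intro cg_mult cg_refl cg_pow) (simp add: cg_def \<pi>_def)
 also have "... = \<pi> ^ i * (g * (c ^ ?n * w ^ i))" by (simp add: power_mult_distrib ac_simps)
 also have "... \<asymp> \<pi> ^ i * (\<Sum>y\<in>Y. \<alpha> y * y)" using \<alpha>(2) by (intro cg_mult cg_refl) (simp add: cg_def)
 finally have e1: "g * (c ^ ?n * a ^ i) \<asymp> \<pi> ^ i * (\<Sum>y\<in>Y. \<alpha> y * y)" .
 let ?\<beta> = "%y. \<pi> ^ i * \<alpha> y - (if y = 1 then g * (c ^ ?n * a ^ i) else 0)"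
 have "(\<Sum>y\<in>Y. (if y = 1 then g * (c ^ ?n * a ^ i) else 0) * y) = (\<Sum>y\<in>Y. if y = 1 then g * (c ^ ?n * a ^ i) else 0)"
  by (rule sum.cong) auto
 also have "... = g * (c ^ ?n * a ^ i)" using oneY finY by (simp add: sum.delta)
 finally have "(\<Sum>y\<in>Y. ?\<beta> y * y) = \<pi> ^ i * (\<Sum>y\<in>Y. \<alpha> y * y) - g * (c ^ ?n * a ^ i)"
  by (simp add: left_diff_distrib sum_subtractf sum_distrib_left mult.assoc)
 also have "... : Q" using cg_sym[OF e1] by (simp add: cg_def)
 finally have s: "(\<Sum>y\<in>Y. ?\<beta> y * y) : Q" .
 define N where "N = i * (1 + \<kappa>) + (?n * \<kappa> + \<kappa>) + (\<kappa> + ?n * \<kappa> + i * s)"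
 have lhsP: "g * (c ^ ?n * a ^ i) : Pol V N"
 proof (rule Pol_mult'[OF gPol])
  show "c ^ ?n * a ^ i : Pol V (?n * \<kappa> + i * s)" by (rule Pol_mult[OF Pol_pow[OF cPol] Pol_pow[OF aV]])
 qed (simp add: N_def)
 have rhsP: "\<pi> ^ i * \<alpha> y : Pol V N" if "y : Y" for y
  by (rule Pol_mult'[OF Pol_pow[OF \<pi>P] bspec[OF \<alpha>(1) that]]) (simp add: N_def)
 have "?\<beta> 1 : Q"
 proof (rule indD[OF indY _ s oneY])
  fix y assume "y : Y"
  thus "?\<beta> y : Pol V N" using rhsP lhsP by (auto intro: Pol_diff)
 qed
 hence e2: "\<pi> ^ i * \<alpha> 1 \<asymp> g * (c ^ ?n * a ^ i)" by (simp add: cg_def)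
 \<comment> \<open>c is invertible modulo powers of pi, because 1 - pi is -c times a variable\<close>
 have "EX r. EX x:Pol V r. (1 - \<pi>) ^ m = 1 - \<pi> * x" for m
 proof (induction m)
  case 0 show ?case by (intro exI[of _ 0] bexI[of _ 0]) (simp_all add: zero_Pol)
 next
  case (Suc m)
  then obtain r x where x: "x : Pol V r" "(1 - \<pi>) ^ m = 1 - \<pi> * x" by blast
  have "(1 - \<pi>) ^ Suc m = 1 - \<pi> * (x + 1 - \<pi> * x)" by (simp add: x(2) algebra_simps)
  moreover have "x + 1 - \<pi> * x : Pol V (1 + \<kappa> + r)"
  proof (intro Pol_diff Pol_add one_Pol)
   show "x : Pol V (1 + \<kappa> + r)" by (rule Pol_mono'[OF x(1)]) simp
   show "\<pi> * x : Pol V (1 + \<kappa> + r)" by (rule Pol_mult'[OF \<pi>P x(1)]) simp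
  qed
  ultimately show ?case by blast
 qed
 then obtain r x where x: "x : Pol V r" "(1 - \<pi>) ^ ?n = 1 - \<pi> * x" by blast
 define v where "v = (\<Sum>j<i. (\<pi> * x) ^ j)"
 have geo: "(\<Sum>j<i. z ^ j) * (1 - z) = 1 - z ^ i" for z :: zpol
  using one_diff_power_eq[of z i] by (simp add: mult.commute)
 have v: "v * (1 - \<pi>) ^ ?n = 1 - \<pi> ^ i * x ^ i" unfolding v_def x(2) geo by (simp add: power_mult_distrib)
 have \<pi>xP: "\<pi> * x : Pol V (1 + \<kappa> + r)" by (rule Pol_mult[OF \<pi>P x(1)])
 have vPol: "v : Pol V (i * (1 + \<kappa> + r))"
  unfolding v_def
 proof (rule Pol_sum)
  fix j assume "j : {..<i}"
  hence "j * (1 + \<kappa> + r) <= i * (1 + \<kappa> + r)" by (intro mult_le_mono1) simp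
  thus "(\<pi> * x) ^ j : Pol V (i * (1 + \<kappa> + r))" by (rule Pol_mono'[OF Pol_pow[OF \<pi>xP]])
 qed
 define R where "R = \<alpha> 1 * ((- vr l) ^ ?n * v) + g * (a ^ i * x ^ i)"
 have p1: "(1 - \<pi>) = (- vr l) * c" by (simp add: \<pi>_def)
 have "g * a ^ i = g * a ^ i * (v * (1 - \<pi>) ^ ?n) + \<pi> ^ i * (g * (a ^ i * x ^ i))"
  unfolding v by (simp add: algebra_simps)
 also have "g * a ^ i * (v * (1 - \<pi>) ^ ?n) = (g * (c ^ ?n * a ^ i)) * ((- vr l) ^ ?n * v)"
  unfolding p1 power_mult_distrib by (simp only: ac_simps)
 also have "(g * (c ^ ?n * a ^ i)) * ((- vr l) ^ ?n * v) + \<pi> ^ i * (g * (a ^ i * x ^ i)) \<asymp>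
  (\<pi> ^ i * \<alpha> 1) * ((- vr l) ^ ?n * v) + \<pi> ^ i * (g * (a ^ i * x ^ i))"
  by (intro cg_add cg_mult cg_refl cg_sym[OF e2])
 also have "... = \<pi> ^ i * R" unfolding R_def by (simp add: algebra_simps)
 finally have e3: "g * a ^ i - \<pi> ^ i * R : Q" unfolding cg_def .
 obtain t1 where RP: "R : Pol V t1"
 proof -
  have "(- vr l) ^ ?n * v : Pol V (?n * 1 + i * (1 + \<kappa> + r))"
   by (rule Pol_mult[OF Pol_pow[OF Pol_minus[OF vP]] vPol])
  from Pol_mult[OF bspec[OF \<alpha>(1) oneY] this]
  have 1: "\<alpha> 1 * ((- vr l) ^ ?n * v) : Pol V (?n * \<kappa> + \<kappa> + (?n * 1 + i * (1 + \<kappa> + r)))" .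
  have 2: "g * (a ^ i * x ^ i) : Pol V (\<kappa> + (i * s + i * r))"
   by (rule Pol_mult[OF gPol Pol_mult[OF Pol_pow[OF aV] Pol_pow[OF x(1)]]])
  have "R : Pol V ((?n * \<kappa> + \<kappa> + (?n * 1 + i * (1 + \<kappa> + r))) + (\<kappa> + (i * s + i * r)))"
   unfolding R_def by (rule Pol_add[OF Pol_mono'[OF 1] Pol_mono'[OF 2]]) simp_all
  thus ?thesis by (rule that)
 qed
 have gaP: "g * a ^ i : Pol V (\<kappa> + i * s)" by (rule Pol_mult[OF gPol Pol_pow[OF aV]])
 have piP: "\<pi> ^ i * R : Pol V (i * (1 + \<kappa>) + t1)" by (rule Pol_mult[OF Pol_pow[OF \<pi>P] RP])
 have "g * a ^ i - \<pi> ^ i * R : Pol V ((\<kappa> + i * s) + (i * (1 + \<kappa>) + t1))"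
  by (rule Pol_diff[OF Pol_mono'[OF gaP] Pol_mono'[OF piP]]) simp_all
 hence kd: "kdv k (g * a ^ i - \<pi> ^ i * R)" using e3 PQ by blast
 have ng: "~ kdv k g" and na: "~ kdv k a" and nc: "~ kdv k c" using nd gQ aQ cQ by blast+
 have nai: "~ kdv k (a ^ i)" using lmk_power[OF kp na] by blast
 have n1: "~ kdv k (g * a ^ i)" and l1: "lmk k (g * a ^ i) = lmk k g + lmk k (a ^ i)"
  using lmk_mult[OF kp ng nai] by blast+
 have "lmk k (a ^ i) : Mon (V - {l}) (i * s)" by (rule lmk_mem[OF nai Pol_pow[OF a]])
 hence "lk (lmk k (a ^ i)) l = 0" by (rule Mon_lk) simp
 hence L: "lk (lmk k (g * a ^ i)) l = lk (lmk k g) l" unfolding l1 by (simp add: lookup_add)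
 have n2: "~ kdv k (\<pi> ^ i * R)" using n1 lmk_cong(1)[OF kd] by blast
 hence np: "~ kdv k (\<pi> ^ i)" "~ kdv k R" using kdv_mult[OF kp] by blast+
 have sh: "~ kdv k \<pi>" "lk (lmk k \<pi>) l >= 1" unfolding \<pi>_def using shifted_one[OF kp cPol nc l] by blast+
 have "lk (lmk k (\<pi> ^ i * R)) l = i * lk (lmk k \<pi>) l + lk (lmk k R) l"
  using lmk_mult(2)[OF kp np] lmk_power[OF kp sh(1), of i] by (simp add: lookup_add)
 moreover have "i * 1 <= i * lk (lmk k \<pi>) l" by (rule mult_left_mono[OF sh(2)]) simp
 ultimately have "i <= lk (lmk k (\<pi> ^ i * R)) l" by linarith
 also have "... = lk (lmk k g) l" using L lmk_cong(2)[OF kd] by simp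
 finally show False by (simp add: i_def)
qed

text \<open>The ideal generated by \<pi> and Q avoids the nonzero polynomials in the remaining variables of V,
so some prime above it does too. Continue with one variable less.\<close>
lemma krull_lower:
 fixes Q :: "zpol set"
 assumes p: "Factorial_Ring.prime p"
 shows "prm Q ==> of_nat p : Q ==> (!!w. EX s. EX f:Pol {..<M} s. w - f : Q) ==>
  AI (int p) Q V ==> V \<subseteq> {..<M} ==> e <= card V ==>
  EX T. T 0 = Q & (ALL i<=e. prm (T i)) & (ALL i<e. T i \<subset> T (Suc i))"
proof (induction e arbitrary: Q V)
 case 0
 thus ?case by (intro exI[of _ "%_. Q"]) simp
next
 case (Suc e)
 note kp = kprime_prime[OF p]
 interpret prime_modulus Q by unfold_locales (use Suc.prems(1) prm_idl in auto)
 have pQ: "of_int (int p) : Q" using Suc.prems(2) by simp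
 from full_data[OF kp pQ Suc.prems(4,5,3)] obtain V' c B \<kappa> g Y where
  d: "V \<subseteq> V'" "AI (int p) Q V'" "frame Q M V' c B \<kappa> g Y" by blast
 interpret F: frame Q M V' c B \<kappa> g Y by (rule d(3))
 have finV': "finite V'" by (rule F.finV)
 have cV: "Suc e <= card V'" using Suc.prems(6) card_mono[OF finV' d(1)] by linarith
 define l where "l = Min V'"
 have ne: "V' ~= {}" using cV by auto
 have l: "l : V'" "!!j. j : V' ==> l <= j" unfolding l_def using finV' ne by auto
 let ?\<pi> = "1 + vr l * c"
 let ?I = "{x. EX w. x - ?\<pi> * w : Q}"
 let ?S = "{f. (EX s. f : Pol (V' - {l}) s) & f ~: Q}"
 have kQ: "f : Q" if "kdv (int p) f" for f
  using kdv_factor[OF that] idl_mult2[OF idl pQ] by auto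
 have dis: "?I \<inter> ?S = {}"
 proof (rule ccontr)
  assume "?I \<inter> ?S ~= {}"
  then obtain a w s where a: "a - ?\<pi> * w : Q" "a : Pol (V' - {l}) s" "a ~: Q" by blast
  have "a : Q"
   by (rule F.avoid_ideal[OF kp d(2) kQ l a(2,1)])
  thus False using a(3) by simp
 qed
 have idI: "idl ?I" by (rule idl_shift_UNIV[OF idl])
 have QI: "Q \<subseteq> ?I"
 proof
  fix x assume "x : Q" hence "x - ?\<pi> * 0 : Q" by simp
  thus "x : ?I" by blast
 qed
 have "EX Q1. prm Q1 & ?I \<subseteq> Q1 & Q1 \<inter> ?S = {}"
 proof (rule prime_avoiding[OF idI _ _ dis])
  show "1 : ?S" using one_Pol prm_one[OF prQ] by blast
  fix a b assume "a : ?S" "b : ?S"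
  thus "a * b : ?S" using Pol_mult prm_mult[OF prQ] by blast
 qed
 then obtain Q1 where Q1: "prm Q1" "?I \<subseteq> Q1" "Q1 \<inter> ?S = {}" by blast
 have QQ1: "Q \<subseteq> Q1" using QI Q1(2) by blast
 have "?\<pi> - ?\<pi> * 1 : Q" using subgrp_zero[OF sg] by simp
 hence piQ1: "?\<pi> : Q1" using Q1(2) by blast
 have cP: "c : Pol V' \<kappa>" by (rule F.cPol)
 have "~ kdv (int p) c" using F.cQ kQ by blast
 from shifted_one(1)[OF kp cP this l] have npi: "~ kdv (int p) ?\<pi>" .
 have "?\<pi> : Pol V' (1 + \<kappa>)"
  by (rule Pol_add[OF one_Pol Pol_mult[OF vr_Pol[OF l(1)] cP]]) simp
 hence "?\<pi> ~: Q" using npi d(2) unfolding AI_def by blast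
 hence strict: "Q \<subset> Q1" using QQ1 piQ1 by blast
 have AI1: "AI (int p) Q1 (V' - {l})"
  unfolding AI_def
 proof (intro allI ballI impI)
  fix s f assume f: "f : Pol (V' - {l}) s" "f : Q1"
  hence "f : Q" using Q1(3) by blast
  moreover have "f : Pol V' s" using f(1) Pol_mono[of "V' - {l}" V' s s] by blast
  ultimately show "kdv (int p) f" using d(2) unfolding AI_def by blast
 qed
 have "EX T. T 0 = Q1 & (ALL i<=e. prm (T i)) & (ALL i<e. T i \<subset> T (Suc i))"
 proof (rule Suc.IH[OF Q1(1) _ _ AI1])
  show "of_nat p : Q1" using Suc.prems(2) QQ1 by blast
  show "EX s. EX f:Pol {..<M} s. w - f : Q1" for w using Suc.prems(3)[of w] QQ1 by blast
  show "V' - {l} \<subseteq> {..<M}" using F.VM by blast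
  show "e <= card (V' - {l})" using cV l(1) finV' by simp
 qed
 then obtain T where T: "T 0 = Q1" "ALL i<=e. prm (T i)" "ALL i<e. T i \<subset> T (Suc i)" by blast
 let ?T = "%i. case i of 0 => Q | Suc j => T j"
 have "prm (?T i)" if "i <= Suc e" for i using that T(2) prQ by (cases i) simp_all
 moreover have "?T i \<subset> ?T (Suc i)" if "i < Suc e" for i using that T(1,3) strict by (cases i) simp_all
 ultimately show ?case by (intro exI[of _ ?T]) simp
qed

text \<open>Transfer between the type-class ring W and a ring B given by a record: ideals of B are the ideals of
W that contain the kernel.\<close>
locale surj_hom = cring B for B :: "('a, 'm) ring_scheme" (structure) +
 fixes \<psi> :: "'w::comm_ring_1 => 'a"
 assumes closed: "\<psi> x : carrier B"
  and hom_add: "\<psi> (x + y) = \<psi> x \<oplus> \<psi> y"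
  and hom_mult: "\<psi> (x * y) = \<psi> x \<otimes> \<psi> y"
  and hom_one: "\<psi> 1 = \<one>"
  and surj: "b : carrier B ==> EX x. b = \<psi> x"
begin

definition krn :: "'w set" where "krn = {x. \<psi> x = \<zero>}"

definition pre :: "'a set => 'w set" where "pre K = {x. \<psi> x : K}"

lemma hom_zero: "\<psi> 0 = \<zero>"
proof -
 have "\<psi> 0 \<oplus> \<psi> 0 = \<psi> 0" using hom_add[of 0 0] by simp
 thus ?thesis using closed[of 0] by (metis l_zero local.add.right_cancel zero_closed)
qed

lemma hom_minus: "\<psi> (- x) = \<ominus> \<psi> x"
proof -
 have "\<psi> (- x) \<oplus> \<psi> x = \<zero>" using hom_add[of "- x" x] hom_zero by simp
 thus ?thesis using closed minus_equality by metis
qed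

lemma hom_diff: "\<psi> (x - y) = \<psi> x \<ominus> \<psi> y"
 using hom_add[of x "- y"] hom_minus by (simp add: a_minus_def)

lemma hom_eq: "\<psi> x = \<psi> y \<longleftrightarrow> x - y : krn"
proof -
 have "\<psi> x \<ominus> \<psi> y = \<zero> \<longleftrightarrow> \<psi> x = \<psi> y" using closed by (metis r_right_minus_eq)
 thus ?thesis by (simp add: krn_def hom_diff)
qed

lemma hom_pow: "\<psi> (x ^ n) = \<psi> x [^] n"
 by (induction n) (simp_all add: hom_one hom_mult m_comm closed)

lemma hom_nat: "\<psi> (of_nat n * x) = [n] \<cdot> \<psi> x"
 by (induction n) (simp_all add: hom_zero hom_add distrib_right closed a_comm)

lemma hom_int: "\<psi> (of_int k * x) = [k] \<cdot> \<psi> x"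
proof (cases "k >= 0")
 case True thus ?thesis using hom_nat[of "nat k" x] by (simp add: add_pow_int_ge)
next
 case False
 hence "of_int k * x = - (of_nat (nat (- k)) * x)" by simp
 hence "\<psi> (of_int k * x) = \<ominus> ([nat (- k)] \<cdot> \<psi> x)" by (simp only: hom_minus hom_nat)
 thus ?thesis using False by (simp add: add_pow_int_lt)
qed

lemma ideal_pre: assumes "ideal K B" shows "idl (pre K)" "krn \<subseteq> pre K"
proof -
 interpret K: ideal K B by fact
 show "idl (pre K)"
  unfolding stab_def subgrp_def pre_def
  using K.zero_closed K.a_inv_closed K.a_closed K.I_l_closed closed
  by (simp add: hom_zero hom_diff hom_mult a_minus_def)
 show "krn \<subseteq> pre K" unfolding krn_def pre_def using K.zero_closed by auto
qed

lemma image_pre: "K \<subseteq> carrier B ==> \<psi> ` pre K = K"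
 unfolding pre_def using surj by blast

lemma krn_idl: "idl krn"
 using ideal_pre(1)[OF zeroideal] by (simp add: pre_def krn_def)

lemma krn_sg: "subgrp krn" using krn_idl by (rule stab_subgrp)

lemma subgroup_image: assumes sN: "subgrp N" shows "subgroup (\<psi> ` N) (add_monoid B)"
 proof (rule add.subgroupI)
  show "\<psi> ` N \<subseteq> carrier B" using closed by blast
  show "\<psi> ` N ~= {}" using subgrp_zero[OF sN] by blast
  fix a assume "a : \<psi> ` N"
  then obtain x where x: "x : N" "a = \<psi> x" by blast
  have "\<psi> (- x) : \<psi> ` N" using subgrp_minus[OF sN x(1)] by (rule imageI)
  thus "\<ominus> a : \<psi> ` N" by (simp only: x(2) hom_minus)
  fix b assume "b : \<psi> ` N"
  then obtain y where y: "y : N" "b = \<psi> y" by blast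
  have "\<psi> (x + y) : \<psi> ` N" using subgrp_add[OF sN x(1) y(1)] by (rule imageI)
  thus "a \<oplus> b : \<psi> ` N" by (simp only: x(2) y(2) hom_add)
 qed

lemma ideal_image: assumes "idl N" shows "ideal (\<psi> ` N) B"
proof (rule idealI[OF ring_axioms])
 show "subgroup (\<psi> ` N) (add_monoid B)" by (rule subgroup_image[OF stab_subgrp[OF assms]])
 fix a x assume a: "a : \<psi> ` N" and x: "x : carrier B"
 obtain n y where n: "n : N" "a = \<psi> n" "x = \<psi> y" using a surj[OF x] by blast
 have "y * n : N" by (rule idl_mult[OF assms n(1)])
 thus xa: "x \<otimes> a : \<psi> ` N" using n by (metis hom_mult imageI)
 thus "a \<otimes> x : \<psi> ` N" using n closed by (simp add: m_comm)
qed

lemma pre_image: assumes "subgrp N" "krn \<subseteq> N" shows "pre (\<psi> ` N) = N"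
proof
 show "pre (\<psi> ` N) \<subseteq> N"
 proof
  fix x assume "x : pre (\<psi> ` N)"
  then obtain n where n: "n : N" "\<psi> x = \<psi> n" unfolding pre_def by blast
  hence "x - n : N" using assms(2) hom_eq by blast
  thus "x : N" using n(1) subgrp_cong[OF assms(1)] by blast
 qed
qed (auto simp: pre_def)

lemma prime_pre: assumes "primeideal K B" shows "prm (pre K)"
proof -
 interpret K: primeideal K B by fact
 show ?thesis unfolding prm_def
 proof (intro conjI allI impI)
  show "idl (pre K)" by (rule ideal_pre[OF K.is_ideal])
  show "1 ~: pre K" unfolding pre_def using K.I_notcarr K.one_imp_carrier by (auto simp: hom_one)
  fix a b assume "a * b : pre K"
  thus "a : pre K | b : pre K" unfolding pre_def using K.I_prime closed by (simp add: hom_mult)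
 qed
qed

lemma prime_image: assumes "prm N" "krn \<subseteq> N" shows "primeideal (\<psi> ` N) B"
proof (rule primeidealI[OF ideal_image[OF prm_idl[OF assms(1)]] is_cring])
 have pn: "pre (\<psi> ` N) = N" by (rule pre_image[OF prm_subgrp[OF assms(1)] assms(2)])
 have "1 ~: pre (\<psi> ` N)" unfolding pn by (rule prm_one[OF assms(1)])
 hence "\<psi> 1 ~: \<psi> ` N" unfolding pre_def by simp
 thus "carrier B ~= \<psi> ` N" using closed by blast
 fix a b assume ab: "a : carrier B" "b : carrier B" "a \<otimes> b : \<psi> ` N"
 obtain x y where xy: "a = \<psi> x" "b = \<psi> y" using ab surj by blast
 have "x * y : pre (\<psi> ` N)" unfolding pre_def using ab(3) xy by (simp add: hom_mult)
 hence "x : N | y : N" unfolding pn using prm_mult[OF assms(1)] by blast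
 thus "a : \<psi> ` N | b : \<psi> ` N" using xy by blast
qed

lemma krull_le:
 assumes "!!n T. (!!i. i <= n ==> prm (T i) & krn \<subseteq> T i) ==> (!!i. i < n ==> T i \<subset> T (Suc i)) ==> n <= e"
 shows "krull_dim B <= enat e"
 unfolding krull_dim_def
proof (rule Sup_least)
 fix x assume "x : {enat n |n. EX P. (ALL i<=n. primeideal (P i) B) & (ALL i<n. P i \<subset> P (Suc i))}"
 then obtain n P where n: "x = enat n" and P: "ALL i<=n. primeideal (P i) B" "ALL i<n. P i \<subset> P (Suc i)" by blast
 have sub: "P i \<subseteq> carrier B" if "i <= n" for i
  using P(1) that by (meson additive_subgroup.a_subset ideal.axioms(1) primeideal.axioms(1))
 have "n <= e"
 proof (rule assms)
  fix i assume i: "i <= n"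
  show "prm (pre (P i)) & krn \<subseteq> pre (P i)" using P(1) i prime_pre ideal_pre(2) primeideal.axioms(1) by blast
 next
  fix i assume i: "i < n"
  have "pre (P i) \<subseteq> pre (P (Suc i))" using P(2) i unfolding pre_def by blast
  moreover have "pre (P i) ~= pre (P (Suc i))"
  proof
   assume "pre (P i) = pre (P (Suc i))"
   hence "\<psi> ` pre (P i) = \<psi> ` pre (P (Suc i))" by simp
   hence "P i = P (Suc i)" using image_pre[OF sub[of i]] image_pre[OF sub[of "Suc i"]] i by simp
   thus False using P(2) i by blast
  qed
  ultimately show "pre (P i) \<subset> pre (P (Suc i))" by blast
 qed
 thus "x <= enat e" using n by simp
qed

lemma krull_ge:
 assumes "!!i. i <= n ==> prm (T i) & krn \<subseteq> T i" "!!i. i < n ==> T i \<subset> T (Suc i)"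
 shows "enat n <= krull_dim B"
 unfolding krull_dim_def
proof (rule Sup_upper, rule CollectI, intro exI conjI allI impI)
 show "enat n = enat n" ..
 fix i assume "i <= n" thus "primeideal (\<psi> ` T i) B" using prime_image assms(1) by blast
next
 fix i assume i: "i < n"
 have "\<psi> ` T i ~= \<psi> ` T (Suc i)"
  using pre_image[of "T i"] pre_image[of "T (Suc i)"] assms i prm_subgrp by (metis Suc_leI less_imp_le psubset_eq)
 thus "\<psi> ` T i \<subset> \<psi> ` T (Suc i)" using assms(2)[OF i] by blast
qed

lemma genideal_pre:
 assumes "T \<subseteq> carrier B"
 shows "pre (genideal B T) = gid ({w. \<psi> w : T} \<union> krn)"
proof
 let ?G = "gid ({w. \<psi> w : T} \<union> krn)"
 have G: "idl ?G" by (rule idl_gid)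
 have kG: "krn \<subseteq> ?G" using gid_incl[of "{w. \<psi> w : T} \<union> krn"] by blast
 have "T \<subseteq> \<psi> ` ?G"
 proof
  fix t assume t: "t : T"
  then obtain w where w: "t = \<psi> w" using surj assms by blast
  have "w : ?G" using gid_incl[of "{w. \<psi> w : T} \<union> krn"] t w by blast
  thus "t : \<psi> ` ?G" using w by blast
 qed
 hence "genideal B T \<subseteq> \<psi> ` ?G" by (rule genideal_minimal[OF ideal_image[OF G]])
 hence "pre (genideal B T) \<subseteq> pre (\<psi> ` ?G)" unfolding pre_def by blast
 thus "pre (genideal B T) \<subseteq> ?G" using pre_image[OF stab_subgrp[OF G] kG] by simp
 have gi: "ideal (genideal B T) B" by (rule genideal_ideal[OF assms])
 show "?G \<subseteq> pre (genideal B T)"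
 proof (rule gid_least[OF ideal_pre(1)[OF gi]])
  show "{w. \<psi> w : T} \<union> krn \<subseteq> pre (genideal B T)"
   using genideal_self[OF assms] ideal_pre(2)[OF gi] unfolding pre_def by blast
 qed
qed

lemma frobenius_pre:
 assumes "ideal K B"
 shows "ideal (frobenius_power B K q) B" "pre (frobenius_power B K q) = FP krn (pre K) q"
proof -
 interpret K: ideal K B by fact
 let ?T = "{x [^] q | x. x : K}"
 have T: "?T \<subseteq> carrier B" using K.a_subset by auto
 show "ideal (frobenius_power B K q) B" unfolding frobenius_power_def by (rule genideal_ideal[OF T])
 have "gid ({w. \<psi> w : ?T} \<union> krn) = gid ({w ^ q |w. w : pre K} \<union> krn)"
 proof
  show "gid ({w. \<psi> w : ?T} \<union> krn) \<subseteq> gid ({w ^ q |w. w : pre K} \<union> krn)"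
  proof (rule gid_least[OF idl_gid])
   have inc: "{w ^ q |w. w : pre K} \<union> krn \<subseteq> gid ({w ^ q |w. w : pre K} \<union> krn)" by (rule gid_incl)
   show "{w. \<psi> w : ?T} \<union> krn \<subseteq> gid ({w ^ q |w. w : pre K} \<union> krn)"
   proof
    fix w assume w: "w : {w. \<psi> w : ?T} \<union> krn"
    show "w : gid ({w ^ q |w. w : pre K} \<union> krn)"
    proof (cases "w : krn")
     case True thus ?thesis using inc by blast
    next
     case False
     then obtain x where x: "x : K" "\<psi> w = x [^] q" using w by blast
     obtain v where v: "x = \<psi> v" using surj x(1) K.a_subset by blast
     have "\<psi> w = \<psi> (v ^ q)" using x v by (simp add: hom_pow)
     hence 1: "w - v ^ q : gid ({w ^ q |w. w : pre K} \<union> krn)" using hom_eq inc by blast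
     have "v : pre K" using x v by (simp add: pre_def)
     hence "v ^ q : gid ({w ^ q |w. w : pre K} \<union> krn)" using inc by blast
     thus ?thesis using subgrp_cong[OF stab_subgrp[OF idl_gid] 1] by blast
    qed
   qed
  qed
  show "gid ({w ^ q |w. w : pre K} \<union> krn) \<subseteq> gid ({w. \<psi> w : ?T} \<union> krn)"
  proof (rule gid_least[OF idl_gid])
   have "{w ^ q |w. w : pre K} \<subseteq> {w. \<psi> w : ?T}" unfolding pre_def by (auto simp: hom_pow)
   thus "{w ^ q |w. w : pre K} \<union> krn \<subseteq> gid ({w. \<psi> w : ?T} \<union> krn)"
    using gid_incl[of "{w. \<psi> w : ?T} \<union> krn"] by blast
  qed
 qed
 thus "pre (frobenius_power B K q) = FP krn (pre K) q"
  unfolding frobenius_power_def FP_def genideal_pre[OF T] .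
qed

section \<open>Colength\<close>

lemma quotient_module_simps:
 "carrier (quotient_module B K) = carrier (B Quot K)"
 "add (quotient_module B K) = add (B Quot K)"
 "ring.zero (quotient_module B K) = ring.zero (B Quot K)"
 "smult (quotient_module B K) r x = (K +> r) \<otimes>\<^bsub>B Quot K\<^esub> x"
 by (simp_all add: quotient_module_def)

lemma quotient_hom: assumes "ideal K B" shows "surj_hom (B Quot K) (%w. K +> \<psi> w)"
proof -
 interpret K: ideal K B by fact
 interpret h: ring_hom_ring B "B Quot K" "(+>) K" by (rule K.rcos_ring_hom_ring)
 interpret q: cring "B Quot K" by (rule K.quotient_is_cring[OF is_cring])
 show ?thesis
 proof
  show "K +> \<psi> w : carrier (B Quot K)" for w using closed h.hom_closed by blast
  show "K +> \<psi> (x + y) = (K +> \<psi> x) \<oplus>\<^bsub>B Quot K\<^esub> (K +> \<psi> y)" for x y by (simp add: hom_add closed)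
  show "K +> \<psi> (x * y) = (K +> \<psi> x) \<otimes>\<^bsub>B Quot K\<^esub> (K +> \<psi> y)" for x y by (simp add: hom_mult closed)
  show "K +> \<psi> 1 = \<one>\<^bsub>B Quot K\<^esub>" by (simp add: hom_one)
  fix z assume "z : carrier (B Quot K)"
  then obtain b where "b : carrier B" "z = K +> b" unfolding FactRing_def A_RCOSETS_def' by auto
  thus "EX x. z = K +> \<psi> x" using surj by blast
 qed
qed

text \<open>The quotient module has its carrier in the type of cosets; its submodules are the ideals of the
quotient ring, and W maps onto this ring with kernel pre K.\<close>
lemma colength_chains:
 assumes K: "ideal K B"
 shows "colength B K = Sup {enat n | n. EX Z. chn UNIV (pre K) UNIV Z n}"
proof -
 interpret K: ideal K B by fact
 interpret q: surj_hom "B Quot K" "%w. K +> \<psi> w" by (rule quotient_hom[OF K])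
 let ?M = "quotient_module B K" and ?q = "%w. K +> \<psi> w"
 have qk: "K +> \<psi> x = \<zero>\<^bsub>B Quot K\<^esub> \<longleftrightarrow> x : pre K" for x
  using quotient_eq_iff_same_a_r_cos[OF K closed closed, of x 0] q.hom_zero hom_diff[of x 0] by (simp add: pre_def)
 have krn: "q.krn = pre K" unfolding q.krn_def qk by simp
 have subm: "submodule N B ?M \<longleftrightarrow> ideal N (B Quot K)" for N
 proof -
  have inv: "m_inv (add_monoid ?M) x = \<ominus>\<^bsub>B Quot K\<^esub> x" for x
   unfolding a_inv_def m_inv_def by (simp add: quotient_module_def)
  have iff: "submodule N B ?M \<longleftrightarrow> N \<subseteq> carrier (B Quot K) & \<zero>\<^bsub>B Quot K\<^esub> : N &
   (ALL x:N. ALL y:N. x \<oplus>\<^bsub>B Quot K\<^esub> y : N) & (ALL x:N. \<ominus>\<^bsub>B Quot K\<^esub> x : N) &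
   (ALL r:carrier B. ALL x:N. (K +> r) \<otimes>\<^bsub>B Quot K\<^esub> x : N)"
   unfolding submodule_def submodule_axioms_def subgroup_def inv by (auto simp: quotient_module_simps)
  show ?thesis
  proof
   assume "submodule N B ?M"
   note N = this[unfolded iff]
   have ml: "y \<otimes>\<^bsub>B Quot K\<^esub> x : N" if y: "y : carrier (B Quot K)" and x: "x : N" for x y
   proof -
    obtain v where "y = ?q v" using q.surj[OF y] by blast
    thus ?thesis using N x closed by blast
   qed
   show "ideal N (B Quot K)"
   proof (rule idealI[OF q.ring_axioms])
    show "subgroup N (add_monoid (B Quot K))" by (rule q.add.subgroupI) (use N in auto)
    fix x y assume xy: "x : N" "y : carrier (B Quot K)"
    thus "y \<otimes>\<^bsub>B Quot K\<^esub> x : N" by (intro ml)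
    moreover have "x : carrier (B Quot K)" using N xy(1) by blast
    ultimately show "x \<otimes>\<^bsub>B Quot K\<^esub> y : N" using xy(2) by (simp add: q.m_comm)
   qed
  next
   assume "ideal N (B Quot K)"
   then interpret N: ideal N "B Quot K" .
   have "?q v : carrier (B Quot K)" for v by (rule q.closed)
   hence "K +> r : carrier (B Quot K)" if "r : carrier B" for r using surj[OF that] by metis
   thus "submodule N B ?M" unfolding iff
    by (intro conjI ballI N.a_subset N.zero_closed N.a_closed N.a_inv_closed N.I_l_closed) assumption+
  qed
 qed
 have "(EX N. (ALL i<=n. submodule (N i) B ?M) & (ALL i<n. N i \<subset> N (Suc i))) \<longleftrightarrow> (EX Z. chn UNIV (pre K) UNIV Z n)" for n
  unfolding subm
 proof
  assume "EX N. (ALL i<=n. ideal (N i) (B Quot K)) & (ALL i<n. N i \<subset> N (Suc i))"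
  then obtain N where N: "ALL i<=n. ideal (N i) (B Quot K)" "ALL i<n. N i \<subset> N (Suc i)" by blast
  have im: "?q ` q.pre (N i) = N i" if "i <= n" for i
   using N(1) that q.image_pre additive_subgroup.a_subset ideal.axioms(1) by metis
  have 1: "idl (q.pre (N i)) & pre K \<subseteq> q.pre (N i)" if "i <= n" for i
   using q.ideal_pre[of "N i"] N(1) that krn by blast
  have 2: "q.pre (N i) \<subset> q.pre (N (Suc i))" if i: "i < n" for i
  proof -
   have "q.pre (N i) \<subseteq> q.pre (N (Suc i))" using N(2) i unfolding q.pre_def by blast
   moreover have "q.pre (N i) ~= q.pre (N (Suc i))"
   proof
    assume "q.pre (N i) = q.pre (N (Suc i))"
    hence "?q ` q.pre (N i) = ?q ` q.pre (N (Suc i))" by (rule arg_cong)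
    hence "N i = N (Suc i)" unfolding im[OF less_imp_le[OF i]] im[OF Suc_leI[OF i]] .
    thus False using N(2) i by blast
   qed
   ultimately show ?thesis by blast
  qed
  show "EX Z. chn UNIV (pre K) UNIV Z n"
   by (rule exI[of _ "%i. q.pre (N i)"], unfold chn_def) (use 1 2 in simp)
 next
  assume "EX Z. chn UNIV (pre K) UNIV Z n"
  then obtain Z where Z: "chn UNIV (pre K) UNIV Z n" by blast
  have pi: "q.pre (?q ` Z i) = Z i" if "i <= n" for i
   using q.pre_image[of "Z i"] chnD(2,3)[OF Z that] krn by simp
  have 1: "ideal (?q ` Z i) (B Quot K)" if "i <= n" for i by (rule q.ideal_image[OF chnD(1)[OF Z that]])
  have 2: "?q ` Z i \<subset> ?q ` Z (Suc i)" if i: "i < n" for i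
  proof -
   have "?q ` Z i ~= ?q ` Z (Suc i)"
   proof
    assume "?q ` Z i = ?q ` Z (Suc i)"
    hence "q.pre (?q ` Z i) = q.pre (?q ` Z (Suc i))" by (rule arg_cong)
    thus False using chnD(5)[OF Z i] unfolding pi[OF less_imp_le[OF i]] pi[OF Suc_leI[OF i]] by blast
   qed
   thus ?thesis using chnD(5)[OF Z i] by blast
  qed
  show "EX N. (ALL i<=n. ideal (N i) (B Quot K)) & (ALL i<n. N i \<subset> N (Suc i))"
   by (intro exI[of _ "%i. ?q ` Z i"] conjI allI impI 1 2)
 qed
 thus ?thesis unfolding colength_def module_length_def by simp
qed

lemma colength_len:
 assumes "ideal K B" "finite (quo (pre K) UNIV)"
 shows "colength B K = enat (len UNIV (pre K) UNIV)"
 unfolding colength_chains[OF assms(1)]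
proof (rule antisym)
 have idp: "idl (pre K)" by (rule ideal_pre(1)[OF assms(1)])
 have sp: "subgrp (pre K)" using idp by (rule stab_subgrp)
 show "Sup {enat n |n. EX Z. chn UNIV (pre K) UNIV Z n} <= enat (len UNIV (pre K) UNIV)"
  by (rule Sup_least) (use len_ge[OF _ sp assms(2)] in auto)
 show "enat (len UNIV (pre K) UNIV) <= Sup {enat n |n. EX Z. chn UNIV (pre K) UNIV Z n}"
  by (rule Sup_upper) (use len_chain[OF idp stab_UNIV _ assms(2)] in auto)
qed

end

section \<open>Evaluation of polynomials\<close>

text \<open>Variables with index at least M are sent to 1, so that every polynomial has the same value as one in
the first M variables.\<close>
lemma eval_hom_exists:
 fixes R (structure) and s :: "nat => 'a"
 assumes "cring R" and s: "!!i. i < M ==> s i : carrier R"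
 obtains \<psi> :: "zpol => 'a" where
  "!!x. \<psi> x : carrier R" "!!x y. \<psi> (x + y) = \<psi> x \<oplus> \<psi> y" "!!x y. \<psi> (x * y) = \<psi> x \<otimes> \<psi> y"
  "\<psi> 1 = \<one>" "!!i. i < M ==> \<psi> (vr i) = s i"
  "!!w. EX t. EX f:Pol {..<M} t. \<psi> w = \<psi> f"
proof -
 interpret cring R by fact
 define val :: "(nat \<Rightarrow>\<^sub>0 nat) => 'a" where "val m = finprod R (%i. s i [^] lk m i) {..<M}" for m
 have val_closed: "val m : carrier R" for m unfolding val_def by (rule finprod_closed) (use s in auto)
 have val_add: "val (m + n) = val m \<otimes> val n" for m n
 proof -
  have "val (m + n) = finprod R (%i. (s i [^] lk m i) \<otimes> (s i [^] lk n i)) {..<M}"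
   unfolding val_def by (rule finprod_cong') (use s in \<open>auto simp: lookup_add nat_pow_mult\<close>)
  also have "... = val m \<otimes> val n" unfolding val_def by (rule finprod_multf) (use s in auto)
  finally show ?thesis .
 qed
 have val_0: "val 0 = \<one>" unfolding val_def by (simp add: finprod_one_eqI)
 have val_vr: "val (sgl i 1) = s i" if "i < M" for i
 proof -
  have "val (sgl i 1) = finprod R (%j. if i = j then s j else \<one>) {..<M}"
   unfolding val_def by (rule finprod_cong') (use s in \<open>auto simp: lookup_single when_def\<close>)
  also have "... = s i" by (rule finprod_singleton[where f = s]) (use s that in auto)
  finally show ?thesis .
 qed
 from add.free_Abelian_group_universal[of val UNIV] obtain \<psi> where
  h: "\<psi> : hom (free_Abelian_group UNIV) (add_monoid R)" and of: "!!x. \<psi> (frag_of x) = val x"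
  using val_closed by auto
 have cl: "\<psi> x : carrier R" for x using h unfolding hom_def by auto
 have ad: "\<psi> (x + y) = \<psi> x \<oplus> \<psi> y" for x y using h unfolding hom_def by auto
 have z: "\<psi> 0 = \<zero>" using ad[of 0 0] cl[of 0] by (metis add.l_cancel_one' add.m_comm add_0 r_zero)
 have mi: "\<psi> (x - y) = \<psi> x \<ominus> \<psi> y" for x y
 proof -
  have "\<psi> (x - y) \<oplus> \<psi> y = \<psi> x" using ad[of "x - y" y] by simp
  thus ?thesis using cl by (metis add.inv_solve_right' a_minus_def)
 qed
 have mu1: "\<psi> (frag_of m * y) = val m \<otimes> \<psi> y" for m y
 using subset_UNIV[of "Poly_Mapping.keys y"]
 proof (induction y rule: frag_induction)
  case (one n)
  have "frag_of m * frag_of n = frag_of (m + n)" by (simp add: mult_single)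
  thus ?case by (simp add: of val_add)
 next
  case (diff a b)
  thus ?case using val_closed cl by (simp add: right_diff_distrib mi a_minus_def r_distr r_minus)
 qed (simp_all add: z val_closed)
 have mu: "\<psi> (x * y) = \<psi> x \<otimes> \<psi> y" for x y
 using subset_UNIV[of "Poly_Mapping.keys x"]
 proof (induction x rule: frag_induction)
  case (one n) thus ?case by (simp add: mu1 of)
 next
  case (diff a b)
  thus ?case using cl by (simp add: left_diff_distrib mi a_minus_def l_distr l_minus)
 qed (simp_all add: z cl)
 have on: "\<psi> 1 = \<one>" using of[of 0] by (simp add: val_0)
 have vi: "\<psi> (vr i) = s i" if "i < M" for i
  using of[of "sgl i 1"] val_vr[OF that] by (simp add: vr_def mon_def)
 have ge: "EX t. EX f:Pol {..<M} t. \<psi> w = \<psi> f" for w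
 using subset_UNIV[of "Poly_Mapping.keys w"]
 proof (induction w rule: frag_induction)
  case zero show ?case using zero_Pol by blast
 next
  case (one m)
  let ?n = "pm (lk m) {..<M}"
  have "val m = val ?n" unfolding val_def by (rule finprod_cong') (use s in \<open>auto simp: lk_pm\<close>)
  hence "\<psi> (frag_of m) = \<psi> (mon ?n)" by (simp add: of mon_def)
  moreover have "EX t. mon ?n : Pol {..<M} t" by (rule Pol_ex) (auto simp: mon_def ks_pm split: if_splits)
  ultimately show ?case by blast
 next
  case (diff a b)
  then obtain t f u g where "f : Pol {..<M} t" "\<psi> a = \<psi> f" "g : Pol {..<M} u" "\<psi> b = \<psi> g" by blast
  moreover from this have "f - g : Pol {..<M} (t + u)"
   by (intro Pol_diff) (auto intro: Pol_mono')
  ultimately show ?case by (metis mi)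
 qed
 show ?thesis by (rule that[OF cl ad mu on vi ge])
qed

section \<open>Tensor products\<close>

lemma frag_extend_fun_add:
 "frag_extend (%u. f u + g u) x = frag_extend f x + (frag_extend g x :: 'b \<Rightarrow>\<^sub>0 int)"
 using subset_UNIV[of "Poly_Mapping.keys x"]
 by (induction x rule: frag_induction) (simp_all add: frag_extend_diff)

lemma frag_extend_fun_minus:
 "frag_extend (%u. - f u) x = - (frag_extend f x :: 'b \<Rightarrow>\<^sub>0 int)"
 using subset_UNIV[of "Poly_Mapping.keys x"]
 by (induction x rule: frag_induction) (simp_all add: frag_extend_diff)

lemma frag_extend_fun_diff:
 "frag_extend (%u. f u - g u) x = frag_extend f x - (frag_extend g x :: 'b \<Rightarrow>\<^sub>0 int)"
 using frag_extend_fun_add[of f "%u. - g u" x] by (simp add: frag_extend_fun_minus)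

locale tensor_setting = A: cring A + B: cring B
 for k :: "('c, 'l) ring_scheme" and \<phi> :: "'c => 'a" and A :: "('a, 'm) ring_scheme" (structure)
  and \<chi> :: "'c => 'b" and B :: "('b, 'n) ring_scheme" +
 assumes \<phi>_closed: "c : carrier k ==> \<phi> c : carrier A" and \<chi>_closed: "c : carrier k ==> \<chi> c : carrier B"
begin

abbreviation "F \<equiv> pair_ring A B"
abbreviation "TI \<equiv> tensor_ideal k \<phi> A \<chi> B"
abbreviation "T \<equiv> tensor_ring k \<phi> A \<chi> B"
abbreviation "pt \<equiv> pure_tensor k \<phi> A \<chi> B"

lemma F_simps:
 "carrier F = {x. Poly_Mapping.keys x \<subseteq> carrier A \<times> carrier B}" "x \<oplus>\<^bsub>F\<^esub> y = x + y" "\<zero>\<^bsub>F\<^esub> = 0"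
 "\<one>\<^bsub>F\<^esub> = frag_of (\<one>, \<one>\<^bsub>B\<^esub>)"
 by (simp_all add: pair_ring_def)

lemma F_mult: "x \<otimes>\<^bsub>F\<^esub> y = frag_extend (%u. frag_extend (%v. frag_of (fst u \<otimes> fst v, snd u \<otimes>\<^bsub>B\<^esub> snd v)) y) x"
 by (simp add: pair_ring_def)

lemma F_mult_of: "frag_of (a, b) \<otimes>\<^bsub>F\<^esub> frag_of (a', b') = frag_of (a \<otimes> a', b \<otimes>\<^bsub>B\<^esub> b')"
 by (simp add: F_mult)

lemma F_mult_0: "0 \<otimes>\<^bsub>F\<^esub> y = 0" "x \<otimes>\<^bsub>F\<^esub> 0 = 0"
 by (simp_all add: F_mult frag_extend_eq_0)

lemma F_mult_diff: "(x - x') \<otimes>\<^bsub>F\<^esub> y = x \<otimes>\<^bsub>F\<^esub> y - x' \<otimes>\<^bsub>F\<^esub> y" "x \<otimes>\<^bsub>F\<^esub> (y - y') = x \<otimes>\<^bsub>F\<^esub> y - x \<otimes>\<^bsub>F\<^esub> y'"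
 by (simp_all add: F_mult frag_extend_diff frag_extend_fun_diff)

lemma F_mult_add: "(x + x') \<otimes>\<^bsub>F\<^esub> y = x \<otimes>\<^bsub>F\<^esub> y + x' \<otimes>\<^bsub>F\<^esub> y"
 by (simp add: F_mult frag_extend_add)

lemma F_of: "a : carrier A ==> b : carrier B ==> frag_of (a, b) : carrier F"
 by (simp add: F_simps)

lemma F_0: "0 : carrier F"
 by (simp add: F_simps)

lemma F_diff: "x : carrier F ==> y : carrier F ==> x - y : carrier F"
 using keys_diff[of x y] by (auto simp: F_simps)

lemma F_add: "x : carrier F ==> y : carrier F ==> x + y : carrier F"
 using F_diff[OF _ F_diff[OF F_0], of x y] by simp

lemma F_induct [consumes 1, case_names zero of diff]:
 assumes "x : carrier F" and "P 0" and "!!a b. a : carrier A ==> b : carrier B ==> P (frag_of (a, b))"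
  and "!!x y. P x ==> P y ==> P (x - y)"
 shows "P x"
proof -
 have "Poly_Mapping.keys x \<subseteq> carrier A \<times> carrier B" using assms(1) by (simp add: F_simps)
 thus ?thesis
 proof (induction x rule: frag_induction)
  case (one u) thus ?case using assms(3)[of "fst u" "snd u"] by auto
 qed (use assms in auto)
qed

lemma F_closed: assumes x: "x : carrier F" and y: "y : carrier F" shows "x \<otimes>\<^bsub>F\<^esub> y : carrier F"
 using x
proof (induction rule: F_induct)
 case (of a b)
 from y show ?case
 proof (induction rule: F_induct)
  case (of a' b') thus ?case using \<open>a : carrier A\<close> \<open>b : carrier B\<close> by (simp only: F_mult_of F_of A.m_closed B.m_closed)
 next
  case (diff x y) thus ?case by (simp only: F_mult_diff F_diff)
 qed (simp only: F_mult_0 F_0)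
next
 case (diff x y) thus ?case by (simp only: F_mult_diff F_diff)
qed (simp only: F_mult_0 F_0)

lemma F_comm: assumes x: "x : carrier F" and y: "y : carrier F" shows "x \<otimes>\<^bsub>F\<^esub> y = y \<otimes>\<^bsub>F\<^esub> x"
 using x
proof (induction rule: F_induct)
 case (of a b)
 from y show ?case
 proof (induction rule: F_induct)
  case (of a' b')
  have "a \<otimes> a' = a' \<otimes> a" "b \<otimes>\<^bsub>B\<^esub> b' = b' \<otimes>\<^bsub>B\<^esub> b"
   using of \<open>a : carrier A\<close> \<open>b : carrier B\<close> by (simp_all add: A.m_comm B.m_comm)
  thus ?case by (simp only: F_mult_of)
 next
  case (diff x y) thus ?case by (simp only: F_mult_diff)
 qed (simp only: F_mult_0)
next
 case (diff x y) thus ?case by (simp only: F_mult_diff)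
qed (simp only: F_mult_0)

lemma F_assoc:
 assumes x: "x : carrier F" and y: "y : carrier F" and z: "z : carrier F"
 shows "x \<otimes>\<^bsub>F\<^esub> y \<otimes>\<^bsub>F\<^esub> z = x \<otimes>\<^bsub>F\<^esub> (y \<otimes>\<^bsub>F\<^esub> z)"
 using x
proof (induction rule: F_induct)
 case (of a b) note ab = of
 from y show ?case
 proof (induction rule: F_induct)
  case (of a' b') note ab' = of
  from z show ?case
  proof (induction rule: F_induct)
   case (of a'' b'')
   have "a \<otimes> a' \<otimes> a'' = a \<otimes> (a' \<otimes> a'')" "b \<otimes>\<^bsub>B\<^esub> b' \<otimes>\<^bsub>B\<^esub> b'' = b \<otimes>\<^bsub>B\<^esub> (b' \<otimes>\<^bsub>B\<^esub> b'')"
    using ab ab' of by (simp_all add: A.m_assoc B.m_assoc)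
   thus ?case by (simp only: F_mult_of)
  next
   case (diff x y) thus ?case by (simp only: F_mult_diff)
  qed (simp only: F_mult_0)
 next
  case (diff x y) thus ?case by (simp only: F_mult_diff)
 qed (simp only: F_mult_0)
next
 case (diff x y) thus ?case by (simp only: F_mult_diff)
qed (simp only: F_mult_0)

lemma F_one: assumes x: "x : carrier F" shows "\<one>\<^bsub>F\<^esub> \<otimes>\<^bsub>F\<^esub> x = x"
 using x
proof (induction rule: F_induct)
 case (of a b) thus ?case by (simp add: F_simps(4) F_mult_of)
next
 case (diff x y) thus ?case by (simp only: F_mult_diff)
qed (simp only: F_mult_0)

lemma F_cring: "cring F"
proof (rule cringI)
 show "abelian_group F"
 proof (rule abelian_groupI)
  fix x assume x: "x : carrier F"
  show "EX y:carrier F. y \<oplus>\<^bsub>F\<^esub> x = \<zero>\<^bsub>F\<^esub>"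
   using F_diff[OF F_0 x] by (intro bexI[of _ "0 - x"]) (simp_all add: F_simps)
 qed (use F_add F_0 in \<open>simp_all add: F_simps(2,3) ac_simps\<close>)
 show "comm_monoid F"
 proof (rule comm_monoidI)
  show "\<one>\<^bsub>F\<^esub> : carrier F" by (simp add: F_simps)
 qed (use F_closed F_assoc F_one F_comm in auto)
 show "(x \<oplus>\<^bsub>F\<^esub> y) \<otimes>\<^bsub>F\<^esub> z = x \<otimes>\<^bsub>F\<^esub> z \<oplus>\<^bsub>F\<^esub> y \<otimes>\<^bsub>F\<^esub> z" for x y z
  by (simp only: F_simps(2) F_mult_add)
qed

sublocale F: cring F by (rule F_cring)

lemma F_minus: "x : carrier F ==> y : carrier F ==> x \<ominus>\<^bsub>F\<^esub> y = x - y"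
proof -
 assume x: "x : carrier F" and y: "y : carrier F"
 have "0 - y : carrier F" by (rule F_diff[OF F_0 y])
 hence "\<ominus>\<^bsub>F\<^esub> y = 0 - y" using y by (intro F.minus_equality) (simp_all add: F_simps(2,3))
 thus ?thesis by (simp add: a_minus_def F_simps(2))
qed

lemma rels_closed: "tensor_rels k \<phi> A \<chi> B \<subseteq> carrier F"
 unfolding tensor_rels_def by (auto intro!: F_diff F_of \<phi>_closed \<chi>_closed)

lemma TI_ideal: "ideal TI F"
 unfolding tensor_ideal_def by (rule F.genideal_ideal[OF rels_closed])

lemma rels_TI: "tensor_rels k \<phi> A \<chi> B \<subseteq> TI"
 unfolding tensor_ideal_def by (rule F.genideal_self[OF rels_closed])

sublocale TI: ideal TI F by (rule TI_ideal)

sublocale T: cring T unfolding tensor_ring_def by (rule TI.quotient_is_cring[OF F_cring])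

sublocale h: ring_hom_ring F T "(+>\<^bsub>F\<^esub>) TI" unfolding tensor_ring_def by (rule TI.rcos_ring_hom_ring)

lemma pt_eq: "pt a b = TI +>\<^bsub>F\<^esub> frag_of (a, b)" by (rule pure_tensor_def)

lemma pt_closed: "a : carrier A ==> b : carrier B ==> pt a b : carrier T"
 unfolding pt_eq by (intro h.hom_closed F_of)

lemma cos_eq: "x : carrier F ==> y : carrier F ==> TI +>\<^bsub>F\<^esub> x = TI +>\<^bsub>F\<^esub> y \<longleftrightarrow> x - y : TI"
 using F.quotient_eq_iff_same_a_r_cos[OF TI_ideal] by (simp add: F_minus)

lemma pt_add_l:
 assumes "a : carrier A" "a' : carrier A" "b : carrier B"
 shows "pt (a \<oplus> a') b = pt a b \<oplus>\<^bsub>T\<^esub> pt a' b"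
proof -
 have "frag_of (a \<oplus> a', b) - frag_of (a, b) - frag_of (a', b) : TI"
  using rels_TI assms unfolding tensor_rels_def by blast
 hence "TI +>\<^bsub>F\<^esub> frag_of (a \<oplus> a', b) = TI +>\<^bsub>F\<^esub> (frag_of (a, b) \<oplus>\<^bsub>F\<^esub> frag_of (a', b))"
  using assms by (subst cos_eq) (auto intro!: F_of F_add simp: F_simps(2) diff_diff_add)
 thus ?thesis using assms unfolding pt_eq by (simp add: F_of)
qed

lemma pt_add_r:
 assumes "a : carrier A" "b : carrier B" "b' : carrier B"
 shows "pt a (b \<oplus>\<^bsub>B\<^esub> b') = pt a b \<oplus>\<^bsub>T\<^esub> pt a b'"
proof -
 have "frag_of (a, b \<oplus>\<^bsub>B\<^esub> b') - frag_of (a, b) - frag_of (a, b') : TI"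
  using rels_TI assms unfolding tensor_rels_def by blast
 hence "TI +>\<^bsub>F\<^esub> frag_of (a, b \<oplus>\<^bsub>B\<^esub> b') = TI +>\<^bsub>F\<^esub> (frag_of (a, b) \<oplus>\<^bsub>F\<^esub> frag_of (a, b'))"
  using assms by (subst cos_eq) (auto intro!: F_of F_add simp: F_simps(2) diff_diff_add)
 thus ?thesis using assms unfolding pt_eq by (simp add: F_of)
qed

lemma pt_balanced:
 assumes "a : carrier A" "b : carrier B" "c : carrier k"
 shows "pt (\<phi> c \<otimes> a) b = pt a (\<chi> c \<otimes>\<^bsub>B\<^esub> b)"
proof -
 have "frag_of (\<phi> c \<otimes> a, b) - frag_of (a, \<chi> c \<otimes>\<^bsub>B\<^esub> b) : TI"
  using rels_TI assms unfolding tensor_rels_def by blast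
 thus ?thesis unfolding pt_eq using assms by (subst cos_eq) (auto intro!: F_of \<phi>_closed \<chi>_closed)
qed

lemma pt_mult:
 assumes "a : carrier A" "b : carrier B" "a' : carrier A" "b' : carrier B"
 shows "pt a b \<otimes>\<^bsub>T\<^esub> pt a' b' = pt (a \<otimes> a') (b \<otimes>\<^bsub>B\<^esub> b')"
 unfolding pt_eq using h.hom_mult[of "frag_of (a, b)" "frag_of (a', b')"] assms by (simp add: F_of F_mult_of)

lemma pt_one: "pt \<one> \<one>\<^bsub>B\<^esub> = \<one>\<^bsub>T\<^esub>"
 unfolding pt_eq using h.hom_one by (simp add: F_simps)

lemma pt_zero_l: "b : carrier B ==> pt \<zero> b = \<zero>\<^bsub>T\<^esub>"
 using pt_add_l[of "\<zero>" "\<zero>" b] pt_closed[of "\<zero>" b] T.add.l_cancel_one by simp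

lemma pt_zero_r: "a : carrier A ==> pt a \<zero>\<^bsub>B\<^esub> = \<zero>\<^bsub>T\<^esub>"
 using pt_add_r[of a "\<zero>\<^bsub>B\<^esub>" "\<zero>\<^bsub>B\<^esub>"] pt_closed[of a "\<zero>\<^bsub>B\<^esub>"] T.add.l_cancel_one by simp

lemma T_induct [consumes 1, case_names zero pt diff]:
 assumes z: "z : carrier T" and "P \<zero>\<^bsub>T\<^esub>" and "!!a b. a : carrier A ==> b : carrier B ==> P (pt a b)"
  and "!!x y. x : carrier T ==> y : carrier T ==> P x ==> P y ==> P (x \<ominus>\<^bsub>T\<^esub> y)"
 shows "P z"
proof -
 from z obtain c where c: "c : carrier F" "z = TI +>\<^bsub>F\<^esub> c"
  unfolding tensor_ring_def FactRing_def A_RCOSETS_def' by auto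
 have "c : carrier F & P (TI +>\<^bsub>F\<^esub> c)"
  using c(1)
 proof (induction rule: F_induct)
  case zero thus ?case using assms(2) h.hom_zero F_0 by (simp add: F_simps(3))
 next
  case (of a b) thus ?case using assms(3) F_of by (simp add: pt_eq)
 next
  case (diff x y)
  hence "TI +>\<^bsub>F\<^esub> ((x - y) \<oplus>\<^bsub>F\<^esub> y) = (TI +>\<^bsub>F\<^esub> (x - y)) \<oplus>\<^bsub>T\<^esub> (TI +>\<^bsub>F\<^esub> y)"
   using h.hom_add F_diff by blast
  hence e: "TI +>\<^bsub>F\<^esub> x = (TI +>\<^bsub>F\<^esub> (x - y)) \<oplus>\<^bsub>T\<^esub> (TI +>\<^bsub>F\<^esub> y)" by (simp add: F_simps(2))
  have cl: "TI +>\<^bsub>F\<^esub> (x - y) : carrier T" "TI +>\<^bsub>F\<^esub> y : carrier T"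
   using diff F_diff h.hom_closed by blast+
  have "TI +>\<^bsub>F\<^esub> (x - y) = (TI +>\<^bsub>F\<^esub> x) \<ominus>\<^bsub>T\<^esub> (TI +>\<^bsub>F\<^esub> y)"
   unfolding e a_minus_def using cl by (simp add: T.a_assoc T.r_neg)
  thus ?case using diff assms(4) h.hom_closed F_diff by simp
 qed
 thus ?thesis using c(2) by blast
qed

text \<open>The map w need be biadditive and balanced only modulo N, so it can be built from arbitrary
representatives and no target group has to be constructed. Let v be its additive extension. The
elements x with v(y x) in N for all y form an ideal that contains the relations, and y = 1 gives the
claim.\<close>
lemma tensor_test:
 fixes w :: "'a => 'b => 'z \<Rightarrow>\<^sub>0 int" and N :: "('z \<Rightarrow>\<^sub>0 int) set"
 assumes N: "0 : N" "!!x y. x : N ==> y : N ==> x - y : N"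
  and l: "!!a a' b. a : carrier A ==> a' : carrier A ==> b : carrier B ==> w (a \<oplus> a') b - w a b - w a' b : N"
  and r: "!!a b b'. a : carrier A ==> b : carrier B ==> b' : carrier B ==> w a (b \<oplus>\<^bsub>B\<^esub> b') - w a b - w a b' : N"
  and bal: "!!a b c. a : carrier A ==> b : carrier B ==> c : carrier k ==> w (\<phi> c \<otimes> a) b - w a (\<chi> c \<otimes>\<^bsub>B\<^esub> b) : N"
  and ab: "a : carrier A" "b : carrier B" "a' : carrier A" "b' : carrier B" and eq: "pt a b = pt a' b'"
 shows "w a b - w a' b' : N"
proof -
 define v where "v = frag_extend (%u. w (fst u) (snd u))"
 have v_diff: "v (x - y) = v x - v y" for x y unfolding v_def by (rule frag_extend_diff)
 have v_of: "v (frag_of (a, b)) = w a b" for a b unfolding v_def by simp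
 have v_0: "v 0 = 0" unfolding v_def by simp
 define T0 where "T0 = {x : carrier F. ALL y:carrier F. v (y \<otimes>\<^bsub>F\<^esub> x) : N}"
 have "ideal T0 F"
 proof (rule idealI[OF F.ring_axioms])
  show "subgroup T0 (add_monoid F)"
  proof (rule F.add.subgroupI)
   show "T0 \<subseteq> carrier F" unfolding T0_def by blast
   have "0 : T0" unfolding T0_def using F_0 N(1) by (simp add: F_mult_0 v_0)
   thus "T0 ~= {}" by blast
   have d: "x - y : T0" if "x : T0" "y : T0" for x y
    using that F_diff N(2) unfolding T0_def by (simp add: F_mult_diff v_diff)
   fix x assume x: "x : T0"
   have "\<ominus>\<^bsub>F\<^esub> x = 0 - x" using x F_minus[OF F_0, of x] F.add.inv_closed unfolding T0_def
    by (simp add: a_minus_def F_simps(2))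
   thus m: "\<ominus>\<^bsub>F\<^esub> x : T0" using d[OF \<open>0 : T0\<close> x] by simp
   fix y assume y: "y : T0"
   have "x - (0 - y) : T0" by (intro d x y \<open>0 : T0\<close>)
   thus "x \<oplus>\<^bsub>F\<^esub> y : T0" by (simp add: F_simps(2))
  qed
  fix x z assume x: "x : T0" and z: "z : carrier F"
  have xc: "x : carrier F" using x unfolding T0_def by blast
  show "z \<otimes>\<^bsub>F\<^esub> x : T0" unfolding T0_def
  proof (intro CollectI conjI ballI F_closed z xc)
   fix y assume y: "y : carrier F"
   have "v (y \<otimes>\<^bsub>F\<^esub> z \<otimes>\<^bsub>F\<^esub> x) : N" using x F_closed[OF y z] unfolding T0_def by blast
   thus "v (y \<otimes>\<^bsub>F\<^esub> (z \<otimes>\<^bsub>F\<^esub> x)) : N" by (simp only: F_assoc[OF y z xc])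
  qed
  thus "x \<otimes>\<^bsub>F\<^esub> z : T0" by (simp only: F_comm[OF xc z])
 qed
 moreover have "tensor_rels k \<phi> A \<chi> B \<subseteq> T0"
 proof
  fix x assume x: "x : tensor_rels k \<phi> A \<chi> B"
  have "v (y \<otimes>\<^bsub>F\<^esub> x) : N" if "y : carrier F" for y
   using that
  proof (induction rule: F_induct)
   case zero thus ?case by (simp only: F_mult_0 v_0 N(1))
  next
   case (diff x y) thus ?case by (simp only: F_mult_diff v_diff N(2))
  next
   case (of a0 b0)
   from x consider
     (1) a a' b where "x = frag_of (a \<oplus> a', b) - frag_of (a, b) - frag_of (a', b)"
      "a : carrier A" "a' : carrier A" "b : carrier B"
    | (2) a b b' where "x = frag_of (a, b \<oplus>\<^bsub>B\<^esub> b') - frag_of (a, b) - frag_of (a, b')"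
      "a : carrier A" "b : carrier B" "b' : carrier B"
    | (3) a b c where "x = frag_of (\<phi> c \<otimes> a, b) - frag_of (a, \<chi> c \<otimes>\<^bsub>B\<^esub> b)"
      "a : carrier A" "b : carrier B" "c : carrier k"
    unfolding tensor_rels_def by blast
   thus ?case
   proof cases
    case 1
    have "a0 \<otimes> (a \<oplus> a') = a0 \<otimes> a \<oplus> a0 \<otimes> a'" using 1 of by (simp add: A.r_distr)
    thus ?thesis unfolding 1(1) F_mult_diff F_mult_of v_diff v_of
     using l[of "a0 \<otimes> a" "a0 \<otimes> a'" "b0 \<otimes>\<^bsub>B\<^esub> b"] 1 of by simp
   next
    case 2
    have "b0 \<otimes>\<^bsub>B\<^esub> (b \<oplus>\<^bsub>B\<^esub> b') = b0 \<otimes>\<^bsub>B\<^esub> b \<oplus>\<^bsub>B\<^esub> b0 \<otimes>\<^bsub>B\<^esub> b'" using 2 of by (simp add: B.r_distr)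
    thus ?thesis unfolding 2(1) F_mult_diff F_mult_of v_diff v_of
     using r[of "a0 \<otimes> a" "b0 \<otimes>\<^bsub>B\<^esub> b" "b0 \<otimes>\<^bsub>B\<^esub> b'"] 2 of by simp
   next
    case 3
    have "a0 \<otimes> (\<phi> c \<otimes> a) = \<phi> c \<otimes> (a0 \<otimes> a)" using 3 of \<phi>_closed[OF 3(4)] by (simp add: A.m_lcomm)
    moreover have "b0 \<otimes>\<^bsub>B\<^esub> (\<chi> c \<otimes>\<^bsub>B\<^esub> b) = \<chi> c \<otimes>\<^bsub>B\<^esub> (b0 \<otimes>\<^bsub>B\<^esub> b)" using 3 of \<chi>_closed[OF 3(4)] by (simp add: B.m_lcomm)
    ultimately show ?thesis unfolding 3(1) F_mult_diff F_mult_of v_diff v_of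
     using bal[of "a0 \<otimes> a" "b0 \<otimes>\<^bsub>B\<^esub> b" c] 3 of by simp
   qed
  qed
  thus "x : T0" unfolding T0_def using x rels_closed by blast
 qed
 ultimately have "TI \<subseteq> T0" unfolding tensor_ideal_def by (rule F.genideal_minimal)
 moreover have "frag_of (a, b) - frag_of (a', b') : TI"
  using eq cos_eq[OF F_of[OF ab(1,2)] F_of[OF ab(3,4)]] unfolding pt_eq by blast
 ultimately have "v (\<one>\<^bsub>F\<^esub> \<otimes>\<^bsub>F\<^esub> (frag_of (a, b) - frag_of (a', b'))) : N"
  unfolding T0_def using F.one_closed by blast
 thus ?thesis using F_one[OF F_diff[OF F_of[OF ab(1,2)] F_of[OF ab(3,4)]]] by (simp add: v_diff v_of)
qed

end

section \<open>The integers in a ring\<close>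

context ring begin

lemma int_map_closed: "int_map R z : carrier R" unfolding int_map_def by simp

lemma int_map_add: "int_map R (a + b) = int_map R a \<oplus> int_map R b"
 unfolding int_map_def by (rule add.int_pow_mult) simp

lemma int_map_mult: "x : carrier R ==> int_map R z \<otimes> x = [z] \<cdot> x"
 unfolding int_map_def using add_pow_ldistr_int[of \<one> x z] by simp

lemma int_map_times: "int_map R (a * b) = int_map R a \<otimes> int_map R b"
 unfolding int_map_mult[OF int_map_closed] unfolding int_map_def
 using add.int_pow_pow[of \<one> a b] add.int_pow_pow[of \<one> b a] by (simp add: mult.commute)

lemma int_map_0: "int_map R 0 = \<zero>" unfolding int_map_def by (simp add: add_pow_def int_pow_0)

lemma int_map_1: "int_map R 1 = \<one>" unfolding int_map_def by simp

lemma int_map_hom: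
 assumes "f : ring_hom R S" "ring S" shows "f (int_map R z) = int_map S z"
proof -
 interpret S: ring S by fact
 interpret f: ring_hom_ring R S f using assms ring_axioms by (simp add: ring_hom_ringI2)
 show ?thesis using group_hom.hom_int_pow[OF f.a_group_hom, of \<one> z]
  unfolding int_map_def add_pow_def by simp
qed

end

lemma ZFact_rep: "e : carrier (ZFact p) ==> EX z. e = int_map (ZFact p) z"
 and ZFact_eq: "int_map (ZFact p) z = int_map (ZFact p) z' \<longleftrightarrow> p dvd z - z'"
proof -
 interpret I: ideal "Idl\<^bsub>\<Z>\<^esub> {p}" \<Z> by (rule int.genideal_ideal) simp
 interpret Z: cring "ZFact p" by (rule ZFact_is_cring)
 have h: "(+>\<^bsub>\<Z>\<^esub>) (Idl\<^bsub>\<Z>\<^esub> {p}) : ring_hom \<Z> (ZFact p)"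
  unfolding ZFact_def by (rule I.rcos_ring_hom)
 have iz: "int_map \<Z> z = z" for z
 proof -
  have 1: "int_map \<Z> (int n) = int n" for n
  proof (induction n)
   case 0 show ?case using int.int_map_0 by simp
  next
   case (Suc n)
   have "int_map \<Z> (int n + 1) = int n + 1" unfolding int.int_map_add int.int_map_1 Suc by simp
   thus ?case by (simp add: add.commute)
  qed
  have "int_map \<Z> (- int n) + int_map \<Z> (int n) = 0" for n
   using int.int_map_add[of "- int n" "int n"] int.int_map_0 by simp
  thus ?thesis using 1 by (cases z) (auto simp: add_eq_0_iff2 simp del: of_nat_Suc)
 qed
 have e: "int_map (ZFact p) z = Idl\<^bsub>\<Z>\<^esub> {p} +>\<^bsub>\<Z>\<^esub> z" for z
  using int.int_map_hom[OF h Z.ring_axioms, of z] by (simp add: iz)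
 show "e : carrier (ZFact p) ==> EX z. e = int_map (ZFact p) z"
  unfolding e unfolding ZFact_def FactRing_def A_RCOSETS_def' by auto
 have "int_map (ZFact p) z = int_map (ZFact p) z' \<longleftrightarrow> z mod p = z' mod p"
  unfolding e using ZMod_eq_mod[of p z z'] by (simp add: ZMod_def)
 thus "int_map (ZFact p) z = int_map (ZFact p) z' \<longleftrightarrow> p dvd z - z'"
  by (simp add: mod_eq_dvd_iff)
qed

section \<open>Binary forms over an algebraically closed field\<close>

text \<open>The homogeneous form with coefficients c_n, ..., c_0 (leading one first, as for the polynomials of
the library) evaluated at x and b.\<close>
primrec hform :: "('t, 'k) ring_scheme => ('c => 't) => 't => 't => 'c list => 't" where
 "hform T \<iota> x b [] = \<zero>\<^bsub>T\<^esub>"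
| "hform T \<iota> x b (c # r) = (\<iota> c \<otimes>\<^bsub>T\<^esub> b [^]\<^bsub>T\<^esub> length r) \<oplus>\<^bsub>T\<^esub> (x \<otimes>\<^bsub>T\<^esub> hform T \<iota> x b r)"

lemma hform_closed:
 fixes T :: "('t, 'k) ring_scheme" (structure)
 assumes "cring T" "\<iota> : ring_hom L T" "x : carrier T" "b : carrier T" "set r \<subseteq> carrier L"
 shows "hform T \<iota> x b r : carrier T"
proof -
 interpret cring T by fact
 show ?thesis using assms(5) by (induction r) (simp_all add: ring_hom_closed[OF assms(2)] assms)
qed

text \<open>Synthetic division by the linear form b - \<alpha> x: replace the second coefficient d by c \<alpha>
+ d and induct.\<close>
lemma hform_divide:
 fixes T :: "('t, 'k) ring_scheme" (structure)
 assumes "cring T" "cring L" "\<iota> : ring_hom L T" "x : carrier T" "b : carrier T" "\<alpha> : carrier L"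
 shows "c : carrier L ==> set r \<subseteq> carrier L ==> r ~= [] ==> EX q. set q \<subseteq> carrier L & length (c # q) = length r &
  hform T \<iota> x b (c # r) = ((b \<ominus> (\<iota> \<alpha> \<otimes> x)) \<otimes> hform T \<iota> x b (c # q)) \<oplus>
   (\<iota> (ring.eval L (c # r) \<alpha>) \<otimes> x [^] length r)"
proof (induction r arbitrary: c)
 case Nil thus ?case by simp
next
 case (Cons d r)
 interpret T: cring T by fact
 interpret L: cring L by fact
 have hc: "!!e. e : carrier L ==> \<iota> e : carrier T" by (rule ring_hom_closed[OF assms(3)])
 have cd: "c : carrier L" "d : carrier L" "set r \<subseteq> carrier L" using Cons.prems by auto
 note ia = ring_hom_add[OF assms(3)] and im = ring_hom_mult[OF assms(3)]
 let ?d = "(c \<otimes>\<^bsub>L\<^esub> \<alpha>) \<oplus>\<^bsub>L\<^esub> d"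
 have dc: "?d : carrier L" using cd assms(6) by simp
 let ?u = "b \<ominus> (\<iota> \<alpha> \<otimes> x)"
 have uc: "?u : carrier T" using assms hc by simp
 have rc: "hform T \<iota> x b r : carrier T" by (rule hform_closed[OF assms(1,3,4,5) cd(3)])
 have ev: "ring.eval L (c # d # r) \<alpha> = ring.eval L (?d # r) \<alpha>"
 proof -
  have e: "L.eval r \<alpha> : carrier L" by (rule L.eval_in_carrier[OF cd(3) assms(6)])
  have p: "\<alpha> [^]\<^bsub>L\<^esub> length r : carrier L" using assms(6) by simp
  have "c \<otimes>\<^bsub>L\<^esub> (\<alpha> [^]\<^bsub>L\<^esub> length r \<otimes>\<^bsub>L\<^esub> \<alpha>) = c \<otimes>\<^bsub>L\<^esub> \<alpha> \<otimes>\<^bsub>L\<^esub> \<alpha> [^]\<^bsub>L\<^esub> length r"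
   using cd p assms(6) by (simp add: L.m_assoc L.m_comm L.m_lcomm)
  thus ?thesis using cd p e assms(6) by (simp add: L.l_distr L.a_assoc)
 qed
 have ec: "\<iota> (ring.eval L (?d # r) \<alpha>) : carrier T"
  by (rule hc, rule L.eval_in_carrier) (use dc cd assms(6) in auto)
 \<comment> \<open>c b^(n+1) = (b - \<alpha> x) c b^n + c \<alpha> x b^n\<close>
 have step: "hform T \<iota> x b (c # d # r) =
  (?u \<otimes> (\<iota> c \<otimes> b [^] length r)) \<oplus> (x \<otimes> hform T \<iota> x b (?d # r))"
 proof -
  define B where "B = b [^] length r"
  define H where "H = hform T \<iota> x b r"
  have cl: "B : carrier T" "H : carrier T" "\<iota> c : carrier T" "\<iota> d : carrier T" "\<iota> \<alpha> : carrier T" "x : carrier T" "b : carrier T"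
   using assms rc cd hc unfolding B_def H_def by auto
  have "\<iota> ?d = (\<iota> c \<otimes> \<iota> \<alpha>) \<oplus> \<iota> d" using cd assms(6) by (simp add: ia im)
  thus ?thesis using cl by (simp add: B_def[symmetric] H_def[symmetric]) algebra
 qed
 show ?case
 proof (cases "r = []")
  case True
  show ?thesis
  proof (intro exI[of _ "[]"] conjI)
   have "ring.eval L [?d] \<alpha> = ?d" using dc assms(6) by simp
   hence e: "ring.eval L [c, d] \<alpha> = ?d" using ev unfolding True by (simp only:)
   have cl: "\<iota> c : carrier T" "\<iota> d : carrier T" "\<iota> \<alpha> : carrier T" using cd assms(6) hc by auto
   have i: "\<iota> ?d = (\<iota> c \<otimes> \<iota> \<alpha>) \<oplus> \<iota> d" using cd assms(6) by (simp add: ia im)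
   have "hform T \<iota> x b [c, d] = (\<iota> c \<otimes> b) \<oplus> (x \<otimes> \<iota> d)" "hform T \<iota> x b [c] = \<iota> c"
    using cl assms by simp_all
   moreover have "(\<iota> c \<otimes> b) \<oplus> (x \<otimes> \<iota> d) = (?u \<otimes> \<iota> c) \<oplus> (\<iota> ?d \<otimes> x)"
    unfolding i using cl assms(4,5) by algebra
   moreover have "x [^] length [d] = x" using assms by simp
   ultimately show "hform T \<iota> x b (c # d # r) = (?u \<otimes> hform T \<iota> x b [c]) \<oplus>
     (\<iota> (ring.eval L (c # d # r) \<alpha>) \<otimes> x [^] length (d # r))"
    unfolding True e by (simp only:)
  qed (use True in auto)
 next
  case False
  from Cons.IH[OF dc cd(3) False] obtain q where q: "set q \<subseteq> carrier L" "length (?d # q) = length r"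
   "hform T \<iota> x b (?d # r) = (?u \<otimes> hform T \<iota> x b (?d # q)) \<oplus>
     (\<iota> (ring.eval L (?d # r) \<alpha>) \<otimes> x [^] length r)" by blast
  show ?thesis
  proof (intro exI[of _ "?d # q"] conjI)
   show "set (?d # q) \<subseteq> carrier L" using q dc by simp
   show "length (c # ?d # q) = length (d # r)" using q by simp
   define Z where "Z = hform T \<iota> x b (?d # q)"
   define E where "E = \<iota> (ring.eval L (?d # r) \<alpha>)"
   define XX where "XX = x [^] length r"
   define C where "C = \<iota> c \<otimes> b [^] length r"
   define U where "U = ?u"
   have cl: "Z : carrier T" "E : carrier T" "XX : carrier T" "C : carrier T" "U : carrier T" "x : carrier T"
    using hform_closed[OF assms(1,3,4,5), of "?d # q"] q dc ec assms uc hc cd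
    unfolding Z_def E_def XX_def C_def U_def by auto
   have h2: "hform T \<iota> x b (c # ?d # q) = C \<oplus> (x \<otimes> Z)"
    unfolding hform.simps(2)[of _ _ _ _ c] q(2) C_def Z_def ..
   have h3: "x [^] length (d # r) = XX \<otimes> x" unfolding XX_def by simp
   have h1: "hform T \<iota> x b (c # d # r) = (U \<otimes> C) \<oplus> (x \<otimes> ((U \<otimes> Z) \<oplus> (E \<otimes> XX)))"
    unfolding step q(3) C_def Z_def E_def XX_def U_def ..
   show "hform T \<iota> x b (c # d # r) = (?u \<otimes> hform T \<iota> x b (c # ?d # q)) \<oplus>
     (\<iota> (ring.eval L (c # d # r) \<alpha>) \<otimes> x [^] length (d # r))"
    unfolding ev h1 h2 h3 E_def[symmetric] U_def[symmetric] using cl by algebra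
  qed
 qed
qed

text \<open>The form is a product of linear forms and the ring is a domain, so one of them vanishes.\<close>
lemma hform_root:
 fixes T :: "('t, 'k) ring_scheme" (structure)
 assumes "domain T" "algebraically_closed L" "\<iota> : ring_hom L T" "x : carrier T" "b : carrier T" "x ~= \<zero>"
 shows "set r \<subseteq> carrier L ==> EX c:set r. c ~= \<zero>\<^bsub>L\<^esub> ==> hform T \<iota> x b r = \<zero> ==>
  EX \<alpha>:carrier L. b = \<iota> \<alpha> \<otimes> x"
proof (induction "length r" arbitrary: r)
 case 0 thus ?case by simp
next
 case (Suc n)
 interpret T: domain T by fact
 interpret L: algebraically_closed L by fact
 interpret \<iota>: ring_hom_ring L T \<iota> using assms(3) by (simp add: ring_hom_ringI2 L.ring_axioms T.ring_axioms)
 obtain c s where r: "r = c # s" "length s = n" using Suc.hyps(2) by (cases r) auto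
 have cs: "c : carrier L" "set s \<subseteq> carrier L" using Suc.prems(1) r by auto
 have Hs: "hform T \<iota> x b s : carrier T" by (rule hform_closed[OF T.is_cring assms(3-5) cs(2)])
 show ?case
 proof (cases "c = \<zero>\<^bsub>L\<^esub>")
  case True
  have "x \<otimes> hform T \<iota> x b s = \<zero>" using Suc.prems(3) Hs assms True by (simp add: r)
  hence "hform T \<iota> x b s = \<zero>" using T.integral assms Hs by blast
  moreover have "EX c:set s. c ~= \<zero>\<^bsub>L\<^esub>" using Suc.prems(2) r True by auto
  ultimately show ?thesis using Suc.hyps(1)[OF r(2)[symmetric] cs(2)] by blast
 next
  case False
  show ?thesis
  proof (cases "s = []")
   case True
   have "\<iota> c = \<zero>" using Suc.prems(3) assms cs by (simp add: r True)
   moreover have "inv\<^bsub>L\<^esub> c : carrier L" "inv\<^bsub>L\<^esub> c \<otimes>\<^bsub>L\<^esub> c = \<one>\<^bsub>L\<^esub>"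
    using False cs(1) L.field_Units by (simp_all add: L.Units_inv_closed L.Units_l_inv)
   ultimately have "\<one> = \<zero>" using \<iota>.hom_mult[of "inv\<^bsub>L\<^esub> c" c] cs(1) by simp
   thus ?thesis by simp
  next
   case ns: False
   have pol: "r : carrier (poly_ring L)"
    unfolding univ_poly_carrier[symmetric] polynomial_def using Suc.prems(1) False r by simp
   have "size (L.roots r) = length s" using L.roots_over_carrier[OF pol] r by (simp add: L.splitted_def)
   hence "L.roots r ~= {#}" using ns by auto
   then obtain \<alpha> where "\<alpha> \<in># L.roots r" by blast
   hence al: "\<alpha> : carrier L" "L.eval r \<alpha> = \<zero>\<^bsub>L\<^esub>"
    using L.roots_mem_iff_is_root[OF pol] by (auto simp: L.is_root_def)
   from hform_divide[OF T.is_cring L.is_cring assms(3-5) al(1) cs ns] obtain q where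
    q: "set q \<subseteq> carrier L" "length (c # q) = length s"
    "hform T \<iota> x b r = ((b \<ominus> (\<iota> \<alpha> \<otimes> x)) \<otimes> hform T \<iota> x b (c # q)) \<oplus>
     (\<iota> (ring.eval L r \<alpha>) \<otimes> x [^] length s)" unfolding r(1) by blast
   have Hq: "hform T \<iota> x b (c # q) : carrier T"
    by (rule hform_closed[OF T.is_cring assms(3-5)]) (use q cs in auto)
   have uc: "b \<ominus> (\<iota> \<alpha> \<otimes> x) : carrier T" using assms al by simp
   have "(b \<ominus> (\<iota> \<alpha> \<otimes> x)) \<otimes> hform T \<iota> x b (c # q) = \<zero>"
    using Suc.prems(3) unfolding q(3) al(2) using Hq uc assms(4) by (simp del: hform.simps)
   hence "b \<ominus> (\<iota> \<alpha> \<otimes> x) = \<zero> | hform T \<iota> x b (c # q) = \<zero>"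
    using T.integral Hq uc by blast
   thus ?thesis
   proof
    assume "b \<ominus> (\<iota> \<alpha> \<otimes> x) = \<zero>"
    hence "b = \<iota> \<alpha> \<otimes> x" using T.r_right_minus_eq assms al by simp
    thus ?thesis using al(1) by blast
   next
    assume z: "hform T \<iota> x b (c # q) = \<zero>"
    show ?thesis
    proof (rule Suc.hyps(1)[OF _ _ _ z])
     show "n = length (c # q)" using q(2) r(2) by simp
     show "set (c # q) \<subseteq> carrier L" using q cs by simp
     show "EX c:set (c # q). c ~= \<zero>\<^bsub>L\<^esub>" using False by simp
    qed
   qed
  qed
 qed
qed

section \<open>A functional on a ring of prime characteristic\<close>

lemma (in ring) subgroup_union_chain:
 assumes "\<C> ~= {}" "!!N. N : \<C> ==> subgroup N (add_monoid R)" "!!N K. N : \<C> ==> K : \<C> ==> N \<subseteq> K | K \<subseteq> N"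
 shows "subgroup (\<Union>\<C>) (add_monoid R)"
proof (rule add.subgroupI)
 show "\<Union>\<C> \<subseteq> carrier R" using assms(2) subgroup.subset by fastforce
 obtain N where "N : \<C>" using assms(1) by blast
 thus "\<Union>\<C> ~= {}" using assms(2) subgroup.one_closed by fastforce
 fix x assume x: "x : \<Union>\<C>"
 then obtain N where N: "N : \<C>" "x : N" by blast
 have "\<ominus> x : N" using subgroup.m_inv_closed[OF assms(2)[OF N(1)] N(2)] by (simp add: a_inv_def)
 thus "\<ominus> x : \<Union>\<C>" using N by blast
 fix y assume "y : \<Union>\<C>"
 then obtain K where K: "K : \<C>" "y : K" by blast
 have "EX M:\<C>. x : M & y : M" using assms(3)[OF N(1) K(1)] N K by blast
 then obtain M where M: "M : \<C>" "x : M" "y : M" by blast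
 have "x \<oplus> y : M" using subgroup.m_closed[OF assms(2)[OF M(1)] M(2,3)] by simp
 thus "x \<oplus> y : \<Union>\<C>" using M by blast
qed

lemma (in ring) int_map_sub: "subgroup N (add_monoid R) ==> x : N ==> int_map R j \<otimes> x : N"
proof -
 assume N: "subgroup N (add_monoid R)" "x : N"
 have "x : carrier R" using subgroup.subset[OF N(1)] N(2) by auto
 thus ?thesis using add.subgroup_int_pow_closed[OF N] int_map_mult by simp
qed

lemma int_inverse_mod:
 assumes "coprime (k::int) j"
 obtains u where "k dvd u * j - 1"
proof -
 from bezout_int[of k j] assms obtain u v where "u * k + v * j = 1" by (auto simp: coprime_iff_gcd_eq_1)
 hence "v * j - 1 = k * (- u)" by (simp add: algebra_simps)
 thus ?thesis using that[of v] by simp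
qed

text \<open>Let N be maximal among the additive subgroups that avoid 1. For every x some integer multiple of 1
agrees with x modulo N, since adjoining x to N would produce 1; this integer, unique modulo p, is
the value of the functional.\<close>
lemma (in cring) int_functional:
 assumes p: "Factorial_Ring.prime p" and char: "int_map R (int p) = \<zero>" and nz: "\<one> ~= \<zero>"
 obtains cf :: "'a => int" where
  "!!x y. x : carrier R ==> y : carrier R ==> int p dvd cf (x \<oplus> y) - (cf x + cf y)"
  "int p dvd cf \<one> - 1"
  "!!z x. x : carrier R ==> int p dvd cf (int_map R z \<otimes> x) - z * cf x"
proof -
 let ?i = "int_map R"
 define A where "A = {N. subgroup N (add_monoid R) & \<one> ~: N}"
 have "{\<zero>} : A" unfolding A_def using add.triv_subgroup nz by simp
 moreover have "\<Union>\<C> : A" if "\<C> ~= {}" "subset.chain A \<C>" for \<C>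
  unfolding A_def
 proof (intro CollectI conjI)
  have "\<C> \<subseteq> A" and tot: "!!N K. N : \<C> ==> K : \<C> ==> N \<subseteq> K | K \<subseteq> N"
   using that(2) unfolding subset.chain_def by blast+
  thus "subgroup (\<Union>\<C>) (add_monoid R)" "\<one> ~: \<Union>\<C>"
   using subgroup_union_chain[OF that(1) _ tot] unfolding A_def by blast+
 qed
 ultimately obtain N where N: "N : A" and max: "!!K. K : A ==> N \<subseteq> K ==> K = N"
  using subset_Zorn_nonempty[of A] by blast
 have sN: "subgroup N (add_monoid R)" and N1: "\<one> ~: N" using N unfolding A_def by blast+
 have Nc: "N \<subseteq> carrier R" using subgroup.subset[OF sN] by simp
 have Nadd: "x \<oplus> y : N" if "x : N" "y : N" for x y using subgroup.m_closed[OF sN that] by simp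
 have Nneg: "\<ominus> x : N" if "x : N" for x using subgroup.m_inv_closed[OF sN that] by (simp add: a_inv_def)
 have Nz: "\<zero> : N" using subgroup.one_closed[OF sN] by simp
 have pz: "?i (int p * j) = \<zero>" for j by (simp add: int_map_times char int_map_closed)
 have icong: "?i a = ?i b" if ab: "int p dvd a - b" for a b
 proof -
  from ab obtain j where "a - b = int p * j" by (rule dvdE)
  hence "a = b + int p * j" by simp
  thus ?thesis by (simp add: int_map_add pz int_map_closed)
 qed
 have inN: "int p dvd j" if "?i j : N" for j
 proof (rule ccontr)
  assume "~ int p dvd j"
  hence "coprime (int p) j" using p by (simp add: prime_imp_coprime)
  then obtain u where u: "int p dvd u * j - 1" by (rule int_inverse_mod)
  have "?i u \<otimes> ?i j : N" by (rule int_map_sub[OF sN that])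
  hence "?i (u * j) : N" by (simp add: int_map_times)
  moreover have "?i (u * j) = \<one>" using icong[OF u] by (simp add: int_map_1)
  ultimately show False using N1 by simp
 qed
 have ex: "EX j. x \<ominus> ?i j : N" if x: "x : carrier R" for x
 proof (cases "x : N")
  case True thus ?thesis using x by (intro exI[of _ 0]) (simp add: int_map_0 a_minus_def)
 next
  case False
  define K where "K = {m \<oplus> (?i j \<otimes> x) | m j. m : N}"
  have "subgroup K (add_monoid R)"
  proof (rule add.subgroupI)
   show "K \<subseteq> carrier R" unfolding K_def using Nc x int_map_closed by auto
   show "K ~= {}" unfolding K_def using Nz by blast
   fix y assume "y : K"
   then obtain m j where m: "y = m \<oplus> (?i j \<otimes> x)" "m : N" unfolding K_def by blast
   have mc: "m : carrier R" using m Nc by blast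
   have i0: "?i (- j) = \<ominus> ?i j" 
    using int_map_add[of "- j" j] minus_equality[of "?i (- j)" "?i j"] int_map_closed by (simp add: int_map_0)
   have "\<ominus> y = \<ominus> m \<oplus> (?i (- j) \<otimes> x)" unfolding m i0
    using mc x int_map_closed[of j] by algebra
   thus "\<ominus> y : K" unfolding K_def using Nneg[OF m(2)] by blast
   fix z assume "z : K"
   then obtain n l where n: "z = n \<oplus> (?i l \<otimes> x)" "n : N" unfolding K_def by blast
   have nc: "n : carrier R" using n Nc by blast
   have "y \<oplus> z = (m \<oplus> n) \<oplus> (?i (j + l) \<otimes> x)" unfolding m n int_map_add
    using mc nc x int_map_closed[of j] int_map_closed[of l] by algebra
   thus "y \<oplus> z : K" unfolding K_def using Nadd[OF m(2) n(2)] by blast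
  qed
  moreover have "N \<subseteq> K"
  proof
   fix m assume "m : N"
   moreover have "m = m \<oplus> (?i 0 \<otimes> x)" using \<open>m : N\<close> Nc x by (auto simp: int_map_0)
   ultimately show "m : K" unfolding K_def by blast
  qed
  moreover have "x : K"
  proof -
   have "x = \<zero> \<oplus> (?i 1 \<otimes> x)" using x by (simp add: int_map_1)
   thus ?thesis unfolding K_def using Nz by blast
  qed
  ultimately have "\<one> : K" using max[of K] False unfolding A_def by blast
  then obtain m j where m: "\<one> = m \<oplus> (?i j \<otimes> x)" "m : N" unfolding K_def by blast
  have mc: "m : carrier R" using m Nc by blast
  have "~ int p dvd j"
  proof
   assume "int p dvd j"
   hence "?i j = \<zero>" using icong[of j 0] by (simp add: int_map_0)
   hence "\<one> = m" using m(1) mc x by simp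
   thus False using m(2) N1 by simp
  qed
  hence "coprime (int p) j" using p by (simp add: prime_imp_coprime)
  then obtain u where u: "int p dvd u * j - 1" by (rule int_inverse_mod)
  have uj: "?i u \<otimes> ?i j = \<one>" using icong[OF u] by (simp add: int_map_1 int_map_times)
  have "?i u = ?i u \<otimes> (m \<oplus> (?i j \<otimes> x))" using m(1) int_map_closed[of u] by (metis r_one)
  also have "... = (?i u \<otimes> m) \<oplus> (?i u \<otimes> ?i j) \<otimes> x"
   using mc x int_map_closed[of u] int_map_closed[of j] by algebra
  also have "... = (?i u \<otimes> m) \<oplus> x" unfolding uj using x by simp
  finally have e: "?i u = (?i u \<otimes> m) \<oplus> x" .
  have umc: "?i u \<otimes> m : carrier R" using mc int_map_closed by simp
  have "x \<ominus> ((?i u \<otimes> m) \<oplus> x) = \<ominus> (?i u \<otimes> m)" using umc x by algebra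
  hence "x \<ominus> ?i u = \<ominus> (?i u \<otimes> m)" using e by simp
  thus ?thesis using Nneg[OF int_map_sub[OF sN m(2)]] by metis
 qed
 then obtain cf where cf: "!!x. x : carrier R ==> x \<ominus> ?i (cf x) : N" by metis
 have ineg: "?i (- j) = \<ominus> ?i j" for j
  using int_map_add[of "- j" j] minus_equality[of "?i (- j)" "?i j"] int_map_closed by (simp add: int_map_0)
 have idiff: "?i (a - b) = ?i a \<ominus> ?i b" for a b
  using int_map_add[of a "- b"] by (simp add: ineg a_minus_def)
 show ?thesis
 proof (rule that)
  fix x y assume xy: "x : carrier R" "y : carrier R"
  have "((x \<ominus> ?i (cf x)) \<oplus> (y \<ominus> ?i (cf y))) \<oplus> (\<ominus> ((x \<oplus> y) \<ominus> ?i (cf (x \<oplus> y)))) : N"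
   using xy by (intro Nadd Nneg cf) auto
  moreover have "((x \<ominus> ?i (cf x)) \<oplus> (y \<ominus> ?i (cf y))) \<oplus> (\<ominus> ((x \<oplus> y) \<ominus> ?i (cf (x \<oplus> y)))) =
    ?i (cf (x \<oplus> y)) \<ominus> (?i (cf x) \<oplus> ?i (cf y))"
   using xy int_map_closed[of "cf x"] int_map_closed[of "cf y"] int_map_closed[of "cf (x \<oplus> y)"] by algebra
  ultimately have "?i (cf (x \<oplus> y) - (cf x + cf y)) : N" by (simp add: idiff int_map_add)
  thus "int p dvd cf (x \<oplus> y) - (cf x + cf y)" by (rule inN)
 next
  have "\<ominus> (\<one> \<ominus> ?i (cf \<one>)) : N" by (intro Nneg cf) simp
  moreover have "\<ominus> (\<one> \<ominus> ?i (cf \<one>)) = ?i (cf \<one>) \<ominus> \<one>" using int_map_closed[of "cf \<one>"] by algebra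
  ultimately have "?i (cf \<one> - 1) : N" by (simp add: idiff int_map_1)
  thus "int p dvd cf \<one> - 1" by (rule inN)
 next
  fix z x assume x: "x : carrier R"
  let ?y = "?i z \<otimes> x"
  have yc: "?y : carrier R" using x int_map_closed by simp
  have "(?i z \<otimes> (x \<ominus> ?i (cf x))) \<oplus> (\<ominus> (?y \<ominus> ?i (cf ?y))) : N"
   by (intro Nadd Nneg cf yc int_map_sub[OF sN] x)
  moreover have "(?i z \<otimes> (x \<ominus> ?i (cf x))) \<oplus> (\<ominus> (?y \<ominus> ?i (cf ?y))) = ?i (cf ?y) \<ominus> (?i z \<otimes> ?i (cf x))"
   using x int_map_closed[of "cf x"] int_map_closed[of "cf ?y"] int_map_closed[of z] by algebra
  ultimately have "?i (cf ?y - z * cf x) : N" by (simp add: idiff int_map_times)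
  thus "int p dvd cf ?y - z * cf x" by (rule inN)
 qed
qed

section \<open>Fibers as quotients of the polynomial ring\<close>

lemma int_cong:
 assumes N: "idl N" "of_nat p : N" and j: "int p dvd j - j'" and u: "u - u' : (N :: zpol set)"
 shows "of_int j * u - of_int j' * u' : N"
proof -
 from j obtain l where l: "j - j' = int p * l" by (rule dvdE)
 have "of_int (j - j') * u : N" unfolding l
  using idl_mult[OF N(1,2), of "of_int l * u"] by (simp add: mult.commute mult.left_commute)
 moreover have "of_int j' * (u - u') : N" by (rule idl_mult[OF N(1) u])
 ultimately have "of_int (j - j') * u + of_int j' * (u - u') : N" by (rule subgrp_add[OF stab_subgrp[OF N(1)]])
 thus ?thesis by (simp add: algebra_simps)
qed

locale fib = surj_hom R \<psi> for R :: "('a, 'm) ring_scheme" (structure) and \<psi> :: "zpol => 'a" +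
 fixes p :: nat
begin

sublocale Fp: cring "ZFact (int p)" by (rule ZFact_is_cring)

abbreviation "Zp \<equiv> ZFact (int p)"
abbreviation "zp \<equiv> int_map Zp"

sublocale Ft: tensor_setting \<Z> "int_map R" R zp Zp
 by unfold_locales (rule int_map_closed Fp.int_map_closed)+

abbreviation "i1 \<equiv> \<one>\<^bsub>Zp\<^esub>"

definition fmap :: "zpol => ('a \<times> int set \<Rightarrow>\<^sub>0 int) set" where "fmap w = fiber_tensor R p (\<psi> w) i1"

lemma fmap_pt: "fmap w = Ft.pt (\<psi> w) i1" unfolding fmap_def fiber_tensor_def ..

lemma fiber_T: "fiber R p = Ft.T" unfolding fiber_def ..

lemma pt_int: "Ft.pt (\<psi> w) (zp z) = fmap (of_int z * w)"
proof -
 have "Ft.pt (int_map R z \<otimes> \<psi> w) i1 = Ft.pt (\<psi> w) (zp z \<otimes>\<^bsub>Zp\<^esub> i1)"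
  by (rule Ft.pt_balanced) (use closed in auto)
 moreover have "int_map R z \<otimes> \<psi> w = \<psi> (of_int z * w)" by (simp add: int_map_mult closed hom_int)
 ultimately show ?thesis using Fp.int_map_closed by (simp add: fmap_pt)
qed

lemma fmap_add: "fmap (x + y) = fmap x \<oplus>\<^bsub>Ft.T\<^esub> fmap y"
 unfolding fmap_pt hom_add by (rule Ft.pt_add_l) (use closed in auto)

sublocale f: surj_hom "fiber R p" fmap
 unfolding fiber_T
proof
 fix x y
 show cl: "fmap x : carrier Ft.T" for x unfolding fmap_pt by (rule Ft.pt_closed) (use closed in auto)
 show "fmap (x + y) = fmap x \<oplus>\<^bsub>Ft.T\<^esub> fmap y" by (rule fmap_add)
 show "fmap (x * y) = fmap x \<otimes>\<^bsub>Ft.T\<^esub> fmap y"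
  unfolding fmap_pt using Ft.pt_mult[of "\<psi> x" i1 "\<psi> y" i1] closed by (simp add: hom_mult)
 show "fmap 1 = \<one>\<^bsub>Ft.T\<^esub>" unfolding fmap_pt hom_one by (rule Ft.pt_one)
 fix b assume "b : carrier Ft.T"
 thus "EX x. b = fmap x"
 proof (induction rule: Ft.T_induct)
  case zero
  have "\<zero>\<^bsub>Ft.T\<^esub> = fmap 0" unfolding fmap_pt hom_zero using Ft.pt_zero_l[of i1] by simp
  thus ?case by blast
 next
  case (pt a b)
  obtain w z where "a = \<psi> w" "b = zp z" using surj pt ZFact_rep by blast
  thus ?case using pt_int by blast
 next
  case (diff x y)
  then obtain u v where uv: "x = fmap u" "y = fmap v" by blast
  have "fmap u = fmap (u - v) \<oplus>\<^bsub>Ft.T\<^esub> fmap v" using fmap_add[of "u - v" v] by simp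
  hence "x \<ominus>\<^bsub>Ft.T\<^esub> y = fmap (u - v)" unfolding uv a_minus_def
   using cl[of v] cl[of "u - v"] by (simp add: Ft.T.a_assoc Ft.T.r_neg)
  thus ?case by blast
 qed
qed

lemma pick: obtains \<sigma> where "!!a. a : carrier R ==> \<psi> (\<sigma> a) = a"
proof -
 have "ALL a:carrier R. EX w. a = \<psi> w" using surj by blast
 from bchoice[OF this] obtain \<sigma> where "ALL a:carrier R. a = \<psi> (\<sigma> a)" ..
 thus ?thesis using that[of \<sigma>] by simp
qed

text \<open>If the class of w in the fiber vanishes, tensor_test is applied to the map that sends a and the
class of an integer z to z times a preimage of a, modulo P + pW.\<close>
lemma krn_PP: "f.krn = PP krn p"
proof
 have idp: "idl (PP krn p)" by (rule PP_idl[OF krn_idl])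
 have pin: "of_nat p : PP krn p" using p_PP[OF krn_sg, of p 1] by simp
 have sPP: "subgrp (PP krn p)" using idp by (rule stab_subgrp)
 show "f.krn \<subseteq> PP krn p"
 proof
  fix w assume "w : f.krn"
  hence "fmap w = \<zero>\<^bsub>fiber R p\<^esub>" unfolding f.krn_def by simp
  hence w0: "fmap w = \<zero>\<^bsub>Ft.T\<^esub>" unfolding fiber_T .
  obtain \<sigma> where \<sigma>: "!!a. a : carrier R ==> \<psi> (\<sigma> a) = a" by (rule pick, rule that)
  have \<sigma>c: "\<sigma> a - v : PP krn p" if "a = \<psi> v" for a v
   using that \<sigma>[of a] closed hom_eq[of "\<sigma> a" v] P_PP by blast
  have "ALL e:carrier Zp. EX z. e = zp z" using ZFact_rep by blast
  from bchoice[OF this] obtain rep where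
   "ALL e:carrier Zp. e = zp (rep e)" ..
  hence rep: "zp (rep e) = e" if "e : carrier Zp" for e using that by simp
  have "of_int (rep i1) * \<sigma> (\<psi> w) - of_int (rep i1) * \<sigma> \<zero> : PP krn p"
  proof (rule Ft.tensor_test[where w = "%a e. of_int (rep e) * \<sigma> a"])
   show "0 : PP krn p" by (rule subgrp_zero[OF sPP])
   show "!!x y. x : PP krn p ==> y : PP krn p ==> x - y : PP krn p" by (rule subgrp_diff[OF sPP])
  next
   fix a a' b assume a: "a : carrier R" "a' : carrier R" and b: "b : carrier Zp"
   have "\<sigma> (a \<oplus> a') - (\<sigma> a + \<sigma> a') : PP krn p" by (rule \<sigma>c) (simp add: hom_add \<sigma> a)
   from idl_mult[OF idp this, of "of_int (rep b)"]
   show "of_int (rep b) * \<sigma> (a \<oplus> a') - of_int (rep b) * \<sigma> a - of_int (rep b) * \<sigma> a' : PP krn p"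
    by (simp add: algebra_simps)
  next
   fix a b b' assume a: "a : carrier R" and b: "b : carrier Zp" "b' : carrier Zp"
   have "zp (rep (b \<oplus>\<^bsub>Zp\<^esub> b')) = zp (rep b + rep b')"
    using b by (simp add: rep Fp.int_map_add)
   hence "int p dvd rep (b \<oplus>\<^bsub>Zp\<^esub> b') - (rep b + rep b')" by (simp only: ZFact_eq)
   from int_cong[OF idp pin this, of "\<sigma> a" "\<sigma> a"] subgrp_zero[OF sPP]
   show "of_int (rep (b \<oplus>\<^bsub>Zp\<^esub> b')) * \<sigma> a - of_int (rep b) * \<sigma> a - of_int (rep b') * \<sigma> a : PP krn p"
    by (simp add: algebra_simps)
  next
   fix a b z assume a: "a : carrier R" and b: "b : carrier Zp"
   have "zp (rep (zp z \<otimes>\<^bsub>Zp\<^esub> b)) = zp (z * rep b)"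
    using b Fp.int_map_closed by (simp add: rep Fp.int_map_times)
   hence d: "int p dvd rep b * z - rep (zp z \<otimes>\<^bsub>Zp\<^esub> b)"
    by (simp only: ZFact_eq) (simp add: dvd_diff_commute mult.commute)
   have "\<sigma> (int_map R z \<otimes> a) - of_int z * \<sigma> a : PP krn p"
    by (rule \<sigma>c) (simp add: hom_int \<sigma> a int_map_mult)
   from idl_mult[OF idp this, of "of_int (rep b)"]
   have 1: "of_int (rep b) * \<sigma> (int_map R z \<otimes> a) - of_int (rep b * z) * \<sigma> a : PP krn p"
    by (simp add: algebra_simps)
   have 2: "of_int (rep b * z) * \<sigma> a - of_int (rep (zp z \<otimes>\<^bsub>Zp\<^esub> b)) * \<sigma> a : PP krn p"
    by (rule int_cong[OF idp pin d]) (simp add: subgrp_zero[OF sPP])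
   show "of_int (rep b) * \<sigma> (int_map R z \<otimes> a) -
     of_int (rep (zp z \<otimes>\<^bsub>Zp\<^esub> b)) * \<sigma> a : PP krn p"
    by (rule subgrp_trans[OF sPP 1 2])
  next
   show "Ft.pt (\<psi> w) i1 = Ft.pt \<zero> i1" using w0 Ft.pt_zero_l[of i1] by (simp add: fmap_pt)
  qed (use closed in auto)
  moreover have "of_int (rep i1) * \<sigma> (\<psi> w) - of_int 1 * w : PP krn p"
  proof (rule int_cong[OF idp pin])
   have "zp (rep i1) = zp 1" by (simp add: rep Fp.int_map_1)
   thus "int p dvd rep i1 - 1" by (simp only: ZFact_eq)
   show "\<sigma> (\<psi> w) - w : PP krn p" by (rule \<sigma>c) simp
  qed
  moreover have "of_int (rep i1) * \<sigma> \<zero> : PP krn p"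
   using idl_mult[OF idp \<sigma>c[of \<zero> 0]] hom_zero by simp
  ultimately show "w : PP krn p"
   by (metis subgrp_cong[OF sPP] mult_1 of_int_1)
 qed
 show "PP krn p \<subseteq> f.krn"
 proof
  fix x assume "x : PP krn p"
  then obtain w z where x: "w : krn" "x = w + of_nat p * z" unfolding PP_def by blast
  have "fmap w = \<zero>\<^bsub>fiber R p\<^esub>" using x(1) Ft.pt_zero_l[of i1] by (simp add: krn_def fmap_pt fiber_T)
  moreover have "fmap (of_int (int p) * z) = \<zero>\<^bsub>fiber R p\<^esub>"
  proof -
   have "zp (int p) = zp 0" by (simp only: ZFact_eq) simp
   thus ?thesis using pt_int[of z "int p"] Ft.pt_zero_r closed by (simp add: fiber_T Fp.int_map_0)
  qed
  ultimately show "x : f.krn" unfolding x(2) f.krn_def by (simp add: f.hom_add)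
 qed
qed

text \<open>A tensor of a with the class of z is the tensor of z a with 1.\<close>
lemma fiber_image_eq:
 assumes "subgroup M (add_monoid R)"
 shows "fiber_image R p M = fmap ` pre M"
proof
 have Mc: "M \<subseteq> carrier R" using subgroup.subset[OF assms] by simp
 have sM: "subgrp (pre M)" unfolding subgrp_def pre_def
  using subgroup.one_closed[OF assms] subgroup.m_closed[OF assms] subgroup.m_inv_closed[OF assms]
  by (simp add: hom_zero hom_diff a_minus_def a_inv_def)
 show "fiber_image R p M \<subseteq> fmap ` pre M"
  unfolding fiber_image_def
 proof (rule f.add.generate_subgroup_incl[OF _ f.subgroup_image[OF sM]])
  show "{fiber_tensor R p a b |a b. a : M & b : carrier Zp} \<subseteq> fmap ` pre M"
  proof
   fix x assume "x : {fiber_tensor R p a b |a b. a : M & b : carrier Zp}"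
   then obtain a b where ab: "x = fiber_tensor R p a b" "a : M" "b : carrier Zp" by blast
   have "a : carrier R" using ab(2) Mc by (rule rev_subsetD)
   then obtain w where w1: "a = \<psi> w" using surj by blast
   obtain z where w2: "b = zp z" using ZFact_rep[OF ab(3)] by blast
   note w = w1 w2
   have "x = fmap (of_int z * w)" using ab(1) pt_int unfolding w fiber_tensor_def by simp
   moreover have "of_int z * w : pre M" by (rule subgrp_of_int[OF sM]) (use ab w in \<open>simp add: pre_def\<close>)
   ultimately show "x : fmap ` pre M" by blast
  qed
 qed
 show "fmap ` pre M \<subseteq> fiber_image R p M"
 proof
  fix x assume "x : fmap ` pre M"
  then obtain w where "w : pre M" "x = fmap w" by blast
  hence "x = fiber_tensor R p (\<psi> w) i1 & \<psi> w : M & i1 : carrier Zp" by (simp add: fmap_def pre_def)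
  hence "x : {fiber_tensor R p a b |a b. a : M & b : carrier Zp}"
   by (intro CollectI exI)
  thus "x : fiber_image R p M" unfolding fiber_image_def by (rule generate.incl)
 qed
qed

lemma pre_fiber_image: 
 assumes "ideal I R" shows "f.pre (fiber_image R p I) = PP (pre I) p"
proof -
 have sI: "subgroup I (add_monoid R)" using assms by (simp add: additive_subgroup.a_subgroup ideal.axioms(1))
 have ip: "idl (pre I)" "krn \<subseteq> pre I" by (rule ideal_pre[OF assms])+
 show ?thesis unfolding fiber_image_eq[OF sI]
 proof
  show "f.pre (fmap ` pre I) \<subseteq> PP (pre I) p"
  proof
   fix x assume "x : f.pre (fmap ` pre I)"
   then obtain w where w: "w : pre I" "fmap x = fmap w" unfolding f.pre_def by blast
   have "x - w : PP krn p" using w(2) f.hom_eq krn_PP by blast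
   then obtain v z where v: "v : krn" "x - w = v + of_nat p * z" unfolding PP_def by blast
   have "x = (w + v) + of_nat p * z" using v(2) by (simp add: algebra_simps)
   moreover have "w + v : pre I" using subgrp_add[OF stab_subgrp[OF ip(1)] w(1)] v(1) ip(2) by blast
   ultimately show "x : PP (pre I) p" unfolding PP_def by blast
  qed
  show "PP (pre I) p \<subseteq> f.pre (fmap ` pre I)"
  proof
   fix x assume "x : PP (pre I) p"
   then obtain w z where w: "w : pre I" "x = w + of_nat p * z" unfolding PP_def by blast
   have "x - w : f.krn" unfolding krn_PP using p_PP[OF krn_sg] w(2) by simp
   hence "fmap x = fmap w" using f.hom_eq by blast
   thus "x : f.pre (fmap ` pre I)" using w(1) unfolding f.pre_def by blast
  qed
 qed
qed

end

section \<open>Geometric integrality\<close>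

text \<open>The form hform with integer coefficients, before passing to the fiber.\<close>
primrec zform :: "zpol => zpol => int list => zpol" where
 "zform x b [] = 0"
| "zform x b (c # r) = of_int c * b ^ length r + x * zform x b r"

locale gfib = fib +
 assumes prime_p: "Factorial_Ring.prime p" and geo: "geometrically_integral_fiber R p"
begin

lemma field_Fp: "field Zp"
proof (rule Fp.cring_fieldI2)
 have "~ int p dvd 0 - 1" using prime_p by (simp add: prime_nat_iff)
 hence "zp 0 ~= zp 1" by (simp only: ZFact_eq not_False_eq_True)
 thus "\<zero>\<^bsub>Zp\<^esub> ~= i1" by (simp add: Fp.int_map_0 Fp.int_map_1)
 fix a assume a: "a : carrier Zp" "a ~= \<zero>\<^bsub>Zp\<^esub>"
 obtain j where j: "a = zp j" using ZFact_rep a(1) by blast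
 have "~ int p dvd j" using a(2) ZFact_eq[of "int p" j 0] by (simp add: j Fp.int_map_0)
 hence "coprime (int p) j" using prime_p by (simp add: prime_imp_coprime)
 then obtain u where u: "int p dvd u * j - 1" by (rule int_inverse_mod)
 hence "zp (u * j) = i1" using ZFact_eq[of "int p" "u * j" 1] by (simp add: Fp.int_map_1)
 hence "a \<otimes>\<^bsub>Zp\<^esub> zp u = i1"
  unfolding j Fp.int_map_times[symmetric] by (simp add: mult.commute)
 thus "EX b:carrier Zp. a \<otimes>\<^bsub>Zp\<^esub> b = i1" using Fp.int_map_closed by blast
qed

abbreviation "L \<equiv> field.alg_closure Zp"
abbreviation "ic \<equiv> ring.indexed_const Zp"

lemma ic_hom: "ic : ring_hom Zp L" by (rule field.alg_closureE(2)[OF field_Fp])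

sublocale L: algebraically_closed L
proof -
 interpret Lc: algebraic_closure L "ic ` carrier Zp" by (rule field.alg_closureE(1)[OF field_Fp])
 show "algebraically_closed L" by (rule Lc.algebraically_closed_axioms)
qed

abbreviation "ft \<equiv> fiber_tensor R p \<one>"

sublocale G: tensor_setting Zp ft "fiber R p" ic L
proof
 fix c assume c: "c : carrier Zp"
 show "ft c : carrier (fiber R p)" unfolding fiber_T fiber_tensor_def by (rule Ft.pt_closed) (use c in auto)
 show "ic c : carrier L" by (rule ring_hom_closed[OF ic_hom c])
qed

lemma dom_T: "domain G.T" using geo unfolding geometrically_integral_fiber_def geometrically_integral_def .

lemma ft_int: "ft (zp z) = fmap (of_int z)"
 using pt_int[of 1 z] unfolding fiber_tensor_def by (simp add: hom_one)

lemma ic_int: "ic (zp z) = int_map L z"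
 by (rule Fp.int_map_hom[OF ic_hom L.ring_axioms])

abbreviation "PQ \<equiv> PP krn p"

lemma PQ_facts: "idl PQ" "of_nat p : PQ" "subgrp PQ"
 using PP_idl[OF krn_idl] p_PP[OF krn_sg, of p 1] stab_subgrp by auto

lemma L_char: "int_map L (int p) = \<zero>\<^bsub>L\<^esub>"
proof -
 have "zp (int p) = zp 0" by (simp only: ZFact_eq) simp
 thus ?thesis using ic_int[of "int p"] ic_int[of 0] by (simp add: L.int_map_0)
qed

lemma pick2: obtains \<sigma> where "!!a v. a = fmap v ==> \<sigma> a - v : PQ"
proof -
 have "ALL a:carrier (fiber R p). EX w. a = fmap w" using f.surj by blast
 from bchoice[OF this] obtain \<sigma> where "ALL a:carrier (fiber R p). a = fmap (\<sigma> a)" ..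
 hence "\<sigma> a - v : PQ" if "a = fmap v" for a v
  using that f.closed[of v] f.hom_eq[of "\<sigma> a" v] krn_PP by simp
 thus ?thesis by (rule that)
qed

text \<open>Apply a functional on the algebraic closure that is 1 at 1 to the second tensor factor; j is its
value at \<alpha>.\<close>
lemma geo_test:
 assumes "\<alpha> : carrier L" and eq: "G.pt (fmap b) \<one>\<^bsub>L\<^esub> = G.pt (fmap x) \<alpha>"
 shows "EX j. b - of_int j * x : PQ"
proof -
 obtain cf :: "_ => int" where cf:
  "!!x y. x : carrier L ==> y : carrier L ==> int p dvd cf (x \<oplus>\<^bsub>L\<^esub> y) - (cf x + cf y)"
  "int p dvd cf \<one>\<^bsub>L\<^esub> - 1"
  "!!z x. x : carrier L ==> int p dvd cf (int_map L z \<otimes>\<^bsub>L\<^esub> x) - z * cf x"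
  by (rule L.int_functional[OF prime_p L_char L.one_not_zero], rule that)
 obtain \<sigma> where \<sigma>: "!!a v. a = fmap v ==> \<sigma> a - v : PQ" by (rule pick2, rule that)
 have \<sigma>r: "fmap (\<sigma> a) = a" if ac: "a : carrier (fiber R p)" for a
 proof -
  obtain v where v: "a = fmap v" using f.surj[OF ac] by blast
  show ?thesis using \<sigma>[OF v] f.hom_eq[of "\<sigma> a" v] v krn_PP by simp
 qed
 have "of_int (cf \<one>\<^bsub>L\<^esub>) * \<sigma> (fmap b) - of_int (cf \<alpha>) * \<sigma> (fmap x) : PQ"
 proof (rule G.tensor_test[where w = "%a e. of_int (cf e) * \<sigma> a"])
  show "0 : PQ" by (rule subgrp_zero[OF PQ_facts(3)])
  show "!!x y. x : PQ ==> y : PQ ==> x - y : PQ" by (rule subgrp_diff[OF PQ_facts(3)])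
 next
  fix a a' e assume a: "a : carrier (fiber R p)" "a' : carrier (fiber R p)" and e: "e : carrier L"
  have "\<sigma> (a \<oplus>\<^bsub>fiber R p\<^esub> a') - (\<sigma> a + \<sigma> a') : PQ" by (rule \<sigma>) (simp add: f.hom_add \<sigma>r a)
  from idl_mult[OF PQ_facts(1) this, of "of_int (cf e)"]
  show "of_int (cf e) * \<sigma> (a \<oplus>\<^bsub>fiber R p\<^esub> a') - of_int (cf e) * \<sigma> a - of_int (cf e) * \<sigma> a' : PQ"
   by (simp add: algebra_simps)
 next
  fix a e e' assume a: "a : carrier (fiber R p)" and e: "e : carrier L" "e' : carrier L"
  from int_cong[OF PQ_facts(1,2) cf(1)[OF e], of "\<sigma> a" "\<sigma> a"] subgrp_zero[OF PQ_facts(3)]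
  show "of_int (cf (e \<oplus>\<^bsub>L\<^esub> e')) * \<sigma> a - of_int (cf e) * \<sigma> a - of_int (cf e') * \<sigma> a : PQ"
   by (simp add: algebra_simps)
 next
  fix a e c assume a: "a : carrier (fiber R p)" and e: "e : carrier L" and c: "c : carrier Zp"
  obtain z where z: "c = zp z" using ZFact_rep[OF c] by blast
  have d: "int p dvd cf e * z - cf (ic c \<otimes>\<^bsub>L\<^esub> e)"
   using cf(3)[OF e, of z] by (simp add: z ic_int dvd_diff_commute mult.commute)
  have "\<sigma> (ft c \<otimes>\<^bsub>fiber R p\<^esub> a) - of_int z * \<sigma> a : PQ"
   by (rule \<sigma>) (simp add: f.hom_mult \<sigma>r a z ft_int)
  from idl_mult[OF PQ_facts(1) this, of "of_int (cf e)"]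
  have 1: "of_int (cf e) * \<sigma> (ft c \<otimes>\<^bsub>fiber R p\<^esub> a) - of_int (cf e * z) * \<sigma> a : PQ"
   by (simp add: algebra_simps)
  have 2: "of_int (cf e * z) * \<sigma> a - of_int (cf (ic c \<otimes>\<^bsub>L\<^esub> e)) * \<sigma> a : PQ"
   by (rule int_cong[OF PQ_facts(1,2) d]) (simp add: subgrp_zero[OF PQ_facts(3)])
  show "of_int (cf e) * \<sigma> (ft c \<otimes>\<^bsub>fiber R p\<^esub> a) - of_int (cf (ic c \<otimes>\<^bsub>L\<^esub> e)) * \<sigma> a : PQ"
   by (rule subgrp_trans[OF PQ_facts(3) 1 2])
 qed (use f.closed assms in auto)
 moreover have "of_int (cf \<one>\<^bsub>L\<^esub>) * \<sigma> (fmap b) - of_int 1 * b : PQ"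
  by (rule int_cong[OF PQ_facts(1,2) cf(2) \<sigma>]) simp
 moreover have "of_int (cf \<alpha>) * \<sigma> (fmap x) - of_int (cf \<alpha>) * x : PQ"
  by (rule int_cong[OF PQ_facts(1,2) _ \<sigma>]) simp_all
 ultimately have "of_int 1 * b - of_int (cf \<alpha>) * x : PQ"
  using subgrp_trans[OF PQ_facts(3)] subgrp_diff_swap[OF PQ_facts(3)] by metis
 thus ?thesis by (intro exI[of _ "cf \<alpha>"]) simp
qed

lemma geo_zero:
 assumes "G.pt (fmap b) \<one>\<^bsub>L\<^esub> = \<zero>\<^bsub>G.T\<^esub>" shows "b : PQ"
proof -
 have "G.pt (fmap 0) \<one>\<^bsub>L\<^esub> = \<zero>\<^bsub>G.T\<^esub>" unfolding f.hom_zero by (rule G.pt_zero_l) simp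
 hence "EX j. b - of_int j * 0 : PQ" using assms by (intro geo_test[of "\<one>\<^bsub>L\<^esub>"]) simp_all
 thus ?thesis by simp
qed

text \<open>By geo_test the fiber embeds into its base change to the algebraic closure, which is a domain.\<close>
lemma prm_PQ: "prm PQ"
 unfolding prm_def
proof (intro conjI allI impI)
 interpret T: domain G.T by (rule dom_T)
 show "idl PQ" by (rule PQ_facts)
 show "1 ~: PQ"
 proof
  assume "1 : PQ"
  hence "fmap 1 = \<zero>\<^bsub>fiber R p\<^esub>" using krn_PP unfolding f.krn_def by blast
  hence "\<one>\<^bsub>G.T\<^esub> = \<zero>\<^bsub>G.T\<^esub>" using G.pt_one G.pt_zero_l[of "\<one>\<^bsub>L\<^esub>"] f.hom_one by simp
  thus False by simp
 qed
 fix a b assume "a * b : PQ"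
 hence "fmap a \<otimes>\<^bsub>fiber R p\<^esub> fmap b = \<zero>\<^bsub>fiber R p\<^esub>"
  using krn_PP f.hom_mult unfolding f.krn_def by blast
 hence "G.pt (fmap a) \<one>\<^bsub>L\<^esub> \<otimes>\<^bsub>G.T\<^esub> G.pt (fmap b) \<one>\<^bsub>L\<^esub> = \<zero>\<^bsub>G.T\<^esub>"
  using G.pt_mult[of "fmap a" "\<one>\<^bsub>L\<^esub>" "fmap b" "\<one>\<^bsub>L\<^esub>"] f.closed G.pt_zero_l[of "\<one>\<^bsub>L\<^esub>"] by simp
 hence "G.pt (fmap a) \<one>\<^bsub>L\<^esub> = \<zero>\<^bsub>G.T\<^esub> | G.pt (fmap b) \<one>\<^bsub>L\<^esub> = \<zero>\<^bsub>G.T\<^esub>"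
  using T.integral G.pt_closed f.closed by simp
 thus "a : PQ | b : PQ" using geo_zero by blast
qed

definition \<iota> where "\<iota> c = G.pt \<one>\<^bsub>fiber R p\<^esub> c"

lemma \<iota>_hom: "\<iota> : ring_hom L G.T"
proof (rule ring_hom_memI)
 fix c e assume c: "c : carrier L"
 show "\<iota> c : carrier G.T" unfolding \<iota>_def by (rule G.pt_closed) (use c in auto)
 assume e: "e : carrier L"
 show "\<iota> (c \<otimes>\<^bsub>L\<^esub> e) = \<iota> c \<otimes>\<^bsub>G.T\<^esub> \<iota> e" unfolding \<iota>_def by (subst G.pt_mult) (use c e in auto)
 show "\<iota> (c \<oplus>\<^bsub>L\<^esub> e) = \<iota> c \<oplus>\<^bsub>G.T\<^esub> \<iota> e" unfolding \<iota>_def by (rule G.pt_add_r) (use c e in auto)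
qed (simp add: \<iota>_def G.pt_one)

abbreviation "em w \<equiv> G.pt (fmap w) \<one>\<^bsub>L\<^esub>"

lemma em_hom: "em (u * v) = em u \<otimes>\<^bsub>G.T\<^esub> em v" "em (u + v) = em u \<oplus>\<^bsub>G.T\<^esub> em v" "em 1 = \<one>\<^bsub>G.T\<^esub>" "em 0 = \<zero>\<^bsub>G.T\<^esub>"
 "em u : carrier G.T"
proof -
 show "em (u * v) = em u \<otimes>\<^bsub>G.T\<^esub> em v"
  using G.pt_mult[of "fmap u" "\<one>\<^bsub>L\<^esub>" "fmap v" "\<one>\<^bsub>L\<^esub>"] f.closed by (simp add: f.hom_mult)
 show "em (u + v) = em u \<oplus>\<^bsub>G.T\<^esub> em v" unfolding f.hom_add by (rule G.pt_add_l) (use f.closed in auto)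
 show "em 1 = \<one>\<^bsub>G.T\<^esub>" using G.pt_one f.hom_one by simp
 show "em 0 = \<zero>\<^bsub>G.T\<^esub>" unfolding f.hom_zero by (rule G.pt_zero_l) simp
 show "em u : carrier G.T" by (rule G.pt_closed) (use f.closed in auto)
qed

lemma em_pow: "em (u ^ n) = em u [^]\<^bsub>G.T\<^esub> n"
proof (induction n)
 case (Suc n)
 have "em (u ^ Suc n) = em (u ^ n * u)" by (simp only: power_Suc2)
 thus ?case by (simp only: em_hom(1) Suc G.T.nat_pow_Suc)
qed (simp add: em_hom(3))

lemma em_int: "em (of_int z) = \<iota> (int_map L z)"
proof -
 have "G.pt (ft (zp z) \<otimes>\<^bsub>fiber R p\<^esub> \<one>\<^bsub>fiber R p\<^esub>) \<one>\<^bsub>L\<^esub> =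
   G.pt \<one>\<^bsub>fiber R p\<^esub> (ic (zp z) \<otimes>\<^bsub>L\<^esub> \<one>\<^bsub>L\<^esub>)"
  by (rule G.pt_balanced) (use Fp.int_map_closed in auto)
 thus ?thesis by (simp add: ft_int ic_int f.closed L.int_map_closed \<iota>_def)
qed

lemma em_form: "em (zform x b r) = hform G.T \<iota> (em x) (em b) (map (int_map L) r)"
 by (induction r) (simp_all add: em_hom em_pow em_int)

text \<open>Over the algebraic closure the form splits, so b is a multiple of x there, and by geo_test already
in the fiber.\<close>
lemma geo_ratio:
 assumes "zform x b r : PQ" "EX c:set r. ~ int p dvd c" "x ~: PQ"
 shows "EX j. b - of_int j * x : PQ"
proof -
 have nz: "int_map L c ~= \<zero>\<^bsub>L\<^esub>" if "~ int p dvd c" for c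
 proof
  assume z: "int_map L c = \<zero>\<^bsub>L\<^esub>"
  have "coprime (int p) c" using that prime_p by (simp add: prime_imp_coprime)
  then obtain u where "int p dvd u * c - 1" by (rule int_inverse_mod)
  then obtain v where "u * c - 1 = int p * v" by (rule dvdE)
  hence "u * c = 1 + int p * v" by simp
  hence "int_map L (u * c) = int_map L (1 + int p * v)" by simp
  hence "\<zero>\<^bsub>L\<^esub> = \<one>\<^bsub>L\<^esub>" by (simp add: L.int_map_add L.int_map_times L_char z L.int_map_1 L.int_map_closed)
  thus False by simp
 qed
 have "fmap (zform x b r) = \<zero>\<^bsub>fiber R p\<^esub>" using assms(1) krn_PP unfolding f.krn_def by blast
 hence h: "hform G.T \<iota> (em x) (em b) (map (int_map L) r) = \<zero>\<^bsub>G.T\<^esub>"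
  using em_form[of x b r] em_hom(4) f.hom_zero by simp
 have "EX \<alpha>:carrier L. em b = \<iota> \<alpha> \<otimes>\<^bsub>G.T\<^esub> em x"
 proof (rule hform_root[OF dom_T L.algebraically_closed_axioms \<iota>_hom em_hom(5) em_hom(5) _ _ _ h])
  show "em x ~= \<zero>\<^bsub>G.T\<^esub>" using geo_zero assms(3) by blast
  show "set (map (int_map L) r) \<subseteq> carrier L" using L.int_map_closed by auto
  show "EX c:set (map (int_map L) r). c ~= \<zero>\<^bsub>L\<^esub>" using assms(2) nz by auto
 qed
 then obtain \<alpha> where \<alpha>: "\<alpha> : carrier L" "em b = \<iota> \<alpha> \<otimes>\<^bsub>G.T\<^esub> em x" by blast
 have "\<iota> \<alpha> \<otimes>\<^bsub>G.T\<^esub> em x = G.pt (fmap x) \<alpha>"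
  unfolding \<iota>_def using G.pt_mult[of "\<one>\<^bsub>fiber R p\<^esub>" \<alpha> "fmap x" "\<one>\<^bsub>L\<^esub>"] \<alpha>(1) f.closed by simp
 thus ?thesis using geo_test[OF \<alpha>(1)] \<alpha>(2) by simp
qed

end

section \<open>Dimension zero\<close>

text \<open>Without variables in V the bound of growth does not depend on s.\<close>
lemma (in red) finite_dim0:
 assumes "card V = 0" shows "finite (quo Q UNIV)"
proof (rule ccontr)
 assume "infinite (quo Q UNIV)"
 then obtain F where F: "finite F" "card F = p ^ card B + 1" "F \<subseteq> quo Q UNIV"
  using infinite_arbitrarily_large by blast
 have "EX s. F \<subseteq> quo Q (Pol {..<M} s)" using F(1,3)
 proof (induction rule: finite_induct)
  case (insert C F)
  then obtain s where s: "F \<subseteq> quo Q (Pol {..<M} s)" by blast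
  obtain w where w: "C = coset Q w" using insert.prems unfolding quo_def by blast
  obtain t f where f: "f : Pol {..<M} t" "w - f : Q" using gen[of w] by blast
  have C: "C = coset Q f" unfolding w using coset_eq[OF sg] f(2) by blast
  have "f : Pol {..<M} (s + t)" by (rule Pol_mono'[OF f(1)]) simp
  moreover have "Pol {..<M} s \<subseteq> Pol {..<M} (s + t)" by (rule Pol_mono) auto
  ultimately have "insert C F \<subseteq> quo Q (Pol {..<M} (s + t))"
   using order_trans[OF s quo_mono] C unfolding quo_def by simp
  thus ?case by blast
 qed simp
 then obtain s where s: "F \<subseteq> quo Q (Pol {..<M} s)" by blast
 have "card F <= card (quo Q (Pol {..<M} s))" by (rule card_mono[OF growth(1) s])
 also have "... <= p ^ card B" using growth(2)[of s] assms by simp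
 finally show False using F(2) by simp
qed

text \<open>W/Q is a finite domain, hence a field; so J is Q or W, and Frobenius powers do nothing.\<close>
lemma (in red) ell_dim0:
 assumes d: "card V = 0" and J: "Q \<subseteq> J" "idl J"
 shows "ell J (Suc n) = ell J n"
proof (cases "J = Q")
 case True
 have "FP Q Q q = Q" if "q >= 1" for q
 proof
  show "FP Q Q q \<subseteq> Q"
  proof (rule FP_least[OF idl order_refl])
   fix w assume "w : Q" thus "w ^ q : Q" using prm_pow[OF prQ] that by simp
  qed
 qed (rule FP_Q)
 thus ?thesis using p_gt unfolding ell_def True by simp
next
 case False
 then obtain j where j: "j : J" "j ~: Q" using J by blast
 have "~ inj_on (%n. coset Q (j ^ n)) (UNIV :: nat set)"
 proof
  assume "inj_on (%n. coset Q (j ^ n)) (UNIV :: nat set)"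
  moreover have "finite (range (%n. coset Q (j ^ n)))"
   by (rule finite_subset[OF _ finite_dim0[OF d]]) (auto simp: quo_def)
  ultimately show False using finite_imageD infinite_UNIV_nat by blast
 qed
 then obtain a b where ab: "a ~= b" "coset Q (j ^ a) = coset Q (j ^ b)" unfolding inj_on_def by blast
 have main: "1 : J" if lt: "a < b" and e: "j ^ a - j ^ b : Q" for a b
 proof -
  have "j ^ b = j ^ a * j ^ (b - a)" using lt by (simp flip: power_add)
  hence "j ^ a - j ^ b = j ^ a * (1 - j ^ (b - a))" by (simp add: right_diff_distrib)
  hence "j ^ a * (1 - j ^ (b - a)) : Q" using e by simp
  hence "1 - j ^ (b - a) : Q" using prm_mult[OF prQ] prm_pow[OF prQ] j(2) by blast
  hence 1: "1 - j ^ (b - a) : J" using J(1) by blast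
  have "j ^ (b - a - 1) * j : J" by (rule idl_mult[OF J(2) j(1)])
  moreover have "j ^ (b - a - 1) * j = j ^ (b - a)" using lt power_Suc2[of j "b - a - 1"] by (simp add: Suc_diff_Suc)
  ultimately show ?thesis using subgrp_cong[OF stab_subgrp[OF J(2)] 1] by simp
 qed
 have "j ^ a - j ^ b : Q" "j ^ b - j ^ a : Q" using ab(2) coset_eq[OF sg] by blast+
 hence "1 : J" using main ab(1) nat_neq_iff[of a b] by blast
 hence one: "1 : FP Q J q" for q using FP_pow[of 1 J q] by simp
 have "FP Q J q = UNIV" for q
 proof -
  have "v * 1 : FP Q J q" for v by (rule idl_mult[OF FP_idl one])
  thus ?thesis by auto
 qed
 thus ?thesis unfolding ell_def by simp
qed

section \<open>Dimension one\<close>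

lemma zform_sum: "zform x b (map c (rev [0..<Suc N])) = (\<Sum>i\<le>N. of_int (c i) * x ^ (N - i) * b ^ i)"
proof (induction N)
 case (Suc N)
 have "zform x b (map c (rev [0..<Suc (Suc N)])) =
  of_int (c (Suc N)) * b ^ Suc N + x * zform x b (map c (rev [0..<Suc N]))"
  by simp
 also have "x * zform x b (map c (rev [0..<Suc N])) = (\<Sum>i\<le>N. of_int (c i) * x ^ (Suc N - i) * b ^ i)"
  unfolding Suc sum_distrib_left by (rule sum.cong) (simp_all add: Suc_diff_le mult.left_commute mult.commute)
 finally show ?case by (simp add: add.commute)
qed simp

text \<open>W n is the preimage of the component of degree n of the fiber. The ratio property is the conclusion
of geo_ratio.\<close>
locale graded_line = red +
 fixes W :: "nat => zpol set" and x :: zpol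
 assumes dim1: "card V = 1"
  and Wsub: "subgrp (W n)" and QW: "Q \<subseteq> W n"
  and Wmult: "u : W i ==> v : W j ==> u * v : W (i + j)"
  and Windep: "(!!n. w n : W n) ==> (\<Sum>n\<le>N. w n) : Q ==> n <= N ==> w n : Q"
  and Wspan: "EX N w. (ALL n. w n : W n) & v - (\<Sum>n\<le>(N::nat). w n) : Q"
  and ratio: "u ~: Q ==> zform u v r : Q ==> EX c:set r. ~ int p dvd c ==> EX j. v - of_int j * u : Q"
  and W1: "1 : W 0" and x1: "x : W 1" and xQ: "x ~: Q"
begin

lemma W_pow: "u : W i ==> u ^ n : W (n * i)"
 by (induction n) (use W1 Wmult in auto)

text \<open>The number of monomials of degree at most N in u and v is quadratic in N, while growth is linear as
card V = 1. So there is an algebraic relation, and by the grading a homogeneous one, to which the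
ratio property applies.\<close>
lemma line_degree:
 assumes u: "u : W e" "u ~: Q" and v: "v : W e" and e: "e >= 1"
 shows "EX j. v - of_int j * u : Q"
proof -
 obtain t1 f1 t2 f2 where f: "f1 : Pol {..<M} t1" "u - f1 : Q" "f2 : Pol {..<M} t2" "v - f2 : Q"
  using gen[of u] gen[of v] by blast
 define t where "t = t1 + t2"
 have ft: "f1 : Pol {..<M} t" "f2 : Pol {..<M} t"
  using Pol_mono'[OF f(1)] Pol_mono'[OF f(3)] unfolding t_def by simp_all
 define N where "N = 2 * (card B * (M * t * \<kappa> + 1))"
 define S where "S = (SIGMA n:{..N}. {..n})"
 have finS: "finite S" unfolding S_def by simp
 have "2 * card S = (N + 1) * (N + 2)"
 proof -
  have "2 * (\<Sum>n\<le>m. n + 1) = (m + 1) * (m + 2)" for m :: nat by (induction m) simp_all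
  thus ?thesis unfolding S_def by (simp add: card_SigmaI)
 qed
 moreover have "card B * (M * (N * t) * \<kappa> + 1) <= card B * ((M * t * \<kappa> + 1) * (N + 1))"
  by (rule mult_le_mono2) (simp add: algebra_simps)
 moreover have "2 * (card B * ((M * t * \<kappa> + 1) * (N + 1))) = N * (N + 1)" unfolding N_def by (simp only: ac_simps)
 moreover have "N * (N + 1) < (N + 1) * (N + 2)" by simp
 ultimately have big: "card B * (M * (N * t) * \<kappa> + 1) < card S" by linarith
 let ?P = "Pol {..<M} (N * t)"
 define E where "E k = (\<Sum>z\<in>S. of_int (k z) * u ^ (fst z - snd z) * v ^ snd z)" for k :: "nat \<times> nat => int"
 let ?D = "S \<rightarrow>\<^sub>E {0..<int p}"
 have "(%k. coset Q (E k)) ` ?D \<subseteq> quo Q ?P"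
 proof
  fix C assume "C : (%k. coset Q (E k)) ` ?D"
  then obtain k where k: "C = coset Q (E k)" by blast
  have "E k - (\<Sum>z\<in>S. of_int (k z) * f1 ^ (fst z - snd z) * f2 ^ snd z) : Q"
   unfolding E_def
   by (rule idl_cong_sum[OF sg]) (intro idl_cong_mult[OF idl] idl_cong_pow[OF idl], use f subgrp_zero[OF sg] in auto)
  moreover have "(\<Sum>z\<in>S. of_int (k z) * f1 ^ (fst z - snd z) * f2 ^ snd z) : ?P"
  proof (rule Pol_sum)
   fix z assume "z : S"
   hence z: "fst z <= N" "snd z <= fst z" unfolding S_def by auto
   have "of_int (k z) * f1 ^ (fst z - snd z) * f2 ^ snd z : Pol {..<M} (0 + (fst z - snd z) * t + snd z * t)"
    by (intro Pol_mult Pol_pow ft int_Pol)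
   moreover have "0 + (fst z - snd z) * t + snd z * t <= N * t"
    using z by (simp flip: distrib_right)
   ultimately show "of_int (k z) * f1 ^ (fst z - snd z) * f2 ^ snd z : ?P" by (rule Pol_mono')
  qed
  ultimately show "C : quo Q ?P" unfolding k quo_def using coset_eq[OF sg] by blast
 qed
 have "~ inj_on (%k. coset Q (E k)) ?D"
 proof
  assume "inj_on (%k. coset Q (E k)) ?D"
  hence "card ?D <= card (quo Q ?P)" using card_inj_on_le[OF _ _ growth(1)] \<open>_ \<subseteq> quo Q ?P\<close> by blast
  also have "... <= p ^ (card B * (M * (N * t) * \<kappa> + 1))" using growth(2)[of "N * t"] dim1 by simp
  also have "... < p ^ card S" by (rule power_strict_increasing[OF big p_gt(1)])
  also have "... = card ?D" using finS by (simp add: card_PiE)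
  finally show False by simp
 qed
 then obtain k k' where k: "k : ?D" "k' : ?D" "k ~= k'" "coset Q (E k) = coset Q (E k')" unfolding inj_on_def by blast
 define c where "c z = k z - k' z" for z
 have "E k - E k' = E c" unfolding E_def c_def by (simp add: left_diff_distrib sum_subtractf)
 hence Ec: "E c : Q" using k(4) coset_eq[OF sg] by metis
 obtain z where z: "z : S" "k z ~= k' z" using k(1-3) by (metis PiE_ext)
 have "~ int p dvd c z"
 proof
  assume d: "int p dvd c z"
  have "0 <= k z" "k z < int p" "0 <= k' z" "k' z < int p" using k(1,2) z(1) by auto
  hence "\<bar>c z\<bar> < int p" unfolding c_def by linarith
  hence "c z = 0" using d dvd_imp_le_int[of "c z" "int p"] by fastforce
  thus False using z(2) by (simp add: c_def)
 qed
 obtain n0 j0 where nj: "z = (n0, j0)" "n0 <= N" "j0 <= n0" using z(1) unfolding S_def by auto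
 \<comment> \<open>the homogeneous components of the relation\<close>
 define h where "h n = (\<Sum>j\<le>n. of_int (c (n, j)) * u ^ (n - j) * v ^ j)" for n
 have hW: "h n : W (n * e)" for n
  unfolding h_def
 proof (rule subgrp_sum[OF Wsub])
  fix j assume "j : {..n}"
  hence "n * e = (n - j) * e + j * e" by (simp flip: distrib_right)
  hence "u ^ (n - j) * v ^ j : W (n * e)" using Wmult[OF W_pow[OF u(1)] W_pow[OF v], of "n - j" j] by simp
  from subgrp_of_int[OF Wsub this, of "c (n, j)"]
  show "of_int (c (n, j)) * u ^ (n - j) * v ^ j : W (n * e)" by (simp add: mult.assoc)
 qed
 have "E c = (\<Sum>n\<le>N. h n)" unfolding E_def S_def h_def by (subst sum.Sigma) (simp_all add: split_def)
 also have "... = (\<Sum>m\<in>(%n. n * e) ` {..N}. h (m div e))"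
  by (subst sum.reindex) (use e in \<open>auto simp: inj_on_def\<close>)
 also have "... = (\<Sum>m\<le>N * e. if e dvd m then h (m div e) else 0)"
 proof (rule sum.mono_neutral_cong_left)
  show "ALL i:{..N * e} - (%n. n * e) ` {..N}. (if e dvd i then h (i div e) else 0) = 0"
  proof
   fix i assume i: "i : {..N * e} - (%n. n * e) ` {..N}"
   have "~ e dvd i"
   proof
    assume "e dvd i"
    then obtain l where "i = e * l" by (rule dvdE)
    hence l: "i = l * e" by simp
    hence "l <= N" using i e by simp
    thus False using i l by blast
   qed
   thus "(if e dvd i then h (i div e) else 0) = 0" by simp
  qed
 qed auto
 finally have "(\<Sum>m\<le>N * e. if e dvd m then h (m div e) else 0) : Q" using Ec by simp
 moreover have "(if e dvd m then h (m div e) else 0) : W m" for m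
  using hW[of "m div e"] subgrp_zero[OF Wsub, of m] by auto
 ultimately have "(if e dvd (n0 * e) then h (n0 * e div e) else 0) : Q"
  using Windep[of "%m. if e dvd m then h (m div e) else 0" "N * e" "n0 * e"] nj(2) by simp
 hence "h n0 : Q" using e by simp
 hence "zform u v (map (%j. c (n0, j)) (rev [0..<Suc n0])) : Q" unfolding zform_sum h_def .
 moreover have "EX d:set (map (%j. c (n0, j)) (rev [0..<Suc n0])). ~ int p dvd d"
 proof
  have "j0 : set (rev [0..<Suc n0])" using nj(3) by (simp only: set_rev set_upt atLeastLessThan_iff less_Suc_eq_le le0 simp_thms)
  thus "c z : set (map (%j. c (n0, j)) (rev [0..<Suc n0]))" unfolding set_map nj(1) by (rule imageI)
 qed fact
 ultimately show ?thesis by (rule ratio[OF u(2)])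
qed

lemma x_pow_notin: "x ^ n ~: Q" using prm_pow[OF prQ] xQ by blast

lemma x_pow_W: "x ^ n : W n" using W_pow[OF x1, of n] by simp

lemma W_line: assumes "w : W n" shows "EX j. w - of_int j * x ^ n : Q"
proof (cases "n = 0")
 case True
 have "w * x : W 1" using Wmult[OF assms x1] True by simp
 then obtain j where "w * x - of_int j * x : Q" using line_degree[OF x1 xQ, of "w * x"] by auto
 hence "(w - of_int j) * x : Q" by (simp add: algebra_simps)
 hence "w - of_int j : Q" using prm_mult[OF prQ] xQ by blast
 thus ?thesis using True by auto
next
 case False
 thus ?thesis using line_degree[OF x_pow_W x_pow_notin assms] by simp
qed

text \<open>The ideal generated by x^N and Q.\<close>
definition A where "A N = {w. EX v. w - x ^ N * v : Q}"

lemma A_idl: "idl (A N)" unfolding A_def by (rule idl_shift_UNIV[OF idl])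

lemma A_sg: "subgrp (A N)" using A_idl by (rule stab_subgrp)

lemma QA: "Q \<subseteq> A N" unfolding A_def by (auto intro: exI[of _ 0])

lemma A_mem: "x ^ N * v : A N" unfolding A_def using subgrp_zero[OF sg] by (auto intro: exI[of _ v])

lemma A_antimono: "N <= K ==> A K \<subseteq> A N"
proof
 fix w assume NK: "N <= K" and "w : A K"
 then obtain v where v: "w - x ^ K * v : Q" unfolding A_def by blast
 have "x ^ K = x ^ N * x ^ (K - N)" using NK by (simp flip: power_add)
 hence "w - x ^ N * (x ^ (K - N) * v) : Q" using v by (simp add: mult.assoc)
 thus "w : A N" unfolding A_def by blast
qed

text \<open>Modulo x^N every element is a combination of smaller powers of x with coefficients below p.\<close>
lemma finite_A: "finite (quo (A N) UNIV)"
proof -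
 let ?D = "{..<N} \<rightarrow>\<^sub>E {0..<int p}"
 have "quo (A N) UNIV \<subseteq> (%k. coset (A N) (\<Sum>n<N. of_int (k n) * x ^ n)) ` ?D"
 proof
  fix C assume "C : quo (A N) UNIV"
  then obtain v where v: "C = coset (A N) v" unfolding quo_def by blast
  obtain K w where w: "ALL n. w n : W n" "v - (\<Sum>n\<le>(K::nat). w n) : Q" using Wspan by blast
  have "ALL n. EX j. w n - of_int j * x ^ n : Q" using W_line w(1) by blast
  from choice[OF this] obtain j where j: "ALL n. w n - of_int (j n) * x ^ n : Q" ..
  define k where "k n = (if n : {..<N} then (if n <= K then j n mod int p else 0) else undefined)" for n
  have kD: "k : ?D" unfolding k_def using p_gt by (auto simp: PiE_def extensional_def)
  have trm: "(if n <= K then w n else 0) - (if n < N then of_int (k n) * x ^ n else 0) : A N" for n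
  proof -
   have 1: "w n - of_int (j n) * x ^ n : A N" using j QA by blast
   have 2: "of_int (j n) * x ^ n - of_int (j n mod int p) * x ^ n : A N"
   proof (rule int_cong[OF A_idl])
    show "of_nat p : A N" using pQ QA by blast
    show "int p dvd j n - j n mod int p" by (simp add: minus_mod_eq_mult_div)
    show "x ^ n - x ^ n : A N" using subgrp_zero[OF A_sg] by simp
   qed
   have 3: "of_int (j n) * x ^ n : A N" if "~ n < N"
   proof -
    have "x ^ n * of_int (j n) : A n" by (rule A_mem)
    thus ?thesis using A_antimono[of N n] that by (auto simp: mult.commute)
   qed
   have 4: "w n : A N" if "~ n < N" using subgrp_cong[OF A_sg 1] 3[OF that] by blast
   show ?thesis using subgrp_trans[OF A_sg 1 2] 4 subgrp_zero[OF A_sg] by (auto simp: k_def)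
  qed
  define T where "T = max (Suc K) N"
  have "(\<Sum>n<T. (if n <= K then w n else 0) - (if n < N then of_int (k n) * x ^ n else 0)) : A N"
   by (rule subgrp_sum[OF A_sg]) (rule trm)
  moreover have "(\<Sum>n<T. if n <= K then w n else 0) = (\<Sum>n\<le>K. w n)"
   by (rule sum.mono_neutral_cong_right) (auto simp: T_def)
  moreover have "(\<Sum>n<T. if n < N then of_int (k n) * x ^ n else 0) = (\<Sum>n<N. of_int (k n) * x ^ n)"
   by (rule sum.mono_neutral_cong_right) (auto simp: T_def)
  ultimately have "(\<Sum>n\<le>K. w n) - (\<Sum>n<N. of_int (k n) * x ^ n) : A N" by (simp only: sum_subtractf)
  moreover have "v - (\<Sum>n\<le>K. w n) : A N" using w(2) QA by blast
  ultimately have "v - (\<Sum>n<N. of_int (k n) * x ^ n) : A N" using subgrp_trans[OF A_sg] by blast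
  hence "C = coset (A N) (\<Sum>n<N. of_int (k n) * x ^ n)" unfolding v using coset_eq[OF A_sg] by blast
  thus "C : (%k. coset (A N) (\<Sum>n<N. of_int (k n) * x ^ n)) ` ?D" using kD by blast
 qed
 moreover have "finite ?D" by (intro finite_PiE) auto
 ultimately show ?thesis by (meson finite_imageI finite_subset)
qed

text \<open>Multiplication by x^N identifies W/(xW + Q) with the subquotient.\<close>
lemma len_A_step: "len UNIV (A (Suc N)) (A N) = len UNIV (A 1) UNIV"
proof (rule antisym)
 have cancel: "y - z : Q" if "x ^ N * y - x ^ N * z : Q" for y z
 proof -
  have "x ^ N * (y - z) : Q" using that by (simp add: right_diff_distrib)
  thus ?thesis using prm_mult[OF prQ] x_pow_notin by blast
 qed
 show "len UNIV (A (Suc N)) (A N) <= len UNIV (A 1) UNIV"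
 proof (rule len_map[where f = "%Z. {z. x ^ N * z : Z}"])
  fix Z assume Z: "idl Z" "A (Suc N) \<subseteq> Z" "Z \<subseteq> A N"
  have "idl {z. x ^ N * z : Z}"
   unfolding stab_def subgrp_def using Z(1) unfolding stab_def subgrp_def
   by (auto simp: right_diff_distrib mult.left_commute)
  moreover have "A 1 \<subseteq> {z. x ^ N * z : Z}"
  proof
   fix z assume "z : A 1"
   then obtain v where "z - x * v : Q" unfolding A_def by auto
   from idl_mult[OF idl this, of "x ^ N"] have "x ^ N * z - x ^ Suc N * v : Q" by (simp add: algebra_simps)
   hence "x ^ N * z : A (Suc N)" unfolding A_def by blast
   thus "z : {z. x ^ N * z : Z}" using Z(2) by blast
  qed
  ultimately show "idl {z. x ^ N * z : Z} & A 1 \<subseteq> {z. x ^ N * z : Z} & {z. x ^ N * z : Z} \<subseteq> UNIV" by simp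
 next
  fix Z Z' assume Z: "idl Z" "idl Z'" "A (Suc N) \<subseteq> Z" "Z \<subset> Z'" "Z' \<subseteq> A N"
  obtain w where w: "w : Z'" "w ~: Z" using Z(4) by blast
  obtain v where v: "w - x ^ N * v : Q" using w(1) Z(5) unfolding A_def by blast
  hence "w - x ^ N * v : Z" "w - x ^ N * v : Z'" using Z(3,4) QA by blast+
  hence "x ^ N * v : Z'" "x ^ N * v ~: Z"
   using w subgrp_cong[OF stab_subgrp[OF Z(1)]] subgrp_cong[OF stab_subgrp[OF Z(2)]] by blast+
  thus "{z. x ^ N * z : Z} \<subset> {z. x ^ N * z : Z'}" using Z(4) by blast
 qed (rule A_sg finite_A)+
 show "len UNIV (A 1) UNIV <= len UNIV (A (Suc N)) (A N)"
 proof (rule len_map[where f = "%Z. {w. EX z:Z. w - x ^ N * z : Q}"])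
  fix Z assume Z: "idl Z" "A 1 \<subseteq> Z" "Z \<subseteq> UNIV"
  have "idl {w. EX z:Z. w - x ^ N * z : Q}" (is "idl ?F") by (rule idl_shift[OF idl Z(1)])
  moreover have "A (Suc N) \<subseteq> ?F"
  proof
   fix w assume "w : A (Suc N)"
   then obtain v where "w - x ^ Suc N * v : Q" unfolding A_def by blast
   hence "w - x ^ N * (x ^ 1 * v) : Q" by (simp add: ac_simps)
   thus "w : ?F" using A_mem[of 1 v] Z(2) by blast
  qed
  moreover have "?F \<subseteq> A N" unfolding A_def by blast
  ultimately show "idl ?F & A (Suc N) \<subseteq> ?F & ?F \<subseteq> A N" by simp
 next
  fix Z Z' assume Z: "idl Z" "idl Z'" "A 1 \<subseteq> Z" "Z \<subset> Z'" "Z' \<subseteq> UNIV"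
  obtain z where z: "z : Z'" "z ~: Z" using Z(4) by blast
  have "x ^ N * z - x ^ N * z : Q" using subgrp_zero[OF sg] by simp
  hence 1: "x ^ N * z : {w. EX z:Z'. w - x ^ N * z : Q}" using z(1) by blast
  have 2: "x ^ N * z ~: {w. EX z:Z. w - x ^ N * z : Q}"
  proof
   assume "x ^ N * z : {w. EX z:Z. w - x ^ N * z : Q}"
   then obtain y where y: "y : Z" "x ^ N * z - x ^ N * y : Q" by blast
   have "z - y : Z" using cancel[OF y(2)] QA Z(3) by blast
   thus False using y(1) z(2) subgrp_cong[OF stab_subgrp[OF Z(1)]] by blast
  qed
  show "{w. EX z:Z. w - x ^ N * z : Q} \<subset> {w. EX z:Z'. w - x ^ N * z : Q}" using 1 2 Z(4) by blast
 next
  show "finite (quo (A (Suc N)) (A N))"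
   by (rule finite_quo_mono[OF finite_A A_sg A_sg order_refl subset_UNIV])
 qed (rule A_sg)
qed

lemma len_A: "len UNIV (A N) UNIV = N * len UNIV (A 1) UNIV"
proof (induction N)
 case 0
 have "A 0 = UNIV" using A_mem[of 0] by auto
 thus ?case by (simp add: len_self)
next
 case (Suc N)
 have "len UNIV (A (Suc N)) UNIV = len UNIV (A (Suc N)) (A N) + len UNIV (A N) UNIV"
  by (rule len_additive[OF A_idl A_idl stab_UNIV A_antimono subset_UNIV finite_A]) simp
 thus ?case by (simp only: Suc len_A_step mult_Suc)
qed

text \<open>By W_line the homogeneous generators of J are multiples of powers of x modulo Q, so J is generated
by Q and the smallest such power x^i. Then the Frobenius powers of J are generated by the x^(iq),
and their colengths are proportional to q.\<close>
lemma ell_dim1: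
 assumes H: "H \<subseteq> (\<Union>n. W n)" "J = gid (H \<union> Q)" and fin: "finite (quo J UNIV)"
 shows "ell J (Suc n) = p * ell J n"
proof -
 have JI: "idl J" "Q \<subseteq> J" "H \<subseteq> J" using idl_gid gid_incl[of "H \<union> Q"] unfolding H(2) by auto
 have "EX h:H. h ~: Q"
 proof (rule ccontr)
  assume "~ (EX h:H. h ~: Q)"
  hence "gid (H \<union> Q) \<subseteq> Q" by (intro gid_least[OF idl]) blast
  hence JQ: "J = Q" using JI H by blast
  have "~ inj_on (%n. coset Q (x ^ n)) (UNIV :: nat set)"
  proof
   assume "inj_on (%n. coset Q (x ^ n)) (UNIV :: nat set)"
   moreover have "finite (range (%n. coset Q (x ^ n)))"
    by (rule finite_subset[OF _ fin[unfolded JQ]]) (auto simp: quo_def)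
   ultimately show False using finite_imageD infinite_UNIV_nat by blast
  qed
  then obtain a b where ab: "a ~= b" "coset Q (x ^ a) = coset Q (x ^ b)" unfolding inj_on_def by blast
  have e: "x ^ a - x ^ b : Q" using ab(2) coset_eq[OF sg] by blast
  let ?w = "%n. if n = a then x ^ a else if n = b then - (x ^ b) else 0"
  have "(\<Sum>n\<le>a + b. ?w n) = (\<Sum>n\<in>{a, b}. ?w n)" by (rule sum.mono_neutral_right) auto
  also have "... = x ^ a - x ^ b" using ab(1) by simp
  finally have "(\<Sum>n\<le>a + b. ?w n) : Q" using e by simp
  moreover have "?w n : W n" for n using x_pow_W subgrp_minus[OF Wsub x_pow_W] subgrp_zero[OF Wsub] by auto
  ultimately have "?w a : Q" by (intro Windep[of ?w "a + b" a]) auto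
  thus False using x_pow_notin by simp
 qed
 have hom: "x ^ m : J & h : A m" if h1: "h : H" and h2: "h ~: Q" and h3: "h : W m" for h m
 proof -
  obtain j where j: "h - of_int j * x ^ m : Q" using W_line[OF h3] by blast
  have "~ int p dvd j"
  proof
   assume "int p dvd j"
   hence "of_int j * x ^ m - of_int 0 * x ^ m : Q"
    using int_cong[OF idl pQ, of j 0 "x ^ m" "x ^ m"] subgrp_zero[OF sg] by simp
   hence "of_int j * x ^ m : Q" by simp
   thus False using h2 subgrp_cong[OF sg j] by blast
  qed
  hence "coprime (int p) j" using pp by (simp add: prime_imp_coprime)
  then obtain u where u: "int p dvd u * j - 1" by (rule int_inverse_mod)
  have "h - of_int j * x ^ m : J" using j JI by blast
  hence "of_int j * x ^ m : J" using h1 JI(3) subgrp_cong[OF stab_subgrp[OF JI(1)]] by blast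
  from idl_mult[OF JI(1) this, of "of_int u"] have 1: "of_int (u * j) * x ^ m : J" by (simp add: mult.assoc)
  have "of_int (u * j) * x ^ m - of_int 1 * x ^ m : J"
   by (rule int_cong[OF JI(1) _ u]) (use pQ JI subgrp_zero[OF stab_subgrp[OF JI(1)]] in auto)
  hence "x ^ m : J" using 1 subgrp_cong[OF stab_subgrp[OF JI(1)]] by simp
  moreover have "h : A m" unfolding A_def using j by (auto simp: mult.commute)
  ultimately show ?thesis by blast
 qed
 have "EX m. x ^ m : J" using \<open>EX h:H. h ~: Q\<close> hom H(1) by blast
 define i where "i = (LEAST m. x ^ m : J)"
 have iJ: "x ^ i : J" unfolding i_def by (rule LeastI_ex) fact
 have imin: "i <= m" if "x ^ m : J" for m unfolding i_def using that by (rule Least_le)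
 have JA: "J = A i"
 proof
  show "J \<subseteq> A i" unfolding H(2)
  proof (rule gid_least[OF A_idl], rule Un_least[OF _ QA], rule subsetI)
   fix h assume h: "h : H"
   show "h : A i"
   proof (cases "h : Q")
    case False
    obtain m where "h : W m" using h H(1) by blast
    from hom[OF h False this] show ?thesis using A_antimono[OF imin] by blast
   qed (use QA in blast)
  qed
  show "A i \<subseteq> J"
  proof
   fix w assume "w : A i"
   then obtain v where v: "w - x ^ i * v : Q" unfolding A_def by blast
   have "w - x ^ i * v : J" using v JI by blast
   moreover have "x ^ i * v : J" using idl_mult[OF JI(1) iJ, of v] by (simp add: mult.commute)
   ultimately show "w : J" using subgrp_cong[OF stab_subgrp[OF JI(1)]] by blast
  qed
 qed
 have FPA: "FP Q J q = A (i * q)" for q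
 proof
  show "FP Q J q \<subseteq> A (i * q)"
  proof (rule FP_least[OF A_idl QA])
   fix w assume "w : J"
   then obtain v where "w - x ^ i * v : Q" unfolding JA A_def by blast
   from idl_cong_pow[OF idl this, of q] have "w ^ q - x ^ (i * q) * v ^ q : Q"
    by (simp add: power_mult_distrib power_mult)
   thus "w ^ q : A (i * q)" unfolding A_def by blast
  qed
  show "A (i * q) \<subseteq> FP Q J q"
  proof
   fix w assume "w : A (i * q)"
   then obtain v where "w - x ^ (i * q) * v : Q" unfolding A_def by blast
   hence 1: "w - x ^ (i * q) * v : FP Q J q" using FP_Q by blast
   have "v * (x ^ i) ^ q : FP Q J q" by (rule idl_mult[OF FP_idl FP_pow[OF iJ]])
   hence "x ^ (i * q) * v : FP Q J q" by (simp add: power_mult mult.commute)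
   thus "w : FP Q J q" using 1 subgrp_cong[OF stab_subgrp[OF FP_idl]] by blast
  qed
 qed
 show ?thesis unfolding ell_def FPA len_A[of "i * p ^ Suc n"] len_A[of "i * p ^ n"] by (simp add: ac_simps)
qed

end

section \<open>Integral relations modulo I\<close>

context surj_hom begin

lemma hom_sum: "finite A ==> \<psi> (sum f A) = finsum B (%i. \<psi> (f i)) A"
 by (induction A rule: finite_induct) (simp_all add: hom_zero hom_add closed)

text \<open>Either two powers of v have the same image, or the images of sufficiently many powers are dependent
because the rank is finite.\<close>
lemma rank_relation:
 assumes "additive_rank B < \<infinity>"
 shows "EX N k. k N ~= 0 & \<psi> (\<Sum>i\<le>N. of_int (k i) * v ^ i) = \<zero>"
proof -
 have "EX N k. (EX i<=N. k i ~= 0) & \<psi> (\<Sum>i\<le>N. of_int (k i) * v ^ i) = \<zero>"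
 proof (cases "inj (%i. \<psi> (v ^ i))")
  case False
  then obtain a b where ab: "a < b" "\<psi> (v ^ a) = \<psi> (v ^ b)"
   unfolding inj_on_def by (metis UNIV_I nat_neq_iff)
  let ?k = "%i. if i = b then 1 else if i = a then - 1 else (0::int)"
  have "(\<Sum>i\<le>b. of_int (?k i) * v ^ i) = (\<Sum>i\<in>{a, b}. of_int (?k i) * v ^ i)"
   by (rule sum.mono_neutral_right) (use ab in auto)
  also have "... = v ^ b - v ^ a" using ab(1) by simp
  finally have "\<psi> (\<Sum>i\<le>b. of_int (?k i) * v ^ i) = \<zero>"
   using ab(2) closed by (simp only: hom_diff) (simp add: a_minus_def r_neg)
  thus ?thesis by (intro exI[of _ b] exI[of _ ?k]) auto
 next
  case True
  obtain r where r: "additive_rank B = enat r" using assms by (cases "additive_rank B") auto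
  let ?S = "(%i. \<psi> (v ^ i)) ` {..r}"
  have inj: "inj_on (%i. \<psi> (v ^ i)) {..r}" using True by (rule inj_on_subset) simp
  have "card ?S = r + 1" using card_image[OF inj] by simp
  hence "~ enat (card ?S) <= additive_rank B" by (simp add: r)
  hence "~ (ALL c :: 'a => int. finsum B (%s. [c s] \<cdot> s) ?S = \<zero> --> (ALL s:?S. c s = 0))"
   unfolding additive_rank_def using closed by (auto intro!: Sup_upper)
  then obtain c :: "'a => int" where c: "finsum B (%s. [c s] \<cdot> s) ?S = \<zero>" "EX s:?S. c s ~= 0" by blast
  have "finsum B (%s. [c s] \<cdot> s) ?S = finsum B (%i. [c (\<psi> (v ^ i))] \<cdot> \<psi> (v ^ i)) {..r}"
   by (rule finsum_reindex) (use inj closed in auto)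
  also have "... = \<psi> (\<Sum>i\<le>r. of_int (c (\<psi> (v ^ i))) * v ^ i)" by (simp add: hom_sum hom_int)
  finally have "\<psi> (\<Sum>i\<le>r. of_int (c (\<psi> (v ^ i))) * v ^ i) = \<zero>" using c(1) by simp
  thus ?thesis using c(2) by (intro exI[of _ r] exI[of _ "%i. c (\<psi> (v ^ i))"]) auto
 qed
 then obtain N k i where k: "i <= N" "k i ~= 0" "\<psi> (\<Sum>i\<le>N. of_int (k i) * v ^ i) = \<zero>" by blast
 define m where "m = Max {i. i <= N & k i ~= 0}"
 have fin: "finite {i. i <= N & k i ~= 0}" by simp
 have m: "m <= N" "k m ~= 0" using Max_in[OF fin] k(1,2) unfolding m_def by blast+
 have "(\<Sum>i\<le>N. of_int (k i) * v ^ i) = (\<Sum>i\<le>m. of_int (k i) * v ^ i)"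
 proof (rule sum.mono_neutral_right)
  show "ALL i:{..N} - {..m}. of_int (k i) * v ^ i = 0"
  proof
   fix i assume i: "i : {..N} - {..m}"
   have "k i = 0"
   proof (rule ccontr)
    assume "k i ~= 0"
    hence "i <= m" unfolding m_def using i by (intro Max_ge[OF fin]) simp
    thus False using i by simp
   qed
   thus "of_int (k i) * v ^ i = 0" by simp
  qed
 qed (use m in auto)
 thus ?thesis using k(3) m(2) by (intro exI[of _ m] exI[of _ k]) simp
qed

lemma quotient_relation:
 assumes K: "ideal K B" and "additive_rank (B Quot K) < \<infinity>"
 shows "EX N k. k N ~= 0 & (\<Sum>i\<le>N. of_int (k i) * v ^ i) : pre K"
proof -
 interpret K: ideal K B by fact
 interpret q: surj_hom "B Quot K" "%w. K +> \<psi> w" by (rule quotient_hom[OF K])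
 from q.rank_relation[OF assms(2), of v] obtain N k where
  k: "k N ~= 0" "K +> \<psi> (\<Sum>i\<le>N. of_int (k i) * v ^ i) = \<zero>\<^bsub>B Quot K\<^esub>" by blast
 have "K +> \<psi> (\<Sum>i\<le>N. of_int (k i) * v ^ i) = K +> \<psi> 0" using k(2) q.hom_zero by simp
 hence "\<psi> (\<Sum>i\<le>N. of_int (k i) * v ^ i) \<ominus> \<psi> 0 : K"
  using quotient_eq_iff_same_a_r_cos[OF K closed closed] by blast
 hence "(\<Sum>i\<le>N. of_int (k i) * v ^ i) : pre K" unfolding pre_def by (simp flip: hom_diff)
 thus ?thesis using k(1) by blast
qed

section \<open>Gradings\<close>

lemma grading_subgrp:
 assumes "subgroup N (add_monoid B)" shows "subgrp (pre N)" "krn \<subseteq> pre N"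
proof -
 show "subgrp (pre N)" unfolding subgrp_def pre_def
  using subgroup.one_closed[OF assms] subgroup.m_closed[OF assms] subgroup.m_inv_closed[OF assms]
  by (simp add: hom_zero hom_diff a_minus_def a_inv_def)
 show "krn \<subseteq> pre N" using subgroup.one_closed[OF assms] unfolding krn_def pre_def by auto
qed

text \<open>Uniqueness of the homogeneous decomposition of 0.\<close>
lemma graded_indep:
 assumes gr: "graded_ring B G" and w: "!!n. w n : pre (G n)" "(\<Sum>n\<le>N. w n) : krn" "n <= N"
 shows "w n : krn"
proof -
 have z: "\<zero> : G i" for i using gr subgroup.one_closed unfolding graded_ring_def by fastforce
 define f where "f n = (if n <= N then \<psi> (w n) else \<zero>)" for n
 have "finsum B f {i. f i ~= \<zero>} = finsum B f {..N}"
  by (rule add.finprod_mono_neutral_cong_left) (use closed in \<open>auto simp: f_def\<close>)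
 also have "... = finsum B (%n. \<psi> (w n)) {..N}" by (rule add.finprod_cong') (use closed in \<open>auto simp: f_def\<close>)
 also have "... = \<psi> (\<Sum>n\<le>N. w n)" by (simp add: hom_sum)
 also have "... = \<zero>" using w(2) by (simp add: krn_def)
 finally have 1: "\<zero> = finsum B f {i. f i ~= \<zero>}" by simp
 have 2: "ALL i. f i : G i" using w(1) z by (simp add: f_def pre_def)
 have "finite {i. f i ~= \<zero>}" by (rule finite_subset[of _ "{..N}"]) (auto simp: f_def)
 note 3 = 2 this 1
 have 4: "ALL i. (%_. \<zero>) i : G i" "finite {i. (%_. \<zero>) i ~= \<zero>}" "\<zero> = finsum B (%_. \<zero>) {i. (%_. \<zero>) i ~= \<zero>}"
  using z by simp_all
 define P where "P f \<longleftrightarrow> (ALL i. f i : G i) & finite {i. f i ~= \<zero>} & \<zero> = finsum B f {i. f i ~= \<zero>}" for f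
 have "EX! f. P f" using gr zero_closed unfolding graded_ring_def P_def by blast
 hence u: "!!f g. P f ==> P g ==> f = g" by (rule ex1E) metis
 have "f = (%_. \<zero>)" by (rule u; unfold P_def) (intro conjI 3, intro conjI 4)
 hence "\<psi> (w n) = \<zero>" using w(3) unfolding f_def by metis
 thus ?thesis by (simp add: krn_def)
qed

lemma graded_span:
 assumes gr: "graded_ring B G"
 shows "EX N w. (ALL n. w n : pre (G n)) & v - (\<Sum>n\<le>(N::nat). w n) : krn"
proof -
 have sub: "G i \<subseteq> carrier B" for i using gr subgroup.subset unfolding graded_ring_def by fastforce
 have "EX f. (ALL i. f i : G i) & finite {i. f i ~= \<zero>} & \<psi> v = finsum B f {i. f i ~= \<zero>}"
  using gr closed[of v] unfolding graded_ring_def by blast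
 then obtain f where f: "ALL i. f i : G i" "finite {i. f i ~= \<zero>}" "\<psi> v = finsum B f {i. f i ~= \<zero>}" by blast
 have "ALL i. EX x. f i = \<psi> x" using surj f(1) sub by blast
 from choice[OF this] obtain w where w: "ALL i. f i = \<psi> (w i)" ..
 obtain N where N: "ALL i:{i. f i ~= \<zero>}. i <= N" using f(2) finite_nat_set_iff_bounded_le by blast
 have "\<psi> v = finsum B (%i. \<psi> (w i)) {..N}" unfolding f(3)
  by (rule add.finprod_mono_neutral_cong_left) (use N w closed in auto)
 also have "... = \<psi> (\<Sum>n\<le>N. w n)" by (simp add: hom_sum)
 finally have "v - (\<Sum>n\<le>N. w n) : krn" by (simp add: hom_eq)
 moreover have "w n : pre (G n)" for n using f(1) w unfolding pre_def by (metis mem_Collect_eq)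
 ultimately show ?thesis by blast
qed

end

text \<open>Multiply by an inverse u of the leading coefficient modulo p and by a power of v.\<close>
lemma monic_relation:
 fixes v :: zpol
 assumes J: "idl J" "of_nat p : J" and p: "Factorial_Ring.prime p"
  and k: "(\<Sum>i\<le>N. of_int (k i) * v ^ i) : J" "~ int p dvd k N" and D: "N <= D"
 shows "EX a. v ^ D - (\<Sum>i<D. of_int (a i) * v ^ i) : J"
proof -
 have "coprime (int p) (k N)" using k(2) p by (simp add: prime_imp_coprime)
 then obtain u where u: "int p dvd u * k N - 1" by (rule int_inverse_mod)
 let ?s = "D - N"
 define a where "a m = (if ?s <= m then - u * k (m - ?s) else 0)" for m
 have "(\<Sum>m<D. of_int (a m) * v ^ m) = (\<Sum>m\<in>(%i. i + ?s) ` {..<N}. of_int (a m) * v ^ m)"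
 proof (rule sum.mono_neutral_right)
  show "ALL m:{..<D} - (%i. i + ?s) ` {..<N}. of_int (a m) * v ^ m = 0"
  proof
   fix m assume m: "m : {..<D} - (%i. i + ?s) ` {..<N}"
   have "~ ?s <= m"
   proof
    assume "?s <= m"
    hence "m = (m - ?s) + ?s" "m - ?s < N" using m D by auto
    thus False using m by blast
   qed
   thus "of_int (a m) * v ^ m = 0" by (simp add: a_def)
  qed
 qed (use D in auto)
 also have "... = (\<Sum>i<N. of_int (a (i + ?s)) * v ^ (i + ?s))" by (simp add: sum.reindex)
 also have "... = - (\<Sum>i<N. of_int (u * k i) * v ^ (i + ?s))" by (simp add: a_def sum_negf)
 finally have s: "(\<Sum>m<D. of_int (a m) * v ^ m) = - (\<Sum>i<N. of_int (u * k i) * v ^ (i + ?s))" .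
 have "(of_int u * v ^ ?s) * (\<Sum>i\<le>N. of_int (k i) * v ^ i) : J" by (rule idl_mult[OF J(1) k(1)])
 also have "(of_int u * v ^ ?s) * (\<Sum>i\<le>N. of_int (k i) * v ^ i) = (\<Sum>i\<le>N. of_int (u * k i) * v ^ (i + ?s))"
  unfolding sum_distrib_left by (rule sum.cong) (simp_all add: power_add ac_simps)
 also have "... = of_int (u * k N) * v ^ D + (\<Sum>i<N. of_int (u * k i) * v ^ (i + ?s))"
  using D by (simp add: lessThan_Suc_atMost[symmetric] add.commute)
 finally have 1: "of_int (u * k N) * v ^ D + (\<Sum>i<N. of_int (u * k i) * v ^ (i + ?s)) : J" .
 have "of_int (u * k N) * v ^ D - of_int 1 * v ^ D : J"
  by (rule int_cong[OF J u]) (simp add: subgrp_zero[OF stab_subgrp[OF J(1)]])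
 from subgrp_diff[OF stab_subgrp[OF J(1)] 1 this]
 have "v ^ D - (\<Sum>m<D. of_int (a m) * v ^ m) : J" unfolding s by (simp add: add.commute)
 thus ?thesis by blast
qed

section \<open>Dimension, length and grading of a fiber\<close>

context gfib begin

lemma krull_fiber:
 assumes r: "red PQ p M V c B \<kappa> g Y" shows "krull_dim (fiber R p) = enat (card V)"
proof (rule antisym)
 interpret r: red PQ p M V c B \<kappa> g Y by (rule r)
 show "krull_dim (fiber R p) <= enat (card V)"
 proof (rule f.krull_le)
  fix n T assume T: "!!i. i <= n ==> prm (T i) & f.krn \<subseteq> T i" "!!i. i < n ==> T i \<subset> T (Suc i)"
  show "n <= card V" by (rule r.krull_upper[of n T]) (use T krn_PP in auto)
 qed
 have "EX T. T 0 = PQ & (ALL i<=card V. prm (T i)) & (ALL i<card V. T i \<subset> T (Suc i))"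
  by (rule krull_lower[OF prime_p r.prQ r.pQ r.gen r.ai r.VM order_refl])
 then obtain T where T: "T 0 = PQ" "ALL i<=card V. prm (T i)" "ALL i<card V. T i \<subset> T (Suc i)" by blast
 have sub: "PQ \<subseteq> T i" if "i <= card V" for i using that
 proof (induction i)
  case (Suc i)
  hence "PQ \<subseteq> T i" "T i \<subset> T (Suc i)" using T(3) by auto
  thus ?case by blast
 qed (simp add: T(1))
 show "enat (card V) <= krull_dim (fiber R p)"
  by (rule f.krull_ge[of "card V" T]) (use T sub krn_PP in auto)
qed

lemma hk_len:
 assumes I: "ideal I R" and fin: "finite (quo (FP PQ (PP (pre I) p) (p ^ n)) UNIV)"
 shows "hk_quotient p d (fiber R p) (fiber_image R p I) n =
  real (len UNIV (FP PQ (PP (pre I) p) (p ^ n)) UNIV) / real p ^ (n * d)"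
proof -
 have sI: "subgroup I (add_monoid R)" using I by (simp add: additive_subgroup.a_subgroup ideal.axioms(1))
 have id: "ideal (fiber_image R p I) (fiber R p)" unfolding fiber_image_eq[OF sI]
  by (rule f.ideal_image[OF ideal_pre(1)[OF I]])
 note fp = f.frobenius_pre[OF id, of "p ^ n"]
 have pre: "f.pre (frobenius_power (fiber R p) (fiber_image R p I) (p ^ n)) = FP PQ (PP (pre I) p) (p ^ n)"
  unfolding fp(2) krn_PP pre_fiber_image[OF I] ..
 have "colength (fiber R p) (frobenius_power (fiber R p) (fiber_image R p I) (p ^ n)) =
   enat (len UNIV (FP PQ (PP (pre I) p) (p ^ n)) UNIV)"
  using f.colength_len[OF fp(1)] fin unfolding pre by blast
 thus ?thesis unfolding hk_quotient_def by simp
qed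

text \<open>The unit lies in degree 0: if e is its component of degree 0, comparing the components of degree 1
of x = x 1 gives x e = x modulo Q, and x can be cancelled.\<close>
lemma graded_fiber:
 assumes r: "red PQ p M V c B \<kappa> g Y" and d1: "card V = 1"
  and gr: "graded_ring (fiber R p) (%i. fiber_image R p (G i))"
  and x: "\<psi> x : G 1" "subgroup (G 1) (add_monoid R)" "x ~: PQ"
 shows "graded_line PQ p M V c B \<kappa> g Y (%i. f.pre (fiber_image R p (G i))) x"
proof -
 interpret r: red PQ p M V c B \<kappa> g Y by (rule r)
 let ?W = "%i. f.pre (fiber_image R p (G i))"
 have sg: "subgroup (fiber_image R p (G i)) (add_monoid (fiber R p))" for i
  using spec[OF conjunct1[OF conjunct2[OF gr[unfolded graded_ring_def]]], of i] .
 have ws: "subgrp (?W n)" and qw: "PQ \<subseteq> ?W n" for n using f.grading_subgrp[OF sg[of n]] krn_PP by simp_all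
 have wm: "u * v : ?W (i + j)" if "u : ?W i" "v : ?W j" for u v i j
  using gr that unfolding graded_ring_def f.pre_def by (simp add: f.hom_mult)
 have ind: "w n : PQ" if "!!n. w n : ?W n" "(\<Sum>n\<le>N. w n) : PQ" "n <= N" for w N n
  using f.graded_indep[OF gr, of w N n] that krn_PP by blast
 have span: "EX N w. (ALL n. w n : ?W n) & v - (\<Sum>n\<le>(N::nat). w n) : PQ" for v
  using f.graded_span[OF gr, of v] krn_PP by simp
 have x1: "x : ?W 1" using x(1) fiber_image_eq[OF x(2)] unfolding f.pre_def pre_def by blast
 have one: "1 : ?W 0"
 proof -
  obtain N e where e: "ALL n. e n : ?W n" "1 - (\<Sum>n\<le>(N::nat). e n) : PQ" using span by blast
  define w where "w n = (case n of 0 => 0 | Suc m => (if m = 0 then x * e 0 - x else x * e m))" for n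
  have "w n : ?W n" for n
  proof (cases n)
   case 0 thus ?thesis using subgrp_zero[OF ws] by (simp add: w_def)
  next
   case (Suc m)
   have "x * e m : ?W (1 + m)" by (rule wm[OF x1]) (use e in blast)
   thus ?thesis using subgrp_diff[OF ws _ x1, of "x * e 0"] Suc by (auto simp: w_def)
  qed
  moreover have "(\<Sum>n\<le>Suc N. w n) : PQ"
  proof -
   have "(\<Sum>n\<le>Suc N. w n) = (\<Sum>m\<le>N. w (Suc m))" by (subst sum.atMost_Suc_shift) (simp add: w_def)
   also have "... = (\<Sum>m\<le>N. x * e m - (if m = 0 then x else 0))" by (rule sum.cong) (auto simp: w_def)
   also have "... = - (x * (1 - (\<Sum>m\<le>N. e m)))"
    by (simp add: sum_subtractf sum_distrib_left[symmetric] algebra_simps)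
   also have "... : PQ" using subgrp_minus[OF r.sg idl_mult[OF r.idl e(2)]] .
   finally show ?thesis .
  qed
  ultimately have "w 1 : PQ" by (rule ind) simp
  hence "x * (e 0 - 1) : PQ" by (simp add: w_def right_diff_distrib)
  hence "e 0 - 1 : PQ" using prm_mult[OF r.prQ] x(3) by blast
  hence "e 0 - 1 : ?W 0" using qw by blast
  thus ?thesis using e(1) subgrp_cong[OF ws[of 0]] by blast
 qed
 show ?thesis
  unfolding graded_line_def graded_line_axioms_def
  by (intro conjI allI impI r d1 ws qw wm ind span geo_ratio one x1 x(3)) (assumption | erule spec)+
qed

end

section \<open>Sequences and the limit over the primes\<close>

text \<open>The tail is dominated by a geometric series with ratio 1/p, whose sum is at most twice its first
term.\<close>
lemma geometric_steps:
 fixes h :: "nat => real"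
 assumes h: "!!n. \<bar>h n - h (Suc n)\<bar> <= C / p ^ n" and p: "p >= (2::real)" and C: "C >= 0"
 shows "\<bar>lim h - h m\<bar> <= 2 * C / p ^ m"
proof -
 have b: "\<bar>h (m + k) - h m\<bar> <= 2 * C / p ^ m * (1 - 1 / p ^ k)" for m k
 proof (induction k)
  case (Suc k)
  have e: "c * (2 * (a - b)) + 2 * c * (1 - a) = 2 * c * (1 - b)" for a b c :: real by (simp add: algebra_simps)
  have pk: "p ^ m > 0" "p ^ k > 0" "p > 0" using p by simp_all
  have "1 / p ^ k - 2 / p ^ Suc k = (p - 2) / p ^ Suc k" using pk by (simp add: field_simps)
  also have "... >= 0" using p pk by simp
  finally have "1 / p ^ k <= 2 * (1 / p ^ k - 1 / p ^ Suc k)" by (simp add: field_simps)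
  hence s: "C / p ^ m * (1 / p ^ k) <= C / p ^ m * (2 * (1 / p ^ k - 1 / p ^ Suc k))"
   using C pk by (intro mult_left_mono) simp_all
  have "\<bar>h (m + Suc k) - h m\<bar> <= \<bar>h (m + k) - h (Suc (m + k))\<bar> + \<bar>h (m + k) - h m\<bar>" by simp
  also have "... <= C / p ^ (m + k) + 2 * C / p ^ m * (1 - 1 / p ^ k)" by (rule add_mono[OF h Suc])
  also have "C / p ^ (m + k) = C / p ^ m * (1 / p ^ k)" by (simp add: power_add)
  also have "C / p ^ m * (1 / p ^ k) + 2 * C / p ^ m * (1 - 1 / p ^ k) \<le>
    C / p ^ m * (2 * (1 / p ^ k - 1 / p ^ Suc k)) + 2 * C / p ^ m * (1 - 1 / p ^ k)"
   using s by simp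
  also have "... = 2 * C / p ^ m * (1 - 1 / p ^ Suc k)"
   using e[of "C / p ^ m" "1 / p ^ k" "1 / p ^ Suc k"] by (simp del: power_Suc)
  finally show ?case .
 qed simp
 have b2: "\<bar>h (m + k) - h m\<bar> <= 2 * C / p ^ m" for m k
 proof -
  have "2 * C / p ^ m * (1 - 1 / p ^ k) <= 2 * C / p ^ m * 1" using C p by (intro mult_left_mono) simp_all
  thus ?thesis using b[of m k] by simp
 qed
 have lim0: "(%m. 2 * C / p ^ m) \<longlonglongrightarrow> 0"
  using tendsto_mult_right_zero[OF LIMSEQ_realpow_zero[of "1 / p"], of "2 * C"] p by (simp add: power_one_over)
 have "Cauchy h"
 proof (rule metric_CauchyI)
  fix e :: real assume "e > 0"
  then obtain m where m: "ALL n>=m. norm (2 * C / p ^ n - 0) < e / 2" using LIMSEQ_D[OF lim0, of "e / 2"] by auto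
  have "norm (2 * C / p ^ m - 0) < e / 2" using m by blast
  hence m2: "2 * C / p ^ m < e / 2" unfolding real_norm_def diff_0_right by (rule le_less_trans[OF abs_ge_self])
  have d: "dist (h n) (h m) < e / 2" if "n >= m" for n
  proof -
   have "\<bar>h n - h m\<bar> <= 2 * C / p ^ m" using b2[of m "n - m"] that by simp
   thus ?thesis using m2 unfolding dist_real_def by linarith
  qed
  have "dist (h n) (h n') < e" if "n >= m" "n' >= m" for n n'
   using d[OF that(1)] d[OF that(2)] by (rule dist_triangle_half_l)
  thus "EX M. ALL m>=M. ALL n>=M. dist (h m) (h n) < e" by blast
 qed
 hence "h \<longlonglongrightarrow> lim h" using Cauchy_convergent convergent_LIMSEQ_iff by blast
 hence "(%k. \<bar>h (k + m) - h m\<bar>) \<longlonglongrightarrow> \<bar>lim h - h m\<bar>"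
  by (intro tendsto_rabs tendsto_diff tendsto_const LIMSEQ_ignore_initial_segment)
 thus ?thesis by (rule LIMSEQ_le_const2) (use b2[of m] in \<open>auto simp: add.commute\<close>)
qed

lemma eventually_primes:
 assumes "finite {p. Factorial_Ring.prime p & ~ P p}" shows "eventually P primes_at_top"
proof -
 obtain N where N: "ALL p:{p. Factorial_Ring.prime p & ~ P p}. p <= N"
  using assms finite_nat_set_iff_bounded_le by blast
 have "\<forall>\<^sub>F p in at_top. p : {p. Factorial_Ring.prime p} --> P p"
 proof (rule eventually_at_top_linorderI[of "Suc N"])
  fix p assume p: "Suc N <= p"
  have "p ~: {p. Factorial_Ring.prime p & ~ P p}" using N p by (meson not_less_eq_eq)
  thus "p : {p. Factorial_Ring.prime p} --> P p" by simp
 qed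
 thus ?thesis unfolding primes_at_top_def by (simp add: eventually_inf_principal)
qed

lemma primes_at_top_le: "primes_at_top <= sequentially"
 unfolding primes_at_top_def by simp

lemma step_real:
 fixes p d n E E' C :: nat
 assumes p: "p > 0" and d: "d >= 1" and up: "E' <= p ^ d * E + C * p ^ d * (p ^ n) ^ (d - 1)"
  and lo: "p ^ d * E <= E' + C * p ^ d * (p ^ n) ^ (d - 1)"
 shows "\<bar>real E / real p ^ (n * d) - real E' / real p ^ (Suc n * d)\<bar> <= real C / real p ^ n"
proof -
 define q where "q = real p ^ n"
 define P where "P = real p ^ d"
 have q0: "q > 0" "P > 0" unfolding q_def P_def using p by simp_all
 have e1: "real p ^ (n * d) = q ^ (d - 1) * q"
  using d by (simp add: q_def power_mult flip: power_Suc2)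
 have e2: "real p ^ (Suc n * d) = P * (q ^ (d - 1) * q)" unfolding e1[symmetric] by (simp add: P_def power_add)
 have "real E' <= real (p ^ d * E + C * p ^ d * (p ^ n) ^ (d - 1))" "real (p ^ d * E) <= real (E' + C * p ^ d * (p ^ n) ^ (d - 1))"
  using up lo by (simp_all only: of_nat_le_iff)
 hence "\<bar>P * real E - real E'\<bar> <= real C * P * q ^ (d - 1)" by (simp add: P_def q_def)
 hence "\<bar>P * real E - real E'\<bar> / (P * (q ^ (d - 1) * q)) <= real C * P * q ^ (d - 1) / (P * (q ^ (d - 1) * q))"
  using q0 by (intro divide_right_mono) simp_all
 moreover have "real C * P * q ^ (d - 1) / (P * (q ^ (d - 1) * q)) = real C / q" using q0 by simp
 moreover have "real E / (q ^ (d - 1) * q) - real E' / (P * (q ^ (d - 1) * q)) = (P * real E - real E') / (P * (q ^ (d - 1) * q))"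
  using q0 by (simp add: diff_divide_distrib)
 ultimately show ?thesis unfolding e1 e2 q_def[symmetric] using q0 by (simp add: abs_divide abs_mult)
qed

text \<open>The constant depends only on the frame over the integers and on the degrees of the integral
relations of the generators modulo I. The excluded primes are those where the frame degenerates,
where a leading coefficient of these relations vanishes, where the hypotheses on the fiber fail,
and, if d = 1, where the chosen element of degree 1 vanishes.\<close>
lemma uniform_step_bound:
 fixes R :: "('a, 'm) ring_scheme" (structure) and G :: "nat => 'a set"
 assumes dom: "domain R" and sgr: "standard_graded R G"
  and fg: "EX S. finite S & S \<subseteq> carrier R & generate_ring R S = carrier R"
  and char: "ALL n::nat. n > 0 --> [n] \<cdot> \<one> ~= \<zero>"
  and I: "ideal I R" and rank: "additive_rank (R Quot I) < \<infinity>"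
  and fib: "finite {p. Factorial_Ring.prime p &
      ~ (standard_graded (fiber R p) (%i. fiber_image R p (G i)) &
       krull_dim (fiber R p) = enat d &
       geometrically_integral_fiber R p &
       homogeneous_ideal (fiber R p) (%i. fiber_image R p (G i)) (fiber_image R p I))}"
  and G1: "d = 1 ==> G 1 ~= {\<zero>}"
 shows "EX C>=0. finite {p. Factorial_Ring.prime p & ~ (ALL n.
  \<bar>hk_quotient p d (fiber R p) (fiber_image R p I) n - hk_quotient p d (fiber R p) (fiber_image R p I) (Suc n)\<bar>
   <= (if d <= 1 then 0 else C / real p ^ n))}"
proof -
 interpret R: domain R by (rule dom)
 obtain S where S: "finite S" "S \<subseteq> carrier R" "generate_ring R S = carrier R" using fg by blast
 obtain M s where sM: "S = s ` {i::nat. i < M}" using finite_imp_nat_seg_image_inj_on[OF S(1)] by blast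
 have sc: "s i : carrier R" if "i < M" for i using S(2) sM that by blast
 obtain \<psi> :: "zpol => 'a" where \<psi>:
  "!!x. \<psi> x : carrier R" "!!x y. \<psi> (x + y) = \<psi> x \<oplus> \<psi> y" "!!x y. \<psi> (x * y) = \<psi> x \<otimes> \<psi> y"
  "\<psi> 1 = \<one>" "!!i. i < M ==> \<psi> (vr i) = s i" "!!w. EX t. EX f:Pol {..<M} t. \<psi> w = \<psi> f"
  by (rule eval_hom_exists[OF R.is_cring sc], assumption, rule that)
 have neg: "\<psi> (- x) = \<ominus> \<psi> x" for x
 proof -
  have "\<psi> 0 \<oplus> \<psi> 0 = \<psi> 0" using \<psi>(2)[of 0 0] by simp
  hence z: "\<psi> 0 = \<zero>" using \<psi>(1)[of 0] R.add.l_cancel_one by simp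
  have "\<psi> (- x) \<oplus> \<psi> x = \<zero>" using \<psi>(2)[of "- x" x] z by simp
  thus ?thesis using R.minus_equality \<psi>(1) by metis
 qed
 have surj: "b : range \<psi>" if "b : generate_ring R S" for b
  using that
 proof (induction rule: generate_ring.induct)
  case one show ?case using \<psi>(4) by (metis rangeI)
 next
  case (incl h) thus ?case using sM \<psi>(5) by (metis (mono_tags, lifting) imageE mem_Collect_eq rangeI)
 next
  case (a_inv h)
  then obtain x where "h = \<psi> x" by blast
  hence "\<ominus> h = \<psi> (- x)" by (simp only: neg)
  thus ?case by (rule range_eqI)
 next
  case (eng_add h1 h2)
  then obtain x y where "h1 = \<psi> x" "h2 = \<psi> y" by blast
  hence "h1 \<oplus> h2 = \<psi> (x + y)" by (simp only: \<psi>(2))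
  thus ?case by (rule range_eqI)
 next
  case (eng_mult h1 h2)
  then obtain x y where "h1 = \<psi> x" "h2 = \<psi> y" by blast
  hence "h1 \<otimes> h2 = \<psi> (x * y)" by (simp only: \<psi>(3))
  thus ?case by (rule range_eqI)
 qed
 interpret h: surj_hom R \<psi>
 proof
  fix b assume "b : carrier R"
  thus "EX x. b = \<psi> x" using surj S(3) by blast
 qed (rule \<psi>)+
 let ?P = "h.krn"
 have prP: "prm ?P" using h.prime_pre[OF R.zeroprimeideal] unfolding h.pre_def h.krn_def by simp
 have genP: "EX t. EX f:Pol {..<M} t. w - f : ?P" for w using \<psi>(6)[of w] h.hom_eq by blast
 have char0: "k = 0" if "of_int k : ?P" for k
 proof (rule ccontr)
  assume k: "k ~= 0"
  have "of_nat (nat \<bar>k\<bar>) : ?P"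
   using that subgrp_minus[OF h.krn_sg that] by (cases "k >= 0") auto
  hence "[nat \<bar>k\<bar>] \<cdot> \<one> = \<zero>" using h.hom_nat[of "nat \<bar>k\<bar>" 1] by (simp add: h.krn_def h.hom_one)
  moreover have "nat \<bar>k\<bar> > 0" using k by simp
  ultimately show False using char by blast
 qed
 from zdata_ex[OF prP genP char0] obtain V c B \<kappa> g Y where "zdata ?P M V c B \<kappa> g Y" by blast
 then interpret z: zdata ?P M V c B \<kappa> g Y .
 have Ip: "idl (h.pre I)" "?P \<subseteq> h.pre I" by (rule h.ideal_pre[OF I])+
 \<comment> \<open>Modulo I every generator satisfies an integer relation, whose leading coefficient is a unit modulo almost all p. D is a common degree.\<close>
 have "ALL l. EX N k. k N ~= 0 & (\<Sum>i\<le>N. of_int (k i) * vr l ^ i) : h.pre I"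
  using h.quotient_relation[OF I rank] by blast
 from choice[OF this] obtain N where "ALL l. EX k. k (N l) ~= 0 & (\<Sum>i\<le>N l. of_int (k i) * vr l ^ i) : h.pre I" ..
 from choice[OF this] obtain k where k: "ALL l. k l (N l) ~= 0 & (\<Sum>i\<le>N l. of_int (k l i) * vr l ^ i) : h.pre I" ..
 define D where "D = 1 + (\<Sum>l<M. N l)"
 have D1: "D >= 1" unfolding D_def by simp
 have DN: "N l <= D" if "l < M" for l
  using member_le_sum[of l "{..<M}" N] that unfolding D_def by simp
 \<comment> \<open>None of these constants depends on p.\<close>
 obtain K where K: "K > 0" "card Y * (K + (\<kappa> + \<kappa> * \<kappa> * M)) ^ card V < (card Y + 1) * K ^ card V"
  using dvd_pow_growth[of "card Y" "card Y + 1" "\<kappa> + \<kappa> * \<kappa> * M" "card V"] by auto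
 define K4 where "K4 = card B * K + M * \<kappa> + 1"
 define C where "C = card B * (M * (2 * K4 * (M * D + 1)) * \<kappa> + 1) ^ card V"
 have "EX w. d = 1 --> \<psi> w : G 1 & w ~: ?P"
 proof (cases "d = 1")
  case True
  have sub: "subgroup (G 1) (add_monoid R)" using sgr unfolding standard_graded_def graded_ring_def by blast
  have "\<zero> : G 1" using subgroup.one_closed[OF sub] by simp
  then obtain a where a: "a : G 1" "a ~= \<zero>" using G1[OF True] by blast
  have "a : carrier R" using subgroup.subset[OF sub] a(1) by auto
  then obtain w where "a = \<psi> w" using h.surj by blast
  thus ?thesis using a unfolding h.krn_def by blast
 qed simp
 then obtain w where w: "d = 1 ==> \<psi> w : G 1" "d = 1 ==> w ~: ?P" by blast
 define bad where "bad = z.badp \<union> (\<Union>l<M. {p. int p dvd k l (N l)}) \<union> {p. Factorial_Ring.prime p &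
      ~ (standard_graded (fiber R p) (%i. fiber_image R p (G i)) &
       krull_dim (fiber R p) = enat d &
       geometrically_integral_fiber R p &
       homogeneous_ideal (fiber R p) (%i. fiber_image R p (G i)) (fiber_image R p I))} \<union>
      (if d = 1 then {p. Factorial_Ring.prime p & w : PP ?P p} else {})"
 have "finite {p. int p dvd j}" if "j ~= 0" for j
 proof (rule finite_subset)
  show "{p. int p dvd j} \<subseteq> {p. p dvd nat \<bar>j\<bar>}" by (auto simp: nat_dvd_iff)
  show "finite {p. p dvd nat \<bar>j\<bar>}" using that by (intro finite_divisors_nat) simp
 qed
 hence fb: "finite bad" unfolding bad_def using z.finite_badp fib z.nonzero_mod[OF w(2)] k by auto
 let ?h = "%p. hk_quotient p d (fiber R p) (fiber_image R p I)"
 have main: "\<bar>?h p n - ?h p (Suc n)\<bar>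
   <= (if d <= 1 then 0 else real C / real p ^ n)" if p: "Factorial_Ring.prime p" and pb: "p ~: bad" for p n
 proof -
  have hyp: "standard_graded (fiber R p) (%i. fiber_image R p (G i))" "krull_dim (fiber R p) = enat d"
   "geometrically_integral_fiber R p"
   "homogeneous_ideal (fiber R p) (%i. fiber_image R p (G i)) (fiber_image R p I)"
   using p pb unfolding bad_def by blast+
  interpret g: gfib R \<psi> p by unfold_locales (rule p hyp(3))+
  have "p ~: z.badp" using pb unfolding bad_def by blast
  from z.red_almost_all[OF p this g.prm_PQ] have red: "red (PP ?P p) p M V c B \<kappa> g Y" .
  interpret r: red "PP ?P p" p M V c B \<kappa> g Y by (rule red)
  have dV: "card V = d" using g.krull_fiber[OF red] hyp(2) by simp
  let ?J = "PP (h.pre I) p"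
  have J: "PP ?P p \<subseteq> ?J" "idl ?J" using Ip(2) PP_idl[OF Ip(1)] unfolding PP_def by blast+
  have pJ: "of_nat p : ?J" using r.pQ J(1) by blast
  have "ALL l:{..<M}. EX a. vr l ^ D - (\<Sum>i<D. of_int (a i) * vr l ^ i) : ?J"
  proof
   fix l assume l: "l : {..<M}"
   show "EX a. vr l ^ D - (\<Sum>i<D. of_int (a i) * vr l ^ i) : ?J"
   proof (rule monic_relation[OF J(2) pJ p])
    show "(\<Sum>i\<le>N l. of_int (k l i) * vr l ^ i) : ?J" using k P_PP by blast
    show "~ int p dvd k l (N l)" using pb l unfolding bad_def by blast
    show "N l <= D" using DN l by simp
   qed
  qed
  from bchoice[OF this] obtain a where "ALL l:{..<M}. vr l ^ D - (\<Sum>i<D. of_int (a l i) * vr l ^ i) : ?J" ..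
  hence rel: "vr l ^ D - (\<Sum>i<D. of_int (a l i) * vr l ^ i) : ?J" if "l < M" for l using that by simp
  have fin: "finite (quo (FP (PP ?P p) ?J (p ^ n)) UNIV)" for n by (rule r.finite_FP[OF J rel D1])
  have hk: "hk_quotient p d (fiber R p) (fiber_image R p I) n = real (r.ell ?J n) / real p ^ (n * d)" for n
   unfolding g.hk_len[OF I fin] r.ell_def ..
  have p0: "p > 0" using r.p_gt by simp
  consider "d = 0" | "d = 1" | "d >= 2" by linarith
  thus ?thesis
  proof cases
   case 1
   thus ?thesis unfolding hk using r.ell_dim0[OF _ J, of n] dV by simp
  next
   case 2
   have gr: "graded_ring (fiber R p) (%i. fiber_image R p (G i))" using hyp(1) unfolding standard_graded_def by blast
   have wn: "w ~: PP ?P p" using pb p 2 unfolding bad_def by simp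
   have sub: "subgroup (G 1) (add_monoid R)" using sgr unfolding standard_graded_def graded_ring_def by blast
   have "card V = 1" using dV 2 by simp
   from g.graded_fiber[OF red this gr w(1)[OF 2] sub wn]
   interpret gl: graded_line "PP ?P p" p M V c B \<kappa> g Y "%i. g.f.pre (fiber_image R p (G i))" w .
   from hyp(4) obtain T where T: "T \<subseteq> (\<Union>i. fiber_image R p (G i))" "fiber_image R p I = genideal (fiber R p) T"
    unfolding homogeneous_ideal_def by blast
   have "fiber_image R p (G i) \<subseteq> carrier (fiber R p)" for i
    using subgroup.subset[OF spec[OF conjunct1[OF conjunct2[OF gr[unfolded graded_ring_def]]], of i]] by simp
   hence Tc: "T \<subseteq> carrier (fiber R p)" using T(1) by blast
   have JT: "?J = gid ({v. g.fmap v : T} \<union> PP ?P p)"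
    using g.f.genideal_pre[OF Tc] T(2) g.pre_fiber_image[OF I] g.krn_PP by simp
   have HW: "{v. g.fmap v : T} \<subseteq> (\<Union>n. g.f.pre (fiber_image R p (G n)))" using T(1) unfolding g.f.pre_def by blast
   have "FP (PP ?P p) ?J (p ^ 0) \<subseteq> ?J" by (rule r.FP_least[OF J(2,1)]) simp
   hence "finite (quo ?J UNIV)"
    by (rule finite_quo_mono[OF fin[of 0] stab_subgrp[OF r.FP_idl] stab_subgrp[OF J(2)] _ subset_UNIV])
   from gl.ell_dim1[OF HW JT this, of n] have e: "r.ell ?J (Suc n) = p * r.ell ?J n" .
   show ?thesis unfolding hk e using 2 p0 by simp
  next
   case 3
   hence d1: "card V >= 1" "d >= 1" using dV by simp_all
   note st = r.HK_step[OF J rel D1 d1(1) K(2,1) K4_def C_def, of n, unfolded dV]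
   show ?thesis unfolding hk using step_real[OF p0 d1(2) st] 3 by simp
  qed
 qed
 have "finite {p. Factorial_Ring.prime p & ~ (ALL n. \<bar>?h p n - ?h p (Suc n)\<bar> <= (if d <= 1 then 0 else real C / real p ^ n))}"
  by (rule finite_subset[OF _ fb]) (use main in blast)
 thus ?thesis by (intro exI[of _ "real C"]) simp
qed

theorem corollary1p2:
 fixes R :: "('a, 'm) ring_scheme" (structure)
  and G :: "nat \<Rightarrow> 'a set"
  and I :: "'a set"
  and d :: nat
 assumes "domain R"
  and "standard_graded R G"
  and "\<exists>S. finite S \<and> S \<subseteq> carrier R \<and> generate_ring R S = carrier R"
  and "\<forall>n::nat. n > 0 \<longrightarrow> [n] \<cdot> \<one> \<noteq> \<zero>"
  and "homogeneous_ideal R G I"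
  and "additive_rank (R Quot I) < \<infinity>"
  and "finite {p. Factorial_Ring.prime p \<and>
      \<not> (standard_graded (fiber R p) (\<lambda>i. fiber_image R p (G i)) \<and>
       krull_dim (fiber R p) = enat d \<and>
       geometrically_integral_fiber R p \<and>
       homogeneous_ideal (fiber R p) (\<lambda>i. fiber_image R p (G i)) (fiber_image R p I) \<and>
       colength (fiber R p) (fiber_image R p I) < \<infinity>)}"
  and "d = 1 \<Longrightarrow> G 1 \<noteq> {\<zero>}"
 shows "(\<exists>C1::real. finite {p. Factorial_Ring.prime p \<and>
      \<not> (\<forall>n\<ge>1. \<bar>hk_quotient p d (fiber R p) (fiber_image R p I) n
            - hk_quotient p d (fiber R p) (fiber_image R p I) (n + 1)\<bar>
           \<le> C1 / real p powi (int n - int d + 2))})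
    \<and> (\<forall>m::nat. int m \<ge> int d - 1 \<longrightarrow>
      ((\<lambda>p. hk_multiplicity p d (fiber R p) (fiber_image R p I)
          - hk_quotient p d (fiber R p) (fiber_image R p I) m) \<longlongrightarrow> 0) primes_at_top
     \<and> ((\<exists>L. ((\<lambda>p. hk_multiplicity p d (fiber R p) (fiber_image R p I)) \<longlongrightarrow> L) primes_at_top)
       \<longleftrightarrow>
       (\<exists>L. ((\<lambda>p. hk_quotient p d (fiber R p) (fiber_image R p I) m) \<longlongrightarrow> L) primes_at_top)))"
proof -
 let ?h = "%p. hk_quotient p d (fiber R p) (fiber_image R p I)"
 let ?e = "%p. hk_multiplicity p d (fiber R p) (fiber_image R p I)"
 have I: "ideal I R" using assms(5) unfolding homogeneous_ideal_def by blast
 have fin: "finite {p. Factorial_Ring.prime p &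
      ~ (standard_graded (fiber R p) (%i. fiber_image R p (G i)) &
       krull_dim (fiber R p) = enat d &
       geometrically_integral_fiber R p &
       homogeneous_ideal (fiber R p) (%i. fiber_image R p (G i)) (fiber_image R p I))}"
  by (rule finite_subset[OF _ assms(7)]) blast
 from uniform_step_bound[OF assms(1-4) I assms(6) fin assms(8)] obtain C where C: "C >= 0"
  "finite {p. Factorial_Ring.prime p & ~ (ALL n. \<bar>?h p n - ?h p (Suc n)\<bar> <= (if d <= 1 then 0 else C / real p ^ n))}"
  by blast
 let ?good = "%p. ALL n. \<bar>?h p n - ?h p (Suc n)\<bar> <= (if d <= 1 then 0 else C / real p ^ n)"
 have one: "\<bar>?h p n - ?h p (n + 1)\<bar> <= C / real p powi (int n - int d + 2)"
  if p: "Factorial_Ring.prime p" and g: "?good p" for p n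
 proof (cases "d <= 1")
  case True
  hence "\<bar>?h p n - ?h p (n + 1)\<bar> <= 0" using g by simp
  also have "0 <= C / real p powi (int n - int d + 2)" using C(1) by simp
  finally show ?thesis .
 next
  case False
  have p1: "real p >= 1" using prime_gt_1_nat[OF p] by simp
  have "real p powi (int n - int d + 2) <= real p powi (int n)" using False p1 by (intro power_int_increasing) auto
  hence "C / real p ^ n <= C / real p powi (int n - int d + 2)"
   using C(1) p1 by (intro divide_left_mono) (auto simp: zero_less_power_int)
  moreover have "\<bar>?h p n - ?h p (n + 1)\<bar> <= C / real p ^ n" using g False by simp
  ultimately show ?thesis by linarith
 qed
 have two: "((%p. ?e p - ?h p m) \<longlongrightarrow> 0) primes_at_top" if m: "int m >= int d - 1" for m
 proof (rule tendsto_0_le[where K = 1])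
  have "\<forall>\<^sub>F p in primes_at_top. Factorial_Ring.prime p & ?good p"
   by (rule eventually_conj; rule eventually_primes) (use C(2) in auto)
  thus "\<forall>\<^sub>F p in primes_at_top. norm (?e p - ?h p m) <= norm (2 * C / real p) * 1"
  proof (rule eventually_mono)
   fix p assume "Factorial_Ring.prime p & ?good p"
   hence p: "real p >= 2" and g: "?good p" using prime_ge_2_nat[of p] by simp_all
   have "norm (?e p - ?h p m) <= 2 * C / real p"
   proof (cases "d <= 1")
    case True
    have "\<bar>lim (?h p) - ?h p m\<bar> <= 2 * 0 / real p ^ m"
     by (rule geometric_steps[OF _ p]) (use g True in simp_all)
    thus ?thesis using C(1) by (simp add: hk_multiplicity_def)
   next
    case False
    have "\<bar>lim (?h p) - ?h p m\<bar> <= 2 * C / real p ^ m"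
     by (rule geometric_steps[OF _ p C(1)]) (use g False in simp)
    moreover have "2 * C / real p ^ m <= 2 * C / real p ^ 1"
    proof (rule divide_left_mono)
     show "real p ^ 1 <= real p ^ m" using m False p by (intro power_increasing) auto
    qed (use C(1) p in auto)
    ultimately show ?thesis by (simp add: hk_multiplicity_def)
   qed
   thus "norm (?e p - ?h p m) <= norm (2 * C / real p) * 1" using C(1) p by simp
  qed
  show "((%p. 2 * C / real p) \<longlongrightarrow> 0) primes_at_top"
   by (rule tendsto_mono[OF primes_at_top_le lim_const_over_n])
 qed
 show ?thesis
 proof (intro conjI allI impI)
  show "EX C1::real. finite {p. Factorial_Ring.prime p &
      ~ (ALL n>=1. \<bar>?h p n - ?h p (n + 1)\<bar> <= C1 / real p powi (int n - int d + 2))}"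
   by (rule exI[of _ C], rule finite_subset[OF _ C(2)]) (use one in blast)
 next
  fix m :: nat assume m: "int m >= int d - 1"
  note t = two[OF m]
  show "((%p. ?e p - ?h p m) \<longlongrightarrow> 0) primes_at_top" by (rule t)
  show "(EX L. (?e \<longlongrightarrow> L) primes_at_top) \<longleftrightarrow> (EX L. ((%p. ?h p m) \<longlongrightarrow> L) primes_at_top)"
  proof
   assume "EX L. (?e \<longlongrightarrow> L) primes_at_top"
   then obtain L where "(?e \<longlongrightarrow> L) primes_at_top" ..
   from tendsto_diff[OF this t] show "EX L. ((%p. ?h p m) \<longlongrightarrow> L) primes_at_top" by auto
  next
   assume "EX L. ((%p. ?h p m) \<longlongrightarrow> L) primes_at_top"
   then obtain L where "((%p. ?h p m) \<longlongrightarrow> L) primes_at_top" ..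
   from tendsto_add[OF this t] show "EX L. (?e \<longlongrightarrow> L) primes_at_top" by auto
  qed
 qed
qed

end
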